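(* Let $F$ be a finitely generated field of characteristic zero and let $G$ be a finitely generated nilpotent group. Let $M$ be an irreducible $FG$-module. Then there are an element $0\neq a\in M$ and a subgroup $L\leq G$ such that $aFG=aFL\otimes_{FL}FG$ and $aFL$ is a primitive $FL$-module.
   Context: All modules are right modules. A field is finitely generated if it is finitely generated as a field (over its prime subfield). For a subgroup $H\leq G$, an $FG$-module $M$ and an $FH$-submodule $U\leq M$, we write $M=U\otimes_{FH}FG$ and say that $M$ is induced from $U$ if $M=\bigoplus_{t\in T}Ut$, where $T$ is a right transversal to $H$ in $G$ (equivalently, the natural map $U\otimes_{FH}FG\to M$ is an isomorphism). For a group $L$, an $FL$-module $N$ is primitive if there is no proper subgroup $H<L$ such that $N$ is induced from some $FH$-submodule of $N$. Here $aFG$ and $aFL$ denote the cyclic $FG$-submodule and the cyclic $FL$-submodule of $M$ generated by $a$. *)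

theory Defs
  imports "HOL-Algebra.Algebra"
begin

section \<open>Finiteness and nilpotency conditions\<close>

definition fin_gen_field :: "('f, 'b) ring_scheme \<Rightarrow> bool" where
  "fin_gen_field F \<longleftrightarrow>
     field F \<and> (\<exists>S. finite S \<and> S \<subseteq> carrier F \<and> generate_field F S = carrier F)"

definition char_zero :: "('f, 'b) ring_scheme \<Rightarrow> bool" where
  "char_zero F \<longleftrightarrow> (\<forall>n::nat. n > 0 \<longrightarrow> add_pow F n \<one>\<^bsub>F\<^esub> \<noteq> \<zero>\<^bsub>F\<^esub>)"

definition fin_gen_group :: "('g, 'b) monoid_scheme \<Rightarrow> bool" where
  "fin_gen_group G \<longleftrightarrow>
     group G \<and> (\<exists>S. finite S \<and> S \<subseteq> carrier G \<and> generate G S = carrier G)"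

fun lower_central :: "('g, 'b) monoid_scheme \<Rightarrow> nat \<Rightarrow> 'g set" where
  "lower_central G 0 = carrier G"
| "lower_central G (Suc n) =
     generate G (\<Union>x \<in> lower_central G n. \<Union>y \<in> carrier G.
       {x \<otimes>\<^bsub>G\<^esub> y \<otimes>\<^bsub>G\<^esub> inv\<^bsub>G\<^esub> x \<otimes>\<^bsub>G\<^esub> inv\<^bsub>G\<^esub> y})"

definition nilpotent_group :: "('g, 'b) monoid_scheme \<Rightarrow> bool" where
  "nilpotent_group G \<longleftrightarrow> group G \<and> (\<exists>n. lower_central G n = {\<one>\<^bsub>G\<^esub>})"


section \<open>Group algebras\<close>

text \<open>
  Elements of the group algebra are functions of finite support that vanish outside
  the carrier of the group.  Hence, for a subgroup \<open>H\<close> of \<open>G\<close>, the algebra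
  \<open>group_algebra F (G\<lparr>carrier := H\<rparr>)\<close> is literally the subalgebra of
  \<open>group_algebra F G\<close> consisting of the elements supported in \<open>H\<close>, and the same module
  structure can be read over either of them.
\<close>

definition group_algebra ::
    "('f, 'b) ring_scheme \<Rightarrow> ('g, 'c) monoid_scheme \<Rightarrow> ('g \<Rightarrow> 'f) ring" where
  "group_algebra F G =
    \<lparr> carrier = {x. x \<in> carrier G \<rightarrow> carrier F \<and> (\<forall>g. g \<notin> carrier G \<longrightarrow> x g = \<zero>\<^bsub>F\<^esub>)
                  \<and> finite {g. x g \<noteq> \<zero>\<^bsub>F\<^esub>}},
      monoid.mult = (\<lambda>x y g. if g \<in> carrier G
                then \<Oplus>\<^bsub>F\<^esub>h \<in> {h. x h \<noteq> \<zero>\<^bsub>F\<^esub>}. x h \<otimes>\<^bsub>F\<^esub> y (inv\<^bsub>G\<^esub> h \<otimes>\<^bsub>G\<^esub> g)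
                else \<zero>\<^bsub>F\<^esub>),
      monoid.one = (\<lambda>g. if g = \<one>\<^bsub>G\<^esub> then \<one>\<^bsub>F\<^esub> else \<zero>\<^bsub>F\<^esub>),
      ring.zero = (\<lambda>g. \<zero>\<^bsub>F\<^esub>),
      ring.add = (\<lambda>x y g. x g \<oplus>\<^bsub>F\<^esub> y g) \<rparr>"

definition group_basis :: "('f, 'b) ring_scheme \<Rightarrow> 'g \<Rightarrow> 'g \<Rightarrow> 'f" where
  "group_basis F t = (\<lambda>g. if g = t then \<one>\<^bsub>F\<^esub> else \<zero>\<^bsub>F\<^esub>)"


section \<open>Right modules\<close>

text \<open>
  The library's locale \<open>module\<close> only covers commutative coefficient rings.  As there, the
  multiplicative fields of the underlying ring record play no role.
\<close>

record ('r, 'm) right_module = "'m ring" +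
  rsmult :: "'m \<Rightarrow> 'r \<Rightarrow> 'm" (infixl \<open>\<bullet>\<index>\<close> 70)

locale right_module = R?: ring R + M?: abelian_group M
  for R :: "('r, 'b) ring_scheme" (structure)
    and M :: "('r, 'm, 'c) right_module_scheme" (structure) +
  assumes rsmult_closed:
      "\<lbrakk> m \<in> carrier M; r \<in> carrier R \<rbrakk> \<Longrightarrow> m \<bullet>\<^bsub>M\<^esub> r \<in> carrier M"
    and rsmult_add_left:
      "\<lbrakk> m \<in> carrier M; n \<in> carrier M; r \<in> carrier R \<rbrakk> \<Longrightarrow>
        (m \<oplus>\<^bsub>M\<^esub> n) \<bullet>\<^bsub>M\<^esub> r = m \<bullet>\<^bsub>M\<^esub> r \<oplus>\<^bsub>M\<^esub> n \<bullet>\<^bsub>M\<^esub> r"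
    and rsmult_add_right:
      "\<lbrakk> m \<in> carrier M; r \<in> carrier R; s \<in> carrier R \<rbrakk> \<Longrightarrow>
        m \<bullet>\<^bsub>M\<^esub> (r \<oplus>\<^bsub>R\<^esub> s) = m \<bullet>\<^bsub>M\<^esub> r \<oplus>\<^bsub>M\<^esub> m \<bullet>\<^bsub>M\<^esub> s"
    and rsmult_assoc:
      "\<lbrakk> m \<in> carrier M; r \<in> carrier R; s \<in> carrier R \<rbrakk> \<Longrightarrow>
        m \<bullet>\<^bsub>M\<^esub> (r \<otimes>\<^bsub>R\<^esub> s) = (m \<bullet>\<^bsub>M\<^esub> r) \<bullet>\<^bsub>M\<^esub> s"
    and rsmult_one:
      "m \<in> carrier M \<Longrightarrow> m \<bullet>\<^bsub>M\<^esub> \<one>\<^bsub>R\<^esub> = m"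

definition right_submodule ::
    "'m set \<Rightarrow> ('r, 'b) ring_scheme \<Rightarrow> ('r, 'm, 'c) right_module_scheme \<Rightarrow> bool" where
  "right_submodule U R M \<longleftrightarrow>
     additive_subgroup U M \<and> (\<forall>u \<in> U. \<forall>r \<in> carrier R. u \<bullet>\<^bsub>M\<^esub> r \<in> U)"

definition irreducible_module ::
    "('r, 'b) ring_scheme \<Rightarrow> ('r, 'm, 'c) right_module_scheme \<Rightarrow> bool" where
  "irreducible_module R M \<longleftrightarrow>
     right_module R M \<and> carrier M \<noteq> {\<zero>\<^bsub>M\<^esub>} \<and>
     (\<forall>U. right_submodule U R M \<longrightarrow> U = {\<zero>\<^bsub>M\<^esub>} \<or> U = carrier M)"

definition cyclic_submodule ::
    "('r, 'b) ring_scheme \<Rightarrow> ('r, 'm, 'c) right_module_scheme \<Rightarrow> 'm \<Rightarrow> 'm set" where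
  "cyclic_submodule R M a = (\<lambda>r. a \<bullet>\<^bsub>M\<^esub> r) ` carrier R"


section \<open>Induced and primitive modules\<close>

definition right_transversal :: "'g set \<Rightarrow> 'g set \<Rightarrow> ('g, 'c) monoid_scheme \<Rightarrow> bool" where
  "right_transversal T H G \<longleftrightarrow>
     T \<subseteq> carrier G \<and> (\<forall>C \<in> rcosets\<^bsub>G\<^esub> H. \<exists>!t. t \<in> T \<and> t \<in> C)"

text \<open>Internal direct sums of subgroups of an abelian group, with possibly infinite index set.\<close>

definition internal_direct_sum :: "('m, 'b) ring_scheme \<Rightarrow> 'i set \<Rightarrow> ('i \<Rightarrow> 'm set) \<Rightarrow> bool" where
  "internal_direct_sum M I V \<longleftrightarrow>
     (\<forall>i \<in> I. additive_subgroup (V i) M) \<and>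
     (\<forall>m \<in> carrier M.
        \<exists>!v. (\<forall>i \<in> I. v i \<in> V i) \<and> (\<forall>i. i \<notin> I \<longrightarrow> v i = \<zero>\<^bsub>M\<^esub>) \<and>
             finite {i. v i \<noteq> \<zero>\<^bsub>M\<^esub>} \<and>
             m = (\<Oplus>\<^bsub>M\<^esub>i \<in> {i. v i \<noteq> \<zero>\<^bsub>M\<^esub>}. v i))"

definition translate ::
    "('f, 'b) ring_scheme \<Rightarrow> ('g \<Rightarrow> 'f, 'm, 'd) right_module_scheme \<Rightarrow> 'm set \<Rightarrow> 'g \<Rightarrow> 'm set" where
  "translate F M U t = (\<lambda>u. u \<bullet>\<^bsub>M\<^esub> group_basis F t) ` U"

text \<open>
  The subgroup \<open>U t\<close> depends only on the coset \<open>H t\<close>, because \<open>U\<close> is a module over the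
  group algebra of \<open>H\<close>; so it does not matter which right transversal is used.
\<close>

definition induced_from ::
    "('f, 'b) ring_scheme \<Rightarrow> ('g, 'c) monoid_scheme \<Rightarrow> ('g \<Rightarrow> 'f, 'm, 'd) right_module_scheme \<Rightarrow>
     'g set \<Rightarrow> 'm set \<Rightarrow> bool" where
  "induced_from F G M H U \<longleftrightarrow>
     right_module (group_algebra F G) M \<and> subgroup H G \<and>
     right_submodule U (group_algebra F (G\<lparr>carrier := H\<rparr>)) M \<and>
     (\<exists>T. right_transversal T H G \<and> internal_direct_sum M T (translate F M U))"

definition primitive_module ::
    "('f, 'b) ring_scheme \<Rightarrow> ('g, 'c) monoid_scheme \<Rightarrow> ('g \<Rightarrow> 'f, 'm, 'd) right_module_scheme \<Rightarrow>
     bool" where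
  "primitive_module F L N \<longleftrightarrow>
     right_module (group_algebra F L) N \<and>
     \<not> (\<exists>H U. subgroup H L \<and> H \<noteq> carrier L \<and> induced_from F L N H U)"


section \<open>The group algebra is a ring\<close>

locale group_algebra_loc = F?: cring F + G?: group G
  for F :: "('f, 'b) ring_scheme" (structure) and G :: "('g, 'c) monoid_scheme" (structure)
begin

abbreviation "A \<equiv> group_algebra F G"
abbreviation "supp x \<equiv> {g. x g \<noteq> \<zero>\<^bsub>F\<^esub>}"

lemma carrierD:
  assumes "x \<in> carrier A"
  shows "x g \<in> carrier F" "g \<notin> carrier G \<Longrightarrow> x g = \<zero>\<^bsub>F\<^esub>" "finite (supp x)" "supp x \<subseteq> carrier G"
  using assms by (auto simp: group_algebra_def Pi_iff)

lemma carrierI: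
  assumes "\<And>g. g \<in> carrier G \<Longrightarrow> x g \<in> carrier F" "\<And>g. g \<notin> carrier G \<Longrightarrow> x g = \<zero>\<^bsub>F\<^esub>"
    "finite S" "supp x \<subseteq> S"
  shows "x \<in> carrier A"
  using assms by (auto simp: group_algebra_def Pi_iff intro: finite_subset)

lemma mult_eq:
  assumes "x \<in> carrier A" "y \<in> carrier A" "finite S" "supp x \<subseteq> S" "S \<subseteq> carrier G" "g \<in> carrier G"
  shows "(x \<otimes>\<^bsub>A\<^esub> y) g = (\<Oplus>\<^bsub>F\<^esub>h \<in> S. x h \<otimes>\<^bsub>F\<^esub> y (inv\<^bsub>G\<^esub> h \<otimes>\<^bsub>G\<^esub> g))"
proof -
  have "(\<Oplus>\<^bsub>F\<^esub>h \<in> supp x. x h \<otimes>\<^bsub>F\<^esub> y (inv\<^bsub>G\<^esub> h \<otimes>\<^bsub>G\<^esub> g))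
      = (\<Oplus>\<^bsub>F\<^esub>h \<in> S. x h \<otimes>\<^bsub>F\<^esub> y (inv\<^bsub>G\<^esub> h \<otimes>\<^bsub>G\<^esub> g))"
    using assms carrierD[OF assms(1)] carrierD[OF assms(2)]
    by (intro F.add.finprod_mono_neutral_cong_left) (auto simp: Pi_iff)
  then show ?thesis using assms(6) by (simp add: group_algebra_def)
qed

lemma mult_outside: "g \<notin> carrier G \<Longrightarrow> (x \<otimes>\<^bsub>A\<^esub> y) g = \<zero>\<^bsub>F\<^esub>"
  by (simp add: group_algebra_def)

lemma add_eq: "(x \<oplus>\<^bsub>A\<^esub> y) g = x g \<oplus>\<^bsub>F\<^esub> y g"
  by (simp add: group_algebra_def)

lemma zero_eq: "\<zero>\<^bsub>A\<^esub> = (\<lambda>g. \<zero>\<^bsub>F\<^esub>)"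
  by (simp add: group_algebra_def)

lemma one_eq: "\<one>\<^bsub>A\<^esub> = (\<lambda>g. if g = \<one>\<^bsub>G\<^esub> then \<one>\<^bsub>F\<^esub> else \<zero>\<^bsub>F\<^esub>)"
  by (simp add: group_algebra_def)

lemma supp_mult:
  assumes "x \<in> carrier A" "y \<in> carrier A"
  shows "supp (x \<otimes>\<^bsub>A\<^esub> y) \<subseteq> (\<lambda>(h, k). h \<otimes>\<^bsub>G\<^esub> k) ` (supp x \<times> supp y)"
proof
  fix g assume "g \<in> supp (x \<otimes>\<^bsub>A\<^esub> y)"
  then have g: "(x \<otimes>\<^bsub>A\<^esub> y) g \<noteq> \<zero>\<^bsub>F\<^esub>" by simp
  then have gG: "g \<in> carrier G" using mult_outside by blast
  note x = carrierD[OF assms(1)] and y = carrierD[OF assms(2)]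
  have "\<exists>h \<in> supp x. y (inv\<^bsub>G\<^esub> h \<otimes>\<^bsub>G\<^esub> g) \<noteq> \<zero>\<^bsub>F\<^esub>"
  proof (rule ccontr)
    assume "\<not> ?thesis"
    then have "(\<Oplus>\<^bsub>F\<^esub>h \<in> supp x. x h \<otimes>\<^bsub>F\<^esub> y (inv\<^bsub>G\<^esub> h \<otimes>\<^bsub>G\<^esub> g)) = \<zero>\<^bsub>F\<^esub>"
      using x(1) by (intro F.add.finprod_one_eqI) auto
    with g show False using mult_eq[OF assms x(3) order.refl x(4) gG] by metis
  qed
  then obtain h where h: "x h \<noteq> \<zero>\<^bsub>F\<^esub>" "y (inv\<^bsub>G\<^esub> h \<otimes>\<^bsub>G\<^esub> g) \<noteq> \<zero>\<^bsub>F\<^esub>" by blast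
  then have "h \<in> carrier G" using x by blast
  then have eq: "g = h \<otimes>\<^bsub>G\<^esub> (inv\<^bsub>G\<^esub> h \<otimes>\<^bsub>G\<^esub> g)"
    using gG by (metis G.inv_closed G.m_assoc G.r_inv G.l_one)
  show "g \<in> (\<lambda>(h, k). h \<otimes>\<^bsub>G\<^esub> k) ` (supp x \<times> supp y)"
  proof (rule image_eqI)
    show "g = (case (h, inv\<^bsub>G\<^esub> h \<otimes>\<^bsub>G\<^esub> g) of (h, k) \<Rightarrow> h \<otimes>\<^bsub>G\<^esub> k)"
      unfolding prod.case by (rule eq)
  qed (use h in simp)
qed

lemma mult_closed:
  assumes "x \<in> carrier A" "y \<in> carrier A"
  shows "x \<otimes>\<^bsub>A\<^esub> y \<in> carrier A"
proof (rule carrierI[OF _ mult_outside _ supp_mult[OF assms]])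
  note x = carrierD[OF assms(1)] and y = carrierD[OF assms(2)]
  show "finite ((\<lambda>(h, k). h \<otimes>\<^bsub>G\<^esub> k) ` (supp x \<times> supp y))" using x(3) y(3) by blast
  fix g assume "g \<in> carrier G"
  then show "(x \<otimes>\<^bsub>A\<^esub> y) g \<in> carrier F"
    using mult_eq[OF assms x(3) order.refl x(4)] x y by (auto intro!: F.add.finprod_closed)
qed

lemma add_closed:
  assumes "x \<in> carrier A" "y \<in> carrier A"
  shows "x \<oplus>\<^bsub>A\<^esub> y \<in> carrier A"
  using carrierD[OF assms(1)] carrierD[OF assms(2)]
  by (intro carrierI[where S = "supp x \<union> supp y"]) (auto simp: add_eq)

lemma finsum_swap:
  assumes "finite S" "finite T" "\<And>i j. i \<in> S \<Longrightarrow> j \<in> T \<Longrightarrow> f i j \<in> carrier F"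
  shows "(\<Oplus>\<^bsub>F\<^esub>i \<in> S. \<Oplus>\<^bsub>F\<^esub>j \<in> T. f i j) = (\<Oplus>\<^bsub>F\<^esub>j \<in> T. \<Oplus>\<^bsub>F\<^esub>i \<in> S. f i j)"
  using assms(1,3)
proof (induction S)
  case empty
  then show ?case by simp
next
  case (insert s S)
  then have "(\<Oplus>\<^bsub>F\<^esub>j \<in> T. \<Oplus>\<^bsub>F\<^esub>i \<in> insert s S. f i j) = (\<Oplus>\<^bsub>F\<^esub>j \<in> T. f s j \<oplus>\<^bsub>F\<^esub> (\<Oplus>\<^bsub>F\<^esub>i \<in> S. f i j))"
    by (intro F.add.finprod_cong') (auto intro!: F.add.finprod_insert F.add.finprod_closed)
  with insert show ?case
    by (simp add: F.add.finprod_multf Pi_iff F.add.finprod_closed)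
qed

lemma mult_assoc:
  assumes "x \<in> carrier A" "y \<in> carrier A" "z \<in> carrier A"
  shows "(x \<otimes>\<^bsub>A\<^esub> y) \<otimes>\<^bsub>A\<^esub> z = x \<otimes>\<^bsub>A\<^esub> (y \<otimes>\<^bsub>A\<^esub> z)"
proof
  fix g
  note x = carrierD[OF assms(1)] and y = carrierD[OF assms(2)] and z = carrierD[OF assms(3)]
  define S where "S = (\<lambda>(h, k). h \<otimes>\<^bsub>G\<^esub> k) ` (supp x \<times> supp y)"
  have S: "finite S" "S \<subseteq> carrier G" "supp (x \<otimes>\<^bsub>A\<^esub> y) \<subseteq> S"
    using x y supp_mult[OF assms(1,2)] by (auto simp: S_def)
  show "((x \<otimes>\<^bsub>A\<^esub> y) \<otimes>\<^bsub>A\<^esub> z) g = (x \<otimes>\<^bsub>A\<^esub> (y \<otimes>\<^bsub>A\<^esub> z)) g"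
  proof (cases "g \<in> carrier G")
    case False
    then show ?thesis by (simp add: mult_outside)
  next
    case g: True
    let ?t = "\<lambda>h k. x h \<otimes>\<^bsub>F\<^esub> (y (inv\<^bsub>G\<^esub> h \<otimes>\<^bsub>G\<^esub> k) \<otimes>\<^bsub>F\<^esub> z (inv\<^bsub>G\<^esub> k \<otimes>\<^bsub>G\<^esub> g))"
    have *: "(\<Oplus>\<^bsub>F\<^esub>k \<in> S. ?t h k) = x h \<otimes>\<^bsub>F\<^esub> (y \<otimes>\<^bsub>A\<^esub> z) (inv\<^bsub>G\<^esub> h \<otimes>\<^bsub>G\<^esub> g)" if h: "h \<in> supp x" for h
    proof -
      have hG: "h \<in> carrier G" using h x by blast
      define S' where "S' = (\<lambda>k. inv\<^bsub>G\<^esub> h \<otimes>\<^bsub>G\<^esub> k) ` S"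
      have S': "finite S'" "S' \<subseteq> carrier G" using S hG by (auto simp: S'_def)
      have "supp y \<subseteq> S'"
      proof
        fix k assume k: "k \<in> supp y"
        then have "k \<in> carrier G" using y by blast
        then have "k = inv\<^bsub>G\<^esub> h \<otimes>\<^bsub>G\<^esub> (h \<otimes>\<^bsub>G\<^esub> k)"
          using hG by (metis G.inv_closed G.m_assoc G.l_inv G.l_one)
        moreover have "h \<otimes>\<^bsub>G\<^esub> k \<in> S" using h k by (auto simp: S_def)
        ultimately show "k \<in> S'" by (auto simp: S'_def)
      qed
      then have "(y \<otimes>\<^bsub>A\<^esub> z) (inv\<^bsub>G\<^esub> h \<otimes>\<^bsub>G\<^esub> g)
          = (\<Oplus>\<^bsub>F\<^esub>l \<in> S'. y l \<otimes>\<^bsub>F\<^esub> z (inv\<^bsub>G\<^esub> l \<otimes>\<^bsub>G\<^esub> (inv\<^bsub>G\<^esub> h \<otimes>\<^bsub>G\<^esub> g)))"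
        using S' assms hG g by (intro mult_eq) auto
      also have "\<dots> = (\<Oplus>\<^bsub>F\<^esub>k \<in> S. y (inv\<^bsub>G\<^esub> h \<otimes>\<^bsub>G\<^esub> k) \<otimes>\<^bsub>F\<^esub>
                        z (inv\<^bsub>G\<^esub> (inv\<^bsub>G\<^esub> h \<otimes>\<^bsub>G\<^esub> k) \<otimes>\<^bsub>G\<^esub> (inv\<^bsub>G\<^esub> h \<otimes>\<^bsub>G\<^esub> g)))"
        unfolding S'_def using y(1) z(1) S(2) hG
        by (intro F.add.finprod_reindex) (auto simp: inj_on_def subset_iff)
      also have "\<dots> = (\<Oplus>\<^bsub>F\<^esub>k \<in> S. y (inv\<^bsub>G\<^esub> h \<otimes>\<^bsub>G\<^esub> k) \<otimes>\<^bsub>F\<^esub> z (inv\<^bsub>G\<^esub> k \<otimes>\<^bsub>G\<^esub> g))"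
      proof (intro F.add.finprod_cong')
        fix k assume "k \<in> S"
        then have kG: "k \<in> carrier G" using S by blast
        have "h \<otimes>\<^bsub>G\<^esub> (inv\<^bsub>G\<^esub> h \<otimes>\<^bsub>G\<^esub> g) = g"
          using hG g by (metis G.inv_closed G.m_assoc G.r_inv G.l_one)
        then have "inv\<^bsub>G\<^esub> (inv\<^bsub>G\<^esub> h \<otimes>\<^bsub>G\<^esub> k) \<otimes>\<^bsub>G\<^esub> (inv\<^bsub>G\<^esub> h \<otimes>\<^bsub>G\<^esub> g) = inv\<^bsub>G\<^esub> k \<otimes>\<^bsub>G\<^esub> g"
          using kG hG g by (simp add: G.inv_mult_group G.m_assoc)
        then show "y (inv\<^bsub>G\<^esub> h \<otimes>\<^bsub>G\<^esub> k) \<otimes>\<^bsub>F\<^esub> z (inv\<^bsub>G\<^esub> (inv\<^bsub>G\<^esub> h \<otimes>\<^bsub>G\<^esub> k) \<otimes>\<^bsub>G\<^esub> (inv\<^bsub>G\<^esub> h \<otimes>\<^bsub>G\<^esub> g))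
            = y (inv\<^bsub>G\<^esub> h \<otimes>\<^bsub>G\<^esub> k) \<otimes>\<^bsub>F\<^esub> z (inv\<^bsub>G\<^esub> k \<otimes>\<^bsub>G\<^esub> g)"
          by simp
      qed (use y(1) z(1) in auto)
      finally show ?thesis
        using x(1) y(1) z(1) S(1) by (simp add: F.finsum_rdistr Pi_iff)
    qed
    have "((x \<otimes>\<^bsub>A\<^esub> y) \<otimes>\<^bsub>A\<^esub> z) g = (\<Oplus>\<^bsub>F\<^esub>k \<in> S. (x \<otimes>\<^bsub>A\<^esub> y) k \<otimes>\<^bsub>F\<^esub> z (inv\<^bsub>G\<^esub> k \<otimes>\<^bsub>G\<^esub> g))"
      using S assms g by (intro mult_eq mult_closed) auto
    also have "\<dots> = (\<Oplus>\<^bsub>F\<^esub>k \<in> S. \<Oplus>\<^bsub>F\<^esub>h \<in> supp x. ?t h k)"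
    proof (intro F.add.finprod_cong')
      fix k assume "k \<in> S"
      then have "k \<in> carrier G" using S by blast
      then have "(x \<otimes>\<^bsub>A\<^esub> y) k = (\<Oplus>\<^bsub>F\<^esub>h \<in> supp x. x h \<otimes>\<^bsub>F\<^esub> y (inv\<^bsub>G\<^esub> h \<otimes>\<^bsub>G\<^esub> k))"
        using mult_eq[OF assms(1,2) x(3) order.refl x(4)] by blast
      then show "(x \<otimes>\<^bsub>A\<^esub> y) k \<otimes>\<^bsub>F\<^esub> z (inv\<^bsub>G\<^esub> k \<otimes>\<^bsub>G\<^esub> g) = (\<Oplus>\<^bsub>F\<^esub>h \<in> supp x. ?t h k)"
        using x(1,3) y(1) z(1) by (simp add: F.finsum_ldistr Pi_iff F.m_assoc)
    qed (use x(1) y(1) z(1) in \<open>auto intro!: F.add.finprod_closed\<close>)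
    also have "\<dots> = (\<Oplus>\<^bsub>F\<^esub>h \<in> supp x. \<Oplus>\<^bsub>F\<^esub>k \<in> S. ?t h k)"
      using x(1,3) y(1) z(1) S(1) by (intro finsum_swap) auto
    also have "\<dots> = (\<Oplus>\<^bsub>F\<^esub>h \<in> supp x. x h \<otimes>\<^bsub>F\<^esub> (y \<otimes>\<^bsub>A\<^esub> z) (inv\<^bsub>G\<^esub> h \<otimes>\<^bsub>G\<^esub> g))"
      using * x(1) carrierD(1)[OF mult_closed[OF assms(2,3)]] by (intro F.add.finprod_cong') auto
    also have "\<dots> = (x \<otimes>\<^bsub>A\<^esub> (y \<otimes>\<^bsub>A\<^esub> z)) g"
      using mult_eq[OF assms(1) mult_closed[OF assms(2,3)] x(3) order.refl x(4) g] by simp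
    finally show ?thesis .
  qed
qed

lemma one_in_carrier: "\<one>\<^bsub>A\<^esub> \<in> carrier A"
  by (rule carrierI[where S = "{\<one>\<^bsub>G\<^esub>}"]) (auto simp: one_eq)

lemma mult_one_left:
  assumes "x \<in> carrier A" shows "\<one>\<^bsub>A\<^esub> \<otimes>\<^bsub>A\<^esub> x = x"
proof
  fix g
  show "(\<one>\<^bsub>A\<^esub> \<otimes>\<^bsub>A\<^esub> x) g = x g"
  proof (cases "g \<in> carrier G")
    case True
    then have "(\<one>\<^bsub>A\<^esub> \<otimes>\<^bsub>A\<^esub> x) g = (\<Oplus>\<^bsub>F\<^esub>h \<in> {\<one>\<^bsub>G\<^esub>}. \<one>\<^bsub>A\<^esub> h \<otimes>\<^bsub>F\<^esub> x (inv\<^bsub>G\<^esub> h \<otimes>\<^bsub>G\<^esub> g))"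
      using assms one_in_carrier by (intro mult_eq) (auto simp: one_eq)
    then show ?thesis using True carrierD[OF assms] by (simp add: one_eq)
  qed (use carrierD[OF assms] in \<open>simp add: mult_outside\<close>)
qed

lemma mult_one_right:
  assumes "x \<in> carrier A" shows "x \<otimes>\<^bsub>A\<^esub> \<one>\<^bsub>A\<^esub> = x"
proof
  fix g
  note x = carrierD[OF assms]
  show "(x \<otimes>\<^bsub>A\<^esub> \<one>\<^bsub>A\<^esub>) g = x g"
  proof (cases "g \<in> carrier G")
    case True
    have "(x \<otimes>\<^bsub>A\<^esub> \<one>\<^bsub>A\<^esub>) g = (\<Oplus>\<^bsub>F\<^esub>h \<in> insert g (supp x). x h \<otimes>\<^bsub>F\<^esub> \<one>\<^bsub>A\<^esub> (inv\<^bsub>G\<^esub> h \<otimes>\<^bsub>G\<^esub> g))"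
      using assms one_in_carrier x True by (intro mult_eq) auto
    also have "\<dots> = (\<Oplus>\<^bsub>F\<^esub>h \<in> insert g (supp x). if g = h then x h else \<zero>\<^bsub>F\<^esub>)"
    proof (intro F.add.finprod_cong')
      fix h assume "h \<in> insert g (supp x)"
      then have "h \<in> carrier G" using x True by blast
      then have "inv\<^bsub>G\<^esub> h \<otimes>\<^bsub>G\<^esub> g = \<one>\<^bsub>G\<^esub> \<longleftrightarrow> g = h"
        using True by (metis G.inv_closed G.inv_comm G.inv_equality G.inv_inv G.r_inv)
      then show "x h \<otimes>\<^bsub>F\<^esub> \<one>\<^bsub>A\<^esub> (inv\<^bsub>G\<^esub> h \<otimes>\<^bsub>G\<^esub> g) = (if g = h then x h else \<zero>\<^bsub>F\<^esub>)"
        using x by (simp add: one_eq)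
    qed (use x(1) in auto)
    also have "\<dots> = x g"
      using x by (intro F.add.finprod_singleton) auto
    finally show ?thesis .
  qed (use x in \<open>simp add: mult_outside\<close>)
qed

lemma mult_add_left:
  assumes "x \<in> carrier A" "y \<in> carrier A" "z \<in> carrier A"
  shows "(x \<oplus>\<^bsub>A\<^esub> y) \<otimes>\<^bsub>A\<^esub> z = x \<otimes>\<^bsub>A\<^esub> z \<oplus>\<^bsub>A\<^esub> y \<otimes>\<^bsub>A\<^esub> z"
proof
  fix g
  note x = carrierD[OF assms(1)] and y = carrierD[OF assms(2)] and z = carrierD[OF assms(3)]
  show "((x \<oplus>\<^bsub>A\<^esub> y) \<otimes>\<^bsub>A\<^esub> z) g = (x \<otimes>\<^bsub>A\<^esub> z \<oplus>\<^bsub>A\<^esub> y \<otimes>\<^bsub>A\<^esub> z) g"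
  proof (cases "g \<in> carrier G")
    case g: True
    let ?S = "supp x \<union> supp y"
    have S: "finite ?S" "?S \<subseteq> carrier G" "supp (x \<oplus>\<^bsub>A\<^esub> y) \<subseteq> ?S" using x y by (auto simp: add_eq)
    have "((x \<oplus>\<^bsub>A\<^esub> y) \<otimes>\<^bsub>A\<^esub> z) g = (\<Oplus>\<^bsub>F\<^esub>h \<in> ?S. (x \<oplus>\<^bsub>A\<^esub> y) h \<otimes>\<^bsub>F\<^esub> z (inv\<^bsub>G\<^esub> h \<otimes>\<^bsub>G\<^esub> g))"
      using S g assms add_closed by (intro mult_eq) auto
    also have "\<dots> = (\<Oplus>\<^bsub>F\<^esub>h \<in> ?S. x h \<otimes>\<^bsub>F\<^esub> z (inv\<^bsub>G\<^esub> h \<otimes>\<^bsub>G\<^esub> g) \<oplus>\<^bsub>F\<^esub> y h \<otimes>\<^bsub>F\<^esub> z (inv\<^bsub>G\<^esub> h \<otimes>\<^bsub>G\<^esub> g))"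
      using x(1) y(1) z(1) by (intro F.add.finprod_cong') (auto simp: add_eq F.l_distr)
    also have "\<dots> = (\<Oplus>\<^bsub>F\<^esub>h \<in> ?S. x h \<otimes>\<^bsub>F\<^esub> z (inv\<^bsub>G\<^esub> h \<otimes>\<^bsub>G\<^esub> g)) \<oplus>\<^bsub>F\<^esub> (\<Oplus>\<^bsub>F\<^esub>h \<in> ?S. y h \<otimes>\<^bsub>F\<^esub> z (inv\<^bsub>G\<^esub> h \<otimes>\<^bsub>G\<^esub> g))"
      using x(1) y(1) z(1) by (intro F.add.finprod_multf) auto
    also have "\<dots> = (x \<otimes>\<^bsub>A\<^esub> z) g \<oplus>\<^bsub>F\<^esub> (y \<otimes>\<^bsub>A\<^esub> z) g"
      using mult_eq[OF assms(1,3) S(1) _ S(2) g] mult_eq[OF assms(2,3) S(1) _ S(2) g] by simp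
    finally show ?thesis by (simp add: add_eq)
  qed (simp add: mult_outside add_eq)
qed

lemma mult_add_right:
  assumes "x \<in> carrier A" "y \<in> carrier A" "z \<in> carrier A"
  shows "z \<otimes>\<^bsub>A\<^esub> (x \<oplus>\<^bsub>A\<^esub> y) = z \<otimes>\<^bsub>A\<^esub> x \<oplus>\<^bsub>A\<^esub> z \<otimes>\<^bsub>A\<^esub> y"
proof
  fix g
  note x = carrierD[OF assms(1)] and y = carrierD[OF assms(2)] and z = carrierD[OF assms(3)]
  show "(z \<otimes>\<^bsub>A\<^esub> (x \<oplus>\<^bsub>A\<^esub> y)) g = (z \<otimes>\<^bsub>A\<^esub> x \<oplus>\<^bsub>A\<^esub> z \<otimes>\<^bsub>A\<^esub> y) g"
  proof (cases "g \<in> carrier G")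
    case g: True
    let ?s = "\<lambda>w. \<Oplus>\<^bsub>F\<^esub>h \<in> supp z. z h \<otimes>\<^bsub>F\<^esub> w (inv\<^bsub>G\<^esub> h \<otimes>\<^bsub>G\<^esub> g)"
    have eq: "(z \<otimes>\<^bsub>A\<^esub> w) g = ?s w" if "w \<in> carrier A" for w
      using mult_eq[OF assms(3) that z(3) order.refl z(4) g] .
    have "?s (x \<oplus>\<^bsub>A\<^esub> y)
        = (\<Oplus>\<^bsub>F\<^esub>h \<in> supp z. z h \<otimes>\<^bsub>F\<^esub> x (inv\<^bsub>G\<^esub> h \<otimes>\<^bsub>G\<^esub> g) \<oplus>\<^bsub>F\<^esub> z h \<otimes>\<^bsub>F\<^esub> y (inv\<^bsub>G\<^esub> h \<otimes>\<^bsub>G\<^esub> g))"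
      using x(1) y(1) z(1) by (intro F.add.finprod_cong') (auto simp: add_eq F.r_distr)
    also have "\<dots> = ?s x \<oplus>\<^bsub>F\<^esub> ?s y"
      using x(1) y(1) z(1) by (intro F.add.finprod_multf) auto
    finally show ?thesis using eq assms add_closed by (simp add: add_eq)
  qed (simp add: mult_outside add_eq)
qed

lemma ring_group_algebra: "ring A"
proof (rule ringI)
  show "abelian_group A"
  proof (rule abelian_groupI)
    show "\<zero>\<^bsub>A\<^esub> \<in> carrier A" by (rule carrierI[where S = "{}"]) (auto simp: zero_eq)
    fix x assume x: "x \<in> carrier A"
    show "\<zero>\<^bsub>A\<^esub> \<oplus>\<^bsub>A\<^esub> x = x" using carrierD[OF x] by (auto simp: add_eq zero_eq)
    have "(\<lambda>g. \<ominus>\<^bsub>F\<^esub> x g) \<in> carrier A"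
      using carrierD[OF x] by (intro carrierI[where S = "supp x"]) auto
    moreover have "(\<lambda>g. \<ominus>\<^bsub>F\<^esub> x g) \<oplus>\<^bsub>A\<^esub> x = \<zero>\<^bsub>A\<^esub>"
      using carrierD[OF x] by (auto simp: add_eq zero_eq F.l_neg)
    ultimately show "\<exists>y \<in> carrier A. y \<oplus>\<^bsub>A\<^esub> x = \<zero>\<^bsub>A\<^esub>" by blast
    fix y assume y: "y \<in> carrier A"
    show "x \<oplus>\<^bsub>A\<^esub> y \<in> carrier A" using x y by (rule add_closed)
    show "x \<oplus>\<^bsub>A\<^esub> y = y \<oplus>\<^bsub>A\<^esub> x"
      using carrierD[OF x] carrierD[OF y] by (auto simp: add_eq F.a_comm)
    fix z assume z: "z \<in> carrier A"
    show "x \<oplus>\<^bsub>A\<^esub> y \<oplus>\<^bsub>A\<^esub> z = x \<oplus>\<^bsub>A\<^esub> (y \<oplus>\<^bsub>A\<^esub> z)"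
      using carrierD[OF x] carrierD[OF y] carrierD[OF z] by (auto simp: add_eq F.a_assoc)
  qed
  show "monoid A"
    by (rule monoidI) (auto intro: mult_closed one_in_carrier mult_assoc mult_one_left mult_one_right)
qed (auto intro: mult_add_left mult_add_right)

end

end

(*
  Call a pair (H, U) good if M is induced from the FH-submodule U. Goodness is transitive, it passes
  to larger subgroups (replace U by U FH'), and U is irreducible when M is. G is polycyclic, so a good
  pair of minimal Hirsch length exists; inside it all good subgroups have finite index. If these
  indices are bounded, a good pair of maximal index gives a primitive module, by transitivity.

  The bound is proved for the good H containing a normal subgroup L of G, by Noetherian induction on
  L. For u outside L and central modulo L, adjoining u to H gives a good subgroup that contains the
  larger normal subgroup L<u>, hence has bounded index. If G/L is not abelian, take for u a commutator
  [x, y]: bounded powers of x and y lie in H<u>, hence a bounded power of u lies in H. If G/L is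
  abelian with torsion, take u of finite order modulo L. If G/L is free abelian of rank k > 0, the
  good H must contain one of finitely many u. To see this, take critical FL-submodules K of M, those
  on which every nonzero partial homomorphism is injective. They form a matroid under the relation
  "K meets the sum of S", on which G/L acts by translations. The translates of K over a box of size R
  have rank of order R^d, where d is the largest number of coordinate directions along which they are
  independent. If d = k, then M is induced from a module for L, of infinite index. If d < k and
  K lies in U, then translates of K in distinct cosets of H do not interact; comparing the rank over a
  box with the rank over the part of H in that box, multiplied by the index of H, bounds the product
  of k - d successive minima of the lattice H/L, so H/L contains a short vector.
*)
theory Submission
  imports Defs "HOL-Library.Function_Algebras"
begin

text \<open>The obstacle is uniformity. The critical submodule \<open>K\<close> inside
  \<open>U\<close> changes with the good pair, yet the short vector must be bounded in terms of
  \<open>L\<close> alone. Growth is therefore measured against one fixed critical \<open>V\<close>.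
  By irreducibility the translates of any critical submodule generate \<open>M\<close>, so
  \<open>K\<close> and \<open>V\<close> depend on finitely many translates of each other. Exchanging
  them enlarges a box by an additive amount only, which depends on the pair but disappears from the
  comparison once the boxes are large.

  Critical submodules exist because every element of \<open>M\<close> lies in a submodule that is
  Noetherian over a polycyclic group, and criticality is what makes the meeting relation transitive.
  Commutators enter because, for \<open>u\<close> central modulo \<open>L\<close>, the quotient of
  \<open>H<u>\<close> by \<open>H\<close> is cyclic: commutators of its elements already lie in
  \<open>H\<close>, which turns a bounded index of \<open>H<u>\<close> into a bounded order of
  \<open>u\<close> over \<open>H\<close>.\<close>

section \<open>Dependence relations and growth of translates\<close>

text \<open>HOL-Algebra interprets the integers as a partial order on \<open>UNIV\<close>, and the resulting classical and
  transitivity rules interfere with ordinary reasoning about \<open>\<le>\<close>.\<close>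

declare int.le_trans [trans del] int.lless_trans [trans del] int.le_cong_l [trans del] int.le_cong_r [trans del]
  int.lless_cong_l [trans del] int.lless_cong_r [trans del]
declare int.le_cong_l [rule del] int.le_cong_r [rule del] int.le_antisym [rule del] int.weak_le_antisym [rule del]
  int.weak_refl [rule del] int.at_least_at_most_upper [rule del] int.at_least_at_most_lower [rule del]

text \<open>A matroid closure relation, later instantiated by critical submodules with
  \<open>dep K S\<close> meaning that \<open>K\<close> meets the sum of \<open>S\<close>.
  Transitivity is assumed for one element at a time because that is the form criticality yields; the
  version for finite sets follows by induction.\<close>

locale dependence =
  fixes C :: "'k set" and dep :: "'k \<Rightarrow> 'k set \<Rightarrow> bool"
  assumes dep_empty: "K \<in> C \<Longrightarrow> \<not> dep K {}"
    and dep_refl: "\<lbrakk>K \<in> S; S \<subseteq> C\<rbrakk> \<Longrightarrow> dep K S"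
    and dep_mono: "\<lbrakk>dep K S; S \<subseteq> S'; S' \<subseteq> C\<rbrakk> \<Longrightarrow> dep K S'"
    and dep_trans1: "\<lbrakk>K' \<in> C; K \<in> C; S \<subseteq> C; dep K S; dep K' (insert K S)\<rbrakk> \<Longrightarrow> dep K' S"
    and dep_exch: "\<lbrakk>K' \<in> C; K \<in> C; S \<subseteq> C; dep K' (insert K S); \<not> dep K' S\<rbrakk> \<Longrightarrow> dep K (insert K' S)"
begin

lemma dep_trans_Un:
  assumes "finite T" "T \<subseteq> C" "S \<subseteq> C" "K' \<in> C" "\<And>K. K \<in> T \<Longrightarrow> dep K S" "dep K' (T \<union> S)"
  shows "dep K' S"
  using assms
proof (induction T)
  case (insert K T)
  have "dep K (T \<union> S)" using insert.prems dep_mono[of K S "T \<union> S"] by auto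
  then have "dep K' (T \<union> S)" using dep_trans1[of K' K "T \<union> S"] insert.prems by auto
  then show ?case using insert by auto
qed simp

lemma dep_trans:
  assumes "finite T" "T \<subseteq> C" "S \<subseteq> C" "K' \<in> C" "\<And>K. K \<in> T \<Longrightarrow> dep K S" "dep K' T"
  shows "dep K' S"
  using dep_trans_Un[OF assms(1-5)] dep_mono[OF assms(6), of "T \<union> S"] assms(2,3) by auto

definition indep :: "'k set \<Rightarrow> bool" where
  "indep A \<longleftrightarrow> (\<forall>K \<in> A. \<not> dep K (A - {K}))"

text \<open>When the elements of \<open>D\<close> are added to \<open>S\<close> one by one,
  \<open>a\<close> becomes dependent at some step, and the exchange axiom applies to the element
  \<open>b\<close> added at that step.\<close>

lemma dep_step:
  assumes "finite D" "S \<union> D \<subseteq> C" "dep a (S \<union> D)" "\<not> dep a S"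
  shows "\<exists>D0 b. b \<in> D \<and> D0 \<subseteq> D - {b} \<and> \<not> dep a (S \<union> D0) \<and> dep a (insert b (S \<union> D0))"
  using assms
proof (induction D)
  case (insert x D)
  show ?case
  proof (cases "dep a (S \<union> D)")
    case True
    then obtain D0 b where "b \<in> D" "D0 \<subseteq> D - {b}" "\<not> dep a (S \<union> D0)" "dep a (insert b (S \<union> D0))"
      using insert by auto
    then show ?thesis by blast
  next
    case False
    then show ?thesis using insert.prems insert.hyps(2) by (intro exI[of _ D] exI[of _ x]) auto
  qed
qed simp

text \<open>Steinitz exchange: an element \<open>a\<close> of \<open>A\<close> outside
  \<open>B\<close> replaces some \<open>b\<close> of \<open>B\<close> outside \<open>A\<close>. The
  new set still spans, is not larger, and shares one more element with \<open>A\<close>, so the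
  induction runs on the number of elements of \<open>A\<close> missing from
  \<open>B\<close>.\<close>

lemma steinitz:
  assumes "finite B" "finite A" "A \<subseteq> C" "B \<subseteq> C" "indep A" "\<And>K. K \<in> A \<Longrightarrow> dep K B"
  shows "card A \<le> card B"
  using assms
proof (induction "card (A - B)" arbitrary: B rule: less_induct)
  case less
  show ?case
  proof (cases "A \<subseteq> B")
    case True
    then show ?thesis using less.prems by (simp add: card_mono)
  next
    case False
    then obtain a where a: "a \<in> A" "a \<notin> B" by blast
    \<comment> \<open>Starting the chain at \<open>A \<inter> B\<close> guarantees that the element
      thrown out of \<open>B\<close> is not one of \<open>A\<close>.\<close>
    have "\<not> dep a (A \<inter> B)"
      using a less.prems(3,5) dep_mono[of a "A \<inter> B" "A - {a}"] unfolding indep_def by blast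
    moreover have "dep a (A \<inter> B \<union> (B - A))" using less.prems(6)[OF a(1)]
      by (metis Int_Diff_Un Int_commute)
    ultimately obtain D0 b where b: "b \<in> B - A" "D0 \<subseteq> B - A - {b}" "\<not> dep a (A \<inter> B \<union> D0)"
        "dep a (insert b (A \<inter> B \<union> D0))"
      using dep_step[of "B - A" "A \<inter> B" a] less.prems(1,4) by auto
    have "a \<in> C" "b \<in> C" "A \<inter> B \<union> D0 \<subseteq> C" using a b(1,2) less.prems(3,4) by auto
    then have "dep b (insert a (A \<inter> B \<union> D0))"
      using dep_exch b(3,4) by blast
    moreover have "insert a (A \<inter> B \<union> D0) \<subseteq> insert a (B - {b})" "insert a (B - {b}) \<subseteq> C"
      using a b(1,2) less.prems(3,4) by auto
    ultimately have depb: "dep b (insert a (B - {b}))" by (rule dep_mono)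
    let ?B = "insert a (B - {b})"
    have depB: "dep K ?B" if "K \<in> B" for K
    proof (cases "K = b")
      case False
      then show ?thesis using that a less.prems(3,4) by (intro dep_refl) auto
    qed (use depb in simp)
    have "card (A - ?B) < card (A - B)"
      using a b less.prems(2) by (intro psubset_card_mono) auto
    moreover have "dep K ?B" if "K \<in> A" for K
    proof (rule dep_trans[OF less.prems(1,4) _ _ depB less.prems(6)[OF that]])
      show "?B \<subseteq> C" "K \<in> C" using a that less.prems(3,4) by auto
    qed
    moreover have "finite ?B" "?B \<subseteq> C" using a less.prems by auto
    ultimately have "card A \<le> card ?B"
      using less.hyps[of ?B] less.prems(2,3,5) by simp
    also have "\<dots> \<le> card B"
      using a b less.prems(1) card.remove[of B b] by simp
    finally show ?thesis .
  qed
qed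

end

section \<open>Exponent vectors and the graded lexicographic order\<close>

definition comb :: "nat \<Rightarrow> (nat \<Rightarrow> nat \<Rightarrow> int) \<Rightarrow> (nat \<Rightarrow> nat) \<Rightarrow> nat \<Rightarrow> int" where
  "comb \<kappa> u n = (\<lambda>i. \<Sum>j<\<kappa>. int (n j) * u j i)"

lemma comb_add: "comb \<kappa> u (n + m) = comb \<kappa> u n + comb \<kappa> u m"
  by (auto simp: comb_def sum.distrib algebra_simps)

definition vsupp :: "nat set \<Rightarrow> (nat \<Rightarrow> nat) set" where
  "vsupp J = {n. \<forall>j. j \<notin> J \<longrightarrow> n j = 0}"

text \<open>The graded lexicographic order: compatible with addition, total on exponents in
  \<open>\<kappa>\<close> variables, and, since degrees are compared before anything else, with only
  finitely many predecessors of each exponent. The exponents in \<open>comb\<close> are natural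
  numbers for the sake of this well-foundedness.\<close>

definition dlex :: "nat \<Rightarrow> (nat \<Rightarrow> nat) \<Rightarrow> (nat \<Rightarrow> nat) \<Rightarrow> bool" where
  "dlex \<kappa> n m \<longleftrightarrow> (\<Sum>j<\<kappa>. n j) < (\<Sum>j<\<kappa>. m j) \<or>
     (\<Sum>j<\<kappa>. n j) = (\<Sum>j<\<kappa>. m j) \<and> (\<exists>i<\<kappa>. n i < m i \<and> (\<forall>j<i. n j = m j))"

lemma dlex_irrefl: "\<not> dlex \<kappa> n n"
  by (auto simp: dlex_def)

lemma dlex_trans:
  assumes "dlex \<kappa> n m" "dlex \<kappa> m l"
  shows "dlex \<kappa> n l"
proof (cases "(\<Sum>j<\<kappa>. n j) < (\<Sum>j<\<kappa>. l j)")
  case False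
  then have eq: "(\<Sum>j<\<kappa>. n j) = (\<Sum>j<\<kappa>. m j)" "(\<Sum>j<\<kappa>. m j) = (\<Sum>j<\<kappa>. l j)"
    using assms unfolding dlex_def by linarith+
  then obtain i i' where i: "i < \<kappa>" "n i < m i" "\<forall>j<i. n j = m j"
      and i': "i' < \<kappa>" "m i' < l i'" "\<forall>j<i'. m j = l j"
    using assms unfolding dlex_def by (metis less_irrefl)
  consider "i < i'" | "i = i'" | "i' < i" by linarith
  then have "\<exists>i<\<kappa>. n i < l i \<and> (\<forall>j<i. n j = l j)"
  proof cases
    case 1 then show ?thesis using i i' by (intro exI[of _ i]) auto
  next
    case 2 then show ?thesis using i i' by (intro exI[of _ i]) auto
  next
    case 3 then show ?thesis using i i' by (intro exI[of _ i']) auto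
  qed
  then show ?thesis using eq by (simp add: dlex_def)
qed (simp add: dlex_def)

lemma dlex_total:
  assumes "n \<in> vsupp {..<\<kappa>}" "m \<in> vsupp {..<\<kappa>}" "n \<noteq> m"
  shows "dlex \<kappa> n m \<or> dlex \<kappa> m n"
proof -
  have "\<exists>i. n i \<noteq> m i" using assms(3) by auto
  then obtain i where i: "n i \<noteq> m i" "\<forall>j<i. n j = m j"
    using exists_least_iff[of "\<lambda>i. n i \<noteq> m i"] by auto
  have "i < \<kappa>"
  proof (rule ccontr)
    assume "\<not> i < \<kappa>"
    then have "n i = 0" "m i = 0" using assms by (auto simp: vsupp_def)
    then show False using i(1) by simp
  qed
  then have "n i < m i \<Longrightarrow> \<exists>i<\<kappa>. n i < m i \<and> (\<forall>j<i. n j = m j)"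
    "m i < n i \<Longrightarrow> \<exists>i<\<kappa>. m i < n i \<and> (\<forall>j<i. m j = n j)"
    using i(2) by auto
  then show ?thesis using i(1) unfolding dlex_def by (meson linorder_neqE_nat)
qed

lemma dlex_add: "dlex \<kappa> n m \<Longrightarrow> dlex \<kappa> (n + v) (m + v)"
  by (auto simp: dlex_def sum.distrib)

text \<open>Restriction to \<open>J\<close> turns exponent vectors into elements of a product
  \<open>PiE\<close>, where cardinalities are known.\<close>

lemma inj_on_restrict_vsupp: "inj_on (\<lambda>n. restrict n J) (vsupp J)"
proof (rule inj_onI, rule ext)
  fix n m j assume "n \<in> vsupp J" "m \<in> vsupp J" "restrict n J = restrict m J"
  then show "n j = m j" by (cases "j \<in> J") (auto simp: vsupp_def dest: fun_cong[where x = j])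
qed

lemma finite_vsupp_le: "finite {n \<in> vsupp {..<\<kappa>}. \<forall>j. n j \<le> R}"
proof (rule inj_on_finite[of "\<lambda>n. restrict n {..<\<kappa>}" _ "PiE {..<\<kappa>} (\<lambda>_. {..R})"])
  show "inj_on (\<lambda>n. restrict n {..<\<kappa>}) {n \<in> vsupp {..<\<kappa>}. \<forall>j. n j \<le> R}"
    by (rule inj_on_subset[OF inj_on_restrict_vsupp]) auto
qed (auto intro: finite_PiE split: if_splits)

lemma finite_dlex: "finite {m \<in> vsupp {..<\<kappa>}. dlex \<kappa> m n}"
proof (rule finite_subset[OF _ finite_vsupp_le[of \<kappa> "\<Sum>j<\<kappa>. n j"]], safe)
  fix m j assume m: "m \<in> vsupp {..<\<kappa>}" "dlex \<kappa> m n"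
  show "m j \<le> (\<Sum>j<\<kappa>. n j)"
  proof (cases "j < \<kappa>")
    case True
    then have "m j \<le> (\<Sum>j<\<kappa>. m j)" by (intro member_le_sum) auto
    then show ?thesis using m(2) by (auto simp: dlex_def)
  qed (use m(1) in \<open>auto simp: vsupp_def\<close>)
qed

text \<open>The number of predecessors serves as measure, since the predecessors of a predecessor
  form a proper subset.\<close>

lemma dlex_induct [consumes 1, case_names less]:
  assumes "n \<in> vsupp {..<\<kappa>}"
    and "\<And>n. n \<in> vsupp {..<\<kappa>} \<Longrightarrow> (\<And>m. m \<in> vsupp {..<\<kappa>} \<Longrightarrow> dlex \<kappa> m n \<Longrightarrow> P m) \<Longrightarrow> P n"
  shows "P n"
  using assms(1)
proof (induction "card {m \<in> vsupp {..<\<kappa>}. dlex \<kappa> m n}" arbitrary: n rule: less_induct)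
  case less
  show ?case
  proof (rule assms(2)[OF less.prems])
    fix m assume m: "m \<in> vsupp {..<\<kappa>}" "dlex \<kappa> m n"
    then have "{l \<in> vsupp {..<\<kappa>}. dlex \<kappa> l m} \<subset> {l \<in> vsupp {..<\<kappa>}. dlex \<kappa> l n}"
      using dlex_trans dlex_irrefl by blast
    then have "card {l \<in> vsupp {..<\<kappa>}. dlex \<kappa> l m} < card {l \<in> vsupp {..<\<kappa>}. dlex \<kappa> l n}"
      by (rule psubset_card_mono[OF finite_dlex])
    then show "P m" by (rule less.hyps) (rule m(1))
  qed
qed

text \<open>Such a box is long only in the directions \<open>I\<close>; the power
  \<open>card I\<close> of its long side becomes the growth exponent.\<close>

lemma card_vsupp_box:
  assumes "I \<subseteq> {..<\<kappa>}"
  shows "finite {n \<in> vsupp {..<\<kappa>}. \<forall>j<\<kappa>. n j \<le> (if j \<in> I then R else c)}"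
    "card {n \<in> vsupp {..<\<kappa>}. \<forall>j<\<kappa>. n j \<le> (if j \<in> I then R else c)} \<le> (R + 1) ^ card I * (c + 1) ^ \<kappa>"
proof -
  let ?S = "{n \<in> vsupp {..<\<kappa>}. \<forall>j<\<kappa>. n j \<le> (if j \<in> I then R else c)}"
  let ?P = "PiE {..<\<kappa>} (\<lambda>j. {..if j \<in> I then R else c})"
  have inj: "inj_on (\<lambda>n. restrict n {..<\<kappa>}) ?S"
    by (rule inj_on_subset[OF inj_on_restrict_vsupp]) auto
  have sub: "(\<lambda>n. restrict n {..<\<kappa>}) ` ?S \<subseteq> ?P" by (auto split: if_splits)
  have fin: "finite ?P" by (intro finite_PiE) auto
  show "finite ?S" using inj_on_finite[OF inj sub fin] .
  have "card ?S \<le> card ?P" using card_inj_on_le[OF inj sub fin] .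
  also have "\<dots> = (\<Prod>j<\<kappa>. (if j \<in> I then R + 1 else c + 1))"
    by (auto simp: card_PiE intro!: prod.cong)
  also have "\<dots> = (\<Prod>j\<in>I. R + 1) * (\<Prod>j\<in>{..<\<kappa>} - I. c + 1)"
    using assms by (simp add: prod.If_cases Int_absorb1 Diff_eq)
  also have "\<dots> \<le> (R + 1) ^ card I * (c + 1) ^ \<kappa>"
    using assms by (auto intro!: mult_left_mono power_increasing simp: card_Diff_subset finite_subset)
  finally show "card ?S \<le> (R + 1) ^ card I * (c + 1) ^ \<kappa>" .
qed

section \<open>Translates by integer vectors and the growth of their rank\<close>

locale translated_dependence = dependence C dep
  for C :: "'k set" and dep :: "'k \<Rightarrow> 'k set \<Rightarrow> bool" +
  fixes T :: "'k \<Rightarrow> (nat \<Rightarrow> int) \<Rightarrow> 'k"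
  assumes T_closed: "K \<in> C \<Longrightarrow> T K a \<in> C"
    and T_add: "K \<in> C \<Longrightarrow> T (T K a) b = T K (a + b)"
    and T_zero: "K \<in> C \<Longrightarrow> T K 0 = K"
    and dep_T: "\<lbrakk>K \<in> C; S \<subseteq> C; dep K S\<rbrakk> \<Longrightarrow> dep (T K a) ((\<lambda>K. T K a) ` S)"
begin

lemma T_image: "K \<in> C \<Longrightarrow> T K ` Y \<subseteq> C"
  using T_closed by blast

lemma dep_shift:
  assumes "K \<in> C" "V \<in> C" "dep (T K a) (T V ` Y)"
  shows "dep (T K (a + b)) (T V ` ((\<lambda>y. y + b) ` Y))"
  using dep_T[OF _ _ assms(3), of b] T_add T_closed T_image assms(1,2) by (simp add: image_image)

text \<open>Independence of the family of translates indexed by \<open>Y\<close>: an index is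
  removed and not a submodule, so that coinciding translates count as dependent.\<close>

definition findep :: "'k \<Rightarrow> (nat \<Rightarrow> int) set \<Rightarrow> bool" where
  "findep K Y \<longleftrightarrow> (\<forall>a \<in> Y. \<not> dep (T K a) (T K ` (Y - {a})))"

lemma findep_card:
  assumes K: "K \<in> C" and Y: "findep K Y" "finite Y" and B: "finite B" "B \<subseteq> C"
    and d: "\<And>a. a \<in> Y \<Longrightarrow> dep (T K a) B"
  shows "card Y \<le> card B"
proof -
  have inj: "inj_on (T K) Y"
  proof (rule inj_onI, rule ccontr)
    fix a b assume ab: "a \<in> Y" "b \<in> Y" "T K a = T K b" "a \<noteq> b"
    then have "dep (T K a) (T K ` (Y - {a}))" using K T_image by (intro dep_refl) auto
    then show False using Y(1) ab(1) by (auto simp: findep_def)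
  qed
  have "indep (T K ` Y)"
    unfolding indep_def
  proof
    fix L assume "L \<in> T K ` Y"
    then obtain a where a: "a \<in> Y" "L = T K a" by blast
    then have "T K ` Y - {L} = T K ` (Y - {a})" using inj by (auto simp: inj_on_def)
    then show "\<not> dep L (T K ` Y - {L})" using Y(1) a by (simp add: findep_def)
  qed
  then have "card (T K ` Y) \<le> card B"
    using steinitz[OF B(1) _ _ B(2)] Y(2) T_image[OF K] d by auto
  then show ?thesis using card_image[OF inj] by simp
qed

text \<open>The vectors \<open>u j\<close> with \<open>j\<close> in \<open>J\<close> are free
  directions for \<open>K\<close>. As in \<open>findep\<close>, exponents are removed and not
  translates, so freeness includes that distinct exponents give distinct translates.\<close>

definition free :: "nat \<Rightarrow> (nat \<Rightarrow> nat \<Rightarrow> int) \<Rightarrow> 'k \<Rightarrow> nat set \<Rightarrow> bool" where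
  "free \<kappa> u K J \<longleftrightarrow> (\<forall>Y n. finite Y \<longrightarrow> Y \<subseteq> vsupp J \<longrightarrow> n \<in> Y \<longrightarrow>
     \<not> dep (T K (comb \<kappa> u n)) ((\<lambda>n. T K (comb \<kappa> u n)) ` (Y - {n})))"

lemma free_findep:
  assumes "K \<in> C" "free \<kappa> u K J" "finite Y" "Y \<subseteq> vsupp J"
  shows "findep K (comb \<kappa> u ` Y)" "inj_on (comb \<kappa> u) Y"
proof -
  show inj: "inj_on (comb \<kappa> u) Y"
  proof (rule inj_onI, rule ccontr)
    fix n m assume nm: "n \<in> Y" "m \<in> Y" "comb \<kappa> u n = comb \<kappa> u m" "n \<noteq> m"
    then have "T K (comb \<kappa> u n) \<in> (\<lambda>n. T K (comb \<kappa> u n)) ` (Y - {n})"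
      by (metis (mono_tags, lifting) DiffI image_eqI singletonD)
    then have "dep (T K (comb \<kappa> u n)) ((\<lambda>n. T K (comb \<kappa> u n)) ` (Y - {n}))"
      using T_closed[OF assms(1)] by (intro dep_refl) auto
    then show False using assms nm unfolding free_def by blast
  qed
  show "findep K (comb \<kappa> u ` Y)"
    unfolding findep_def
  proof safe
    fix n assume n: "n \<in> Y" "dep (T K (comb \<kappa> u n)) (T K ` (comb \<kappa> u ` Y - {comb \<kappa> u n}))"
    have "comb \<kappa> u ` Y - {comb \<kappa> u n} = comb \<kappa> u ` (Y - {n})"
      using inj n(1) by (auto simp: inj_on_def)
    then show False using n assms(2-4) unfolding free_def by (simp add: image_image)
  qed
qed

text \<open>As in Groebner basis theory, the standard exponents are those whose translate does not depend
  on smaller ones; they form a down-closed set whose coordinate orthants are free.\<close>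

lemma growth_bound:
  assumes K: "K \<in> C"
    and nf': "\<And>J. J \<subseteq> {..<\<kappa>} \<Longrightarrow> card J = Suc \<delta> \<Longrightarrow> \<not> free \<kappa> u K J"
  shows "\<exists>c. \<forall>R. \<exists>Xs. finite Xs \<and> card Xs \<le> c * (R + 1) ^ \<delta> \<and>
    (\<forall>n \<in> vsupp {..<\<kappa>}. (\<forall>j. n j \<le> R) \<longrightarrow> dep (T K (comb \<kappa> u n)) ((\<lambda>n. T K (comb \<kappa> u n)) ` Xs))"
proof -
  define d where "d = Suc \<delta>"
  have d: "1 \<le> d" and nf: "\<And>J. J \<subseteq> {..<\<kappa>} \<Longrightarrow> card J = d \<Longrightarrow> \<not> free \<kappa> u K J"
    using nf' by (simp_all add: d_def)
  define f where "f n = T K (comb \<kappa> u n)" for n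
  have fC: "f ` Xs \<subseteq> C" for Xs using T_closed[OF K] by (auto simp: f_def)
  then have fC1: "f n \<in> C" for n by blast
  define N where "N = vsupp {..<\<kappa>}"
  define P where "P n = {m \<in> N. dlex \<kappa> m n}" for n
  define S where "S = {n \<in> N. \<not> dep (f n) (f ` P n)}"
  have finP: "finite (P n)" for n using finite_dlex by (simp add: P_def N_def)
  \<comment> \<open>The nonstandard exponents are closed under adding any exponent, like the leading
    exponents of an ideal: translation carries a dependence on smaller exponents to a dependence on
    smaller exponents.\<close>
  have up: "n + v \<in> N \<and> n + v \<notin> S" if "n \<in> N" "n \<notin> S" "v \<in> N" for n v
  proof -
    have "dep (f n) (f ` P n)" using that by (simp add: S_def)
    from dep_T[OF _ _ this, of "comb \<kappa> u v"]
    have "dep (f (n + v)) ((\<lambda>m. f (m + v)) ` P n)"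
      using fC fC1 by (simp add: f_def T_add[OF K] comb_add image_image)
    then have "dep (f (n + v)) (f ` ((\<lambda>m. m + v) ` P n))" by (simp add: image_image)
    moreover have "(\<lambda>m. m + v) ` P n \<subseteq> P (n + v)"
      using that dlex_add by (auto simp: P_def N_def vsupp_def)
    ultimately have "dep (f (n + v)) (f ` P (n + v))"
      using dep_mono[OF _ image_mono fC] by simp
    moreover have "n + v \<in> N" using that by (auto simp: N_def vsupp_def)
    ultimately show ?thesis by (simp add: S_def)
  qed
  have fin_max: "\<exists>m \<in> Z. \<forall>l \<in> Z. l \<noteq> m \<longrightarrow> dlex \<kappa> l m" if "finite Z" "Z \<noteq> {}" "Z \<subseteq> N" for Z
    using that
    proof (induction Z rule: finite_ne_induct)
      case (insert x F)
      then obtain m where m: "m \<in> F" "\<forall>l \<in> F. l \<noteq> m \<longrightarrow> dlex \<kappa> l m" by auto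
      have "x \<noteq> m" using m(1) insert by auto
      then consider "dlex \<kappa> x m" | "dlex \<kappa> m x"
        using dlex_total[of x \<kappa> m] m insert by (auto simp: N_def)
      then show ?case
      proof cases
        case 1 then show ?thesis using m by (intro bexI[of _ m]) auto
      next
        case 2
        then have "dlex \<kappa> l x" if "l \<in> F" for l
          using m(2) that dlex_trans[of \<kappa> l m x] by (cases "l = m") auto
        then show ?thesis by (intro bexI[of _ x]) auto
      qed
    qed auto
  \<comment> \<open>Induction on the size of \<open>Y\<close>. Its largest element \<open>m\<close>
    is standard and hence does not depend on the rest; if another \<open>n\<close> depended on the
    rest, exchange would make \<open>m\<close> dependent after all.\<close>
  have indepS: "\<not> dep (f n) (f ` (Y - {n}))" if "finite Y" "Y \<subseteq> S" "n \<in> Y" for Y n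
    using that
  proof (induction "card Y" arbitrary: Y n)
    case (Suc k)
    obtain m where m: "m \<in> Y" "\<forall>l \<in> Y. l \<noteq> m \<longrightarrow> dlex \<kappa> l m"
      using fin_max[of Y] Suc.prems by (auto simp: S_def)
    have sub: "Y - {m} \<subseteq> P m" using m Suc.prems by (auto simp: P_def S_def)
    have ndm: "\<not> dep (f m) (f ` (Y - {m}))"
    proof
      assume "dep (f m) (f ` (Y - {m}))"
      then have "dep (f m) (f ` P m)" by (rule dep_mono[OF _ image_mono[OF sub] fC])
      then show False using m(1) Suc.prems(2) by (auto simp: S_def)
    qed
    show ?case
    proof (cases "n = m")
      case False
      have "\<not> dep (f n) (f ` (Y - {m} - {n}))"
      proof (rule Suc.hyps(1))
        show "k = card (Y - {m})" using Suc.hyps(2) m(1) Suc.prems(1) by simp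
      qed (use Suc.prems False in auto)
      moreover have "f ` (Y - {n}) = insert (f m) (f ` (Y - {m} - {n}))" using m(1) False by auto
      ultimately have "dep (f n) (f ` (Y - {n})) \<Longrightarrow> dep (f m) (insert (f n) (f ` (Y - {m} - {n})))"
        using dep_exch[OF fC1 fC1 fC] by simp
      moreover have "insert (f n) (f ` (Y - {m} - {n})) = f ` (Y - {m})" using Suc.prems(3) False by auto
      ultimately show ?thesis using ndm by auto
    qed (use ndm in simp)
  qed simp
  \<comment> \<open>Otherwise the whole orthant of \<open>J\<close> would consist of standard
    exponents and hence be free.\<close>
  have "\<exists>p. p \<in> vsupp J \<and> p \<notin> S" if "J \<subseteq> {..<\<kappa>}" "card J = d" for J
  proof (rule ccontr)
    assume "\<not> ?thesis"
    then have "vsupp J \<subseteq> S" by blast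
    then have "free \<kappa> u K J" using indepS by (auto simp: free_def f_def)
    then show False using nf[OF that] by simp
  qed
  then have "\<forall>J. \<exists>p. J \<subseteq> {..<\<kappa>} \<and> card J = d \<longrightarrow> p \<in> vsupp J \<and> p \<notin> S" by blast
  from choice[OF this] obtain p where
    p: "\<And>J. J \<subseteq> {..<\<kappa>} \<Longrightarrow> card J = d \<Longrightarrow> p J \<in> vsupp J \<and> p J \<notin> S" by blast
  define c where "c = (\<Sum>J \<in> Pow {..<\<kappa>}. \<Sum>j<\<kappa>. p J j)"
  have pc: "p J j \<le> c" if "J \<subseteq> {..<\<kappa>}" "card J = d" for J j
  proof (cases "j < \<kappa>")
    case True
    then have "p J j \<le> (\<Sum>j<\<kappa>. p J j)" by (intro member_le_sum) auto
    also have "\<dots> \<le> c" unfolding c_def using that by (intro member_le_sum) auto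
    finally show ?thesis .
  next
    case False
    then have "j \<notin> J" using that by auto
    then show ?thesis using p[OF that] by (auto simp: vsupp_def)
  qed
  \<comment> \<open>A standard exponent with \<open>d\<close> coordinates above \<open>c\<close>
    would dominate some nonstandard \<open>p J\<close> in every coordinate, and so be nonstandard
    itself.\<close>
  have few: "card {j. j < \<kappa> \<and> c < n j} < d" if "n \<in> S" for n
  proof (rule ccontr)
    assume "\<not> ?thesis"
    then obtain J where J: "J \<subseteq> {j. j < \<kappa> \<and> c < n j}" "card J = d"
      by (meson not_less obtain_subset_with_card_n)
    then have J': "J \<subseteq> {..<\<kappa>}" by auto
    have le: "p J j \<le> n j" for j
      using pc[OF J' J(2), of j] p[OF J' J(2)] J(1) by (cases "j \<in> J") (auto simp: vsupp_def)
    define v where "v = (\<lambda>j. n j - p J j)"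
    have "n = p J + v" using le by (auto simp: v_def)
    moreover have "v \<in> N" using that by (auto simp: v_def N_def vsupp_def S_def)
    moreover have "p J \<in> N" using p[OF J' J(2)] J' by (auto simp: N_def vsupp_def)
    ultimately have "n \<notin> S" using up[of "p J" v] p[OF J' J(2)] by auto
    then show False using that by simp
  qed
  \<comment> \<open>The factor \<open>2 ^ \<kappa>\<close> counts the possible sets of long
    directions; \<open>\<kappa> + 1\<close> enters because an exponent with entries at most
    \<open>R\<close> can have degree \<open>\<kappa> * R\<close>.\<close>
  define e where "e = 2 ^ \<kappa> * ((\<kappa> + 1) ^ (d - 1) * (c + 1) ^ \<kappa>)"
  have "\<exists>Xs. finite Xs \<and> card Xs \<le> e * (R + 1) ^ (d - 1) \<and> (\<forall>n \<in> N. (\<forall>j. n j \<le> R) \<longrightarrow> dep (f n) (f ` Xs))" for R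
  proof -
    define Xs where "Xs = {n \<in> S. (\<Sum>j<\<kappa>. n j) \<le> \<kappa> * R}"
    define Bx where "Bx I = {n \<in> vsupp {..<\<kappa>}. \<forall>j<\<kappa>. n j \<le> (if j \<in> I then \<kappa> * R else c)}" for I
    define D where "D = {I. I \<subseteq> {..<\<kappa>} \<and> card I \<le> d - 1}"
    have finD: "finite D" unfolding D_def by (rule finite_subset[of _ "Pow {..<\<kappa>}"]) auto
    have XB: "Xs \<subseteq> (\<Union>I \<in> D. Bx I)"
    proof
      fix n assume n: "n \<in> Xs"
      let ?I = "{j. j < \<kappa> \<and> c < n j}"
      have "?I \<in> D" using few[of n] n by (auto simp: D_def Xs_def)
      moreover have "n j \<le> \<kappa> * R" if "j < \<kappa>" for j
      proof -
        have "n j \<le> (\<Sum>j<\<kappa>. n j)" using that by (intro member_le_sum) auto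
        then show ?thesis using n by (auto simp: Xs_def)
      qed
      then have "n \<in> Bx ?I" using n by (auto simp: Bx_def Xs_def S_def N_def)
      ultimately show "n \<in> (\<Union>I \<in> D. Bx I)" by blast
    qed
    have Bx: "finite (Bx I)" "card (Bx I) \<le> (\<kappa> + 1) ^ (d - 1) * (c + 1) ^ \<kappa> * (R + 1) ^ (d - 1)" if "I \<in> D" for I
    proof -
      show "finite (Bx I)" using card_vsupp_box(1)[of I \<kappa> "\<kappa> * R" c] that unfolding Bx_def D_def by simp
      have "card (Bx I) \<le> (\<kappa> * R + 1) ^ card I * (c + 1) ^ \<kappa>"
        using card_vsupp_box(2)[of I \<kappa> "\<kappa> * R" c] that unfolding Bx_def D_def by simp
      also have "\<dots> \<le> ((\<kappa> + 1) * (R + 1)) ^ (d - 1) * (c + 1) ^ \<kappa>"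
      proof (rule mult_right_mono)
        have "(\<kappa> * R + 1) ^ card I \<le> (\<kappa> * R + 1) ^ (d - 1)"
          using that by (intro power_increasing) (auto simp: D_def)
        also have "\<dots> \<le> ((\<kappa> + 1) * (R + 1)) ^ (d - 1)" by (intro power_mono) auto
        finally show "(\<kappa> * R + 1) ^ card I \<le> ((\<kappa> + 1) * (R + 1)) ^ (d - 1)" .
      qed simp
      finally show "card (Bx I) \<le> (\<kappa> + 1) ^ (d - 1) * (c + 1) ^ \<kappa> * (R + 1) ^ (d - 1)"
        by (simp only: power_mult_distrib mult_ac)
    qed
    have finXs: "finite Xs" using XB finD Bx(1) by (intro finite_subset[OF XB] finite_UN_I)
    have "card Xs \<le> card (\<Union>I \<in> D. Bx I)" using XB finD Bx(1) by (intro card_mono) auto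
    also have "\<dots> \<le> (\<Sum>I\<in>D. card (Bx I))" by (rule card_UN_le[OF finD])
    also have "\<dots> \<le> (\<Sum>I\<in>D. (\<kappa> + 1) ^ (d - 1) * (c + 1) ^ \<kappa> * (R + 1) ^ (d - 1))"
      by (intro sum_mono Bx(2))
    also have "\<dots> = card D * ((\<kappa> + 1) ^ (d - 1) * (c + 1) ^ \<kappa> * (R + 1) ^ (d - 1))" by simp
    also have "\<dots> \<le> 2 ^ \<kappa> * ((\<kappa> + 1) ^ (d - 1) * (c + 1) ^ \<kappa> * (R + 1) ^ (d - 1))"
    proof (intro mult_right_mono)
      have "card D \<le> card (Pow {..<\<kappa>})" by (intro card_mono) (auto simp: D_def)
      then show "card D \<le> 2 ^ \<kappa>" by (simp add: card_Pow)
    qed simp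
    finally have cX: "card Xs \<le> e * (R + 1) ^ (d - 1)" by (simp add: e_def mult_ac)
    \<comment> \<open>The translate of a nonstandard exponent depends on those of smaller exponents,
      whose degree is no larger, so every dependence can be pushed down into
      \<open>Xs\<close>.\<close>
    have "dep (f n) (f ` Xs)" if "n \<in> N" "(\<Sum>j<\<kappa>. n j) \<le> \<kappa> * R" for n
      using that(1)[unfolded N_def] that(2)
    proof (induction n rule: dlex_induct)
      case (less n)
      show ?case
      proof (cases "n \<in> S")
        case True
        then have "n \<in> Xs" using less.prems by (simp add: Xs_def)
        then show ?thesis by (intro dep_refl[OF _ fC] imageI)
      next
        case False
        then have dn: "dep (f n) (f ` P n)" using less.hyps by (simp add: S_def N_def)
        show ?thesis
        proof (rule dep_trans[OF _ fC fC fC1 _ dn])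
          show "finite (f ` P n)" using finP by simp
          fix K assume "K \<in> f ` P n"
          then obtain m where m: "K = f m" "m \<in> N" "dlex \<kappa> m n" by (auto simp: P_def)
          then have "(\<Sum>j<\<kappa>. m j) \<le> \<kappa> * R" using less.prems by (auto simp: dlex_def)
          then show "dep K (f ` Xs)" using less.IH[of m] m by (auto simp: N_def)
        qed
      qed
    qed
    moreover have "(\<Sum>j<\<kappa>. n j) \<le> \<kappa> * R" if "\<forall>j. n j \<le> R" for n
      using sum_bounded_above[of "{..<\<kappa>}" n R] that by simp
    ultimately show ?thesis using finXs cX by blast
  qed
  moreover have "d - 1 = \<delta>" by (simp add: d_def)
  ultimately show ?thesis unfolding f_def N_def by metis
qed

end

section \<open>Successive minima\<close>

definition zvec :: "nat \<Rightarrow> (nat \<Rightarrow> int) set" where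
  "zvec k = {a. \<forall>i\<ge>k. a i = 0}"

text \<open>The maximum norm; the inserted 0 keeps the maximum defined for
  \<open>k = 0\<close>.\<close>

definition nrm :: "nat \<Rightarrow> (nat \<Rightarrow> int) \<Rightarrow> nat" where
  "nrm k h = Max (insert 0 ((\<lambda>i. nat \<bar>h i\<bar>) ` {..<k}))"

lemma nrm_ge: "h \<in> zvec k \<Longrightarrow> \<bar>h i\<bar> \<le> int (nrm k h)"
proof (cases "i < k")
  case True
  then have "nat \<bar>h i\<bar> \<le> nrm k h" unfolding nrm_def by (intro Max_ge) auto
  then show ?thesis by simp
qed (auto simp: zvec_def)

lemma nrm_le: "(\<And>i. i < k \<Longrightarrow> \<bar>h i\<bar> \<le> int m) \<Longrightarrow> nrm k h \<le> m"
  unfolding nrm_def by (intro Max.boundedI) fastforce+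

text \<open>A positive multiple of every unit vector makes \<open>H\<close> a lattice of finite
  index. This is the form in which finite index of a good subgroup is available: powers of group
  elements lie in it.\<close>

locale full_lattice =
  fixes k :: nat and H :: "(nat \<Rightarrow> int) set"
  assumes sub: "H \<subseteq> zvec k"
    and zero: "0 \<in> H"
    and diff: "\<lbrakk>a \<in> H; b \<in> H\<rbrakk> \<Longrightarrow> a - b \<in> H"
    and full: "l < k \<Longrightarrow> \<exists>N>0. (\<lambda>i. if i = l then N else 0) \<in> H"
begin

end

text \<open>One stage of the successive minima construction: \<open>E\<close> consists of the integral vectors in the
  rational span of \<open>u 0, \<dots>, u (j - 1)\<close>, on which the pivot coordinates \<open>l 0, \<dots>, l (j - 1)\<close> control
  the norm up to the factor \<open>3 ^ j\<close>.\<close>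

locale minima_stage = full_lattice k H for k :: nat and H :: "(nat \<Rightarrow> int) set" +
  fixes j :: nat and E :: "(nat \<Rightarrow> int) set" and u :: "nat \<Rightarrow> nat \<Rightarrow> int" and l m :: "nat \<Rightarrow> nat"
  assumes E0: "0 \<in> E" and Ez: "E \<subseteq> zvec k"
    and Elin: "\<lbrakk>e \<in> E; e' \<in> E\<rbrakk> \<Longrightarrow> (\<lambda>i. a * e i + b * e' i) \<in> E"
    and Esat: "\<lbrakk>x \<in> zvec k; c \<noteq> 0; (\<lambda>i. c * x i) \<in> E\<rbrakk> \<Longrightarrow> x \<in> E"
    and linj: "inj_on l {..<j}" and lk: "l ` {..<j} \<subseteq> {..<k}"
    and Enorm: "\<lbrakk>x \<in> E; \<And>i. i < j \<Longrightarrow> \<bar>x (l i)\<bar> \<le> b; 0 \<le> b\<rbrakk> \<Longrightarrow> \<bar>x i\<bar> \<le> 3 ^ j * b"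
    and Epiv: "x \<in> zvec k \<Longrightarrow> \<exists>N e. 0 < N \<and> e \<in> E \<and> (\<forall>i<j. e (l i) = N * x (l i))"
    and Espan: "x \<in> E \<Longrightarrow> \<exists>N \<beta>. 0 < N \<and> (\<forall>i. N * x i = (\<Sum>t<j. \<beta> t * u t i))"
    and u: "t < j \<Longrightarrow> u t \<in> H \<and> u t \<noteq> 0 \<and> (\<forall>i. \<bar>u t i\<bar> \<le> int (m t)) \<and> 1 \<le> m t"
    and Esep: "\<lbrakk>x \<in> H; x \<in> E; \<And>i. i < j \<Longrightarrow> 3 ^ k * \<bar>x (l i)\<bar> < int (m i)\<rbrakk> \<Longrightarrow> x = 0"
    and Emin: "\<lbrakk>h \<in> H; h \<notin> E; i < j\<rbrakk> \<Longrightarrow> m i \<le> nrm k h"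

lemma (in full_lattice) stage_zero: "minima_stage k H 0 {0} u l m"
proof
  fix x assume "x \<in> zvec k"
  show "\<exists>N e. 0 < N \<and> e \<in> {0} \<and> (\<forall>i<0. e (l i) = N * x (l i))"
    by (intro exI[of _ 1] exI[of _ 0]) auto
qed (auto simp: zvec_def fun_eq_iff intro: exI[of _ 1])

text \<open>The next minimum is a shortest vector \<open>h\<close> of \<open>H\<close> outside
  \<open>E\<close>. Clearing the pivot coordinates of a multiple of \<open>h\<close> leaves
  \<open>w\<close>, and a coordinate where \<open>w\<close> is largest becomes the new pivot, as in
  Gaussian elimination with pivoting.\<close>

lemma (in minima_stage) stage_Suc:
  assumes j: "j < k"
  shows "\<exists>E' u' l' m'. minima_stage k H (Suc j) E' u' l' m'"
proof -
  have Escale: "(\<lambda>i. a * e i) \<in> E" if "e \<in> E" for a e using Elin[OF that that, of a 0] by simp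
  have "\<exists>q<k. q \<notin> l ` {..<j}"
  proof (rule ccontr)
    assume "\<not> ?thesis"
    then have "{..<k} \<subseteq> l ` {..<j}" by auto
    then have "k \<le> card (l ` {..<j})" using card_mono[of "l ` {..<j}" "{..<k}"] by simp
    also have "\<dots> \<le> j" using card_image_le[of "{..<j}" l] by simp
    finally show False using j by simp
  qed
  then obtain q where q: "q < k" "q \<notin> l ` {..<j}" by blast
  obtain N where N: "N > 0" "(\<lambda>i. if i = q then N else 0) \<in> H" using full[OF q(1)] by blast
  \<comment> \<open>This vector vanishes at all pivots but not at \<open>q\<close>, which
    \<open>Enorm\<close> with bound 0 excludes for elements of \<open>E\<close>. So \<open>H\<close>
    has a vector outside \<open>E\<close>.\<close>
  have "(\<lambda>i. if i = q then N else 0) \<notin> E"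
  proof
    assume "(\<lambda>i. if i = q then N else 0) \<in> E"
    moreover have "\<bar>if l i = q then N else 0\<bar> \<le> 0" if "i < j" for i using that q(2) by auto
    ultimately show False using Enorm[of _ 0 q] N(1) by fastforce
  qed
  with N(2) have ex: "(\<lambda>i. if i = q then N else 0) \<in> H - E" by blast
  obtain h where h: "h \<in> H - E" "\<And>h'. h' \<in> H - E \<Longrightarrow> nrm k h \<le> nrm k h'"
    using ex_has_least_nat[of "\<lambda>h. h \<in> H - E" _ "nrm k", OF ex] by blast
  have hz: "h \<in> zvec k" using h(1) sub by blast
  have h0: "h \<noteq> 0" using h(1) E0 by auto
  obtain N' e' where e': "0 < N'" "e' \<in> E" "\<And>i. i < j \<Longrightarrow> e' (l i) = N' * h (l i)" using Epiv[OF hz] by blast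
  define w where "w = (\<lambda>i. N' * h i - e' i)"
  have wz: "w \<in> zvec k" using hz e'(2) Ez by (auto simp: w_def zvec_def)
  have wl: "w (l i) = 0" if "i < j" for i using e'(3)[OF that] by (simp add: w_def)
  have "w \<noteq> 0"
  proof
    assume "w = 0"
    then have "(\<lambda>i. N' * h i) = e'" by (auto simp: w_def fun_eq_iff)
    then show False using Esat[OF hz, of N'] e' h(1) by auto
  qed
  then obtain r0 where r0: "w r0 \<noteq> 0" by (auto simp: fun_eq_iff)
  have wle: "\<bar>w i\<bar> \<le> int (nrm k w)" for i by (rule nrm_ge[OF wz])
  have "nrm k w \<noteq> 0" using wle[of r0] r0 by auto
  moreover have "nrm k w \<in> insert 0 ((\<lambda>i. nat \<bar>w i\<bar>) ` {..<k})"
    unfolding nrm_def by (rule Max_in) auto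
  ultimately obtain r where r: "r < k" "nrm k w = nat \<bar>w r\<bar>" by auto
  have wr: "\<bar>w i\<bar> \<le> \<bar>w r\<bar>" for i using wle[of i] r(2) by simp
  have wr0: "w r \<noteq> 0" using wr[of r0] r0 by auto
  have rl: "r \<notin> l ` {..<j}" using wl wr0 by auto
  \<comment> \<open>The integral vectors among the rational combinations of \<open>w\<close> and
    \<open>E\<close>; the denominator \<open>c\<close> makes \<open>E'\<close> saturated.\<close>
  define E' where "E' = {x \<in> zvec k. \<exists>c d e. c \<noteq> 0 \<and> e \<in> E \<and> (\<forall>i. c * x i = d * w i + e i)}"
  define u' where "u' = u(j := h)"
  define l' where "l' = l(j := r)"
  define m' where "m' = m(j := nrm k h)"
  have EE': "E \<subseteq> E'"
  proof
    fix x assume x: "x \<in> E"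
    then have "x \<in> zvec k" "\<forall>i. 1 * x i = 0 * w i + x i" using Ez by auto
    then have "\<exists>c d e. c \<noteq> 0 \<and> e \<in> E \<and> (\<forall>i. c * x i = d * w i + e i)"
      by (intro exI[of _ 1] exI[of _ 0] exI[of _ x]) (use x in simp)
    then show "x \<in> E'" unfolding E'_def using x Ez by blast
  qed
  \<comment> \<open>The origin of the factor 3. In \<open>c * x = d * w + e\<close> the part
    \<open>e\<close> is at most \<open>3 ^ j\<close> times the pivot bound of \<open>c * x\<close>,
    and \<open>d * w\<close> is largest at \<open>r\<close>, where it is at most that bound plus the
    bound for \<open>e\<close>. Together this is at most \<open>1 + 2 * 3 ^ j\<close>, hence at most
    \<open>3 ^ Suc j\<close>, times the pivot bound.\<close>
  have norm': "\<bar>x i\<bar> \<le> 3 ^ Suc j * b" if x: "x \<in> E'" "\<And>i. i < Suc j \<Longrightarrow> \<bar>x (l' i)\<bar> \<le> b" "0 \<le> b" for x b i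
  proof -
    obtain c d e where c: "c \<noteq> 0" "e \<in> E" "\<And>i. c * x i = d * w i + e i" using x(1) by (auto simp: E'_def)
    have xl: "\<bar>x (l i)\<bar> \<le> b" if "i < j" for i using x(2)[of i] that by (simp add: l'_def)
    have xr: "\<bar>x r\<bar> \<le> b" using x(2)[of j] by (simp add: l'_def)
    have "\<bar>e (l i)\<bar> \<le> \<bar>c\<bar> * b" if "i < j" for i
      using c(3)[of "l i"] wl[OF that] mult_left_mono[OF xl[OF that], of "\<bar>c\<bar>"] by (metis abs_ge_zero abs_mult add_0 mult_zero_right)
    then have el: "\<bar>e i\<bar> \<le> 3 ^ j * (\<bar>c\<bar> * b)" for i using Enorm[OF c(2)] x(3) by simp
    have dw: "\<bar>d * w i\<bar> \<le> \<bar>c\<bar> * b + 3 ^ j * (\<bar>c\<bar> * b)" for i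
    proof -
    have "\<bar>d * w i\<bar> \<le> \<bar>d * w r\<bar>" using wr by (simp add: abs_mult mult_left_mono)
    also have "d * w r = c * x r - e r" using c(3)[of r] by simp
    also have "\<bar>c * x r - e r\<bar> \<le> \<bar>c * x r\<bar> + \<bar>e r\<bar>" by (rule abs_triangle_ineq4)
    also have "\<dots> \<le> \<bar>c\<bar> * b + 3 ^ j * (\<bar>c\<bar> * b)"
      using el[of r] xr by (intro add_mono) (auto simp: abs_mult mult_left_mono)
    finally show ?thesis .
    qed
    have "\<bar>c\<bar> * \<bar>x i\<bar> = \<bar>d * w i + e i\<bar>" by (simp add: c(3)[symmetric] abs_mult)
    also have "\<dots> \<le> \<bar>d * w i\<bar> + \<bar>e i\<bar>" by (rule abs_triangle_ineq)
    also have "\<dots> \<le> \<bar>c\<bar> * b + 3 ^ j * (\<bar>c\<bar> * b) + 3 ^ j * (\<bar>c\<bar> * b)" using dw[of i] el[of i] by linarith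
    also have "\<dots> \<le> 3 ^ j * (\<bar>c\<bar> * b) + 3 ^ j * (\<bar>c\<bar> * b) + 3 ^ j * (\<bar>c\<bar> * b)"
      using mult_right_mono[of 1 "3 ^ j" "\<bar>c\<bar> * b"] x(3) by (simp only: add_right_mono mult_1 one_le_power abs_ge_zero mult_nonneg_nonneg)
    also have "\<dots> = \<bar>c\<bar> * (3 ^ Suc j * b)" by simp
    finally show ?thesis using c(1) by (simp add: mult_le_cancel_left)
  qed
  have sep': "x = 0" if x: "x \<in> H" "x \<in> E'" "\<And>i. i < Suc j \<Longrightarrow> 3 ^ k * \<bar>x (l' i)\<bar> < int (m' i)" for x
  proof -
    have mj: "m' i \<le> nrm k h" if "i < Suc j" for i
      using Emin[of h i] h(1) that by (cases "i = j") (auto simp: m'_def)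
    have "x \<in> E"
    proof (rule ccontr)
      assume "x \<notin> E"
      then have hx: "nrm k h \<le> nrm k x" using h(2) x(1) by blast
      \<comment> \<open>The largest integer with \<open>3 ^ k * b\<close> below the norm of
        \<open>h\<close>. The pivots of \<open>x\<close> are bounded by it, so \<open>norm'\<close>
        makes \<open>x\<close> shorter than \<open>h\<close>, although \<open>h\<close> is shortest
        outside \<open>E\<close>.\<close>
      define b where "b = (int (nrm k h) - 1) div 3 ^ k"
      have pos: "1 \<le> int (nrm k h)" using mj[of 0] x(3)[of 0] by (smt (verit) abs_ge_zero mult_nonneg_nonneg of_nat_mono zero_le_power zero_less_Suc)
      then have b0: "0 \<le> b" by (simp add: b_def pos_imp_zdiv_nonneg_iff)
      have xb: "\<bar>x (l' i)\<bar> \<le> b" if "i < Suc j" for i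
      proof -
        have "3 ^ k * \<bar>x (l' i)\<bar> \<le> int (nrm k h) - 1" using x(3)[OF that] mj[OF that] by linarith
        then have "(3 ^ k * \<bar>x (l' i)\<bar>) div 3 ^ k \<le> b" unfolding b_def by (rule zdiv_mono1) simp
        then show ?thesis by simp
      qed
      have "\<bar>x i\<bar> \<le> int (nrm k h - 1)" for i
      proof -
        have "\<bar>x i\<bar> \<le> 3 ^ Suc j * b" by (rule norm'[OF x(2) xb b0])
        also have "\<dots> \<le> 3 ^ k * b" using j b0 by (intro mult_right_mono power_increasing) auto
        also have "\<dots> \<le> int (nrm k h) - 1"
        proof -
          have "0 \<le> (int (nrm k h) - 1) mod 3 ^ k" by simp
          then show ?thesis using mult_div_mod_eq[of "3 ^ k" "int (nrm k h) - 1"] unfolding b_def by linarith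
        qed
        finally show ?thesis using pos by simp
      qed
      then have "nrm k x \<le> nrm k h - 1" by (intro nrm_le)
      then show False using hx pos by linarith
    qed
    then show ?thesis
    proof (rule Esep[OF x(1)])
      fix i assume "i < j"
      then show "3 ^ k * \<bar>x (l i)\<bar> < int (m i)" using x(3)[of i] by (simp add: l'_def m'_def)
    qed
  qed
  have piv': "\<exists>N e. 0 < N \<and> e \<in> E' \<and> (\<forall>i<Suc j. e (l' i) = N * x (l' i))" if x: "x \<in> zvec k" for x
  proof -
    obtain N e where e: "0 < N" "e \<in> E" "\<And>i. i < j \<Longrightarrow> e (l i) = N * x (l i)" using Epiv[OF x] by blast
    define s where "s = w r * (N * x r - e r)"
    have se: "(\<lambda>i. w r * w r * e i) \<in> E" using Escale[OF e(2), of "w r * w r"] .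
    have "(\<lambda>i. s * w i + w r * w r * e i) \<in> zvec k" using wz e(2) Ez by (auto simp: zvec_def)
    moreover have "\<exists>c d f. c \<noteq> 0 \<and> f \<in> E \<and> (\<forall>i. c * (s * w i + w r * w r * e i) = d * w i + f i)"
      by (intro exI[of _ 1] exI[of _ s] exI[of _ "\<lambda>i. w r * w r * e i"]) (use se in simp)
    ultimately have "(\<lambda>i. s * w i + w r * w r * e i) \<in> E'" unfolding E'_def by blast
    moreover have "s * w (l' i) + w r * w r * e (l' i) = (w r * w r * N) * x (l' i)" if "i < Suc j" for i
      using that wl e(3) by (cases "i = j") (auto simp: l'_def s_def algebra_simps)
    moreover have "0 < w r * w r * N" using wr0 e(1) by (simp add: zero_less_mult_iff) (metis not_less_iff_gr_or_eq)
    ultimately show ?thesis by blast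
  qed
  have span': "\<exists>N \<beta>. 0 < N \<and> (\<forall>i. N * x i = (\<Sum>t<Suc j. \<beta> t * u' t i))" if x: "x \<in> E'" for x
  proof -
    obtain c d e where c: "c \<noteq> 0" "e \<in> E" "\<And>i. c * x i = d * w i + e i" using x by (auto simp: E'_def)
    have "(\<lambda>i. 1 * e i + (- d) * e' i) \<in> E" by (rule Elin[OF c(2) e'(2)])
    then obtain N \<beta> where N: "0 < N" "\<And>i. N * (1 * e i + (- d) * e' i) = (\<Sum>t<j. \<beta> t * u t i)" using Espan by blast
    define \<gamma> where "\<gamma> = (\<lambda>t. c * (if t = j then N * d * N' else \<beta> t))"
    have "N * (c * c) * x i = (\<Sum>t<Suc j. \<gamma> t * u' t i)" for i
    proof -
      have "N * (c * c) * x i = c * (N * (c * x i))" by (simp add: mult_ac)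
      also have "c * x i = d * (N' * h i - e' i) + e i" using c(3) by (simp add: w_def)
      also have "c * (N * (d * (N' * h i - e' i) + e i)) = c * (N * (1 * e i + (- d) * e' i)) + c * (N * d * N') * h i"
        by (simp add: algebra_simps)
      also have "\<dots> = (\<Sum>t<j. c * \<beta> t * u t i) + c * (N * d * N') * h i" by (simp only: N(2)) (simp add: sum_distrib_left mult_ac)
      also have "\<dots> = (\<Sum>t<Suc j. \<gamma> t * u' t i)" by (simp add: \<gamma>_def u'_def)
      finally show ?thesis .
    qed
    moreover have "0 < N * (c * c)" using N(1) c(1) by (simp add: zero_less_mult_iff) (metis not_less_iff_gr_or_eq)
    ultimately show ?thesis by blast
  qed
  have lin': "(\<lambda>i. a * x i + b * y i) \<in> E'" if xy: "x \<in> E'" "y \<in> E'" for x y a b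
  proof -
    obtain c d e where c: "c \<noteq> 0" "e \<in> E" "\<And>i. c * x i = d * w i + e i" using xy(1) by (auto simp: E'_def)
    obtain c' d' f where c': "c' \<noteq> 0" "f \<in> E" "\<And>i. c' * y i = d' * w i + f i" using xy(2) by (auto simp: E'_def)
    have "(c * c') * (a * x i + b * y i) = (a * c' * d + b * c * d') * w i + ((a * c') * e i + (b * c) * f i)" for i
    proof -
      have "(c * c') * (a * x i + b * y i) = a * c' * (c * x i) + b * c * (c' * y i)" by (simp add: algebra_simps)
      then show ?thesis by (simp only: c(3) c'(3)) (simp add: algebra_simps)
    qed
    moreover have "(\<lambda>i. (a * c') * e i + (b * c) * f i) \<in> E" by (rule Elin[OF c(2) c'(2)])
    moreover have "(\<lambda>i. a * x i + b * y i) \<in> zvec k" using xy by (auto simp: E'_def zvec_def)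
    moreover have "c * c' \<noteq> 0" using c(1) c'(1) by simp
    ultimately show ?thesis unfolding E'_def by blast
  qed
  have sat': "x \<in> E'" if x: "x \<in> zvec k" "c \<noteq> 0" "(\<lambda>i. c * x i) \<in> E'" for x c
  proof -
    obtain c' d e where c': "c' \<noteq> 0" "e \<in> E" "\<And>i. c' * (c * x i) = d * w i + e i" using x(3) by (auto simp: E'_def)
    then have "\<exists>c d e. c \<noteq> 0 \<and> e \<in> E \<and> (\<forall>i. c * x i = d * w i + e i)"
      using x(2) by (intro exI[of _ "c' * c"] exI[of _ d] exI[of _ e]) (simp add: mult.assoc)
    then show ?thesis unfolding E'_def using x(1) by blast
  qed
  have hp: "1 \<le> nrm k h"
  proof (rule ccontr)
    assume "\<not> ?thesis"
    then have "h i = 0" for i using nrm_ge[OF hz, of i] by simp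
    then show False using h0 by (auto simp: fun_eq_iff)
  qed
  have "minima_stage k H (Suc j) E' u' l' m'"
  proof (unfold_locales; (rule norm' sep' piv' span' lin' sat'; assumption)?)
    show "0 \<in> E'" using EE' E0 by blast
    show "E' \<subseteq> zvec k" by (auto simp: E'_def)
    show "inj_on l' {..<Suc j}" using linj rl by (auto simp: l'_def inj_on_def lessThan_Suc)
    show "l' ` {..<Suc j} \<subseteq> {..<k}" using lk r(1) by (auto simp: l'_def less_Suc_eq image_subset_iff)
    fix t assume "t < Suc j"
    then show "u' t \<in> H \<and> u' t \<noteq> 0 \<and> (\<forall>i. \<bar>u' t i\<bar> \<le> int (m' t)) \<and> 1 \<le> m' t"
      using u[of t] h(1) h0 nrm_ge[OF hz] hp by (cases "t = j") (auto simp: u'_def m'_def)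
  next
    fix g i assume "g \<in> H" "g \<notin> E'" "i < Suc j"
    then show "m' i \<le> nrm k g"
      using Emin[of g i] h(2)[of g] EE' by (cases "i = j") (auto simp: m'_def)
  qed
  then show ?thesis by blast
qed

text \<open>A weak form of Minkowski's second theorem. The set \<open>A\<close> consists of pairwise incongruent vectors
  modulo \<open>H\<close>, so its cardinality bounds the index of \<open>H\<close> from below.\<close>

lemma (in full_lattice) successive_minima:
  "\<exists>u m A. (\<forall>t<k. u t \<in> H \<and> u t \<noteq> 0 \<and> (\<forall>i. \<bar>u t i\<bar> \<le> int (m t)) \<and> 1 \<le> m t) \<and>
     (\<forall>x \<in> zvec k. \<exists>N \<beta>. 0 < N \<and> (\<forall>i. N * x i = (\<Sum>t<k. \<beta> t * u t i))) \<and>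
     finite A \<and> A \<subseteq> zvec k \<and> (\<forall>a \<in> A. \<forall>b \<in> A. a \<noteq> b \<longrightarrow> a - b \<notin> H) \<and>
     (\<Prod>t<k. m t) \<le> 3 ^ (k * k) * card A"
proof -
  have "j \<le> k \<Longrightarrow> \<exists>E u l m. minima_stage k H j E u l m" for j
  proof (induction j)
    case 0 then show ?case using stage_zero by blast
  next
    case (Suc j)
    then obtain E u l m where "minima_stage k H j E u l m" by auto
    then show ?case using minima_stage.stage_Suc Suc.prems by auto
  qed
  then obtain E u l m where "minima_stage k H k E u l m" by blast
  then interpret minima_stage k H k E u l m .
  have lim: "l ` {..<k} = {..<k}" by (rule card_subset_eq[OF _ lk]) (simp_all add: card_image[OF linj])
  \<comment> \<open>After \<open>k\<close> stages every coordinate is a pivot, and \<open>E\<close>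
    consists of all integer vectors.\<close>
  have EZ: "x \<in> E" if x: "x \<in> zvec k" for x
  proof -
    obtain N e where e: "0 < N" "e \<in> E" "\<forall>i<k. e (l i) = N * x (l i)" using Epiv[OF x] by blast
    have "e i = N * x i" for i
    proof (cases "i < k")
      case True
      then obtain t where "t < k" "i = l t" using lim by (metis imageE lessThan_iff)
      then show ?thesis using e(3) by simp
    next
      case False
      then show ?thesis using x e(2) Ez by (auto simp: zvec_def)
    qed
    then have "(\<lambda>i. N * x i) \<in> E" using e(2) by (metis ext)
    then show ?thesis using Esat[OF x, of N] e(1) by simp
  qed
  \<comment> \<open>The quotient of \<open>m t\<close> by \<open>3 ^ k\<close>, rounded up: two
    natural numbers below \<open>L t\<close> differ by less than \<open>m t / 3 ^ k\<close>, so
    \<open>Esep\<close> keeps the vectors with such pivot entries incongruent modulo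
    \<open>H\<close>. Rounding down could leave no vectors at all.\<close>
  define L where "L t = (m t + 3 ^ k - 1) div 3 ^ k" for t
  have L: "3 ^ k * b < m t" if "b < L t" for b t
  proof -
    have "Suc b * 3 ^ k \<le> L t * 3 ^ k" using that by (intro mult_right_mono) auto
    also have "\<dots> \<le> m t + 3 ^ k - 1" unfolding L_def by (rule div_times_less_eq_dividend)
    finally have "3 ^ k * b + 3 ^ k \<le> m t + 3 ^ k - 1" by (simp add: algebra_simps)
    moreover have "(0::nat) < 3 ^ k" by simp
    ultimately show ?thesis by linarith
  qed
  have L': "m t \<le> 3 ^ k * L t" for t
  proof -
    have "m t + 3 ^ k - 1 = L t * 3 ^ k + (m t + 3 ^ k - 1) mod 3 ^ k"
      unfolding L_def by (rule div_mult_mod_eq[symmetric])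
    moreover have "(m t + 3 ^ k - 1) mod 3 ^ k < 3 ^ k" by simp
    ultimately have "m t \<le> L t * 3 ^ k" by linarith
    then show ?thesis by (simp only: mult.commute)
  qed
  define P where "P = PiE {..<k} (\<lambda>t. {..<L t})"
  define li where "li = inv_into {..<k} l"
  define vec where "vec g = (\<lambda>i. if i < k then int (g (li i)) else 0)" for g :: "nat \<Rightarrow> nat"
  have vl: "vec g (l t) = int (g t)" if "t < k" for g t
    using that lk linj by (auto simp: vec_def li_def inv_into_f_f)
  have finP: "finite P" unfolding P_def by (intro finite_PiE) auto
  have injv: "inj_on vec P"
  proof (rule inj_onI)
    fix g h assume gh: "g \<in> P" "h \<in> P" "vec g = vec h"
    show "g = h"
    proof (rule PiE_ext[OF gh(1,2)[unfolded P_def]])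
      fix t assume "t \<in> {..<k}"
      then show "g t = h t" using vl[of t g] vl[of t h] gh(3) by simp
    qed
  qed
  have sep: "g = h" if gh: "g \<in> P" "h \<in> P" "vec g - vec h \<in> H" for g h
  proof -
    have "vec g - vec h \<in> E" using gh(3) sub EZ by blast
    moreover have "3 ^ k * \<bar>(vec g - vec h) (l t)\<bar> < int (m t)" if t: "t < k" for t
    proof -
      have "g t < L t" "h t < L t" using gh(1,2) t by (auto simp: P_def)
      then have "3 ^ k * g t < m t" "3 ^ k * h t < m t" using L by auto
      then have gt: "3 ^ k * int (g t) < int (m t)" "3 ^ k * int (h t) < int (m t)"
        by (metis of_nat_less_iff of_nat_mult of_nat_numeral of_nat_power)+
      have "\<bar>(vec g - vec h) (l t)\<bar> = int (g t) - int (h t) \<or> \<bar>(vec g - vec h) (l t)\<bar> = int (h t) - int (g t)"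
        using vl[OF t] by (auto simp: abs_if)
      then have "\<bar>(vec g - vec h) (l t)\<bar> \<le> int (g t) \<or> \<bar>(vec g - vec h) (l t)\<bar> \<le> int (h t)" by linarith
      then have "3 ^ k * \<bar>(vec g - vec h) (l t)\<bar> \<le> 3 ^ k * int (g t) \<or> 3 ^ k * \<bar>(vec g - vec h) (l t)\<bar> \<le> 3 ^ k * int (h t)"
        by (simp add: mult_left_mono)
      then show ?thesis using gt by linarith
    qed
    ultimately have "vec g - vec h = 0" by (intro Esep[OF gh(3)])
    then have "vec g = vec h" by simp
    then show ?thesis using injv gh(1,2) by (auto simp: inj_on_def)
  qed
  have "(\<Prod>t<k. m t) \<le> (\<Prod>t<k. 3 ^ k * L t)" using L' by (intro prod_mono) auto
  also have "\<dots> = 3 ^ (k * k) * (\<Prod>t<k. L t)" by (simp add: prod.distrib power_mult)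
  also have "(\<Prod>t<k. L t) = card (vec ` P)" unfolding card_image[OF injv] by (simp add: P_def card_PiE)
  finally have "(\<Prod>t<k. m t) \<le> 3 ^ (k * k) * card (vec ` P)" .
  moreover have "finite (vec ` P)" "vec ` P \<subseteq> zvec k" using finP by (auto simp: vec_def zvec_def)
  moreover have "\<forall>a \<in> vec ` P. \<forall>b \<in> vec ` P. a \<noteq> b \<longrightarrow> a - b \<notin> H" using sep by blast
  moreover have "\<forall>t<k. u t \<in> H \<and> u t \<noteq> 0 \<and> (\<forall>i. \<bar>u t i\<bar> \<le> int (m t)) \<and> 1 \<le> m t" using u by blast
  moreover have "\<forall>x \<in> zvec k. \<exists>N \<beta>. 0 < N \<and> (\<forall>i. N * x i = (\<Sum>t<k. \<beta> t * u t i))"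
    using Espan EZ by blast
  ultimately show ?thesis by blast
qed

section \<open>Short vectors\<close>

lemma vsupp_empty: "vsupp {} = {0}"
  by (auto simp: vsupp_def fun_eq_iff)

text \<open>Exact counts, in contrast to the estimate \<open>card_vsupp_box\<close>, because they
  provide lower bounds for ranks.\<close>

lemma vsupp_cube:
  assumes "finite J"
  shows "finite {n \<in> vsupp J. \<forall>j \<in> J. n j \<le> A j}"
    and "card {n \<in> vsupp J. \<forall>j \<in> J. n j \<le> A j} = (\<Prod>j\<in>J. A j + 1)"
proof -
  let ?S = "{n \<in> vsupp J. \<forall>j \<in> J. n j \<le> A j}"
  let ?P = "PiE J (\<lambda>j. {..A j})"
  have bij: "bij_betw (\<lambda>n. restrict n J) ?S ?P"
  proof (rule bij_betwI')
    fix x y assume "x \<in> ?S" "y \<in> ?S"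
    then show "restrict x J = restrict y J \<longleftrightarrow> x = y"
      using inj_on_restrict_vsupp[of J] by (auto simp: inj_on_def)
  next
    fix x assume "x \<in> ?S"
    then show "restrict x J \<in> ?P" by (auto split: if_splits)
  next
    fix y assume y: "y \<in> ?P"
    let ?x = "\<lambda>j. if j \<in> J then y j else 0"
    have "?x \<in> ?S" using y by (auto simp: vsupp_def)
    moreover have "y = restrict ?x J" using y by (auto simp: fun_eq_iff PiE_def extensional_def)
    ultimately show "\<exists>x \<in> ?S. y = restrict x J" by blast
  qed
  show "finite ?S" using bij_betw_finite[OF bij] assms by (simp add: finite_PiE)
  show "card ?S = (\<Prod>j\<in>J. A j + 1)" using bij_betw_same_card[OF bij] assms by (simp add: card_PiE)
qed

definition unit_vec :: "nat \<Rightarrow> nat \<Rightarrow> int" where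
  "unit_vec j = (\<lambda>i. if i = j then 1 else 0)"

lemma comb_unit: "comb k unit_vec n = (\<lambda>i. if i < k then int (n i) else 0)"
  by (auto simp: comb_def unit_vec_def fun_eq_iff if_distrib cong: if_cong)

lemma zvec_add: "a \<in> zvec k \<Longrightarrow> b \<in> zvec k \<Longrightarrow> a + b \<in> zvec k"
  by (auto simp: zvec_def)

lemma finite_bounded:
  assumes "finite F" "F \<subseteq> zvec k"
  obtains r :: nat where "\<And>a i. a \<in> F \<Longrightarrow> \<bar>a i\<bar> \<le> int r"
proof
  fix a i assume a: "a \<in> F"
  have "nrm k a \<le> (\<Sum>a\<in>F. nrm k a)" using assms a by (intro member_le_sum) auto
  then show "\<bar>a i\<bar> \<le> int (\<Sum>a\<in>F. nrm k a)" using nrm_ge[of a k i] assms a by (meson of_nat_mono order_trans subsetD)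
qed

context full_lattice
begin

lemma scale_mem: assumes "a \<in> H" shows "(\<lambda>i. z * a i) \<in> H"
proof -
  have neg: "- b \<in> H" if "b \<in> H" for b using diff[OF zero that] by simp
  have add: "b + c \<in> H" if "b \<in> H" "c \<in> H" for b c using diff[OF that(1) neg[OF that(2)]] by simp
  have nat: "(\<lambda>i. int n * a i) \<in> H" for n
  proof (induction n)
    case 0 then show ?case using zero by (simp add: zero_fun_def)
  next
    case (Suc n)
    have "(\<lambda>i. int (Suc n) * a i) = (\<lambda>i. int n * a i) + a" by (auto simp: algebra_simps)
    then show ?case using add[OF Suc assms] by simp
  qed
  show ?thesis
  proof (cases "0 \<le> z")
    case True then show ?thesis using nat[of "nat z"] by simp
  next
    case False
    then have "(\<lambda>i. z * a i) = - (\<lambda>i. int (nat (- z)) * a i)" by auto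
    then show ?thesis using neg[OF nat[of "nat (- z)"]] by metis
  qed
qed

lemma sum_mem:
  assumes "\<And>j. j < n \<Longrightarrow> u j \<in> H" shows "(\<lambda>i. \<Sum>j<(n::nat). z j * u j i) \<in> H"
  using assms
proof (induction n)
  case 0 then show ?case using zero by (simp add: zero_fun_def)
next
  case (Suc n)
  have "(\<lambda>i. \<Sum>j<Suc n. z j * u j i) = (\<lambda>i. \<Sum>j<n. z j * u j i) - (\<lambda>i. - z n * u n i)" by auto
  moreover have "(\<lambda>i. \<Sum>j<n. z j * u j i) \<in> H" "(\<lambda>i. - z n * u n i) \<in> H"
    using Suc scale_mem[of "u n" "- z n"] by auto
  ultimately show ?case using diff by metis
qed

end

text \<open>The denominators of the unit vectors are multiplied into one \<open>M\<close>. The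
  coefficients obtained are linear in \<open>b\<close>, hence bounded by a fixed multiple of its
  norm, and \<open>spanned_lattice\<close> relies on this.\<close>

lemma spanning_multiple:
  assumes "\<And>x. x \<in> zvec k \<Longrightarrow> \<exists>N \<beta>. 0 < N \<and> (\<forall>i. N * x i = (\<Sum>t<k. \<beta> t * u t i))"
  shows "\<exists>M \<gamma>. (0::int) < M \<and> (\<forall>b \<in> zvec k. \<forall>i. M * b i = (\<Sum>t<k. (\<Sum>l<k. b l * \<gamma> l t) * u t i))"
proof -
  have "\<forall>l. \<exists>N \<beta>. l < k \<longrightarrow> 0 < N \<and> (\<forall>i. N * unit_vec l i = (\<Sum>t<k. \<beta> t * u t i))"
    using assms[of "unit_vec _"] by (auto simp: zvec_def unit_vec_def)
  then obtain N \<beta> where N: "\<And>l. l < k \<Longrightarrow> 0 < N l"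
      "\<And>l i. l < k \<Longrightarrow> N l * unit_vec l i = (\<Sum>t<k. \<beta> l t * u t i)" by metis
  define M where "M = (\<Prod>l<k. N l)"
  define \<gamma> where "\<gamma> l t = (\<Prod>l'\<in>{..<k} - {l}. N l') * \<beta> l t" for l t
  have g: "M * unit_vec l i = (\<Sum>t<k. \<gamma> l t * u t i)" if "l < k" for l i
  proof -
    have "M * unit_vec l i = (\<Prod>l'\<in>{..<k} - {l}. N l') * (N l * unit_vec l i)"
      using that by (simp add: M_def prod.remove[of "{..<k}" l] mult_ac)
    also have "\<dots> = (\<Sum>t<k. \<gamma> l t * u t i)"
      by (simp only: N(2)[OF that] sum_distrib_left \<gamma>_def mult.assoc)
    finally show ?thesis .
  qed
  have "M * b i = (\<Sum>t<k. (\<Sum>l<k. b l * \<gamma> l t) * u t i)" if b: "b \<in> zvec k" for b i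
  proof -
    have "b i = (\<Sum>l<k. b l * unit_vec l i)"
      using b by (auto simp: unit_vec_def zvec_def if_distrib cong: if_cong)
    then have "M * b i = (\<Sum>l<k. b l * (M * unit_vec l i))" by (simp add: sum_distrib_left mult_ac)
    also have "\<dots> = (\<Sum>l<k. b l * (\<Sum>t<k. \<gamma> l t * u t i))" using g by (intro sum.cong) auto
    also have "\<dots> = (\<Sum>l<k. \<Sum>t<k. b l * \<gamma> l t * u t i)" by (simp add: sum_distrib_left mult_ac)
    also have "\<dots> = (\<Sum>t<k. \<Sum>l<k. b l * \<gamma> l t * u t i)" by (rule sum.swap)
    finally show ?thesis by (simp add: sum_distrib_right)
  qed
  moreover have "0 < M" unfolding M_def using N(1) by (intro prod_pos) auto
  ultimately show ?thesis by blast
qed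

section \<open>Comparison of ranks over cubes\<close>

context translated_dependence
begin

text \<open>An upper bound \<open>n\<close> for the rank of the translates of \<open>K\<close> over
  the cube of radius \<open>R\<close>; the spanning set may consist of arbitrary elements of
  \<open>C\<close>.\<close>

definition spanned :: "nat \<Rightarrow> 'k \<Rightarrow> nat \<Rightarrow> nat \<Rightarrow> bool" where
  "spanned k K R n \<longleftrightarrow> (\<exists>B. finite B \<and> B \<subseteq> C \<and> card B \<le> n \<and>
     (\<forall>a \<in> zvec k. (\<forall>i. \<bar>a i\<bar> \<le> int R) \<longrightarrow> dep (T K a) B))"

text \<open>If \<open>K\<close> depends on translates of \<open>V\<close> by vectors of norm at most
  \<open>\<rho>\<close>, then its translates over a cube depend on those of \<open>V\<close> over
  the cube enlarged by \<open>\<rho>\<close>. This is the only cost of exchanging one element of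
  \<open>C\<close> for another.\<close>

lemma findep_card_spanned:
  assumes "K \<in> C" "V \<in> C" and F: "finite F" "F \<subseteq> zvec k" "dep K (T V ` F)" "\<And>a i. a \<in> F \<Longrightarrow> \<bar>a i\<bar> \<le> int \<rho>"
    and Y: "findep K Y" "finite Y" "Y \<subseteq> zvec k" "\<And>a i. a \<in> Y \<Longrightarrow> \<bar>a i\<bar> \<le> int R"
    and sp: "spanned k V (R + \<rho>) n"
  shows "card Y \<le> n"
proof -
  obtain B where B: "finite B" "B \<subseteq> C" "card B \<le> n"
      "\<And>a. a \<in> zvec k \<Longrightarrow> (\<forall>i. \<bar>a i\<bar> \<le> int (R + \<rho>)) \<Longrightarrow> dep (T V a) B"
    using sp unfolding spanned_def by blast
  have "dep (T K a) B" if a: "a \<in> Y" for a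
  proof (rule dep_trans)
    have "dep (T K 0) (T V ` F)" using F(3) T_zero[OF assms(1)] by simp
    from dep_shift[OF assms(1,2) this, of a]
    show "dep (T K a) (T V ` ((\<lambda>y. y + a) ` F))" by simp
    fix L assume "L \<in> T V ` ((\<lambda>y. y + a) ` F)"
    then obtain y where y: "y \<in> F" "L = T V (y + a)" by blast
    have "\<bar>(y + a) i\<bar> \<le> int (R + \<rho>)" for i using F(4)[OF y(1), of i] Y(4)[OF a, of i] by simp
    moreover have "y + a \<in> zvec k" using y(1) a F(2) Y(3) zvec_add by blast
    ultimately show "dep L B" using B(4) y(2) by simp
  qed (use F(1) B(2) T_image[OF assms(2)] T_closed[OF assms(1)] in auto)
  then have "card Y \<le> card B" by (rule findep_card[OF assms(1) Y(1,2) B(1,2)])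
  then show ?thesis using B(3) by linarith
qed

text \<open>\<open>growth_bound\<close> concerns nonnegative exponents; the shift by
  \<open>- R\<close> in every coordinate turns its box of side \<open>2 * R\<close> into the cube of
  radius \<open>R\<close>.\<close>

lemma spanned_unit:
  assumes V: "V \<in> C" and nf: "\<And>J. J \<subseteq> {..<k} \<Longrightarrow> card J = Suc \<delta> \<Longrightarrow> \<not> free k unit_vec V J"
  shows "\<exists>c. \<forall>R. spanned k V R (c * (2 * R + 1) ^ \<delta>)"
proof -
  obtain c where c: "\<And>R. \<exists>Xs. finite Xs \<and> card Xs \<le> c * (R + 1) ^ \<delta> \<and>
    (\<forall>n \<in> vsupp {..<k}. (\<forall>j. n j \<le> R) \<longrightarrow> dep (T V (comb k unit_vec n)) ((\<lambda>n. T V (comb k unit_vec n)) ` Xs))"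
    using growth_bound[OF V nf] by blast
  have "spanned k V R (c * (2 * R + 1) ^ \<delta>)" for R
  proof -
    obtain Xs where Xs: "finite Xs" "card Xs \<le> c * (2 * R + 1) ^ \<delta>"
      "\<And>n. n \<in> vsupp {..<k} \<Longrightarrow> (\<forall>j. n j \<le> 2 * R) \<Longrightarrow> dep (T V (comb k unit_vec n)) (T V ` (comb k unit_vec ` Xs))"
      using c[of "2 * R"] unfolding image_image by blast
    define s :: "nat \<Rightarrow> int" where "s = (\<lambda>i. if i < k then - int R else 0)"
    let ?B = "T V ` ((\<lambda>y. y + s) ` (comb k unit_vec ` Xs))"
    have "dep (T V a) ?B" if a: "a \<in> zvec k" "\<forall>i. \<bar>a i\<bar> \<le> int R" for a
    proof -
      define n where "n = (\<lambda>i. if i < k then nat (a i + int R) else 0)"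
      have ar: "- int R \<le> a i" "a i \<le> int R" for i using a(2)[rule_format, of i] by linarith+
      have "n \<in> vsupp {..<k}" by (simp add: n_def vsupp_def)
      moreover have "n j \<le> 2 * R" for j using ar(2)[of j] by (simp add: n_def nat_le_iff)
      ultimately have "dep (T V (comb k unit_vec n)) (T V ` (comb k unit_vec ` Xs))" using Xs(3) by blast
      from dep_shift[OF V V this, of s]
      have "dep (T V (comb k unit_vec n + s)) ?B" .
      moreover have "comb k unit_vec n + s = a"
      proof
        fix i
        show "(comb k unit_vec n + s) i = a i"
          using a(1) ar(1)[of i] by (cases "i < k") (simp_all add: comb_unit s_def n_def zvec_def)
      qed
      ultimately show ?thesis by simp
    qed
    moreover have "card ?B \<le> card Xs"
      by (meson Xs(1) card_image_le finite_imageI order_trans)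
    ultimately show ?thesis
      unfolding spanned_def using Xs(1,2) T_image[OF V] by (intro exI[of _ ?B]) auto
  qed
  then show ?thesis by blast
qed

text \<open>Growth along spanning lattice vectors governs growth over all integer vectors: each
  vector is \<open>M * q + s\<close> with \<open>s\<close> from a finite set of residues, and
  \<open>M * q\<close> is a combination of the \<open>u t\<close> with coefficients bounded by a
  multiple of \<open>R\<close>.\<close>

lemma spanned_lattice:
  assumes K: "K \<in> C" and nf: "\<And>J. J \<subseteq> {..<k} \<Longrightarrow> card J = Suc \<delta> \<Longrightarrow> \<not> free k u K J"
    and span: "\<And>x. x \<in> zvec k \<Longrightarrow> \<exists>N \<beta>. 0 < N \<and> (\<forall>i. N * x i = (\<Sum>t<k. \<beta> t * u t i))"
  shows "\<exists>c. \<forall>R. spanned k K R (c * (R + 1) ^ \<delta>)"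
proof -
  obtain c where c: "\<And>R. \<exists>Xs. finite Xs \<and> card Xs \<le> c * (R + 1) ^ \<delta> \<and>
    (\<forall>n \<in> vsupp {..<k}. (\<forall>j. n j \<le> R) \<longrightarrow> dep (T K (comb k u n)) ((\<lambda>n. T K (comb k u n)) ` Xs))"
    using growth_bound[OF K nf] by blast
  obtain M \<gamma> where M: "(0::int) < M" "\<And>b i. b \<in> zvec k \<Longrightarrow> M * b i = (\<Sum>t<k. (\<Sum>l<k. b l * \<gamma> l t) * u t i)"
    using spanning_multiple[OF span] by blast
  define G where "G = (\<Sum>t<k. \<Sum>l<k. nat \<bar>\<gamma> l t\<bar>)"
  define S where "S = {s \<in> zvec k. \<forall>i<k. s i \<in> {0..<M}}"
  have finS: "finite S"
  proof (rule inj_on_finite[of "\<lambda>n. restrict n {..<k}" _ "PiE {..<k} (\<lambda>_. {0..<M})"])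
    show "inj_on (\<lambda>n. restrict n {..<k}) S"
    proof (rule inj_onI, rule ext)
      fix x y i assume "x \<in> S" "y \<in> S" "restrict x {..<k} = restrict y {..<k}"
      then show "x i = y i" by (cases "i < k") (auto simp: S_def zvec_def dest: fun_cong[where x = i])
    qed
  qed (auto intro: finite_PiE simp: S_def split: if_splits)
  have "spanned k K R (card S * c * (2 * G + 1) ^ \<delta> * (R + 1) ^ \<delta>)" for R
  proof -
    define R' where "R' = G * R"
    obtain Xs where Xs: "finite Xs" "card Xs \<le> c * (2 * R' + 1) ^ \<delta>"
      "\<And>n. n \<in> vsupp {..<k} \<Longrightarrow> (\<forall>j. n j \<le> 2 * R') \<Longrightarrow> dep (T K (comb k u n)) (T K ` (comb k u ` Xs))"
      using c[of "2 * R'"] unfolding image_image by blast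
    \<comment> \<open>Adding \<open>R'\<close> to every coefficient makes it a natural number, as
      \<open>comb\<close> requires; subtracting \<open>w\<close> undoes this.\<close>
    define w where "w = comb k u (\<lambda>_. R')"
    define B where "B = (\<Union>s \<in> S. T K ` ((\<lambda>y. y + (s - w)) ` (comb k u ` Xs)))"
    have BC: "B \<subseteq> C" using T_image[OF K] by (auto simp: B_def)
    have finB: "finite B" using finS Xs(1) by (simp add: B_def)
    have "dep (T K b) B" if b: "b \<in> zvec k" "\<forall>i. \<bar>b i\<bar> \<le> int R" for b
    proof -
      define q where "q = (\<lambda>i. b i div M)"
      define s where "s = (\<lambda>i. b i mod M)"
      have qz: "q \<in> zvec k" using b(1) by (auto simp: q_def zvec_def)
      have sS: "s \<in> S" using b(1) M(1) by (auto simp: s_def S_def zvec_def)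
      have bs: "b i = M * q i + s i" for i by (simp add: q_def s_def)
      define a where "a t = (\<Sum>l<k. q l * \<gamma> l t)" for t
      have q_le: "\<bar>q l\<bar> \<le> int R" for l
      proof -
        have "- int R \<le> b l" "b l \<le> int R" using b(2)[rule_format, of l] by linarith+
        then have "(- int R) div M \<le> q l" "q l \<le> int R div M" unfolding q_def using M(1) by (auto intro: zdiv_mono1)
        moreover have "int R div M \<le> int R"
        proof -
          have "int R div M \<le> (int R * M) div M" using M(1)
            by (intro zdiv_mono1) (auto simp: mult_le_cancel_left1)
          then show ?thesis using M(1) by simp
        qed
        moreover have "- int R \<le> (- int R) div M"
        proof -
          have "(- int R * M) div M \<le> (- int R) div M" using M(1)
            by (intro zdiv_mono1) (auto simp: mult_le_cancel_left1)
          moreover have "(- int R * M) div M = - int R"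
            using M(1) by (intro nonzero_mult_div_cancel_right) auto
          ultimately show ?thesis by linarith
        qed
        ultimately show ?thesis by linarith
      qed
      have a_le: "\<bar>a t\<bar> \<le> int R'" if "t < k" for t
      proof -
        have "\<bar>a t\<bar> \<le> (\<Sum>l<k. \<bar>q l * \<gamma> l t\<bar>)" unfolding a_def by (rule sum_abs)
        also have "\<dots> \<le> (\<Sum>l<k. int (nat \<bar>\<gamma> l t\<bar>) * int R)"
        proof (rule sum_mono)
          fix l
          show "\<bar>q l * \<gamma> l t\<bar> \<le> int (nat \<bar>\<gamma> l t\<bar>) * int R"
            using mult_right_mono[OF q_le[of l], of "\<bar>\<gamma> l t\<bar>"] by (simp add: abs_mult mult.commute)
        qed
        also have "\<dots> = int ((\<Sum>l<k. nat \<bar>\<gamma> l t\<bar>) * R)" by (simp add: sum_distrib_right)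
        also have "\<dots> \<le> int R'"
        proof -
          have "(\<Sum>l<k. nat \<bar>\<gamma> l t\<bar>) \<le> G" unfolding G_def using that
            by (intro member_le_sum[of t "{..<k}" "\<lambda>t. \<Sum>l<k. nat \<bar>\<gamma> l t\<bar>"]) auto
          then show ?thesis unfolding R'_def by (intro of_nat_mono mult_right_mono) auto
        qed
        finally show ?thesis .
      qed
      define n where "n = (\<lambda>t. if t < k then nat (a t + int R') else 0)"
      have "n \<in> vsupp {..<k}" by (simp add: n_def vsupp_def)
      moreover have "n t \<le> 2 * R'" for t using a_le[of t] by (auto simp: n_def)
      ultimately have "dep (T K (comb k u n)) (T K ` (comb k u ` Xs))" using Xs(3) by blast
      from dep_shift[OF K K this, of "s - w"]
      have "dep (T K (comb k u n + (s - w))) B"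
        by (rule dep_mono[OF _ _ BC]) (unfold B_def, rule UN_upper[OF sS])
      moreover have "comb k u n + (s - w) = b"
      proof
        fix i
        have "comb k u n i = (\<Sum>t<k. (a t + int R') * u t i)"
          unfolding comb_def
        proof (rule sum.cong)
          fix t assume "t \<in> {..<k}"
          then have "int (n t) = a t + int R'" using a_le[of t] by (simp add: n_def)
          then show "int (n t) * u t i = (a t + int R') * u t i" by simp
        qed simp
        also have "\<dots> = M * q i + w i" using M(2)[OF qz, of i]
          by (simp add: a_def w_def comb_def distrib_right sum.distrib)
        finally show "(comb k u n + (s - w)) i = b i" using bs[of i] by simp
      qed
      ultimately show ?thesis by simp
    qed
    moreover have "card B \<le> card S * c * (2 * G + 1) ^ \<delta> * (R + 1) ^ \<delta>"
    proof -
      have "card B \<le> (\<Sum>s\<in>S. card (T K ` ((\<lambda>y. y + (s - w)) ` (comb k u ` Xs))))"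
        unfolding B_def by (rule card_UN_le[OF finS])
      also have "\<dots> \<le> (\<Sum>s\<in>S. card Xs)"
        by (intro sum_mono) (meson Xs(1) card_image_le finite_imageI order_trans)
      also have "\<dots> = card S * card Xs" by simp
      also have "\<dots> \<le> card S * (c * ((2 * G + 1) * (R + 1)) ^ \<delta>)"
      proof (intro mult_left_mono order_trans[OF Xs(2)] power_mono)
        show "2 * R' + 1 \<le> (2 * G + 1) * (R + 1)" by (simp add: R'_def algebra_simps)
      qed auto
      finally show ?thesis by (simp only: power_mult_distrib mult.assoc)
    qed
    ultimately show ?thesis unfolding spanned_def using finB BC by blast
  qed
  then show ?thesis by blast
qed

text \<open>What the matroid sees of an induced module: when \<open>K\<close> lies in a module that
  induces \<open>M\<close> from the subgroup with lattice \<open>H\<close>, translates in distinct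
  cosets lie in independent summands.\<close>

definition coset_split :: "nat \<Rightarrow> 'k \<Rightarrow> (nat \<Rightarrow> int) set \<Rightarrow> bool" where
  "coset_split k K H \<longleftrightarrow> (\<forall>A Y. finite A \<longrightarrow> A \<subseteq> zvec k \<longrightarrow> (\<forall>a \<in> A. \<forall>b \<in> A. a \<noteq> b \<longrightarrow> a - b \<notin> H) \<longrightarrow>
     finite Y \<longrightarrow> Y \<subseteq> H \<longrightarrow> findep K Y \<longrightarrow> findep K ((\<lambda>(y, a). y + a) ` (Y \<times> A)))"

text \<open>Let \<open>\<delta>\<close> be the growth exponent of the translates of \<open>V\<close>. The lattice \<open>H\<close> contains \<open>\<delta>\<close> free
  directions, and comparing the growth within \<open>H\<close>, multiplied by the index of \<open>H\<close>, with the growth of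
  all translates bounds the product of the remaining successive minima of \<open>H\<close>.\<close>

theorem short_vector:
  assumes V: "V \<in> C" and nfV: "\<not> free k unit_vec V {..<k}"
    and conn: "\<And>K K'. K \<in> C \<Longrightarrow> K' \<in> C \<Longrightarrow> \<exists>F. finite F \<and> F \<subseteq> zvec k \<and> dep K (T K' ` F)"
  shows "\<exists>c::nat. \<forall>H K. full_lattice k H \<longrightarrow> K \<in> C \<longrightarrow> coset_split k K H \<longrightarrow>
    (\<exists>x \<in> H. x \<noteq> 0 \<and> (\<forall>i. \<bar>x i\<bar> \<le> int c))"
proof -
  have "free k unit_vec V {}"
    unfolding free_def
  proof (intro allI impI)
    fix Y n assume "Y \<subseteq> vsupp {}" "n \<in> Y"
    then have e: "Y - {n} = {}" unfolding vsupp_empty by auto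
    show "\<not> dep (T V (comb k unit_vec n)) ((\<lambda>n. T V (comb k unit_vec n)) ` (Y - {n}))"
      unfolding e image_empty by (rule dep_empty[OF T_closed[OF V]])
  qed
  then have ex: "(\<lambda>J. J \<subseteq> {..<k} \<and> free k unit_vec V J) {}" by simp
  have le: "\<forall>J. J \<subseteq> {..<k} \<and> free k unit_vec V J \<longrightarrow> card J < Suc k"
    using card_mono[of "{..<k}"] by (auto simp: less_Suc_eq_le)
  \<comment> \<open>The size \<open>\<delta>\<close> of a largest free set of unit directions is the
    growth exponent of \<open>V\<close>, and it is below \<open>k\<close> by assumption.\<close>
  then obtain J0 where J0: "J0 \<subseteq> {..<k}" "free k unit_vec V J0"
      "\<And>J. J \<subseteq> {..<k} \<Longrightarrow> free k unit_vec V J \<Longrightarrow> card J \<le> card J0"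
    using ex_has_greatest_nat[where P = "\<lambda>J. J \<subseteq> {..<k} \<and> free k unit_vec V J" and f = card, OF ex le] by blast
  define \<delta> where "\<delta> = card J0"
  have finJ0: "finite J0" using J0(1) finite_subset by blast
  have \<delta>k: "\<delta> < k"
  proof -
    have "J0 \<noteq> {..<k}" using J0(2) nfV by auto
    then show ?thesis using J0(1) psubset_card_mono[of "{..<k}" J0] by (auto simp: \<delta>_def)
  qed
  have nf: "\<not> free k unit_vec V J" if "J \<subseteq> {..<k}" "card J = Suc \<delta>" for J
    using J0(3)[of J] that by (auto simp: \<delta>_def)
  obtain c1 where c1: "\<And>R. spanned k V R (c1 * (2 * R + 1) ^ \<delta>)" using spanned_unit[OF V nf] by blast
  \<comment> \<open>Only \<open>k\<close> and \<open>V\<close> enter this constant, so it serves all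
    \<open>H\<close> and \<open>K\<close> alike.\<close>
  define c where "c = 3 ^ (k * k) * (c1 * (2 * \<delta> + 1) ^ \<delta>)"
  have "\<exists>x \<in> H. x \<noteq> 0 \<and> (\<forall>i. \<bar>x i\<bar> \<le> int c)" if H: "full_lattice k H" and K: "K \<in> C" and split: "coset_split k K H" for H K
  proof -
    interpret full_lattice k H by fact
    obtain u m A where u': "\<forall>t<k. u t \<in> H \<and> u t \<noteq> 0 \<and> (\<forall>i. \<bar>u t i\<bar> \<le> int (m t)) \<and> 1 \<le> m t"
      and span': "\<forall>x \<in> zvec k. \<exists>N \<beta>. 0 < N \<and> (\<forall>i. N * x i = (\<Sum>t<k. \<beta> t * u t i))"
      and A: "finite A" "A \<subseteq> zvec k" "\<forall>a \<in> A. \<forall>b \<in> A. a \<noteq> b \<longrightarrow> a - b \<notin> H"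
        "(\<Prod>t<k. m t) \<le> 3 ^ (k * k) * card A"
      using successive_minima by (elim exE conjE)
    have u: "u t \<in> H \<and> u t \<noteq> 0 \<and> (\<forall>i. \<bar>u t i\<bar> \<le> int (m t)) \<and> 1 \<le> m t" if "t < k" for t
      using u' that by simp
    have span: "\<exists>N \<beta>. 0 < N \<and> (\<forall>i. N * x i = (\<Sum>t<k. \<beta> t * u t i))" if "x \<in> zvec k" for x
      by (rule bspec[OF span' that])
    obtain F where F: "finite F" "F \<subseteq> zvec k" "dep K (T V ` F)" using conn[OF K V] by blast
    obtain F' where F': "finite F'" "F' \<subseteq> zvec k" "dep V (T K ` F')" using conn[OF V K] by blast
    obtain \<rho> where \<rho>: "\<And>a i. a \<in> F \<Longrightarrow> \<bar>a i\<bar> \<le> int \<rho>" using finite_bounded[OF F(1,2)] by blast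
    obtain \<rho>' where \<rho>': "\<And>a i. a \<in> F' \<Longrightarrow> \<bar>a i\<bar> \<le> int \<rho>'" using finite_bounded[OF F'(1,2)] by blast
    obtain \<alpha> where \<alpha>: "\<And>a i. a \<in> A \<Longrightarrow> \<bar>a i\<bar> \<le> int \<alpha>" using finite_bounded[OF A(1,2)] by blast
    \<comment> \<open>At least \<open>\<delta>\<close> of the minima are free directions for
      \<open>K\<close>: otherwise the translates of \<open>K\<close> would grow with a smaller
      exponent, too slowly for the translates of \<open>V\<close>, which depend on them.\<close>
    have "\<exists>J \<subseteq> {..<k}. card J = \<delta> \<and> free k u K J"
    proof (cases \<delta>)
      case 0
      have "free k u K {}"
        unfolding free_def
      proof (intro allI impI)
        fix Y n assume "Y \<subseteq> vsupp {}" "n \<in> Y"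
        then have e: "Y - {n} = {}" unfolding vsupp_empty by auto
        show "\<not> dep (T K (comb k u n)) ((\<lambda>n. T K (comb k u n)) ` (Y - {n}))"
          unfolding e image_empty by (rule dep_empty[OF T_closed[OF K]])
      qed
      then show ?thesis using 0 by (intro exI[of _ "{}"]) auto
    next
      case (Suc \<epsilon>)
      show ?thesis
      proof (rule ccontr)
        assume "\<not> ?thesis"
        then have "\<And>J. J \<subseteq> {..<k} \<Longrightarrow> card J = Suc \<epsilon> \<Longrightarrow> \<not> free k u K J" using Suc by auto
        from spanned_lattice[OF K this span]
        obtain c3 where c3: "\<And>R. spanned k K R (c3 * (R + 1) ^ \<epsilon>)" by blast
        \<comment> \<open>Chosen so that \<open>c3 * ((\<rho>' + 1) * (R + 1)) ^ \<epsilon>\<close>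
          equals \<open>R * (R + 1) ^ \<epsilon>\<close>, which is just below
          \<open>(R + 1) ^ \<delta>\<close>.\<close>
        define R where "R = c3 * (\<rho>' + 1) ^ \<epsilon>"
        define Q where "Q = {n \<in> vsupp J0. \<forall>j \<in> J0. n j \<le> R}"
        have finQ: "finite Q" and cQ: "card Q = (R + 1) ^ \<delta>"
          using vsupp_cube[OF finJ0, of "\<lambda>_. R"] by (auto simp: Q_def \<delta>_def)
        have fd: "findep V (comb k unit_vec ` Q)" and inj: "inj_on (comb k unit_vec) Q"
          using free_findep[OF V J0(2) finQ] by (auto simp: Q_def)
        have "card (comb k unit_vec ` Q) \<le> c3 * (R + \<rho>' + 1) ^ \<epsilon>"
        proof (rule findep_card_spanned[where R = R and \<rho> = \<rho>', OF V K F'])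
          show "spanned k K (R + \<rho>') (c3 * (R + \<rho>' + 1) ^ \<epsilon>)" by (rule c3)
          show "findep V (comb k unit_vec ` Q)" by (rule fd)
          show "\<bar>a i\<bar> \<le> int \<rho>'" if "a \<in> F'" for a i by (rule \<rho>'[OF that])
        next
          fix a i assume "a \<in> comb k unit_vec ` Q"
          then obtain n where "n \<in> Q" "a = comb k unit_vec n" by blast
          then show "\<bar>a i\<bar> \<le> int R" by (cases "i \<in> J0") (auto simp: comb_unit Q_def vsupp_def)
        qed (use finQ in \<open>auto simp: comb_unit zvec_def\<close>)
        also have "\<dots> \<le> c3 * ((\<rho>' + 1) * (R + 1)) ^ \<epsilon>"
          by (intro mult_left_mono power_mono) auto
        also have "\<dots> = R * (R + 1) ^ \<epsilon>" by (simp only: R_def power_mult_distrib mult.assoc)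
        also have "\<dots> < (R + 1) ^ \<delta>" by (simp add: Suc)
        finally show False using cQ by (simp add: card_image[OF inj])
      qed
    qed
    then obtain J where J: "J \<subseteq> {..<k}" "card J = \<delta>" "free k u K J" by blast
    have finJ: "finite J" using J(1) finite_subset by blast
    define P where "P = (\<Prod>j\<in>J. m j)"
    have mpos: "1 \<le> m j" if "j \<in> J" for j using u J(1) that by auto
    have Ppos: "1 \<le> P" unfolding P_def using mpos by (intro prod_ge_1) auto
    \<comment> \<open>Large enough for the offsets \<open>\<alpha>\<close> and
      \<open>\<rho>\<close>, which depend on \<open>H\<close> and \<open>K\<close>, to be swallowed
      by the size \<open>t * P\<close> of the box.\<close>
    define t where "t = 2 * \<alpha> + 2 * \<rho> + 1"
    \<comment> \<open>Sides inversely proportional to the minima, so that \<open>a j * m j\<close>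
      is \<open>t * P\<close> for every \<open>j\<close>: the box has at least
      \<open>(t * P) ^ \<delta> / P\<close> points, and its combinations have norm at most
      \<open>\<delta> * (t * P)\<close>.\<close>
    define a where "a j = t * (P div m j)" for j
    have am: "a j * m j = t * P" if "j \<in> J" for j
    proof -
      have "m j dvd P" unfolding P_def using finJ that by (rule dvd_prodI)
      then show ?thesis by (simp add: a_def)
    qed
    define Q where "Q = {n \<in> vsupp J. \<forall>j \<in> J. n j \<le> a j}"
    define Y where "Y = comb k u ` Q"
    have finQ: "finite Q" and cQ: "card Q = (\<Prod>j\<in>J. a j + 1)"
      using vsupp_cube[OF finJ, of a] by (auto simp: Q_def)
    have fdY: "findep K Y" and inj: "inj_on (comb k u) Q"
      using free_findep[OF K J(3) finQ] by (auto simp: Q_def Y_def)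
    have YH: "Y \<subseteq> H" unfolding Y_def comb_def using sum_mem[of k u] u by auto
    have finY: "finite Y" using finQ by (simp add: Y_def)
    define Z where "Z = (\<lambda>(y, a). y + a) ` (Y \<times> A)"
    have fdZ: "findep K Z" using split A(1-3) finY YH fdY unfolding coset_split_def Z_def by blast
    have injZ: "inj_on (\<lambda>(y, a). y + a) (Y \<times> A)"
    proof (rule inj_onI, clarify)
      fix y b y' b' assume *: "y \<in> Y" "b \<in> A" "y' \<in> Y" "b' \<in> A" "y + b = y' + b'"
      then have "b - b' = y' - y" by (metis add_diff_cancel_left add_diff_cancel_right diff_add_eq_diff_diff_swap add.commute diff_diff_eq2)
      then have "b - b' \<in> H" using diff * YH by auto
      then have "b = b'" using A(3) * by blast
      then show "y = y' \<and> b = b'" using *(5) by simp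
    qed
    have cZ: "card Z = card Q * card A"
      by (simp add: Z_def card_image[OF injZ] card_cartesian_product) (simp add: Y_def card_image[OF inj])
    have "card Z \<le> c1 * (2 * (\<delta> * (t * P) + \<alpha> + \<rho>) + 1) ^ \<delta>"
    proof (rule findep_card_spanned[where R = "\<delta> * (t * P) + \<alpha>" and \<rho> = \<rho>, OF K V F])
      show "spanned k V (\<delta> * (t * P) + \<alpha> + \<rho>) (c1 * (2 * (\<delta> * (t * P) + \<alpha> + \<rho>) + 1) ^ \<delta>)" by (rule c1)
      show "findep K Z" by (rule fdZ)
      show "\<bar>a i\<bar> \<le> int \<rho>" if "a \<in> F" for a i by (rule \<rho>[OF that])
      show "finite Z" using finY A(1) by (simp add: Z_def)
      show "Z \<subseteq> zvec k" using YH sub A(2) by (auto simp: Z_def intro!: zvec_add)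
      fix z i assume "z \<in> Z"
      then obtain n b where n: "n \<in> Q" "b \<in> A" "z = comb k u n + b" by (auto simp: Z_def Y_def)
      have "\<bar>comb k u n i\<bar> \<le> (\<Sum>j<k. \<bar>int (n j) * u j i\<bar>)" unfolding comb_def by (rule sum_abs)
      also have "\<dots> = (\<Sum>j\<in>J. \<bar>int (n j) * u j i\<bar>)"
        using J(1) n(1) by (intro sum.mono_neutral_right) (auto simp: Q_def vsupp_def)
      also have "\<dots> \<le> (\<Sum>j\<in>J. int (t * P))"
      proof (rule sum_mono)
        fix j assume j: "j \<in> J"
        have "\<bar>int (n j) * u j i\<bar> \<le> int (a j) * int (m j)"
          unfolding abs_mult using n(1) u[of j] j J(1) by (intro mult_mono) (auto simp: Q_def)
        then show "\<bar>int (n j) * u j i\<bar> \<le> int (t * P)" using am[OF j] by (metis of_nat_mult)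
      qed
      also have "\<dots> = int (\<delta> * (t * P))" using J(2) by simp
      finally show "\<bar>z i\<bar> \<le> int (\<delta> * (t * P) + \<alpha>)" using \<alpha>[OF n(2), of i] n(3) by simp
    qed
    also have "\<dots> \<le> c1 * ((2 * \<delta> + 1) * (t * P)) ^ \<delta>"
    proof (intro mult_left_mono power_mono)
      have "t \<le> t * P" using Ppos by simp
      moreover have "2 * (\<delta> * (t * P) + \<alpha> + \<rho>) + 1 = 2 * (\<delta> * (t * P)) + t" by (simp add: t_def)
      ultimately show "2 * (\<delta> * (t * P) + \<alpha> + \<rho>) + 1 \<le> (2 * \<delta> + 1) * (t * P)" by (simp add: distrib_right)
    qed auto
    finally have Zle: "card Q * card A \<le> c1 * (2 * \<delta> + 1) ^ \<delta> * (t * P) ^ \<delta>" by (simp only: cZ power_mult_distrib mult.assoc)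
    \<comment> \<open>Cancelling \<open>(t * P) ^ \<delta>\<close> removes the size of the box and
      bounds the number of cosets in \<open>A\<close> by the minima in the free directions, up to a
      constant.\<close>
    have "(t * P) ^ \<delta> = (\<Prod>j\<in>J. a j * m j)" using am J(2) by simp
    also have "\<dots> = (\<Prod>j\<in>J. a j) * P" by (simp add: prod.distrib P_def)
    also have "\<dots> \<le> card Q * P" unfolding cQ by (intro mult_right_mono prod_mono) auto
    finally have "(t * P) ^ \<delta> * card A \<le> card Q * P * card A" by (intro mult_right_mono) auto
    also have "\<dots> = P * (card Q * card A)" by (simp only: mult_ac)
    also have "\<dots> \<le> P * (c1 * (2 * \<delta> + 1) ^ \<delta> * (t * P) ^ \<delta>)" using Zle by (intro mult_left_mono) auto
    finally have "(t * P) ^ \<delta> * card A \<le> (t * P) ^ \<delta> * (P * (c1 * (2 * \<delta> + 1) ^ \<delta>))" by (simp only: mult_ac)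
    moreover have "0 < (t * P) ^ \<delta>" using Ppos by (auto simp: t_def)
    ultimately have cA: "card A \<le> P * (c1 * (2 * \<delta> + 1) ^ \<delta>)" by (metis mult_le_cancel1)
    \<comment> \<open>Cancelling the minima in the free directions bounds the product of the others.
      There is at least one other, as \<open>\<delta> < k\<close>, and since all are at least 1,
      each is bounded.\<close>
    have "P * (\<Prod>j\<in>{..<k} - J. m j) = (\<Prod>j<k. m j)"
      unfolding P_def using prod.subset_diff[OF J(1), of m] by (simp add: mult.commute)
    also have "\<dots> \<le> 3 ^ (k * k) * (P * (c1 * (2 * \<delta> + 1) ^ \<delta>))"
      using A(4) cA by (meson mult_le_mono2 order_trans)
    also have "\<dots> = P * c" by (simp only: c_def mult_ac)
    finally have le: "(\<Prod>j\<in>{..<k} - J. m j) \<le> c" using Ppos by (simp add: mult_le_cancel1)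
    have "{..<k} - J \<noteq> {}"
    proof
      assume "{..<k} - J = {}"
      then have "J = {..<k}" using J(1) by blast
      then show False using J(2) \<delta>k by simp
    qed
    then obtain j where j: "j < k" "j \<notin> J" by blast
    have "(\<Prod>j\<in>{..<k} - J. m j) = m j * (\<Prod>j\<in>{..<k} - J - {j}. m j)" using j by (intro prod.remove) auto
    moreover have "1 \<le> (\<Prod>j\<in>{..<k} - J - {j}. m j)" using u by (intro prod_ge_1) auto
    ultimately have "m j \<le> c" using le by (metis le_trans mult_le_mono2 mult.right_neutral)
    then have "\<bar>u j i\<bar> \<le> int c" for i using u[OF j(1)] by (meson of_nat_mono order_trans)
    then show ?thesis using u[OF j(1)] by blast
  qed
  then show ?thesis by blast
qed

end

section \<open>Modules with operators and critical submodules\<close>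

text \<open>Additive inverses come from the operators: \<open>Om\<close> is assumed below to contain
  one that acts as negation.\<close>

definition opsub :: "('m, 'c) ring_scheme \<Rightarrow> ('m \<Rightarrow> 'g \<Rightarrow> 'm) \<Rightarrow> ('m \<Rightarrow> 'm) set \<Rightarrow> 'g set \<Rightarrow> 'm set \<Rightarrow> bool" where
  "opsub M act Om L W \<longleftrightarrow> W \<subseteq> carrier M \<and> \<zero>\<^bsub>M\<^esub> \<in> W \<and> (\<forall>x \<in> W. \<forall>y \<in> W. x \<oplus>\<^bsub>M\<^esub> y \<in> W) \<and>
     (\<forall>x \<in> W. \<forall>\<omega> \<in> Om. \<omega> x \<in> W) \<and> (\<forall>x \<in> W. \<forall>l \<in> L. act x l \<in> W)"

text \<open>Adding one element at a time allows induction without index sets. As the carrier of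
  \<open>M\<close> does not occur, sums formed in a submodule agree with those formed in
  \<open>M\<close>.\<close>

inductive_set msum :: "('m, 'c) ring_scheme \<Rightarrow> 'm set set \<Rightarrow> 'm set"
  for M :: "('m, 'c) ring_scheme" and S :: "'m set set" where
  zero: "\<zero>\<^bsub>M\<^esub> \<in> msum M S"
| step: "\<lbrakk>Z \<in> S; x \<in> Z; y \<in> msum M S\<rbrakk> \<Longrightarrow> add M x y \<in> msum M S"

definition tr :: "('m \<Rightarrow> 'g \<Rightarrow> 'm) \<Rightarrow> 'm set \<Rightarrow> 'g \<Rightarrow> 'm set" where
  "tr act W g = (\<lambda>w. act w g) ` W"

definition normalizes :: "('g, 'b) monoid_scheme \<Rightarrow> 'g \<Rightarrow> 'g set \<Rightarrow> bool" where
  "normalizes G x N \<longleftrightarrow> (\<forall>n \<in> N. x \<otimes>\<^bsub>G\<^esub> n \<otimes>\<^bsub>G\<^esub> inv\<^bsub>G\<^esub> x \<in> N \<and> inv\<^bsub>G\<^esub> x \<otimes>\<^bsub>G\<^esub> n \<otimes>\<^bsub>G\<^esub> x \<in> N)"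

text \<open>The operators \<open>Om\<close> stand for the scalars of the field, and the last axiom is all that is needed from
  its being a field.\<close>

locale opmod = G?: group G + M?: abelian_group M
  for G :: "('g, 'b) monoid_scheme" (structure) and M :: "('m, 'c) ring_scheme" (structure) +
  fixes act :: "'m \<Rightarrow> 'g \<Rightarrow> 'm" and Om :: "('m \<Rightarrow> 'm) set"
  assumes act_closed: "\<lbrakk>m \<in> carrier M; g \<in> carrier G\<rbrakk> \<Longrightarrow> act m g \<in> carrier M"
    and act_add: "\<lbrakk>m \<in> carrier M; n \<in> carrier M; g \<in> carrier G\<rbrakk> \<Longrightarrow> act (m \<oplus>\<^bsub>M\<^esub> n) g = act m g \<oplus>\<^bsub>M\<^esub> act n g"
    and act_act: "\<lbrakk>m \<in> carrier M; g \<in> carrier G; h \<in> carrier G\<rbrakk> \<Longrightarrow> act (act m g) h = act m (g \<otimes> h)"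
    and act_one: "m \<in> carrier M \<Longrightarrow> act m \<one> = m"
    and om_closed: "\<lbrakk>\<omega> \<in> Om; m \<in> carrier M\<rbrakk> \<Longrightarrow> \<omega> m \<in> carrier M"
    and om_add: "\<lbrakk>\<omega> \<in> Om; m \<in> carrier M; n \<in> carrier M\<rbrakk> \<Longrightarrow> \<omega> (m \<oplus>\<^bsub>M\<^esub> n) = \<omega> m \<oplus>\<^bsub>M\<^esub> \<omega> n"
    and om_act: "\<lbrakk>\<omega> \<in> Om; m \<in> carrier M; g \<in> carrier G\<rbrakk> \<Longrightarrow> \<omega> (act m g) = act (\<omega> m) g"
    and om_neg: "\<exists>\<omega> \<in> Om. \<forall>m \<in> carrier M. \<omega> m = \<ominus>\<^bsub>M\<^esub> m"
    and line: "a \<in> carrier M \<Longrightarrow> \<exists>V. opsub M act Om {\<one>} V \<and> a \<in> V \<and>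
      (\<forall>W. opsub M act Om {\<one>} W \<longrightarrow> W \<subseteq> V \<longrightarrow> W = {\<zero>\<^bsub>M\<^esub>} \<or> W = V)"
begin

abbreviation "sub \<equiv> opsub M act Om"
abbreviation "sumof \<equiv> msum M"
abbreviation "tra \<equiv> tr act"

lemma subD:
  assumes "sub L W"
  shows "W \<subseteq> carrier M" "\<zero>\<^bsub>M\<^esub> \<in> W" "\<And>x y. x \<in> W \<Longrightarrow> y \<in> W \<Longrightarrow> x \<oplus>\<^bsub>M\<^esub> y \<in> W"
    "\<And>x \<omega>. x \<in> W \<Longrightarrow> \<omega> \<in> Om \<Longrightarrow> \<omega> x \<in> W" "\<And>x l. x \<in> W \<Longrightarrow> l \<in> L \<Longrightarrow> act x l \<in> W"
  using assms by (auto simp: opsub_def)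

lemma sub_carrier: "sub L W \<Longrightarrow> x \<in> W \<Longrightarrow> x \<in> carrier M"
  using subD(1) by blast

lemma sub_neg: "sub L W \<Longrightarrow> x \<in> W \<Longrightarrow> \<ominus>\<^bsub>M\<^esub> x \<in> W"
  using om_neg subD(4) sub_carrier by metis

lemma sub_minus: "sub L W \<Longrightarrow> x \<in> W \<Longrightarrow> y \<in> W \<Longrightarrow> x \<ominus>\<^bsub>M\<^esub> y \<in> W"
  using subD(3) sub_neg by (simp add: M.minus_eq)

lemma sub_mono: "sub L W \<Longrightarrow> L' \<subseteq> L \<Longrightarrow> sub L' W"
  by (auto simp: opsub_def)

lemma sub_Int: "sub L W \<Longrightarrow> sub L W' \<Longrightarrow> sub L (W \<inter> W')"
  by (auto simp: opsub_def)

lemma om_zero: "\<omega> \<in> Om \<Longrightarrow> \<omega> \<zero>\<^bsub>M\<^esub> = \<zero>\<^bsub>M\<^esub>"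
  using om_add[of \<omega> "\<zero>\<^bsub>M\<^esub>" "\<zero>\<^bsub>M\<^esub>"] om_closed[of \<omega> "\<zero>\<^bsub>M\<^esub>"] by (simp add: M.add.l_cancel_one)

lemma act_zero: "g \<in> carrier G \<Longrightarrow> act \<zero>\<^bsub>M\<^esub> g = \<zero>\<^bsub>M\<^esub>"
  using act_add[of "\<zero>\<^bsub>M\<^esub>" "\<zero>\<^bsub>M\<^esub>" g] act_closed[of "\<zero>\<^bsub>M\<^esub>" g] by (simp add: M.add.l_cancel_one)

lemma act_inv: "m \<in> carrier M \<Longrightarrow> g \<in> carrier G \<Longrightarrow> act (act m g) (inv g) = m"
  "m \<in> carrier M \<Longrightarrow> g \<in> carrier G \<Longrightarrow> act (act m (inv g)) g = m"
  by (simp_all add: act_act act_one)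

lemma act_eq_zero: "m \<in> carrier M \<Longrightarrow> g \<in> carrier G \<Longrightarrow> act m g = \<zero>\<^bsub>M\<^esub> \<longleftrightarrow> m = \<zero>\<^bsub>M\<^esub>"
  using act_inv(1)[of m g] act_zero by (metis G.inv_closed)

lemma sub_zero: "L \<subseteq> carrier G \<Longrightarrow> sub L {\<zero>\<^bsub>M\<^esub>}"
  by (auto simp: opsub_def om_zero act_zero)

lemma sub_full: "L \<subseteq> carrier G \<Longrightarrow> sub L (carrier M)"
  by (auto simp: opsub_def act_closed om_closed)

lemma add_minus_cancel:
  "\<lbrakk>x \<in> carrier M; y \<in> carrier M\<rbrakk> \<Longrightarrow> (x \<oplus>\<^bsub>M\<^esub> y) \<oplus>\<^bsub>M\<^esub> \<ominus>\<^bsub>M\<^esub> y = x"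
  "\<lbrakk>x \<in> carrier M; y \<in> carrier M\<rbrakk> \<Longrightarrow> (x \<oplus>\<^bsub>M\<^esub> \<ominus>\<^bsub>M\<^esub> y) \<oplus>\<^bsub>M\<^esub> y = x"
  by (simp_all add: M.a_assoc M.l_neg M.r_neg)

lemma sumof_mono: "S \<subseteq> S' \<Longrightarrow> sumof S \<subseteq> sumof S'"
proof
  fix x assume "x \<in> sumof S" "S \<subseteq> S'"
  then show "x \<in> sumof S'" by (induction) (auto intro: msum.intros)
qed

lemma sumof_carrier:
  assumes "\<And>Z. Z \<in> S \<Longrightarrow> Z \<subseteq> carrier M" "x \<in> sumof S"
  shows "x \<in> carrier M"
  using assms(2)
proof induction
  case (step Z x y)
  then show ?case using assms(1)[OF step(1)] by auto
qed simp

lemma sumof_incl: "Z \<in> S \<Longrightarrow> Z \<subseteq> carrier M \<Longrightarrow> Z \<subseteq> sumof S"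
  using msum.step[OF _ _ msum.zero, of Z S _ M] by (auto simp: subset_iff)

lemma sumof_least:
  assumes "sub L W" "\<And>Z. Z \<in> S \<Longrightarrow> Z \<subseteq> W" shows "sumof S \<subseteq> W"
proof
  fix x assume "x \<in> sumof S"
  then show "x \<in> W"
  proof induction
    case (step Z x y)
    then show ?case using subD(3)[OF assms(1)] assms(2)[OF step(1)] by blast
  qed (rule subD(2)[OF assms(1)])
qed

lemma sumof_add:
  assumes "\<And>Z. Z \<in> S \<Longrightarrow> Z \<subseteq> carrier M" "x \<in> sumof S" "y \<in> sumof S"
  shows "x \<oplus>\<^bsub>M\<^esub> y \<in> sumof S"
  using assms(2)
proof induction
  case zero
  have "y \<in> carrier M" by (rule sumof_carrier[OF assms(1,3)])
  then show ?case using assms(3) by simp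
next
  case (step Z a b)
  then have "a \<in> carrier M" "b \<in> carrier M" "y \<in> carrier M" using assms sumof_carrier by blast+
  then show ?case using step msum.step[of Z S a "b \<oplus>\<^bsub>M\<^esub> y" M] by (simp add: M.a_assoc)
qed

lemma sumof_sub:
  assumes "\<And>Z. Z \<in> S \<Longrightarrow> sub L Z" "L \<subseteq> carrier G"
  shows "sub L (sumof S)"
proof -
  have c: "Z \<subseteq> carrier M" if "Z \<in> S" for Z using assms(1)[OF that] subD(1) by blast
  have "\<omega> x \<in> sumof S" if "x \<in> sumof S" "\<omega> \<in> Om" for x \<omega>
    using that(1)
  proof induction
    case zero then show ?case using that(2) by (simp add: om_zero msum.zero)
  next
    case (step Z x y)
    then have "x \<in> carrier M" "y \<in> carrier M" using c sumof_carrier by blast+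
    then show ?case using step that(2) subD(4)[OF assms(1)] by (auto simp: om_add intro: msum.step)
  qed
  moreover have "act x l \<in> sumof S" if "x \<in> sumof S" "l \<in> L" for x l
    using that(1)
  proof induction
    case zero then show ?case using that(2) assms(2) by (simp add: act_zero msum.zero subset_iff)
  next
    case (step Z x y)
    then have "x \<in> carrier M" "y \<in> carrier M" using c sumof_carrier by blast+
    then show ?case using step that(2) subD(5)[OF assms(1)] assms(2) by (auto simp: act_add subset_iff intro: msum.step)
  qed
  ultimately show ?thesis
    using sumof_carrier[OF c] sumof_add[OF c] by (auto simp: opsub_def msum.zero)
qed

lemma sumof_empty: "sumof {} = {\<zero>\<^bsub>M\<^esub>}"
  by (auto elim: msum.cases intro: msum.zero)

lemma sumof_Un:
  assumes "\<And>Z. Z \<in> S \<union> S' \<Longrightarrow> Z \<subseteq> carrier M" "z \<in> sumof (S \<union> S')"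
  shows "\<exists>x \<in> sumof S. \<exists>y \<in> sumof S'. z = x \<oplus>\<^bsub>M\<^esub> y"
  using assms(2)
proof induction
  case zero
  then show ?case using msum.zero by (intro bexI[of _ "\<zero>\<^bsub>M\<^esub>"]) auto
next
  case (step Z a b)
  then obtain x y where xy: "x \<in> sumof S" "y \<in> sumof S'" "b = x \<oplus>\<^bsub>M\<^esub> y" by blast
  have c: "a \<in> carrier M" "x \<in> carrier M" "y \<in> carrier M"
    using assms(1) step(1,2) sumof_carrier[of S] sumof_carrier[of S'] xy(1,2) by blast+
  show ?case
  proof (cases "Z \<in> S")
    case True
    then have "a \<oplus>\<^bsub>M\<^esub> x \<in> sumof S" using step xy by (auto intro: msum.step)
    then show ?thesis using xy c by (intro bexI[of _ "a \<oplus>\<^bsub>M\<^esub> x"] bexI[of _ y]) (auto simp: M.a_assoc)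
  next
    case False
    then have "a \<oplus>\<^bsub>M\<^esub> y \<in> sumof S'" using step xy by (auto intro: msum.step)
    then show ?thesis using xy c by (intro bexI[of _ x] bexI[of _ "a \<oplus>\<^bsub>M\<^esub> y"]) (auto simp: M.a_lcomm)
  qed
qed

lemma sumof_single: assumes "sub L Z" shows "sumof {Z} = Z"
  using sumof_least[OF assms, of "{Z}"] sumof_incl[of Z "{Z}"] subD(1)[OF assms] by auto

lemma sumof_insert:
  assumes "sub L Z" "\<And>Y. Y \<in> S \<Longrightarrow> Y \<subseteq> carrier M" "z \<in> sumof (insert Z S)"
  shows "\<exists>x \<in> Z. \<exists>y \<in> sumof S. z = x \<oplus>\<^bsub>M\<^esub> y"
  using sumof_Un[of "{Z}" S z] assms subD(1)[OF assms(1)] sumof_single[OF assms(1)] by auto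

lemma sumof_finite:
  assumes "z \<in> sumof S" shows "\<exists>S'. finite S' \<and> S' \<subseteq> S \<and> z \<in> sumof S'"
  using assms
proof induction
  case zero
  show ?case by (intro exI[of _ "{}"]) (auto intro: msum.zero)
next
  case (step Z x y)
  then obtain S' where S': "finite S'" "S' \<subseteq> S" "y \<in> sumof S'" by blast
  then have "y \<in> sumof (insert Z S')" using sumof_mono[of S' "insert Z S'"] by blast
  then have "x \<oplus>\<^bsub>M\<^esub> y \<in> sumof (insert Z S')" using step by (auto intro: msum.step)
  then show ?case using S' step(1) by (intro exI[of _ "insert Z S'"]) auto
qed

lemma tr_carrier: "W \<subseteq> carrier M \<Longrightarrow> g \<in> carrier G \<Longrightarrow> tra W g \<subseteq> carrier M"
  by (auto simp: tr_def act_closed)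

lemma tr_tr: "W \<subseteq> carrier M \<Longrightarrow> g \<in> carrier G \<Longrightarrow> h \<in> carrier G \<Longrightarrow> tra (tra W g) h = tra W (g \<otimes> h)"
  by (auto simp: tr_def image_image act_act subset_iff)

lemma tr_one: "W \<subseteq> carrier M \<Longrightarrow> tra W \<one> = W"
  by (auto simp: tr_def act_one image_iff subset_iff)

lemma mem_tr_iff: "W \<subseteq> carrier M \<Longrightarrow> g \<in> carrier G \<Longrightarrow> x \<in> carrier M \<Longrightarrow> x \<in> tra W g \<longleftrightarrow> act x (inv g) \<in> W"
  by (auto simp: tr_def act_inv subset_iff image_iff intro: bexI[of _ "act x (inv g)"])

lemma normalizes_conj:
  assumes "normalizes G x L" "x \<in> carrier G" "L \<subseteq> carrier G" "l \<in> L"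
  shows "\<exists>l' \<in> L. l \<otimes> x = x \<otimes> l'" "\<exists>l' \<in> L. x \<otimes> l = l' \<otimes> x"
proof -
  have l: "l \<in> carrier G" using assms by blast
  have "l \<otimes> x = x \<otimes> (inv x \<otimes> l \<otimes> x)"
    using l assms(2) by (simp add: G.m_assoc[symmetric])
  then show "\<exists>l' \<in> L. l \<otimes> x = x \<otimes> l'" using assms by (auto simp: normalizes_def)
  have "x \<otimes> l = (x \<otimes> l \<otimes> inv x) \<otimes> x"
    using l assms(2) by (simp add: G.m_assoc)
  then show "\<exists>l' \<in> L. x \<otimes> l = l' \<otimes> x" using assms by (auto simp: normalizes_def)
qed

lemma sub_tr:
  assumes "sub L W" "g \<in> carrier G" "normalizes G g L" "L \<subseteq> carrier G"
  shows "sub L (tra W g)"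
proof -
  note W = subD[OF assms(1)]
  have "act (act x g) l \<in> tra W g" if x: "x \<in> W" and l: "l \<in> L" for x l
  proof -
    obtain l' where l': "l' \<in> L" "g \<otimes> l = l' \<otimes> g" using normalizes_conj(2)[OF assms(3,2,4) l] by blast
    have "x \<in> carrier M" "l \<in> carrier G" "l' \<in> carrier G" using x l l'(1) W(1) assms(4) by auto
    then have "act (act x g) l = act (act x l') g" using l'(2) assms(2) by (simp add: act_act)
    then show ?thesis using W(5)[OF x l'(1)] by (auto simp: tr_def)
  qed
  moreover have "act x g \<oplus>\<^bsub>M\<^esub> act y g \<in> tra W g" if "x \<in> W" "y \<in> W" for x y
    using act_add[of x y g] W(1,3) that assms(2) by (auto simp: tr_def subset_iff intro: image_eqI[of _ _ "x \<oplus>\<^bsub>M\<^esub> y"])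
  moreover have "\<omega> (act x g) \<in> tra W g" if "x \<in> W" "\<omega> \<in> Om" for x \<omega>
    using om_act[of \<omega> x g] W(1,4) that assms(2) by (auto simp: tr_def subset_iff)
  moreover have "\<zero>\<^bsub>M\<^esub> \<in> tra W g" using act_zero[OF assms(2)] W(2) by (metis image_eqI tr_def)
  ultimately show ?thesis using tr_carrier[OF W(1) assms(2)] by (auto simp: opsub_def tr_def)
qed

lemma tr_sumof:
  assumes "\<And>Z. Z \<in> S \<Longrightarrow> Z \<subseteq> carrier M" "g \<in> carrier G"
  shows "tra (sumof S) g = sumof ((\<lambda>Z. tra Z g) ` S)"
proof (intro equalityI subsetI)
  fix z assume "z \<in> tra (sumof S) g"
  then obtain x where x: "x \<in> sumof S" "z = act x g" by (auto simp: tr_def)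
  have "act x g \<in> sumof ((\<lambda>Z. tra Z g) ` S)" using x(1)
  proof induction
    case zero then show ?case by (simp add: act_zero assms(2) msum.zero)
  next
    case (step Z x y)
    then have "x \<in> carrier M" "y \<in> carrier M" using assms(1) sumof_carrier by blast+
    then have "act (x \<oplus>\<^bsub>M\<^esub> y) g = act x g \<oplus>\<^bsub>M\<^esub> act y g" using assms(2) by (simp add: act_add)
    moreover have "act x g \<in> tra Z g" using step by (auto simp: tr_def)
    ultimately show ?case using step msum.step[of "tra Z g" "(\<lambda>Z. tra Z g) ` S"] by simp
  qed
  then show "z \<in> sumof ((\<lambda>Z. tra Z g) ` S)" using x by simp
next
  fix z assume "z \<in> sumof ((\<lambda>Z. tra Z g) ` S)"
  then show "z \<in> tra (sumof S) g"
  proof induction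
    case zero then show ?case using act_zero[OF assms(2)] msum.zero by (metis image_eqI tr_def)
  next
    case (step Y x y)
    then obtain Z a b where ab: "Z \<in> S" "a \<in> Z" "x = act a g" "b \<in> sumof S" "y = act b g" by (auto simp: tr_def)
    then have "a \<in> carrier M" "b \<in> carrier M" using assms(1) sumof_carrier by blast+
    then have "x \<oplus>\<^bsub>M\<^esub> y = act (a \<oplus>\<^bsub>M\<^esub> b) g" using ab assms(2) by (simp add: act_add)
    moreover have "a \<oplus>\<^bsub>M\<^esub> b \<in> sumof S" using ab by (auto intro: msum.step)
    ultimately show ?case by (auto simp: tr_def)
  qed
qed

lemma tr_Int_zero:
  assumes "A \<subseteq> carrier M" "B \<subseteq> carrier M" "\<zero>\<^bsub>M\<^esub> \<in> A" "\<zero>\<^bsub>M\<^esub> \<in> B" "g \<in> carrier G"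
  shows "tra A g \<inter> tra B g = {\<zero>\<^bsub>M\<^esub>} \<longleftrightarrow> A \<inter> B = {\<zero>\<^bsub>M\<^esub>}"
proof -
  have "tra A g \<inter> tra B g = tra (A \<inter> B) g"
  proof
    show "tra A g \<inter> tra B g \<subseteq> tra (A \<inter> B) g"
    proof
      fix z assume "z \<in> tra A g \<inter> tra B g"
      then obtain a b where ab: "a \<in> A" "b \<in> B" "z = act a g" "z = act b g" by (auto simp: tr_def)
      have "a = act (act a g) (inv g)" "b = act (act b g) (inv g)"
        using ab(1,2) assms by (auto simp: act_inv subset_iff)
      then have "a = b" using ab(3,4) by simp
      then show "z \<in> tra (A \<inter> B) g" using ab by (auto simp: tr_def)
    qed
  qed (auto simp: tr_def)
  moreover have "tra (A \<inter> B) g = {\<zero>\<^bsub>M\<^esub>} \<longleftrightarrow> A \<inter> B = {\<zero>\<^bsub>M\<^esub>}"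
  proof -
    have "act x g = \<zero>\<^bsub>M\<^esub> \<longleftrightarrow> x = \<zero>\<^bsub>M\<^esub>" if "x \<in> A" for x using act_eq_zero[OF _ assms(5), of x] assms(1) that by blast
    then show ?thesis using assms(3,4) act_zero[OF assms(5)] by (force simp: tr_def)
  qed
  ultimately show ?thesis by simp
qed

text \<open>Translates of \<open>L\<close>-submodules are thus indexed by right cosets of
  \<open>L\<close>, and later by integer vectors.\<close>

lemma tr_coset:
  assumes "sub L W" "l \<in> L" "subgroup L G" "g \<in> carrier G"
  shows "tra W (l \<otimes> g) = tra W g"
proof -
  interpret L: subgroup L G by fact
  have l: "l \<in> carrier G" using assms L.subset by blast
  have "tra W l = W"
  proof
    show "tra W l \<subseteq> W" using subD(5)[OF assms(1)] assms(2) by (auto simp: tr_def)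
    show "W \<subseteq> tra W l"
    proof
      fix w assume w: "w \<in> W"
      then have "w = act (act w (inv l)) l" using l sub_carrier[OF assms(1)] by (simp add: act_inv)
      then show "w \<in> tra W l" unfolding tr_def
        using subD(5)[OF assms(1) w L.m_inv_closed[OF assms(2)]] by (rule image_eqI)
    qed
  qed
  then show ?thesis using tr_tr[OF subD(1)[OF assms(1)] l assms(4)] by simp
qed

section \<open>Partial homomorphisms and critical submodules\<close>

definition subp :: "'g set \<Rightarrow> ('m \<times> 'm) set \<Rightarrow> bool" where
  "subp L R \<longleftrightarrow> R \<subseteq> carrier M \<times> carrier M \<and> (\<zero>\<^bsub>M\<^esub>, \<zero>\<^bsub>M\<^esub>) \<in> R \<and>
     (\<forall>a b c d. (a, b) \<in> R \<longrightarrow> (c, d) \<in> R \<longrightarrow> (a \<oplus>\<^bsub>M\<^esub> c, b \<oplus>\<^bsub>M\<^esub> d) \<in> R) \<and>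
     (\<forall>a b \<omega>. (a, b) \<in> R \<longrightarrow> \<omega> \<in> Om \<longrightarrow> (\<omega> a, \<omega> b) \<in> R) \<and>
     (\<forall>a b l. (a, b) \<in> R \<longrightarrow> l \<in> L \<longrightarrow> (act a l, act b l) \<in> R)"

text \<open>The fibre over zero decides single-valuedness, because the relation is additive and,
  through the operators, closed under negation.\<close>

definition partial_hom :: "'g set \<Rightarrow> 'm set \<Rightarrow> ('m \<times> 'm) set \<Rightarrow> bool" where
  "partial_hom L K R \<longleftrightarrow> subp L R \<and> Domain R \<subseteq> K \<and> (\<forall>y. (\<zero>\<^bsub>M\<^esub>, y) \<in> R \<longrightarrow> y = \<zero>\<^bsub>M\<^esub>)"

text \<open>Homomorphisms from submodules of \<open>K\<close> to \<open>M\<close> are given by their graphs \<open>R\<close>.\<close>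

definition crit :: "'g set \<Rightarrow> 'm set \<Rightarrow> bool" where
  "crit L K \<longleftrightarrow> sub L K \<and> K \<noteq> {\<zero>\<^bsub>M\<^esub>} \<and>
     (\<forall>R. partial_hom L K R \<longrightarrow> (\<forall>x. (x, \<zero>\<^bsub>M\<^esub>) \<in> R \<longrightarrow> x = \<zero>\<^bsub>M\<^esub>) \<or> Range R \<subseteq> {\<zero>\<^bsub>M\<^esub>})"

lemma critD: "crit L K \<Longrightarrow> sub L K" "crit L K \<Longrightarrow> K \<noteq> {\<zero>\<^bsub>M\<^esub>}"
  "crit L K \<Longrightarrow> partial_hom L K R \<Longrightarrow> (x, \<zero>\<^bsub>M\<^esub>) \<in> R \<Longrightarrow> x \<noteq> \<zero>\<^bsub>M\<^esub> \<Longrightarrow> Range R \<subseteq> {\<zero>\<^bsub>M\<^esub>}"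
  by (auto simp: crit_def)

lemma subpD:
  assumes "subp L R"
  shows "(a, b) \<in> R \<Longrightarrow> a \<in> carrier M" "(a, b) \<in> R \<Longrightarrow> b \<in> carrier M" "(\<zero>\<^bsub>M\<^esub>, \<zero>\<^bsub>M\<^esub>) \<in> R"
    "\<lbrakk>(a, b) \<in> R; (c, d) \<in> R\<rbrakk> \<Longrightarrow> (a \<oplus>\<^bsub>M\<^esub> c, b \<oplus>\<^bsub>M\<^esub> d) \<in> R"
    "\<lbrakk>(a, b) \<in> R; \<omega> \<in> Om\<rbrakk> \<Longrightarrow> (\<omega> a, \<omega> b) \<in> R" "\<lbrakk>(a, b) \<in> R; l \<in> L\<rbrakk> \<Longrightarrow> (act a l, act b l) \<in> R"
  using assms by (auto simp: subp_def)

lemma sub_Range: assumes "subp L R" shows "sub L (Range R)"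
  unfolding opsub_def
proof (intro conjI ballI subsetI)
  note R = subpD[OF assms]
  show "\<zero>\<^bsub>M\<^esub> \<in> Range R" using R(3) by blast
  fix x assume "x \<in> Range R"
  then obtain a where a: "(a, x) \<in> R" by blast
  show "x \<in> carrier M" using R(2)[OF a] .
  show "\<omega> x \<in> Range R" if "\<omega> \<in> Om" for \<omega> using R(5)[OF a that] by blast
  show "act x l \<in> Range R" if "l \<in> L" for l using R(6)[OF a that] by blast
  fix y assume "y \<in> Range R"
  then obtain b where b: "(b, y) \<in> R" by blast
  show "x \<oplus>\<^bsub>M\<^esub> y \<in> Range R" using R(4)[OF a b] by blast
qed

lemma sub_kernel: assumes "subp L R" "L \<subseteq> carrier G" shows "sub L {x. (x, \<zero>\<^bsub>M\<^esub>) \<in> R}"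
  unfolding opsub_def
proof (intro conjI ballI subsetI)
  note R = subpD[OF assms(1)]
  show "\<zero>\<^bsub>M\<^esub> \<in> {x. (x, \<zero>\<^bsub>M\<^esub>) \<in> R}" using R(3) by blast
  fix x assume "x \<in> {x. (x, \<zero>\<^bsub>M\<^esub>) \<in> R}"
  then have x: "(x, \<zero>\<^bsub>M\<^esub>) \<in> R" by blast
  show "x \<in> carrier M" using R(1)[OF x] .
  show "\<omega> x \<in> {x. (x, \<zero>\<^bsub>M\<^esub>) \<in> R}" if "\<omega> \<in> Om" for \<omega> using R(5)[OF x that] om_zero[OF that] by simp
  show "act x l \<in> {x. (x, \<zero>\<^bsub>M\<^esub>) \<in> R}" if "l \<in> L" for l
    using R(6)[OF x that] act_zero[of l] assms(2) that by auto
  fix y assume "y \<in> {x. (x, \<zero>\<^bsub>M\<^esub>) \<in> R}"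
  then have y: "(y, \<zero>\<^bsub>M\<^esub>) \<in> R" by blast
  show "x \<oplus>\<^bsub>M\<^esub> y \<in> {x. (x, \<zero>\<^bsub>M\<^esub>) \<in> R}" using R(4)[OF x y] by simp
qed

lemma subp_comp:
  assumes "subp L R" "subp L Q" shows "subp L (R O Q)"
proof -
  note R = subpD[OF assms(1)] and Q = subpD[OF assms(2)]
  have "(\<zero>\<^bsub>M\<^esub>, \<zero>\<^bsub>M\<^esub>) \<in> R O Q" using R(3) Q(3) by blast
  moreover have "(a \<oplus>\<^bsub>M\<^esub> c, b \<oplus>\<^bsub>M\<^esub> d) \<in> R O Q" if "(a, b) \<in> R O Q" "(c, d) \<in> R O Q" for a b c d
  proof -
    obtain x y where xy: "(a, x) \<in> R" "(x, b) \<in> Q" "(c, y) \<in> R" "(y, d) \<in> Q" using \<open>(a, b) \<in> R O Q\<close> \<open>(c, d) \<in> R O Q\<close> by blast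
    show ?thesis using R(4)[OF xy(1,3)] Q(4)[OF xy(2,4)] by (rule relcompI)
  qed
  moreover have "(\<omega> a, \<omega> b) \<in> R O Q" if "(a, b) \<in> R O Q" "\<omega> \<in> Om" for a b \<omega>
  proof -
    obtain x where "(a, x) \<in> R" "(x, b) \<in> Q" using \<open>(a, b) \<in> R O Q\<close> by blast
    then show ?thesis using R(5)[OF _ that(2)] Q(5)[OF _ that(2)] by blast
  qed
  moreover have "(act a l, act b l) \<in> R O Q" if "(a, b) \<in> R O Q" "l \<in> L" for a b l
  proof -
    obtain x where "(a, x) \<in> R" "(x, b) \<in> Q" using \<open>(a, b) \<in> R O Q\<close> by blast
    then show ?thesis using R(6)[OF _ that(2)] Q(6)[OF _ that(2)] by blast
  qed
  moreover have "R O Q \<subseteq> carrier M \<times> carrier M" using R(1) Q(2) by auto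
  ultimately show ?thesis unfolding subp_def by simp
qed

text \<open>A partial homomorphism on the image, composed with \<open>R\<close>, is a partial
  homomorphism on \<open>K\<close>; criticality of \<open>K\<close> applies to the
  composite.\<close>

lemma crit_Range:
  assumes K: "crit L K" and R: "partial_hom L K R" and nz: "\<not> Range R \<subseteq> {\<zero>\<^bsub>M\<^esub>}"
  shows "crit L (Range R)"
proof -
  have subR: "subp L R" and dR: "Domain R \<subseteq> K" and sR: "\<And>y. (\<zero>\<^bsub>M\<^esub>, y) \<in> R \<Longrightarrow> y = \<zero>\<^bsub>M\<^esub>"
    using R by (auto simp: partial_hom_def)
  have "(\<forall>x. (x, \<zero>\<^bsub>M\<^esub>) \<in> Q \<longrightarrow> x = \<zero>\<^bsub>M\<^esub>) \<or> Range Q \<subseteq> {\<zero>\<^bsub>M\<^esub>}" if Q: "partial_hom L (Range R) Q" for Q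
  proof -
    have subQ: "subp L Q" and dQ: "Domain Q \<subseteq> Range R" and sQ: "\<And>y. (\<zero>\<^bsub>M\<^esub>, y) \<in> Q \<Longrightarrow> y = \<zero>\<^bsub>M\<^esub>"
      using Q by (auto simp: partial_hom_def)
    have "partial_hom L K (R O Q)"
      unfolding partial_hom_def using subp_comp[OF subR subQ] dR sR sQ by blast
    then consider "\<And>x. (x, \<zero>\<^bsub>M\<^esub>) \<in> R O Q \<Longrightarrow> x = \<zero>\<^bsub>M\<^esub>" | "Range (R O Q) \<subseteq> {\<zero>\<^bsub>M\<^esub>}"
      using critD(3)[OF K] by blast
    then show ?thesis
    proof cases
      case 1
      have "y = \<zero>\<^bsub>M\<^esub>" if y: "(y, \<zero>\<^bsub>M\<^esub>) \<in> Q" for y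
      proof -
        obtain x where "(x, y) \<in> R" using y dQ by blast
        then show ?thesis using 1[of x] y sR by blast
      qed
      then show ?thesis by blast
    next
      case 2
      then show ?thesis using dQ by blast
    qed
  qed
  moreover have "Range R \<noteq> {\<zero>\<^bsub>M\<^esub>}" using nz by blast
  ultimately show ?thesis using sub_Range[OF subR] by (simp add: crit_def)
qed

section \<open>Noetherian modules and the existence of critical submodules\<close>

definition noeth :: "'g set \<Rightarrow> 'm set \<Rightarrow> bool" where
  "noeth L V \<longleftrightarrow> (\<forall>f. (\<forall>n::nat. sub L (f n) \<and> f n \<subseteq> V \<and> f n \<subseteq> f (Suc n)) \<longrightarrow> (\<exists>n. \<forall>m\<ge>n. f m = f n))"

lemma noethD:
  assumes "noeth L V" "\<And>n::nat. sub L (f n)" "\<And>n. f n \<subseteq> V" "\<And>n. f n \<subseteq> f (Suc n)"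
  shows "\<exists>n. \<forall>m\<ge>n. f m = f n"
  using assms(1) unfolding noeth_def by (elim allE impE) (simp_all add: assms(2-4))

lemma noeth_max:
  assumes "noeth L V" "W0 \<in> F" "\<And>W. W \<in> F \<Longrightarrow> sub L W \<and> W \<subseteq> V"
  shows "\<exists>W \<in> F. \<forall>W' \<in> F. W \<subseteq> W' \<longrightarrow> W' = W"
proof (rule ccontr)
  assume "\<not> ?thesis"
  then have ex: "\<exists>W'. W' \<in> F \<and> W \<subset> W'" if "W \<in> F" for W using that by blast
  define nx where "nx W = (SOME W'. W' \<in> F \<and> W \<subset> W')" for W
  have nx: "nx W \<in> F" "W \<subset> nx W" if "W \<in> F" for W
    using someI_ex[OF ex[OF that]] by (auto simp: nx_def)
  define f where "f n = (nx ^^ n) W0" for n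
  have fF: "f n \<in> F" for n by (induction n) (auto simp: f_def assms(2) nx)
  have "f (Suc n) = nx (f n)" for n by (simp add: f_def)
  then have inc: "f n \<subset> f (Suc n)" for n using nx[OF fF[of n]] by simp
  then have "\<exists>n. \<forall>m\<ge>n. f m = f n" using assms(1,3) fF unfolding noeth_def by blast
  then obtain n where "f (Suc n) = f n" by (metis le_SucI order_refl)
  then show False using inc[of n] by simp
qed

text \<open>Among the nonzero partial homomorphisms on \<open>V\<close>, one with maximal kernel has
  a critical image: a nonzero partial homomorphism on the image that is not injective would give a
  composite with a larger kernel.\<close>

lemma crit_exists:
  assumes V: "sub L V" "noeth L V" "V \<noteq> {\<zero>\<^bsub>M\<^esub>}" "L \<subseteq> carrier G"
  shows "\<exists>K. crit L K"
proof -
  define F where "F = {W. \<exists>R. partial_hom L V R \<and> \<not> Range R \<subseteq> {\<zero>\<^bsub>M\<^esub>} \<and> W = {x. (x, \<zero>\<^bsub>M\<^esub>) \<in> R}}"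
  have "partial_hom L V (Id_on V)" using V(1) by (auto simp: partial_hom_def subp_def opsub_def)
  moreover have "\<not> Range (Id_on V) \<subseteq> {\<zero>\<^bsub>M\<^esub>}" using V(3) subD(2)[OF V(1)] by auto
  ultimately have F0: "{x. (x, \<zero>\<^bsub>M\<^esub>) \<in> Id_on V} \<in> F" unfolding F_def by blast
  have F1: "sub L W \<and> W \<subseteq> V" if "W \<in> F" for W
  proof -
    obtain R where R: "partial_hom L V R" "W = {x. (x, \<zero>\<^bsub>M\<^esub>) \<in> R}" using \<open>W \<in> F\<close> by (auto simp: F_def)
    have "sub L W" unfolding R(2) using R(1) V(4) by (intro sub_kernel) (simp_all add: partial_hom_def)
    then show ?thesis using R by (auto simp: partial_hom_def)
  qed
  obtain W where W: "W \<in> F" "\<And>W'. W' \<in> F \<Longrightarrow> W \<subseteq> W' \<Longrightarrow> W' = W"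
    using noeth_max[OF V(2) F0 F1] by blast
  then obtain R where R: "partial_hom L V R" "\<not> Range R \<subseteq> {\<zero>\<^bsub>M\<^esub>}" "W = {x. (x, \<zero>\<^bsub>M\<^esub>) \<in> R}" by (auto simp: F_def)
  have sR: "subp L R" using R by (simp add: partial_hom_def)
  have "(\<forall>x. (x, \<zero>\<^bsub>M\<^esub>) \<in> Q \<longrightarrow> x = \<zero>\<^bsub>M\<^esub>) \<or> Range Q \<subseteq> {\<zero>\<^bsub>M\<^esub>}" if Q: "partial_hom L (Range R) Q" for Q
  proof (rule disjCI)
    assume nQ: "\<not> Range Q \<subseteq> {\<zero>\<^bsub>M\<^esub>}"
    have dQ: "Domain Q \<subseteq> Range R" and subQ: "subp L Q" using Q by (auto simp: partial_hom_def)
    have "partial_hom L V (R O Q)"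
      using R(1) Q subp_comp[OF sR subQ] unfolding partial_hom_def by blast
    moreover have "\<not> Range (R O Q) \<subseteq> {\<zero>\<^bsub>M\<^esub>}" using nQ dQ by blast
    ultimately have inF: "{x. (x, \<zero>\<^bsub>M\<^esub>) \<in> R O Q} \<in> F" unfolding F_def by blast
    have "(\<zero>\<^bsub>M\<^esub>, \<zero>\<^bsub>M\<^esub>) \<in> Q" using subQ by (simp add: subp_def)
    then have "W \<subseteq> {x. (x, \<zero>\<^bsub>M\<^esub>) \<in> R O Q}" using R(3) by blast
    from W(2)[OF inF this] have eq: "{x. (x, \<zero>\<^bsub>M\<^esub>) \<in> R O Q} = W" .
    have "y = \<zero>\<^bsub>M\<^esub>" if y: "(y, \<zero>\<^bsub>M\<^esub>) \<in> Q" for y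
    proof -
      obtain x where x: "(x, y) \<in> R" using y dQ by blast
      then have x0: "(x, \<zero>\<^bsub>M\<^esub>) \<in> R" using eq R(3) y by blast
      have c: "x \<in> carrier M" "y \<in> carrier M" using x sR by (auto simp: subp_def)
      obtain \<omega> where \<omega>: "\<omega> \<in> Om" "\<And>m. m \<in> carrier M \<Longrightarrow> \<omega> m = \<ominus>\<^bsub>M\<^esub> m" using om_neg by blast
      have "(x \<oplus>\<^bsub>M\<^esub> \<omega> x, y \<oplus>\<^bsub>M\<^esub> \<omega> \<zero>\<^bsub>M\<^esub>) \<in> R"
        by (rule subpD(4)[OF sR x subpD(5)[OF sR x0 \<omega>(1)]])
      then have "(\<zero>\<^bsub>M\<^esub>, y) \<in> R" using c \<omega> om_zero[OF \<omega>(1)] by (simp add: M.r_neg)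
      then show ?thesis using R(1) by (simp add: partial_hom_def)
    qed
    then show "\<forall>x. (x, \<zero>\<^bsub>M\<^esub>) \<in> Q \<longrightarrow> x = \<zero>\<^bsub>M\<^esub>" by blast
  qed
  then have "crit L (Range R)" using sub_Range[OF sR] R(2) by (auto simp: crit_def)
  then show ?thesis by blast
qed

text \<open>The correspondence modulo \<open>W\<close> between \<open>A\<close> and
  \<open>B\<close>. It becomes a partial homomorphism as soon as \<open>B\<close> and
  \<open>W\<close> meet trivially, which is how \<open>crit_meets_trans\<close> and
  \<open>crit_below\<close> use it.\<close>

lemma subp_diff:
  assumes "sub L A" "sub L B" "sub L W" "L \<subseteq> carrier G"
  shows "subp L {(a, b). a \<in> A \<and> b \<in> B \<and> (\<exists>w \<in> W. b = a \<oplus>\<^bsub>M\<^esub> w)}"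
proof -
  note A = subD[OF assms(1)] and B = subD[OF assms(2)] and W = subD[OF assms(3)]
  have c: "x \<in> carrier M" if "x \<in> A \<or> x \<in> B \<or> x \<in> W" for x using that A(1) B(1) W(1) by blast
  have "\<exists>w \<in> W. \<zero>\<^bsub>M\<^esub> = \<zero>\<^bsub>M\<^esub> \<oplus>\<^bsub>M\<^esub> w" using W(2) by (intro bexI[of _ "\<zero>\<^bsub>M\<^esub>"]) auto
  moreover have "\<exists>w \<in> W. a \<oplus>\<^bsub>M\<^esub> x \<oplus>\<^bsub>M\<^esub> (a' \<oplus>\<^bsub>M\<^esub> y) = a \<oplus>\<^bsub>M\<^esub> a' \<oplus>\<^bsub>M\<^esub> w"
    if "a \<in> A" "a' \<in> A" "x \<in> W" "y \<in> W" for a a' x y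
    using that c W(3) by (intro bexI[of _ "x \<oplus>\<^bsub>M\<^esub> y"]) (auto simp: M.add.m_ac)
  moreover have "\<exists>w \<in> W. \<omega> (a \<oplus>\<^bsub>M\<^esub> x) = \<omega> a \<oplus>\<^bsub>M\<^esub> w" if "a \<in> A" "x \<in> W" "\<omega> \<in> Om" for a x \<omega>
    using that c W(4) by (intro bexI[of _ "\<omega> x"]) (auto simp: om_add)
  moreover have "\<exists>w \<in> W. act (a \<oplus>\<^bsub>M\<^esub> x) l = act a l \<oplus>\<^bsub>M\<^esub> w" if "a \<in> A" "x \<in> W" "l \<in> L" for a x l
    using that c W(5) assms(4) by (intro bexI[of _ "act x l"]) (auto simp: act_add subset_iff)
  ultimately show ?thesis
    unfolding subp_def using A B c by auto
qed

text \<open>The source of transitivity. If \<open>K'\<close> and \<open>W\<close> met trivially,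
  congruence modulo \<open>W\<close> would define a partial homomorphism from \<open>K\<close> to
  \<open>K'\<close>. It sends the nonzero \<open>v\<close> in \<open>W\<close> to zero, so
  criticality makes it zero, yet it sends \<open>k\<close> to the nonzero
  \<open>k \<oplus> w\<close>.\<close>

lemma crit_meets_trans:
  assumes K: "crit L K" and K': "sub L K'" and W: "sub L W" and L: "L \<subseteq> carrier G"
    and KW: "v \<in> K" "v \<in> W" "v \<noteq> \<zero>\<^bsub>M\<^esub>" and z: "k \<in> K" "w \<in> W" "k \<oplus>\<^bsub>M\<^esub> w \<in> K'" "k \<oplus>\<^bsub>M\<^esub> w \<noteq> \<zero>\<^bsub>M\<^esub>"
  shows "K' \<inter> W \<noteq> {\<zero>\<^bsub>M\<^esub>}"
proof
  assume triv: "K' \<inter> W = {\<zero>\<^bsub>M\<^esub>}"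
  define R where "R = {(a, b). a \<in> K \<and> b \<in> K' \<and> (\<exists>w \<in> W. b = a \<oplus>\<^bsub>M\<^esub> w)}"
  note kc = sub_carrier[OF critD(1)[OF K]] and wc = sub_carrier[OF W]
  have "y = \<zero>\<^bsub>M\<^esub>" if "(\<zero>\<^bsub>M\<^esub>, y) \<in> R" for y using that triv wc by (auto simp: R_def)
  then have "partial_hom L K R"
    using subp_diff[OF critD(1)[OF K] K' W L] by (auto simp: partial_hom_def R_def)
  moreover have "(v, \<zero>\<^bsub>M\<^esub>) \<in> R"
    unfolding R_def using KW kc sub_neg[OF W] subD(2)[OF K'] by (auto intro!: bexI[of _ "\<ominus>\<^bsub>M\<^esub> v"] simp: M.r_neg)
  ultimately have "Range R \<subseteq> {\<zero>\<^bsub>M\<^esub>}" using critD(3)[OF K] KW(3) by blast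
  moreover have "(k, k \<oplus>\<^bsub>M\<^esub> w) \<in> R" unfolding R_def using z by blast
  ultimately show False using z(4) by blast
qed

text \<open>Translation by \<open>g\<close> is an isomorphism up to the automorphism of
  \<open>L\<close> given by conjugation; a partial homomorphism on the translate is pulled back to
  the relation \<open>P\<close> on \<open>K\<close>.\<close>

lemma crit_tr:
  assumes K: "crit L K" and g: "g \<in> carrier G" "normalizes G g L" and L: "L \<subseteq> carrier G"
  shows "crit L (tra K g)"
proof -
  note kc = sub_carrier[OF critD(1)[OF K]]
  define R where "R = {(x, y). x \<in> K \<and> y = act x g}"
  have ng: "normalizes G (inv g) L" using g by (auto simp: normalizes_def)
  have nz: "tra K g \<noteq> {\<zero>\<^bsub>M\<^esub>}"
  proof
    assume eq: "tra K g = {\<zero>\<^bsub>M\<^esub>}"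
    have "x = \<zero>\<^bsub>M\<^esub>" if "x \<in> K" for x
    proof -
      have "act x g \<in> tra K g" using that by (auto simp: tr_def)
      then show ?thesis using eq act_eq_zero[OF kc[OF that] g(1)] by simp
    qed
    then show False using critD(2)[OF K] subD(2)[OF critD(1)[OF K]] by blast
  qed
  have "(\<forall>x. (x, \<zero>\<^bsub>M\<^esub>) \<in> Q \<longrightarrow> x = \<zero>\<^bsub>M\<^esub>) \<or> Range Q \<subseteq> {\<zero>\<^bsub>M\<^esub>}" if Q: "partial_hom L (tra K g) Q" for Q
  proof -
    define P where "P = {(x, y). x \<in> carrier M \<and> y \<in> carrier M \<and> (act x g, act y g) \<in> Q}"
    have sQ: "subp L Q" and dQ: "Domain Q \<subseteq> tra K g" and zQ: "\<And>y. (\<zero>\<^bsub>M\<^esub>, y) \<in> Q \<Longrightarrow> y = \<zero>\<^bsub>M\<^esub>"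
      using Q by (auto simp: partial_hom_def)
    have cQ: "x \<in> carrier M" "y \<in> carrier M" if "(x, y) \<in> Q" for x y using sQ that by (auto simp: subp_def)
    have QL: "(act a l, act b l) \<in> Q" if "(a, b) \<in> Q" "l \<in> L" for a b l using sQ that by (auto simp: subp_def)
    have PL: "(act a l, act b l) \<in> P" if ab: "(a, b) \<in> P" "l \<in> L" for a b l
    proof -
      obtain l' where l': "l' \<in> L" "l \<otimes> g = g \<otimes> l'" using normalizes_conj(1)[OF g(2,1) L ab(2)] by blast
      have "(act (act a g) l', act (act b g) l') \<in> Q" using QL ab l'(1) by (auto simp: P_def)
      moreover have "act (act x g) l' = act (act x l) g" if "x \<in> carrier M" for x
        using l' that g L ab(2) by (auto simp: act_act subset_iff)
      ultimately show ?thesis using ab L by (auto simp: P_def act_closed subset_iff)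
    qed
    have "subp L P"
      unfolding subp_def
    proof (intro conjI allI impI)
      show "(\<zero>\<^bsub>M\<^esub>, \<zero>\<^bsub>M\<^esub>) \<in> P" using sQ g by (auto simp: P_def subp_def act_zero)
      show "(a \<oplus>\<^bsub>M\<^esub> c, b \<oplus>\<^bsub>M\<^esub> d) \<in> P" if "(a, b) \<in> P" "(c, d) \<in> P" for a b c d
        using sQ g that by (auto simp: P_def subp_def act_add)
      show "(\<omega> a, \<omega> b) \<in> P" if "(a, b) \<in> P" "\<omega> \<in> Om" for a b \<omega>
        using sQ g that om_act[OF that(2), symmetric] by (auto simp: P_def subp_def om_closed)
    qed (use PL in \<open>auto simp: P_def\<close>)
    moreover have "Domain P \<subseteq> K"
    proof
      fix x assume "x \<in> Domain P"
      then obtain y where "x \<in> carrier M" "(act x g, y) \<in> Q" by (auto simp: P_def)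
      then show "x \<in> K" using dQ mem_tr_iff[of K g "act x g"] g act_inv(1)[of x g] act_closed kc by (auto simp: subset_iff)
    qed
    moreover have "y = \<zero>\<^bsub>M\<^esub>" if "(\<zero>\<^bsub>M\<^esub>, y) \<in> P" for y
      using that zQ act_zero[OF g(1)] act_eq_zero[OF _ g(1)] by (auto simp: P_def)
    ultimately have "partial_hom L K P" by (simp add: partial_hom_def)
    then consider "\<And>x. (x, \<zero>\<^bsub>M\<^esub>) \<in> P \<Longrightarrow> x = \<zero>\<^bsub>M\<^esub>" | "Range P \<subseteq> {\<zero>\<^bsub>M\<^esub>}" using critD(3)[OF K] by blast
    then show ?thesis
    proof cases
      case 1
      have "x = \<zero>\<^bsub>M\<^esub>" if x: "(x, \<zero>\<^bsub>M\<^esub>) \<in> Q" for x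
      proof -
        have "(act x (inv g), \<zero>\<^bsub>M\<^esub>) \<in> P" using x cQ g by (auto simp: P_def act_inv act_zero act_closed)
        then have "act x (inv g) = \<zero>\<^bsub>M\<^esub>" by (rule 1)
        then show ?thesis using act_eq_zero[of x "inv g"] cQ[OF x] g by simp
      qed
      then show ?thesis by blast
    next
      case 2
      have "y = \<zero>\<^bsub>M\<^esub>" if xy: "(x, y) \<in> Q" for x y
      proof -
        have "(act x (inv g), act y (inv g)) \<in> P" using xy cQ[OF xy] g by (auto simp: P_def act_inv act_closed)
        then have "act y (inv g) = \<zero>\<^bsub>M\<^esub>" using 2 by blast
        then show ?thesis using act_eq_zero[of y "inv g"] cQ[OF xy] g by simp
      qed
      then show ?thesis by blast
    qed
  qed
  then show ?thesis using sub_tr[OF critD(1)[OF K] g L] nz by (simp add: crit_def)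
qed

text \<open>Projecting a nonzero element of \<open>W\<close> with as few components as possible to one of its components
  gives a homomorphism which, inverted, embeds a submodule of a translate of \<open>V\<close> into \<open>W\<close>.\<close>

lemma crit_below:
  assumes V: "crit L V" and L: "L \<subseteq> carrier G" "\<And>g. g \<in> carrier G \<Longrightarrow> normalizes G g L"
    and W: "sub L W" "W \<noteq> {\<zero>\<^bsub>M\<^esub>}" "W \<subseteq> sumof (tra V ` carrier G)"
  shows "\<exists>K. crit L K \<and> K \<subseteq> W"
proof -
  have trc: "tra V g \<subseteq> carrier M" if "g \<in> carrier G" for g
    using tr_carrier[OF subD(1)[OF critD(1)[OF V]] that] .
  define P where "P n \<longleftrightarrow> (\<exists>F w. finite F \<and> F \<subseteq> carrier G \<and> card F = n \<and> w \<in> W \<and> w \<noteq> \<zero>\<^bsub>M\<^esub> \<and> w \<in> sumof (tra V ` F))" for n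
  obtain w0 where w0: "w0 \<in> W" "w0 \<noteq> \<zero>\<^bsub>M\<^esub>" using W subD(2) by blast
  have "w0 \<in> sumof (tra V ` carrier G)" using w0(1) W(3) by auto
  from sumof_finite[OF this] obtain S where S: "finite S" "S \<subseteq> tra V ` carrier G" "w0 \<in> sumof S" by auto
  from finite_subset_image[OF S(1,2)] obtain F0 where F0: "F0 \<subseteq> carrier G" "finite F0" "S = tra V ` F0" by auto
  have "P (card F0)" unfolding P_def by (intro exI[of _ F0] exI[of _ w0]) (use F0 S(3) w0 in simp)
  then have "\<exists>n. P n \<and> (\<forall>m<n. \<not> P m)" using exists_least_iff[of P] by auto
  then obtain n where n: "P n" "\<And>m. m < n \<Longrightarrow> \<not> P m" by auto
  from n(1)[unfolded P_def] obtain F w where F: "finite F" "F \<subseteq> carrier G" "card F = n" "w \<in> W" "w \<noteq> \<zero>\<^bsub>M\<^esub>" "w \<in> sumof (tra V ` F)"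
    by (elim exE conjE) (rule that)
  have "F \<noteq> {}"
  proof
    assume "F = {}"
    then show False using F(5,6) by (simp add: sumof_empty)
  qed
  then obtain g where g: "g \<in> F" by blast
  define F' where "F' = F - {g}"
  have F': "finite F'" "F' \<subseteq> carrier G" "card F' < n" "F = insert g F'"
    using F(1-3) g card_Diff1_less[OF F(1) g] by (auto simp: F'_def)
  have gG: "g \<in> carrier G" using g F(2) by blast
  define Sm where "Sm = sumof (tra V ` F')"
  have subSm: "sub L Sm"
    unfolding Sm_def by (rule sumof_sub) (use sub_tr[OF critD(1)[OF V]] L F'(2) in auto)
  \<comment> \<open>By minimality of \<open>n\<close>, no nonzero element of \<open>W\<close> is a
    sum from the remaining translates; this makes the relation \<open>R\<close> below
    single-valued.\<close>
  have mn: "x = \<zero>\<^bsub>M\<^esub>" if "x \<in> W" "x \<in> Sm" for x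
  proof (rule ccontr)
    assume "x \<noteq> \<zero>\<^bsub>M\<^esub>"
    then have "P (card F')" unfolding P_def
      by (intro exI[of _ F'] exI[of _ x]) (use that F'(1,2) in \<open>simp add: Sm_def\<close>)
    then show False using n(2)[OF F'(3)] by simp
  qed
  have cg: "crit L (tra V g)" by (rule crit_tr[OF V gG L(2)[OF gG] L(1)])
  define R where "R = {(a, b). a \<in> tra V g \<and> b \<in> W \<and> (\<exists>s \<in> Sm. b = a \<oplus>\<^bsub>M\<^esub> s)}"
  have "y = \<zero>\<^bsub>M\<^esub>" if "(\<zero>\<^bsub>M\<^esub>, y) \<in> R" for y
    using that mn sub_carrier[OF subSm] by (auto simp: R_def)
  then have ph: "partial_hom L (tra V g) R"
    using subp_diff[OF critD(1)[OF cg] W(1) subSm L(1)] by (auto simp: partial_hom_def R_def)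
  have "w \<in> sumof (insert (tra V g) (tra V ` F'))" using F(6) F'(4) by simp
  then obtain a s where "a \<in> tra V g" "s \<in> Sm" "w = a \<oplus>\<^bsub>M\<^esub> s"
    using sumof_insert[OF critD(1)[OF cg] _ \<open>w \<in> sumof (insert (tra V g) (tra V ` F'))\<close>] trc F'(2)
    unfolding Sm_def by (metis (no_types, lifting) imageE subsetD)
  then have "(a, w) \<in> R" using F(4) by (auto simp: R_def)
  then have "\<not> Range R \<subseteq> {\<zero>\<^bsub>M\<^esub>}" using F(5) by blast
  from crit_Range[OF cg ph this] show ?thesis by (auto simp: R_def)
qed

end

section \<open>Polycyclic groups and Noetherian modules\<close>

text \<open>Subgroups of a fixed \<open>G\<close> reached from the trivial one by cyclic extensions.
  Expressing normality through \<open>normalizes G x N\<close> spares a change of group structure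
  along the series.\<close>

inductive polycyclic :: "('g, 'b) monoid_scheme \<Rightarrow> 'g set \<Rightarrow> bool" for G :: "('g, 'b) monoid_scheme" where
  trivial: "polycyclic G {\<one>\<^bsub>G\<^esub>}"
| extend: "\<lbrakk>polycyclic G N; subgroup N G; subgroup K G; N \<subseteq> K; x \<in> K; normalizes G x N;
     \<And>k. k \<in> K \<Longrightarrow> \<exists>n \<in> N. \<exists>j::int. k = n \<otimes>\<^bsub>G\<^esub> x [^]\<^bsub>G\<^esub> j\<rbrakk> \<Longrightarrow> polycyclic G K"

lemma (in group) normalizes_mult:
  assumes "normalizes G x N" "normalizes G y N" "N \<subseteq> carrier G" "x \<in> carrier G" "y \<in> carrier G"
  shows "normalizes G (x \<otimes> y) N"
  unfolding normalizes_def
proof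
  fix n assume n: "n \<in> N"
  then have nc: "n \<in> carrier G" using assms by blast
  have "x \<otimes> y \<otimes> n \<otimes> inv (x \<otimes> y) = x \<otimes> (y \<otimes> n \<otimes> inv y) \<otimes> inv x"
    "inv (x \<otimes> y) \<otimes> n \<otimes> (x \<otimes> y) = inv y \<otimes> (inv x \<otimes> n \<otimes> x) \<otimes> y"
    using nc assms by (simp_all add: inv_mult_group m_assoc)
  then show "x \<otimes> y \<otimes> n \<otimes> inv (x \<otimes> y) \<in> N \<and> inv (x \<otimes> y) \<otimes> n \<otimes> (x \<otimes> y) \<in> N"
    using n assms(1,2) by (simp add: normalizes_def)
qed

lemma (in group) normalizes_inv: "normalizes G x N \<Longrightarrow> x \<in> carrier G \<Longrightarrow> normalizes G (inv x) N"
  by (simp add: normalizes_def)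

lemma (in group) normalizes_int_pow:
  assumes "normalizes G x N" "N \<subseteq> carrier G" "x \<in> carrier G"
  shows "normalizes G (x [^] (j::int)) N"
proof -
  have nat: "normalizes G (y [^] (n::nat)) N" if "normalizes G y N" "y \<in> carrier G" for y n
  proof (induction n)
    case 0 then show ?case using assms(2) by (auto simp: normalizes_def)
  next
    case (Suc n)
    then show ?case using normalizes_mult[OF Suc that(1) assms(2)] that(2) by simp
  qed
  show ?thesis
  proof (cases "0 \<le> j")
    case True
    then have "x [^] j = x [^] nat j" by (rule pow_nat[symmetric])
    then show ?thesis using nat[OF assms(1,3), of "nat j"] by (simp only:)
  next
    case False
    then have "x [^] j = inv (x [^] nat (- j))" by (subst int_pow_def2) simp
    then show ?thesis using normalizes_inv[OF nat[OF assms(1,3), of "nat (- j)"]] assms(3) by (simp only: nat_pow_closed)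
  qed
qed

section \<open>Hilbert's basis theorem for cyclic extensions\<close>

context opmod
begin

text \<open>Hall's form of the basis theorem. Elements of \<open>A\<close> behave like Laurent
  polynomials in \<open>x\<close> with coefficients in \<open>A0\<close>, although their expansions
  need not be unique: \<open>T n\<close> plays the polynomials of degree below \<open>n\<close>, and
  \<open>P n W\<close> the leading coefficients of elements of \<open>W\<close> at degree
  \<open>n\<close>.\<close>

lemma noeth_extend:
  assumes N: "subgroup N G" and K: "subgroup K G" and NK: "N \<subseteq> K" and x: "x \<in> K" "normalizes G x N"
    and gen: "\<And>k. k \<in> K \<Longrightarrow> \<exists>n \<in> N. \<exists>j::int. k = n \<otimes> x [^] j"
    and A0: "sub N A0" "noeth N A0"
  shows "\<exists>A. sub K A \<and> A0 \<subseteq> A \<and> noeth K A"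
proof -
  have NG: "N \<subseteq> carrier G" and KG: "K \<subseteq> carrier G" using N K subgroup.subset by blast+
  have xG: "x \<in> carrier G" using x KG by blast
  have xpG: "x [^] j \<in> carrier G" for j :: int using xG by simp
  have A0c: "A0 \<subseteq> carrier M" using subD(1)[OF A0(1)] .
  have nx: "normalizes G (x [^] j) N" for j :: int by (rule normalizes_int_pow[OF x(2) NG xG])
  have trsub: "sub N (tra A0 (x [^] j))" for j :: int by (rule sub_tr[OF A0(1) xpG nx NG])
  define A where "A = sumof (range (\<lambda>j::int. tra A0 (x [^] j)))"
  define T where "T n = sumof ((\<lambda>j::int. tra A0 (x [^] j)) ` {0..<int n})" for n :: nat
  have subA: "sub N A" unfolding A_def by (rule sumof_sub) (use trsub NG in auto)
  have subT: "sub N (T n)" for n unfolding T_def by (rule sumof_sub) (use trsub NG in auto)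
  have TA: "T n \<subseteq> A" for n unfolding T_def A_def by (intro sumof_mono) auto
  have Ac: "A \<subseteq> carrier M" using subD(1)[OF subA] .
  have Tc: "T n \<subseteq> carrier M" for n using TA Ac by blast
  have Tmono: "n \<le> m \<Longrightarrow> T n \<subseteq> T m" for n m unfolding T_def by (intro sumof_mono image_mono) auto
  have trx: "tra (tra A0 (x [^] j)) (x [^] i) = tra A0 (x [^] (j + i))" for i j :: int
    using tr_tr[OF A0c xpG xpG] xG by (simp add: int_pow_mult)
  have Ax: "tra A (x [^] i) = A" for i :: int
  proof -
    have "tra A (x [^] i) = sumof ((\<lambda>Z. tra Z (x [^] i)) ` range (\<lambda>j::int. tra A0 (x [^] j)))"
      unfolding A_def by (rule tr_sumof) (use tr_carrier[OF A0c] xpG in auto)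
    also have "(\<lambda>Z. tra Z (x [^] i)) ` range (\<lambda>j::int. tra A0 (x [^] j)) = range (\<lambda>j::int. tra A0 (x [^] (j + i)))"
      by (simp add: image_image trx)
    also have "\<dots> = range (\<lambda>j::int. tra A0 (x [^] j))"
    proof -
      have "j \<in> range (\<lambda>j. j + i)" for j by (rule range_eqI[of _ _ "j - i"]) simp
      then have "range (\<lambda>j. j + i) = UNIV" by blast
      then show ?thesis using image_image[of "\<lambda>j. tra A0 (x [^] j)" "\<lambda>j. j + i" UNIV] by simp
    qed
    finally show ?thesis by (simp add: A_def)
  qed
  have actA: "act a (x [^] i) \<in> A" if "a \<in> A" for a and i :: int
  proof -
    have "act a (x [^] i) \<in> tra A (x [^] i)" using that by (auto simp: tr_def)
    then show ?thesis using Ax by simp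
  qed
  have subKA: "sub K A"
    unfolding opsub_def
  proof (intro conjI ballI)
    fix a k assume a: "a \<in> A" and k: "k \<in> K"
    obtain n j where nj: "n \<in> N" "k = n \<otimes> x [^] (j::int)" using gen[OF k] by blast
    have "act a k = act (act a n) (x [^] j)" using a nj Ac NG xpG by (auto simp: act_act subset_iff)
    then show "act a k \<in> A" using actA[OF subD(5)[OF subA a nj(1)]] by simp
  qed (use subD[OF subA] in auto)
  have A0A: "A0 \<subseteq> A"
  proof -
    have "tra A0 (x [^] (0::int)) = A0" using tr_one[OF A0c] by simp
    moreover have "tra A0 (x [^] (0::int)) \<subseteq> A" unfolding A_def
      by (rule sumof_incl[OF rangeI]) (rule tr_carrier[OF A0c xpG])
    ultimately show ?thesis by simp
  qed
  have Tshift: "act s x \<in> T (Suc n)" if "s \<in> T n" for s n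
  proof -
    have "act s x \<in> tra (T n) (x [^] (1::int))" unfolding tr_def int_pow_1[OF xG] using that by (rule imageI)
    also have "tra (T n) (x [^] (1::int)) = sumof ((\<lambda>Z. tra Z (x [^] (1::int))) ` ((\<lambda>j::int. tra A0 (x [^] j)) ` {0..<int n}))"
      unfolding T_def by (rule tr_sumof) (use tr_carrier[OF A0c] xpG in auto)
    also have "\<dots> = sumof ((\<lambda>j::int. tra A0 (x [^] (j + 1))) ` {0..<int n})" by (simp only: image_image trx)
    also have "\<dots> \<subseteq> T (Suc n)"
    proof -
      have "(\<lambda>j::int. tra A0 (x [^] (j + 1))) ` {0..<int n} \<subseteq> (\<lambda>j::int. tra A0 (x [^] j)) ` {0..<int (Suc n)}"
      proof
        fix Y assume "Y \<in> (\<lambda>j::int. tra A0 (x [^] (j + 1))) ` {0..<int n}"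
        then obtain j :: int where "0 \<le> j" "j < int n" "Y = tra A0 (x [^] (j + 1))" by auto
        then show "Y \<in> (\<lambda>j::int. tra A0 (x [^] j)) ` {0..<int (Suc n)}" by (intro image_eqI[of _ _ "j + 1"]) auto
      qed
      then show ?thesis unfolding T_def by (rule sumof_mono)
    qed
    finally show ?thesis .
  qed
  have TSuc: "\<exists>s \<in> T n. \<exists>a \<in> A0. t = s \<oplus>\<^bsub>M\<^esub> act a (x [^] int n)" if "t \<in> T (Suc n)" for t n
  proof -
    have "{0..<int (Suc n)} = insert (int n) {0..<int n}" by auto
    then have "t \<in> sumof (insert (tra A0 (x [^] int n)) ((\<lambda>j::int. tra A0 (x [^] j)) ` {0..<int n}))"
      using that by (simp add: T_def)
    from sumof_insert[OF trsub _ this] obtain b s where "b \<in> tra A0 (x [^] int n)" "s \<in> T n" "t = b \<oplus>\<^bsub>M\<^esub> s"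
      using tr_carrier[OF A0c xpG] by (auto simp: T_def)
    moreover from this obtain a where "a \<in> A0" "b = act a (x [^] int n)" by (auto simp: tr_def)
    moreover have "s \<in> carrier M" "b \<in> carrier M" using calculation Tc A0c act_closed xpG by auto
    ultimately show ?thesis by (auto simp: M.a_comm)
  qed
  define P where "P n W = {a \<in> A0. \<exists>s \<in> T n. s \<oplus>\<^bsub>M\<^esub> act a (x [^] int n) \<in> W}" for n W
  have PI: "a \<in> P n W" if "a \<in> A0" "s \<in> T n" "s \<oplus>\<^bsub>M\<^esub> act a (x [^] int n) \<in> W" for a s n W
    unfolding P_def using that by blast
  have PE: "\<exists>s. a \<in> A0 \<and> s \<in> T n \<and> s \<oplus>\<^bsub>M\<^esub> act a (x [^] int n) \<in> W" if "a \<in> P n W" for a n W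
    using that unfolding P_def by blast
  have subP: "sub N (P n W)" if W: "sub K W" for n W
  proof -
    note w = subD[OF W]
    have ac: "act a (x [^] int n) \<in> carrier M" "a \<in> carrier M" if "a \<in> A0" for a using that A0c act_closed xpG by auto
    have tc: "s \<in> carrier M" if "s \<in> T n" for s using that Tc by blast
    show ?thesis
      unfolding opsub_def
    proof (intro conjI ballI)
      show "P n W \<subseteq> carrier M" using A0c by (auto simp: P_def)
      have "\<zero>\<^bsub>M\<^esub> \<oplus>\<^bsub>M\<^esub> act \<zero>\<^bsub>M\<^esub> (x [^] int n) \<in> W" using act_zero[OF xpG] w(2) by simp
      then show "\<zero>\<^bsub>M\<^esub> \<in> P n W" by (rule PI[OF subD(2)[OF A0(1)] subD(2)[OF subT]])
      fix a assume "a \<in> P n W"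
      then obtain s where s: "a \<in> A0" "s \<in> T n" "s \<oplus>\<^bsub>M\<^esub> act a (x [^] int n) \<in> W" using PE by blast
      show "\<omega> a \<in> P n W" if "\<omega> \<in> Om" for \<omega>
      proof -
        have "\<omega> (s \<oplus>\<^bsub>M\<^esub> act a (x [^] int n)) = \<omega> s \<oplus>\<^bsub>M\<^esub> act (\<omega> a) (x [^] int n)"
          using that s ac tc xpG by (simp add: om_add om_act)
        then have "\<omega> s \<oplus>\<^bsub>M\<^esub> act (\<omega> a) (x [^] int n) \<in> W" using w(4)[OF s(3) that] by simp
        then show ?thesis by (rule PI[OF subD(4)[OF A0(1) s(1) that] subD(4)[OF subT s(2) that]])
      qed
      show "act a l \<in> P n W" if l: "l \<in> N" for l
      proof -
        obtain l' where l': "l' \<in> N" "l \<otimes> x [^] int n = x [^] int n \<otimes> l'"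
          using normalizes_conj(1)[OF nx xpG NG l] by blast
        have lc: "l \<in> carrier G" "l' \<in> carrier G" using l l'(1) NG by auto
        have "act (s \<oplus>\<^bsub>M\<^esub> act a (x [^] int n)) l' = act s l' \<oplus>\<^bsub>M\<^esub> act (act a l) (x [^] int n)"
          using s(1,2) ac tc lc l'(2) xpG by (simp add: act_add act_act)
        moreover have "act (s \<oplus>\<^bsub>M\<^esub> act a (x [^] int n)) l' \<in> W" using w(5)[OF s(3)] l'(1) NK by blast
        ultimately show ?thesis
          by (intro PI[OF subD(5)[OF A0(1) s(1) l] subD(5)[OF subT s(2) l'(1)]]) simp
      qed
      fix b assume "b \<in> P n W"
      then obtain t where t: "b \<in> A0" "t \<in> T n" "t \<oplus>\<^bsub>M\<^esub> act b (x [^] int n) \<in> W" using PE by blast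
      have "(s \<oplus>\<^bsub>M\<^esub> act a (x [^] int n)) \<oplus>\<^bsub>M\<^esub> (t \<oplus>\<^bsub>M\<^esub> act b (x [^] int n)) =
          (s \<oplus>\<^bsub>M\<^esub> t) \<oplus>\<^bsub>M\<^esub> act (a \<oplus>\<^bsub>M\<^esub> b) (x [^] int n)"
        using s t ac tc xpG by (simp add: act_add M.add.m_ac)
      then have "(s \<oplus>\<^bsub>M\<^esub> t) \<oplus>\<^bsub>M\<^esub> act (a \<oplus>\<^bsub>M\<^esub> b) (x [^] int n) \<in> W" using w(3)[OF s(3) t(3)] by simp
      then show "a \<oplus>\<^bsub>M\<^esub> b \<in> P n W"
        by (rule PI[OF subD(3)[OF A0(1) s(1) t(1)] subD(3)[OF subT s(2) t(2)]])
    qed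
  qed
  \<comment> \<open>Acting with \<open>x\<close> raises the degree by one and keeps the leading
    coefficient.\<close>
  have PSuc: "P n W \<subseteq> P (Suc n) W" if W: "sub K W" for n W
  proof
    fix a assume "a \<in> P n W"
    then obtain s where s: "a \<in> A0" "s \<in> T n" "s \<oplus>\<^bsub>M\<^esub> act a (x [^] int n) \<in> W" using PE by blast
    have c: "s \<in> carrier M" "a \<in> carrier M" using s Tc A0c by auto
    have "x [^] int (Suc n) = x [^] int n \<otimes> x" unfolding int_pow_int by simp
    then have "act (s \<oplus>\<^bsub>M\<^esub> act a (x [^] int n)) x = act s x \<oplus>\<^bsub>M\<^esub> act a (x [^] int (Suc n))"
      using c xG xpG[of "int n"] by (simp add: act_add act_act act_closed)
    moreover have "act (s \<oplus>\<^bsub>M\<^esub> act a (x [^] int n)) x \<in> W" using subD(5)[OF W s(3) x(1)] .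
    ultimately show "a \<in> P (Suc n) W" by (intro PI[OF s(1) Tshift[OF s(2)]]) simp
  qed
  have Pmono: "P n W \<subseteq> P m W'" if "sub K W" "W \<subseteq> W'" "n \<le> m" for n m W W'
  proof -
    have "P n W \<subseteq> P m W" using that(3)
    proof (induction m rule: dec_induct)
      case (step m) then show ?case using PSuc[OF that(1), of m] by blast
    qed simp
    moreover have "P m W \<subseteq> P m W'" using that(2) by (auto simp: P_def)
    ultimately show ?thesis by blast
  qed
  have PA0: "P n W \<subseteq> A0" for n W by (auto simp: P_def)
  \<comment> \<open>Negative powers are removed by acting with a large power of \<open>x\<close>;
    \<open>K\<close>-submodules are stable under this action and its inverse.\<close>
  have big: "\<exists>j n. act t (x [^] (int j)) \<in> T n" if "t \<in> A" for t
  proof -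
    have "\<exists>j. \<forall>i\<ge>j. \<exists>n. act t (x [^] (i::int)) \<in> T n" using that unfolding A_def
    proof induction
      case zero
      have "act \<zero>\<^bsub>M\<^esub> (x [^] i) \<in> T 0" for i :: int using act_zero[OF xpG] subD(2)[OF subT[of 0]] by simp
      then show ?case by blast
    next
      case (step Z a y)
      then obtain l :: int where l: "a \<in> tra A0 (x [^] l)" by auto
      then obtain b where b: "b \<in> A0" "a = act b (x [^] l)" by (auto simp: tr_def)
      from step.IH obtain j where j: "\<forall>i\<ge>j. \<exists>n. act y (x [^] (i::int)) \<in> T n" by (rule exE)
      have bc: "b \<in> carrier M" using b(1) A0c by blast
      have yc: "y \<in> carrier M" using step.hyps(3) Ac[unfolded A_def] by (rule subsetD[rotated])
      have ac: "a \<in> carrier M" using b(2) act_closed[OF bc xpG] by simp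
      have "\<exists>n. act (a \<oplus>\<^bsub>M\<^esub> y) (x [^] i) \<in> T n" if i: "max j (- l) \<le> i" for i
      proof -
        have "j \<le> i" using i by simp
        then obtain n where n: "act y (x [^] i) \<in> T n" using j by blast
        define m where "m = max n (Suc (nat (l + i)))"
        have "act a (x [^] i) = act b (x [^] (l + i))"
          unfolding b(2) act_act[OF bc xpG xpG] using int_pow_mult[OF xG] by simp
        moreover have "act b (x [^] (l + i)) \<in> tra A0 (x [^] (l + i))" using b(1) by (auto simp: tr_def)
        moreover have "tra A0 (x [^] (l + i)) \<subseteq> T m"
          unfolding T_def
        proof (rule sumof_incl[OF imageI])
          show "l + i \<in> {0..<int m}" using i by (auto simp: m_def)
        qed (rule tr_carrier[OF A0c xpG])
        ultimately have "act a (x [^] i) \<in> T m" by auto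
        moreover have "act y (x [^] i) \<in> T m" using n Tmono[of n m] by (auto simp: m_def)
        ultimately have "act a (x [^] i) \<oplus>\<^bsub>M\<^esub> act y (x [^] i) \<in> T m" by (rule subD(3)[OF subT])
        then show ?thesis using act_add[OF ac yc xpG] by auto
      qed
      then show ?case by blast
    qed
    then obtain j where j: "\<forall>i\<ge>j. \<exists>n. act t (x [^] (i::int)) \<in> T n" by (rule exE)
    have "j \<le> int (nat j)" by simp
    then show ?thesis using j by blast
  qed
  have noethA: "noeth K A"
    unfolding noeth_def
  proof (intro allI impI)
    fix f :: "nat \<Rightarrow> 'm set" assume f: "\<forall>n. sub K (f n) \<and> f n \<subseteq> A \<and> f n \<subseteq> f (Suc n)"
    then have fs: "sub K (f n)" and fA: "f n \<subseteq> A" and fi: "f n \<subseteq> f (Suc n)" for n by auto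
    have fmono: "f n \<subseteq> f m" if "n \<le> m" for n m by (rule lift_Suc_mono_le[of f, OF fi that])
    define D where "D n m = P n (f m)" for n m
    have Dmono: "D n m \<subseteq> D n' m'" if "n \<le> n'" "m \<le> m'" for n m n' m'
      unfolding D_def by (rule Pmono[OF fs fmono[OF that(2)] that(1)])
    have stab: "\<exists>p. \<forall>q\<ge>p. D (g q) q = D (g p) p" if "\<And>q. g q \<le> g (Suc q)" for g
    proof -
      show ?thesis
      proof (rule noethD[OF A0(2), of "\<lambda>q. D (g q) q"])
        fix q
        show "sub N (D (g q) q)" unfolding D_def by (rule subP[OF fs])
        show "D (g q) q \<subseteq> A0" unfolding D_def by (rule PA0)
        show "D (g q) q \<subseteq> D (g (Suc q)) (Suc q)" by (rule Dmono[OF that]) simp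
      qed
    qed
    obtain p where p: "\<And>q. p \<le> q \<Longrightarrow> D q q = D p p" using stab[of "\<lambda>q. q"] by auto
    have "\<forall>n. \<exists>q. \<forall>m\<ge>q. D n m = D n q"
    proof
      fix n show "\<exists>q. \<forall>m\<ge>q. D n m = D n q" using stab[of "\<lambda>_. n"] by simp
    qed
    from choice[OF this] obtain r where r: "\<And>n m. r n \<le> m \<Longrightarrow> D n m = D n (r n)" by blast
    define q where "q = p + (\<Sum>n<p. r n)"
    have Dq: "D n m = D n q" if "q \<le> m" for n m
    proof (cases "n < p")
      case True
      then have "r n \<le> (\<Sum>n<p. r n)" by (intro member_le_sum) auto
      then have "r n \<le> q" by (simp add: q_def)
      then show ?thesis using r[of n m] r[of n q] that by simp
    next
      case False
      have "D n m' = D p p" if "q \<le> m'" for m'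
      proof
        have "D n m' \<subseteq> D (max n m') (max n m')" by (rule Dmono) auto
        also have "\<dots> = D p p" using False by (intro p) auto
        finally show "D n m' \<subseteq> D p p" .
        show "D p p \<subseteq> D n m'" using False that by (intro Dmono) (auto simp: q_def)
      qed
      then show ?thesis using that by simp
    qed
    \<comment> \<open>Descent in the degree: subtracting an element of \<open>f q\<close> with the
      same leading coefficient leaves an element of lower degree.\<close>
    have fT: "t \<in> f q" if "q \<le> m" "t \<in> f m" "t \<in> T n" for t m n
      using that(2,3)
    proof (induction n arbitrary: t)
      case 0
      then have "t = \<zero>\<^bsub>M\<^esub>" by (simp add: T_def sumof_empty)
      then show ?case using subD(2)[OF fs] by simp
    next
      case (Suc n)
      obtain s a where sa: "s \<in> T n" "a \<in> A0" "t = s \<oplus>\<^bsub>M\<^esub> act a (x [^] int n)" using TSuc[OF Suc.prems(2)] by blast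
      then have "a \<in> D n m" unfolding D_def using Suc.prems(1) by (intro PI[of a s]) simp_all
      then have "a \<in> D n q" using Dq[OF that(1)] by simp
      then obtain s' where s': "s' \<in> T n" "s' \<oplus>\<^bsub>M\<^esub> act a (x [^] int n) \<in> f q"
        unfolding D_def using PE by blast
      let ?b = "act a (x [^] int n)"
      have c: "s \<in> carrier M" "s' \<in> carrier M" "?b \<in> carrier M" using sa s' Tc A0c act_closed xpG by auto
      have "t \<ominus>\<^bsub>M\<^esub> (s' \<oplus>\<^bsub>M\<^esub> ?b) \<in> f m"
        using sub_minus[OF fs Suc.prems(1)] s'(2) fmono[OF that(1)] by blast
      moreover have eq: "t \<ominus>\<^bsub>M\<^esub> (s' \<oplus>\<^bsub>M\<^esub> ?b) = s \<ominus>\<^bsub>M\<^esub> s'"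
      proof -
        have "t \<ominus>\<^bsub>M\<^esub> (s' \<oplus>\<^bsub>M\<^esub> ?b) = (s \<oplus>\<^bsub>M\<^esub> ?b) \<oplus>\<^bsub>M\<^esub> (\<ominus>\<^bsub>M\<^esub> ?b \<oplus>\<^bsub>M\<^esub> \<ominus>\<^bsub>M\<^esub> s')"
          using c sa(3) by (simp add: M.minus_eq M.minus_add M.a_comm)
        also have "\<dots> = s \<oplus>\<^bsub>M\<^esub> (?b \<oplus>\<^bsub>M\<^esub> (\<ominus>\<^bsub>M\<^esub> ?b \<oplus>\<^bsub>M\<^esub> \<ominus>\<^bsub>M\<^esub> s'))" using c by (simp add: M.a_assoc)
        also have "?b \<oplus>\<^bsub>M\<^esub> (\<ominus>\<^bsub>M\<^esub> ?b \<oplus>\<^bsub>M\<^esub> \<ominus>\<^bsub>M\<^esub> s') = \<ominus>\<^bsub>M\<^esub> s'"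
          using c by (simp add: M.a_assoc[symmetric] M.r_neg)
        finally show ?thesis by (simp add: M.minus_eq)
      qed
      moreover have "s \<ominus>\<^bsub>M\<^esub> s' \<in> T n" using sub_minus[OF subT sa(1) s'(1)] .
      ultimately have "s \<ominus>\<^bsub>M\<^esub> s' \<in> f q" using Suc.IH[of "s \<ominus>\<^bsub>M\<^esub> s'"] by simp
      then have "(s \<ominus>\<^bsub>M\<^esub> s') \<oplus>\<^bsub>M\<^esub> (s' \<oplus>\<^bsub>M\<^esub> ?b) \<in> f q" using s'(2) subD(3)[OF fs] by blast
      moreover have "(s \<ominus>\<^bsub>M\<^esub> s') \<oplus>\<^bsub>M\<^esub> (s' \<oplus>\<^bsub>M\<^esub> ?b) = t"
      proof -
        have "(s \<ominus>\<^bsub>M\<^esub> s') \<oplus>\<^bsub>M\<^esub> (s' \<oplus>\<^bsub>M\<^esub> ?b) = s \<oplus>\<^bsub>M\<^esub> (\<ominus>\<^bsub>M\<^esub> s' \<oplus>\<^bsub>M\<^esub> (s' \<oplus>\<^bsub>M\<^esub> ?b))"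
          using c by (simp add: M.minus_eq M.a_assoc)
        also have "\<ominus>\<^bsub>M\<^esub> s' \<oplus>\<^bsub>M\<^esub> (s' \<oplus>\<^bsub>M\<^esub> ?b) = ?b" using c by (simp add: M.a_assoc[symmetric] M.l_neg)
        finally show ?thesis using sa(3) by simp
      qed
      ultimately show ?case by simp
    qed
    have "f m = f q" if "q \<le> m" for m
    proof
      show "f q \<subseteq> f m" by (rule fmono[OF that])
      show "f m \<subseteq> f q"
      proof
        fix t assume t: "t \<in> f m"
        then have "t \<in> A" using fA by blast
        from big[OF this] obtain j n where jn: "act t (x [^] (int j)) \<in> T n" by (elim exE)
        have xK: "x [^] i \<in> K" for i :: int by (rule subgroup_int_pow_closed[OF K x(1)])
        have tc: "t \<in> carrier M" using t fA Ac by blast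
        have "act t (x [^] (int j)) \<in> f q" by (rule fT[OF that subD(5)[OF fs t xK] jn])
        from subD(5)[OF fs this xK, of "- int j"] show "t \<in> f q"
          using tc xG by (simp add: act_act int_pow_mult[symmetric] act_one)
      qed
    qed
    then show "\<exists>n. \<forall>m\<ge>n. f m = f n" by blast
  qed
  show ?thesis using subKA A0A noethA by blast
qed

text \<open>The induction starts from the module supplied by \<open>line\<close>, which has no
  proper nonzero submodules, and enlarges it by the basis theorem at each cyclic extension.\<close>

lemma noeth_polycyclic:
  assumes "polycyclic G L" "a \<in> carrier M"
  shows "\<exists>V. sub L V \<and> a \<in> V \<and> noeth L V"
  using assms(1)
proof induction
  case trivial
  obtain V where V: "sub {\<one>} V" "a \<in> V" "\<And>W. sub {\<one>} W \<Longrightarrow> W \<subseteq> V \<Longrightarrow> W = {\<zero>\<^bsub>M\<^esub>} \<or> W = V"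
    using line[OF assms(2)] by blast
  have "noeth {\<one>} V"
    unfolding noeth_def
  proof (intro allI impI)
    fix f :: "nat \<Rightarrow> 'm set" assume f: "\<forall>n. sub {\<one>} (f n) \<and> f n \<subseteq> V \<and> f n \<subseteq> f (Suc n)"
    have c: "f n = {\<zero>\<^bsub>M\<^esub>} \<or> f n = V" for n using V(3) f by blast
    have fi: "f n \<subseteq> f (Suc n)" for n using f by simp
    have fmono: "f n \<subseteq> f m" if "n \<le> m" for n m by (rule lift_Suc_mono_le[of f, OF fi that])
    show "\<exists>n. \<forall>m\<ge>n. f m = f n"
    proof (cases "\<exists>n. f n = V")
      case True
      then obtain n where "f n = V" by blast
      then have "\<forall>m\<ge>n. f m = f n" using fmono f by blast
      then show ?thesis by blast
    next
      case False
      then have "f m = {\<zero>\<^bsub>M\<^esub>}" for m using c by blast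
      then show ?thesis by simp
    qed
  qed
  then show ?case using V by blast
next
  case (extend N K x)
  then obtain V where V: "sub N V" "a \<in> V" "noeth N V" by blast
  from noeth_extend[OF extend.hyps(2-7) V(1,3)] V(2) show ?case by blast
qed

end

section \<open>Commutator identities\<close>

context group
begin

definition commutator :: "'a \<Rightarrow> 'a \<Rightarrow> 'a" where
  "commutator x y = x \<otimes> y \<otimes> inv x \<otimes> inv y"

lemma commutator_closed: "x \<in> carrier G \<Longrightarrow> y \<in> carrier G \<Longrightarrow> commutator x y \<in> carrier G"
  by (simp add: commutator_def)

lemma cancel_left:
  assumes "x \<in> carrier G" "y \<in> carrier G"
  shows "inv x \<otimes> (x \<otimes> y) = y" "x \<otimes> (inv x \<otimes> y) = y"
  using assms by (simp_all add: m_assoc[symmetric])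

lemma commutator_mult_right:
  assumes "x \<in> carrier G" "y \<in> carrier G" "z \<in> carrier G"
  shows "commutator x (y \<otimes> z) = commutator x y \<otimes> (y \<otimes> commutator x z \<otimes> inv y)"
  using assms by (simp add: commutator_def inv_mult_group m_assoc cancel_left)

lemma commutator_mult_left:
  assumes "x \<in> carrier G" "y \<in> carrier G" "z \<in> carrier G"
  shows "commutator (x \<otimes> z) y = x \<otimes> commutator z y \<otimes> inv x \<otimes> commutator x y"
  using assms by (simp add: commutator_def inv_mult_group m_assoc cancel_left)

lemma commutator_inv_right:
  assumes "x \<in> carrier G" "y \<in> carrier G"
  shows "commutator x (inv y) = inv y \<otimes> inv (commutator x y) \<otimes> inv (inv y)"
  using assms by (simp add: commutator_def inv_mult_group m_assoc cancel_left)

lemma commutator_inv_left: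
  assumes "x \<in> carrier G" "y \<in> carrier G"
  shows "commutator (inv x) y = inv x \<otimes> inv (commutator x y) \<otimes> inv (inv x)"
  using assms by (simp add: commutator_def inv_mult_group m_assoc cancel_left)

lemma commutator_one:
  assumes "x \<in> carrier G" shows "commutator x \<one> = \<one>" "commutator \<one> x = \<one>"
  using assms by (simp_all add: commutator_def)

lemma conj_commutator:
  assumes "x \<in> carrier G" "y \<in> carrier G"
  shows "x \<otimes> y \<otimes> inv x = commutator x y \<otimes> y"
  using assms by (simp add: commutator_def m_assoc)

lemma commutator_swap:
  assumes "x \<in> carrier G" "y \<in> carrier G"
  shows "commutator y x = inv (commutator x y)"
  using assms by (simp add: commutator_def inv_mult_group m_assoc)

text \<open>Conjugation by \<open>x\<close> changes \<open>n\<close> by the factor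
  \<open>commutator x n\<close>, so control of commutators is enough.\<close>

lemma normalizes_commutator:
  assumes "subgroup N G" "x \<in> carrier G" "\<And>n. n \<in> N \<Longrightarrow> commutator x n \<in> N"
    "\<And>n. n \<in> N \<Longrightarrow> commutator (inv x) n \<in> N"
  shows "normalizes G x N"
  unfolding normalizes_def
proof (intro ballI conjI)
  interpret N: subgroup N G by fact
  fix n assume n: "n \<in> N"
  show "x \<otimes> n \<otimes> inv x \<in> N" using conj_commutator[OF assms(2) N.mem_carrier[OF n]] assms(3)[OF n] n by simp
  show "inv x \<otimes> n \<otimes> x \<in> N"
    using conj_commutator[OF inv_closed[OF assms(2)] N.mem_carrier[OF n]] assms(2) assms(4)[OF n] n by simp
qed

text \<open>Together with its left-hand counterpart this allows inclusions between commutators to be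
  checked on generators.\<close>

lemma subgroup_commutator_right:
  assumes K: "subgroup K G" and nK: "\<And>y k. y \<in> carrier G \<Longrightarrow> k \<in> K \<Longrightarrow> y \<otimes> k \<otimes> inv y \<in> K" and x: "x \<in> carrier G"
  shows "subgroup {y \<in> carrier G. commutator x y \<in> K} G"
proof (rule subgroupI)
  interpret K: subgroup K G by fact
  show "{y \<in> carrier G. commutator x y \<in> K} \<noteq> {}" using commutator_one(1)[OF x] one_closed K.one_closed by auto
  fix y assume "y \<in> {y \<in> carrier G. commutator x y \<in> K}"
  then have y: "y \<in> carrier G" "commutator x y \<in> K" by auto
  show "inv y \<in> {y \<in> carrier G. commutator x y \<in> K}"
    using y nK[of "inv y" "inv (commutator x y)"] commutator_inv_right[OF x y(1)] by simp
  fix z assume "z \<in> {y \<in> carrier G. commutator x y \<in> K}"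
  then have z: "z \<in> carrier G" "commutator x z \<in> K" by auto
  show "y \<otimes> z \<in> {y \<in> carrier G. commutator x y \<in> K}"
    using y z nK[OF y(1) z(2)] commutator_mult_right[OF x y(1) z(1)] by simp
qed auto

lemma subgroup_commutator_left:
  assumes K: "subgroup K G" and nK: "\<And>y k. y \<in> carrier G \<Longrightarrow> k \<in> K \<Longrightarrow> y \<otimes> k \<otimes> inv y \<in> K" and y: "y \<in> carrier G"
  shows "subgroup {x \<in> carrier G. commutator x y \<in> K} G"
proof (rule subgroupI)
  interpret K: subgroup K G by fact
  show "{x \<in> carrier G. commutator x y \<in> K} \<noteq> {}" using commutator_one(2)[OF y] one_closed K.one_closed by auto
  fix x assume "x \<in> {x \<in> carrier G. commutator x y \<in> K}"
  then have x: "x \<in> carrier G" "commutator x y \<in> K" by auto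
  show "inv x \<in> {x \<in> carrier G. commutator x y \<in> K}"
    using x nK[of "inv x" "inv (commutator x y)"] commutator_inv_left[OF x(1) y] by simp
  fix z assume "z \<in> {x \<in> carrier G. commutator x y \<in> K}"
  then have z: "z \<in> carrier G" "commutator z y \<in> K" by auto
  show "x \<otimes> z \<in> {x \<in> carrier G. commutator x y \<in> K}"
    using x z nK[OF x(1) z(2)] commutator_mult_left[OF x(1) y z(1)] by simp
qed auto

section \<open>Cyclic extensions and subgroups of polycyclic groups\<close>

definition adjoin :: "'a set \<Rightarrow> 'a \<Rightarrow> 'a set" where
  "adjoin N x = {n \<otimes> x [^] (j::int) |n j. n \<in> N}"

lemma normalizes_move:
  assumes "normalizes G x N" "N \<subseteq> carrier G" "x \<in> carrier G" "n \<in> N"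
  shows "\<exists>n' \<in> N. x \<otimes> n = n' \<otimes> x" "\<exists>n' \<in> N. n \<otimes> x = x \<otimes> n'"
proof -
  have nc: "n \<in> carrier G" using assms by blast
  have "x \<otimes> n = (x \<otimes> n \<otimes> inv x) \<otimes> x" using nc assms(3) by (simp add: m_assoc)
  then show "\<exists>n' \<in> N. x \<otimes> n = n' \<otimes> x" using assms(1,4) by (auto simp: normalizes_def)
  have "n \<otimes> x = x \<otimes> (inv x \<otimes> n \<otimes> x)" using nc assms(3) by (simp add: m_assoc cancel_left)
  then show "\<exists>n' \<in> N. n \<otimes> x = x \<otimes> n'" using assms(1,4) by (auto simp: normalizes_def)
qed

lemma adjoin:
  assumes N: "subgroup N G" and x: "x \<in> carrier G" and nx: "normalizes G x N"
  shows "subgroup (adjoin N x) G" "N \<subseteq> adjoin N x" "x \<in> adjoin N x"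
proof -
  interpret N: subgroup N G by fact
  show NA: "N \<subseteq> adjoin N x"
  proof
    fix n assume "n \<in> N"
    then show "n \<in> adjoin N x" unfolding adjoin_def by (auto intro!: exI[of _ n] exI[of _ "0::int"])
  qed
  show "x \<in> adjoin N x"
    unfolding adjoin_def using x N.one_closed by (auto intro!: exI[of _ \<one>] exI[of _ "1::int"])
  have nxj: "normalizes G (x [^] j) N" for j :: int by (rule normalizes_int_pow[OF nx N.subset x])
  have xj: "x [^] j \<in> carrier G" for j :: int using x by simp
  show "subgroup (adjoin N x) G"
  proof (rule subgroupI)
    show "adjoin N x \<subseteq> carrier G" using N.subset x by (auto simp: adjoin_def)
    show "adjoin N x \<noteq> {}" using NA N.one_closed by blast
    fix a assume "a \<in> adjoin N x"
    then obtain n j where a: "n \<in> N" "a = n \<otimes> x [^] (j::int)" by (auto simp: adjoin_def)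
    have "inv a = x [^] (- j) \<otimes> inv n" using a x N.mem_carrier by (simp add: inv_mult_group int_pow_neg)
    moreover obtain n' where "n' \<in> N" "x [^] (- j) \<otimes> inv n = n' \<otimes> x [^] (- j)"
      using normalizes_move(1)[OF nxj N.subset xj, of "inv n" "- j"] a(1) by blast
    ultimately show "inv a \<in> adjoin N x" by (auto simp: adjoin_def)
    fix b assume "b \<in> adjoin N x"
    then obtain m i where b: "m \<in> N" "b = m \<otimes> x [^] (i::int)" by (auto simp: adjoin_def)
    obtain m' where m': "m' \<in> N" "x [^] j \<otimes> m = m' \<otimes> x [^] j"
      using normalizes_move(1)[OF nxj N.subset xj b(1), of j] by blast
    have c: "n \<in> carrier G" "m \<in> carrier G" "m' \<in> carrier G" using a b m' N.mem_carrier by auto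
    have "a \<otimes> b = n \<otimes> (x [^] j \<otimes> m) \<otimes> x [^] i" using a b c xj by (simp add: m_assoc)
    also have "\<dots> = (n \<otimes> m') \<otimes> x [^] (j + i)" using m'(2) c xj x by (simp add: m_assoc int_pow_mult)
    finally show "a \<otimes> b \<in> adjoin N x" using a(1) m'(1) by (auto simp: adjoin_def)
  qed
qed

lemma adjoin_least:
  assumes "subgroup H G" "N \<subseteq> H" "x \<in> H" shows "adjoin N x \<subseteq> H"
  using assms subgroup_int_pow_closed[OF assms(1,3)] subgroup.m_closed[OF assms(1)] by (auto simp: adjoin_def)

text \<open>The power law in the cyclic quotient of \<open>adjoin N x\<close> by \<open>N\<close>,
  stated with representatives because only \<open>x\<close> is known to normalize
  \<open>N\<close>.\<close>

lemma coset_int_pow: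
  assumes N: "subgroup N G" and x: "x \<in> carrier G" and nx: "normalizes G x N" and m: "m \<in> N"
  shows "\<exists>n \<in> N. (m \<otimes> x [^] (j::int)) [^] (e::int) = n \<otimes> x [^] (j * e)"
proof -
  interpret N: subgroup N G by fact
  have nxj: "normalizes G (x [^] i) N" for i :: int by (rule normalizes_int_pow[OF nx N.subset x])
  have xi: "x [^] i \<in> carrier G" for i :: int using x by simp
  have nat: "\<exists>n \<in> N. (m \<otimes> x [^] j) [^] (t::nat) = n \<otimes> x [^] (j * int t)" for t
  proof (induction t)
    case 0 then show ?case using N.one_closed by (intro bexI[of _ \<one>]) auto
  next
    case (Suc t)
    then obtain n' where n': "n' \<in> N" "(m \<otimes> x [^] j) [^] t = n' \<otimes> x [^] (j * int t)" by blast
    obtain k where k: "k \<in> N" "x [^] (j * int t) \<otimes> m = k \<otimes> x [^] (j * int t)"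
      using normalizes_move(1)[OF nxj N.subset xi m, of "j * int t"] by blast
    have c: "m \<in> carrier G" "n' \<in> carrier G" "k \<in> carrier G" using m n' k N.mem_carrier by auto
    have "(m \<otimes> x [^] j) [^] Suc t = n' \<otimes> (x [^] (j * int t) \<otimes> m) \<otimes> x [^] j"
      using n'(2) c xi by (simp add: m_assoc)
    also have "\<dots> = (n' \<otimes> k) \<otimes> x [^] (j * int t + j)" using k(2) c xi x by (simp only: m_assoc int_pow_mult m_closed)
    finally show ?case using n'(1) k(1) by (intro bexI[of _ "n' \<otimes> k"]) (auto simp: algebra_simps)
  qed
  show ?thesis
  proof (cases "0 \<le> e")
    case True
    then have "(m \<otimes> x [^] j) [^] e = (m \<otimes> x [^] j) [^] nat e" by (rule pow_nat[symmetric])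
    then show ?thesis using nat[of "nat e"] True by simp
  next
    case False
    then have *: "(m \<otimes> x [^] j) [^] e = inv ((m \<otimes> x [^] j) [^] nat (- e))" by (subst int_pow_def2) simp
    obtain n' where n': "n' \<in> N" "(m \<otimes> x [^] j) [^] nat (- e) = n' \<otimes> x [^] (- (j * e))"
      using nat[of "nat (- e)"] False by auto
    have "inv (n' \<otimes> x [^] (- (j * e))) = x [^] (j * e) \<otimes> inv n'"
      using n'(1) N.mem_carrier x by (simp add: inv_mult_group int_pow_neg)
    moreover obtain k where "k \<in> N" "x [^] (j * e) \<otimes> inv n' = k \<otimes> x [^] (j * e)"
      using normalizes_move(1)[OF nxj N.subset xi, of "inv n'" "j * e"] n'(1) by blast
    ultimately show ?thesis using * n'(2) by (intro bexI[of _ k]) auto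
  qed
qed

lemma polycyclic_adjoin:
  assumes "polycyclic G N" "subgroup N G" "x \<in> carrier G" "normalizes G x N"
  shows "polycyclic G (adjoin N x)"
proof (rule polycyclic.extend[OF assms(1,2) _ _ _ assms(4)])
  show "subgroup (adjoin N x) G" "N \<subseteq> adjoin N x" "x \<in> adjoin N x" using adjoin[OF assms(2-4)] .
  show "\<exists>n\<in>N. \<exists>j::int. k = n \<otimes> x [^] j" if "k \<in> adjoin N x" for k using that by (auto simp: adjoin_def)
qed

text \<open>Modulo \<open>N\<close>, the exponents of \<open>x\<close> that occur in
  \<open>H\<close> form a subgroup of the integers, so \<open>H\<close> is again a cyclic extension
  of \<open>H \<inter> N\<close>.\<close>

lemma polycyclic_subgroup:
  assumes "polycyclic G K" "subgroup H G" "H \<subseteq> K"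
  shows "polycyclic G H"
  using assms
proof (induction arbitrary: H)
  case trivial
  then have "H = {\<one>}" using subgroup.one_closed by blast
  then show ?case using polycyclic.trivial by simp
next
  case (extend N K x)
  interpret H: subgroup H G by fact
  interpret N: subgroup N G by fact
  have xG: "x \<in> carrier G" using extend.hyps subgroup.subset by blast
  have xj: "x [^] j \<in> carrier G" for j :: int using xG by simp
  have sHN: "subgroup (H \<inter> N) G" by (rule subgroups_Inter_pair) (use extend in auto)
  have pHN: "polycyclic G (H \<inter> N)" by (rule extend.IH[OF sHN]) simp
  define J where "J = {j::int. \<exists>n \<in> N. n \<otimes> x [^] j \<in> H}"
  have nxj: "normalizes G (x [^] j) N" for j :: int by (rule normalizes_int_pow[OF extend.hyps(6) N.subset xG])
  have Jdiff: "i - d * j \<in> J" if i: "i \<in> J" and j: "j \<in> J" for i j d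
  proof -
    obtain n m where nm: "n \<in> N" "n \<otimes> x [^] i \<in> H" "m \<in> N" "m \<otimes> x [^] j \<in> H" using i j by (auto simp: J_def)
    have "\<exists>m' \<in> N. (m \<otimes> x [^] j) [^] (- d) = m' \<otimes> x [^] (j * - d)"
      by (rule coset_int_pow[OF extend.hyps(2) xG extend.hyps(6) nm(3)])
    then obtain m' where m': "m' \<in> N" "(m \<otimes> x [^] j) [^] (- d) = m' \<otimes> x [^] (- d * j)" by (auto simp: mult.commute)
    obtain m'' where m'': "m'' \<in> N" "x [^] i \<otimes> m' = m'' \<otimes> x [^] i"
      using normalizes_move(1)[OF nxj N.subset xj m'(1), of i] by blast
    have c: "n \<in> carrier G" "m' \<in> carrier G" "m'' \<in> carrier G" using nm m' m'' N.mem_carrier by auto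
    have "(n \<otimes> x [^] i) \<otimes> (m \<otimes> x [^] j) [^] (- d) \<in> H"
      using nm subgroup_int_pow_closed[OF extend.prems(1)] by auto
    also have "(n \<otimes> x [^] i) \<otimes> (m \<otimes> x [^] j) [^] (- d) = n \<otimes> (x [^] i \<otimes> m') \<otimes> x [^] (- d * j)"
      using m'(2) c xj by (simp add: m_assoc)
    also have "\<dots> = (n \<otimes> m'') \<otimes> x [^] (i + - d * j)" using m''(2) c xj xG by (simp only: m_assoc int_pow_mult m_closed)
    finally show ?thesis unfolding J_def using nm(1) m''(1) by auto
  qed
  have J0: "0 \<in> J" unfolding J_def using H.one_closed N.one_closed by (auto intro!: bexI[of _ \<one>])
  show ?case
  proof (cases "\<exists>j \<in> J. j \<noteq> 0")
    case False
    have "h \<in> N" if h: "h \<in> H" for h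
    proof -
      have "h \<in> K" using h extend.prems by blast
      then obtain n j where nj: "n \<in> N" "h = n \<otimes> x [^] (j::int)" using extend.hyps(7) by blast
      then have "j = 0" using False h by (auto simp: J_def)
      then show ?thesis using nj N.mem_carrier by simp
    qed
    then have "H \<inter> N = H" by blast
    then show ?thesis using pHN by simp
  next
    case True
    then obtain j0 where j0: "j0 \<in> J" "j0 \<noteq> 0" by blast
    \<comment> \<open>The positive generator of the group of exponents; an element of
      \<open>H\<close> with this exponent generates \<open>H\<close> modulo
      \<open>H \<inter> N\<close>.\<close>
    define d where "d = (LEAST n. 0 < n \<and> int n \<in> J)"
    have "\<bar>j0\<bar> \<in> J"
      using Jdiff[OF J0 j0(1), of 1] j0(1) by (cases "0 \<le> j0") auto
    then have ex: "0 < nat \<bar>j0\<bar> \<and> int (nat \<bar>j0\<bar>) \<in> J" using j0(2) by simp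
    have d: "0 < d" "int d \<in> J" using LeastI[of "\<lambda>n. 0 < n \<and> int n \<in> J", OF ex] by (auto simp: d_def)
    have dmin: "d \<le> n" if "0 < n" "int n \<in> J" for n using Least_le[of "\<lambda>n. 0 < n \<and> int n \<in> J" n] that by (simp add: d_def)
    have div: "int d dvd j" if "j \<in> J" for j
    proof (rule ccontr)
      assume nd: "\<not> int d dvd j"
      have "j - (j div int d) * int d \<in> J" by (rule Jdiff[OF that d(2)])
      then have m: "j mod int d \<in> J" by (simp add: minus_div_mult_eq_mod)
      have pos: "0 < j mod int d" using nd d(1) by (metis dvd_eq_mod_eq_0 less_le of_nat_0_less_iff pos_mod_sign)
      then have "d \<le> nat (j mod int d)" using m by (intro dmin) auto
      moreover have "j mod int d < int d" using d(1) by simp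
      ultimately show False using pos by linarith
    qed
    obtain m where m: "m \<in> N" "m \<otimes> x [^] int d \<in> H" using d(2) by (auto simp: J_def)
    define y where "y = m \<otimes> x [^] int d"
    have yG: "y \<in> carrier G" using m H.mem_carrier by (simp add: y_def)
    have yH: "y \<in> H" using m by (simp add: y_def)
    have ny: "normalizes G y (H \<inter> N)"
    proof -
      have "normalizes G m N" unfolding normalizes_def using m(1) by auto
      then have "normalizes G y N" unfolding y_def
        by (rule normalizes_mult[OF _ nxj N.subset N.mem_carrier[OF m(1)] xj])
      then show ?thesis using yH by (auto simp: normalizes_def)
    qed
    show ?thesis
    proof (rule polycyclic.extend[OF pHN sHN extend.prems(1) _ yH ny])
      fix h assume h: "h \<in> H"
      then have "h \<in> K" using extend.prems by blast
      then obtain n j where nj: "n \<in> N" "h = n \<otimes> x [^] (j::int)" using extend.hyps(7) by blast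
      then have "j \<in> J" using h by (auto simp: J_def)
      then obtain e where e: "j = int d * e" using div by (auto simp: dvd_def)
      have yeH: "y [^] e \<in> H" by (rule subgroup_int_pow_closed[OF extend.prems(1) yH])
      have sA: "subgroup (adjoin N x) G" using adjoin[OF extend.hyps(2) xG extend.hyps(6)] by blast
      have "\<exists>n' \<in> N. y [^] e = n' \<otimes> x [^] (int d * e)"
        unfolding y_def by (rule coset_int_pow[OF extend.hyps(2) xG extend.hyps(6) m(1)])
      then obtain n' where n': "n' \<in> N" "y [^] e = n' \<otimes> x [^] j" using e by auto
      have c: "n \<in> carrier G" "n' \<in> carrier G" using nj n' N.mem_carrier by auto
      have "h \<otimes> inv (y [^] e) = n \<otimes> inv n'"
        using nj(2) n'(2) c xj by (simp add: inv_mult_group m_assoc cancel_left)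
      then have "h \<otimes> inv (y [^] e) \<in> H \<inter> N" using h yeH nj(1) n'(1) by (metis H.m_closed H.m_inv_closed IntI N.m_closed N.m_inv_closed)
      moreover have "h = (h \<otimes> inv (y [^] e)) \<otimes> y [^] e" using h H.mem_carrier yG by (simp add: m_assoc)
      ultimately show "\<exists>n\<in>H \<inter> N. \<exists>j::int. h = n \<otimes> y [^] j" by blast
    qed auto
  qed
qed

end

section \<open>Subgroups of finite index\<close>

text \<open>The set \<open>K\<close> meets at most \<open>B\<close> right cosets of
  \<open>H\<close>. The representatives are taken in \<open>G\<close> and \<open>H\<close> may stick
  out of \<open>K\<close>, so a covering survives when \<open>H\<close> is enlarged.\<close>

definition covered :: "('g, 'b) monoid_scheme \<Rightarrow> 'g set \<Rightarrow> 'g set \<Rightarrow> nat \<Rightarrow> bool" where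
  "covered G H K B \<longleftrightarrow> (\<exists>T. finite T \<and> card T \<le> B \<and> T \<subseteq> carrier G \<and> (\<forall>k \<in> K. \<exists>h \<in> H. \<exists>t \<in> T. k = h \<otimes>\<^bsub>G\<^esub> t))"

context group
begin

lemma coveredI:
  assumes "finite T" "card T \<le> B" "T \<subseteq> carrier G" "\<And>k. k \<in> K \<Longrightarrow> \<exists>h \<in> H. \<exists>t \<in> T. k = h \<otimes> t"
  shows "covered G H K B"
  unfolding covered_def by (intro exI[of _ T] conjI ballI assms)

lemma covered_mono:
  assumes "covered G H K B" "H \<subseteq> H'" shows "covered G H' K B"
proof -
  obtain T where T: "finite T" "card T \<le> B" "T \<subseteq> carrier G" "\<forall>k \<in> K. \<exists>h \<in> H. \<exists>t \<in> T. k = h \<otimes> t"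
    using assms(1) unfolding covered_def by (elim exE conjE)
  show ?thesis
  proof (rule coveredI[OF T(1-3)])
    fix k assume "k \<in> K"
    then obtain h t where "h \<in> H" "t \<in> T" "k = h \<otimes> t" using T(4) by blast
    then show "\<exists>h\<in>H'. \<exists>t\<in>T. k = h \<otimes> t" using assms(2) by blast
  qed
qed

lemma covered_le:
  assumes "covered G H K B" "B \<le> B'" shows "covered G H K B'"
proof -
  obtain T where T: "finite T" "card T \<le> B" "T \<subseteq> carrier G" "\<forall>k \<in> K. \<exists>h \<in> H. \<exists>t \<in> T. k = h \<otimes> t"
    using assms(1) unfolding covered_def by blast
  show ?thesis by (rule coveredI[of T]) (use T assms(2) in auto)
qed

lemma covered_self: "H \<subseteq> carrier G \<Longrightarrow> covered G H H 1"
proof (rule coveredI[of "{\<one>}"])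
  fix k assume "H \<subseteq> carrier G" "k \<in> H"
  then have "k = k \<otimes> \<one>" by (simp add: subset_iff)
  then show "\<exists>h\<in>H. \<exists>t\<in>{\<one>}. k = h \<otimes> t" using \<open>k \<in> H\<close> by blast
qed auto

lemma covered_trans:
  assumes "covered G H1 K B1" "covered G H2 H1 B2" "H2 \<subseteq> carrier G"
  shows "covered G H2 K (B1 * B2)"
proof -
  obtain T1 where T1: "finite T1" "card T1 \<le> B1" "T1 \<subseteq> carrier G" "\<forall>k \<in> K. \<exists>h \<in> H1. \<exists>t \<in> T1. k = h \<otimes> t"
    using assms(1) unfolding covered_def by blast
  obtain T2 where T2: "finite T2" "card T2 \<le> B2" "T2 \<subseteq> carrier G" "\<forall>k \<in> H1. \<exists>h \<in> H2. \<exists>t \<in> T2. k = h \<otimes> t"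
    using assms(2) unfolding covered_def by blast
  let ?T = "(\<lambda>(t1, t2). t2 \<otimes> t1) ` (T1 \<times> T2)"
  show ?thesis
  proof (rule coveredI[of ?T])
    show "finite ?T" using T1 T2 by simp
    have "card ?T \<le> card (T1 \<times> T2)" by (rule card_image_le) (use T1 T2 in simp)
    also have "\<dots> \<le> B1 * B2" using T1 T2 by (simp add: card_cartesian_product mult_le_mono)
    finally show "card ?T \<le> B1 * B2" .
    show "?T \<subseteq> carrier G" using T1 T2 by auto
    fix k assume "k \<in> K"
    then obtain h1 t1 where 1: "h1 \<in> H1" "t1 \<in> T1" "k = h1 \<otimes> t1" using T1(4) by blast
    then obtain h2 t2 where 2: "h2 \<in> H2" "t2 \<in> T2" "h1 = h2 \<otimes> t2" using T2(4) by blast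
    have "h2 \<in> carrier G" "t2 \<in> carrier G" "t1 \<in> carrier G" using 1 2 T1 T2 assms(3) by auto
    then have "k = h2 \<otimes> (t2 \<otimes> t1)" using 1 2 by (simp add: m_assoc)
    then show "\<exists>h\<in>H2. \<exists>t\<in>?T. k = h \<otimes> t" using 1 2 by (intro bexI[of _ h2] bexI[of _ "t2 \<otimes> t1"]) auto
  qed
qed

text \<open>The given representatives may lie outside \<open>K'\<close>; each is replaced by an
  element of \<open>K'\<close> from the same coset, if there is one.\<close>

lemma covered_into:
  assumes "covered G H K B" "subgroup H G" "subgroup K' G" "K' \<subseteq> K"
  shows "covered G (H \<inter> K') K' B"
proof -
  interpret H: subgroup H G by fact
  interpret K: subgroup K' G by fact
  obtain T where T: "finite T" "card T \<le> B" "T \<subseteq> carrier G" "\<forall>k \<in> K. \<exists>h \<in> H. \<exists>t \<in> T. k = h \<otimes> t"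
    using assms(1) unfolding covered_def by blast
  define U where "U = {t \<in> T. \<exists>h \<in> H. h \<otimes> t \<in> K'}"
  have "\<forall>t \<in> U. \<exists>s. s \<in> K' \<and> (\<exists>h \<in> H. s = h \<otimes> t)" unfolding U_def by blast
  from bchoice[OF this] obtain s where s: "\<And>t. t \<in> U \<Longrightarrow> s t \<in> K' \<and> (\<exists>h \<in> H. s t = h \<otimes> t)" by blast
  have UT: "U \<subseteq> T" by (auto simp: U_def)
  show ?thesis
  proof (rule coveredI[of "s ` U"])
    show "finite (s ` U)" using UT T finite_subset by blast
    show "card (s ` U) \<le> B"
      using card_image_le[of U s] card_mono[OF T(1) UT] T(1,2) UT finite_subset[of U T] by linarith
    show "s ` U \<subseteq> carrier G" using s K.subset by blast
    fix k assume k: "k \<in> K'"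
    then obtain h t where ht: "h \<in> H" "t \<in> T" "k = h \<otimes> t" using T(4) assms(4) by blast
    then have t: "t \<in> U" using k by (auto simp: U_def)
    from s[OF t] obtain h' where h': "s t \<in> K'" "h' \<in> H" "s t = h' \<otimes> t" by blast
    have c: "h \<in> carrier G" "h' \<in> carrier G" "t \<in> carrier G" using ht h' T H.subset by auto
    have e: "k \<otimes> inv (s t) = h \<otimes> inv h'" using c ht h' by (simp add: inv_mult_group m_assoc cancel_left)
    have "h \<otimes> inv h' \<in> H" using ht(1) h'(2) by simp
    moreover have "k \<otimes> inv (s t) \<in> K'" using k h'(1) by simp
    moreover have "k = (k \<otimes> inv (s t)) \<otimes> s t" using K.mem_carrier[OF k] K.mem_carrier[OF h'(1)] by (simp add: m_assoc)
    ultimately show "\<exists>h\<in>H \<inter> K'. \<exists>t\<in>s ` U. k = h \<otimes> t" using e t by (intro bexI[of _ "k \<otimes> inv (s t)"] bexI[of _ "s t"]) auto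
  qed
qed

text \<open>Two of the powers of \<open>g\<close> with exponents from 0 to \<open>B\<close> lie in
  the same coset, so some exponent between 1 and \<open>B\<close> leads into \<open>H\<close>; the
  factorial is a multiple of whichever it is.\<close>

lemma covered_pow:
  assumes "covered G H K B" "subgroup H G" "subgroup K G" "g \<in> K"
  shows "g [^] (fact B :: nat) \<in> H"
proof -
  interpret H: subgroup H G by fact
  interpret K: subgroup K G by fact
  obtain T where T: "finite T" "card T \<le> B" "T \<subseteq> carrier G" "\<forall>k \<in> K. \<exists>h \<in> H. \<exists>t \<in> T. k = h \<otimes> t"
    using assms(1) unfolding covered_def by blast
  have g: "g \<in> carrier G" using assms(4) by simp
  have gK: "g [^] i \<in> K" for i :: nat by (induction i) (use assms(4) in auto)
  have "\<forall>i::nat. \<exists>t. t \<in> T \<and> (\<exists>h \<in> H. g [^] i = h \<otimes> t)" using bspec[OF T(4) gK] by blast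
  from choice[OF this] obtain f where f: "\<And>i::nat. f i \<in> T \<and> (\<exists>h \<in> H. g [^] i = h \<otimes> f i)" by blast
  have "card (f ` {..B}) \<le> card T" using f T(1) by (intro card_mono) auto
  then have "card (f ` {..B}) < card {..B}" using T(2) by simp
  then have "\<not> inj_on f {..B}" by (rule pigeonhole)
  then obtain i j where "i \<in> {..B}" "j \<in> {..B}" "i \<noteq> j" "f i = f j" by (auto simp: inj_on_def)
  then obtain i j where ij: "i < j" "j \<le> B" "f i = f j"
    by (metis atMost_iff linorder_neqE_nat)
  obtain h where h: "h \<in> H" "g [^] i = h \<otimes> f i" using f by blast
  obtain h' where h': "h' \<in> H" "g [^] j = h' \<otimes> f i" using f[of j] ij by auto
  have c: "h \<in> carrier G" "h' \<in> carrier G" "f i \<in> carrier G" using h h' f T(3) by auto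
  have "g [^] j \<otimes> inv (g [^] i) = h' \<otimes> inv h" using c h h' by (simp add: inv_mult_group m_assoc cancel_left)
  moreover have "g [^] j = g [^] (j - i) \<otimes> g [^] i" using ij g nat_pow_mult[OF g, of "j - i" i] by simp
  ultimately have "g [^] (j - i) = h' \<otimes> inv h" using g by (simp add: m_assoc)
  then have gh: "g [^] (j - i) \<in> H" using h h' by simp
  have "(j - i) dvd fact B" using ij by (intro dvd_fact) auto
  then obtain e where e: "fact B = (j - i) * e" by (auto simp: dvd_def)
  have "(g [^] (j - i)) [^] e \<in> H" by (induction e) (use gh in auto)
  then show ?thesis using g e by (simp add: nat_pow_pow)
qed

lemma covered_adjoin:
  assumes H: "subgroup H G" and u: "u \<in> carrier G" "normalizes G u H" and e: "0 < e" "u [^] (e::nat) \<in> H"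
  shows "covered G H (adjoin H u) e"
proof (rule coveredI[of "(\<lambda>i::nat. u [^] i) ` {..<e}"])
  interpret H: subgroup H G by fact
  show "card ((\<lambda>i::nat. u [^] i) ` {..<e}) \<le> e" using card_image_le[of "{..<e}" "\<lambda>i::nat. u [^] i"] by simp
  show "(\<lambda>i::nat. u [^] i) ` {..<e} \<subseteq> carrier G" using u by auto
  fix k assume "k \<in> adjoin H u"
  then obtain h j where k: "h \<in> H" "k = h \<otimes> u [^] (j::int)" by (auto simp: adjoin_def)
  define q where "q = j div int e"
  define r where "r = nat (j mod int e)"
  have r: "r < e" "j = int e * q + int r" using e by (auto simp: r_def q_def nat_less_iff)
  have ue: "u [^] int e \<in> H" using e(2) by (simp add: int_pow_int)
  have "u [^] j = (u [^] int e) [^] q \<otimes> u [^] r" using r(2) u by (simp add: int_pow_mult int_pow_pow flip: int_pow_int)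
  then have "k = (h \<otimes> (u [^] int e) [^] q) \<otimes> u [^] r" using k u by (simp add: m_assoc)
  moreover have "h \<otimes> (u [^] int e) [^] q \<in> H" using k(1) subgroup_int_pow_closed[OF H ue] by simp
  ultimately show "\<exists>h\<in>H. \<exists>t\<in>(\<lambda>i::nat. u [^] i) ` {..<e}. k = h \<otimes> t" using r(1) by blast
qed simp

text \<open>The least \<open>B\<close> with \<open>covered G H (carrier G) B\<close> is the index of \<open>H\<close>.\<close>

lemma covered_index_increases:
  assumes H: "subgroup H G" and H': "subgroup H' G" "H' \<subseteq> H" "H' \<noteq> H"
    and c: "covered G H' (carrier G) B"
  shows "0 < B" "covered G H (carrier G) (B - 1)"
proof -
  interpret H: subgroup H G by fact
  interpret H': subgroup H' G by fact
  obtain T where T: "finite T" "card T \<le> B" "T \<subseteq> carrier G" "\<forall>k \<in> carrier G. \<exists>h \<in> H'. \<exists>t \<in> T. k = h \<otimes> t"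
    using c unfolding covered_def by blast
  obtain x where x: "x \<in> H" "x \<notin> H'" using H' by blast
  obtain h1 t1 where 1: "h1 \<in> H'" "t1 \<in> T" "\<one> = h1 \<otimes> t1" using bspec[OF T(4) one_closed] by blast
  obtain h2 t2 where 2: "h2 \<in> H'" "t2 \<in> T" "x = h2 \<otimes> t2" using bspec[OF T(4), of x] x(1) H.subset by blast
  have cc: "h1 \<in> carrier G" "h2 \<in> carrier G" "t1 \<in> carrier G" "t2 \<in> carrier G" using 1 2 T(3) by auto
  have t1: "t1 = inv h1" using 1(3) cc by (metis inv_equality inv_inv)
  have t2: "t2 = inv h2 \<otimes> x" using 2(3) cc by (simp add: cancel_left)
  have ne: "t1 \<noteq> t2"
  proof
    assume "t1 = t2"
    then have "x = h2 \<otimes> inv h1" using 2(3) t1 by simp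
    then show False using x(2) 1(1) 2(1) by simp
  qed
  have hh: "h1 \<in> H" "h2 \<in> H" using 1 2 H' by auto
  have t12: "t2 \<otimes> inv t1 \<in> H" using t1 t2 hh x(1) by simp
  show "0 < B" using T(1,2) 1(2) by (metis card_gt_0_iff empty_iff le_zero_eq neq0_conv)
  show "covered G H (carrier G) (B - 1)"
  proof (rule coveredI[of "T - {t2}"])
    show "card (T - {t2}) \<le> B - 1" using T(1,2) 2(2) by simp
    fix k assume "k \<in> carrier G"
    then obtain h t where ht: "h \<in> H'" "t \<in> T" "k = h \<otimes> t" using T(4) by blast
    show "\<exists>h\<in>H. \<exists>t\<in>T - {t2}. k = h \<otimes> t"
    proof (cases "t = t2")
      case False then show ?thesis using ht H' by blast
    next
      case True
      have "k = (h \<otimes> (t2 \<otimes> inv t1)) \<otimes> t1" using ht True cc H'.mem_carrier[OF ht(1)] by (simp add: m_assoc)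
      moreover have "h \<otimes> (t2 \<otimes> inv t1) \<in> H" using t12 ht(1) H' by auto
      ultimately show ?thesis using 1(2) ne by blast
    qed
  qed (use T in auto)
qed

text \<open>The measure is the Hirsch length, computed along the series as the number of levels at
  which a subgroup acquires an infinite cyclic factor.\<close>

lemma polycyclic_measure:
  assumes "polycyclic G P"
  shows "\<exists>\<mu> :: 'a set \<Rightarrow> nat. \<forall>K K'. subgroup K G \<longrightarrow> subgroup K' G \<longrightarrow> K' \<subseteq> K \<longrightarrow> K \<subseteq> P \<longrightarrow>
    \<mu> K' \<le> \<mu> K \<and> (\<mu> K' = \<mu> K \<longrightarrow> (\<exists>B. covered G K' K B))"
  using assms
proof induction
  case trivial
  have "covered G K' K 1" if "subgroup K' G" "K' \<subseteq> K" "K \<subseteq> {\<one>}" for K K'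
  proof -
    have "K = K'" using that subgroup.one_closed[of K' G] by blast
    then show ?thesis using covered_self[OF subgroup.subset[OF that(1)]] by simp
  qed
  then show ?case by (intro exI[of _ "\<lambda>_. 0"]) blast
next
  case (extend N P x)
  interpret N: subgroup N G by fact
  have xG: "x \<in> carrier G" using extend.hyps subgroup.subset by blast
  have xj: "x [^] j \<in> carrier G" for j :: int using xG by simp
  have nxj: "normalizes G (x [^] j) N" for j :: int by (rule normalizes_int_pow[OF extend.hyps(6) N.subset xG])
  obtain \<mu> :: "'a set \<Rightarrow> nat" where \<mu>: "\<And>K K'. subgroup K G \<Longrightarrow> subgroup K' G \<Longrightarrow> K' \<subseteq> K \<Longrightarrow> K \<subseteq> N \<Longrightarrow>
    \<mu> K' \<le> \<mu> K \<and> (\<mu> K' = \<mu> K \<longrightarrow> (\<exists>B. covered G K' K B))" using extend.IH by blast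
  \<comment> \<open>The quotient of \<open>K\<close> by \<open>K \<inter> N\<close> embeds in a
    cyclic group, so this level contributes 0 or 1 according to whether it is finite.\<close>
  define fi where "fi K \<longleftrightarrow> (\<exists>B. covered G (K \<inter> N) K B)" for K
  define \<nu> where "\<nu> K = \<mu> (K \<inter> N) + (if fi K then 0 else 1)" for K
  show ?case
  proof (intro exI[of _ \<nu>] allI impI)
    fix K K' assume K: "subgroup K G" and K': "subgroup K' G" and sub: "K' \<subseteq> K" and KP: "K \<subseteq> P"
    have sN: "subgroup (K \<inter> N) G" "subgroup (K' \<inter> N) G" using subgroups_Inter_pair K K' extend.hyps(2) by auto
    have m: "\<mu> (K' \<inter> N) \<le> \<mu> (K \<inter> N)" "\<mu> (K' \<inter> N) = \<mu> (K \<inter> N) \<Longrightarrow> \<exists>B. covered G (K' \<inter> N) (K \<inter> N) B"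
      using \<mu>[OF sN] sub by auto
    have fim: "fi K'" if "fi K"
    proof -
      obtain B where "covered G (K \<inter> N) K B" using \<open>fi K\<close> by (auto simp: fi_def)
      from covered_into[OF this sN(1) K' sub] have "covered G (K \<inter> N \<inter> K') K' B" .
      moreover have "K \<inter> N \<inter> K' = K' \<inter> N" using sub by blast
      ultimately show ?thesis by (auto simp: fi_def)
    qed
    have le: "\<nu> K' \<le> \<nu> K" using m(1) fim by (auto simp: \<nu>_def)
    moreover have "\<exists>B. covered G K' K B" if eq: "\<nu> K' = \<nu> K"
    proof -
      have eqm: "\<mu> (K' \<inter> N) = \<mu> (K \<inter> N)" and eqf: "fi K' \<longleftrightarrow> fi K" using eq m(1) fim by (auto simp: \<nu>_def split: if_splits)
      from m(2)[OF eqm] obtain B where B: "covered G (K' \<inter> N) (K \<inter> N) B" by blast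
      show ?thesis
      proof (cases "fi K")
        case True
        then obtain B' where B': "covered G (K \<inter> N) K B'" by (auto simp: fi_def)
        have "covered G (K' \<inter> N) K (B' * B)" by (rule covered_trans[OF B' B]) auto
        then have "covered G K' K (B' * B)" by (rule covered_mono) auto
        then show ?thesis by blast
      next
        case False
        then have "\<not> fi K'" using eqf by simp
        then have "\<not> K' \<subseteq> N" using covered_self[OF subgroup.subset[OF K']] unfolding fi_def by (metis inf.absorb1)
        \<comment> \<open>Both subgroups are infinite over \<open>N\<close>, so \<open>K'\<close>
          has an element whose exponent of \<open>x\<close> is nonzero. Up to sign this exponent is
          \<open>d\<close>, and reducing exponents of elements of \<open>K\<close> modulo
          \<open>d\<close> leaves the finitely many residues in \<open>I\<close>.\<close>
        then obtain y0 where y0: "y0 \<in> K'" "y0 \<notin> N" by blast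
        then have "y0 \<in> P" using sub KP by blast
        then obtain n0 j0 where nj0: "n0 \<in> N" "y0 = n0 \<otimes> x [^] (j0::int)" using extend.hyps(7) by blast
        then have j0: "j0 \<noteq> 0" using y0(2) by auto
        obtain n1 where n1: "n1 \<in> N" "y0 [^] (sgn j0) = n1 \<otimes> x [^] \<bar>j0\<bar>"
          using coset_int_pow[OF extend.hyps(2) xG extend.hyps(6) nj0(1), of j0 "sgn j0"] nj0(2) by (auto simp: abs_sgn)
        define y where "y = n1 \<otimes> x [^] \<bar>j0\<bar>"
        define d where "d = \<bar>j0\<bar>"
        have d: "0 < d" using j0 by (simp add: d_def)
        have yK': "y \<in> K'" using n1(2) subgroup_int_pow_closed[OF K' y0(1), of "sgn j0"] by (simp add: y_def)
        define I where "I = {r \<in> {0..<d}. \<exists>n \<in> N. n \<otimes> x [^] r \<in> K}"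
        have "\<forall>r \<in> I. \<exists>k. k \<in> K \<and> (\<exists>n \<in> N. k = n \<otimes> x [^] r)" unfolding I_def by blast
        from bchoice[OF this] obtain \<kappa> where \<kappa>: "\<And>r. r \<in> I \<Longrightarrow> \<kappa> r \<in> K \<and> (\<exists>n \<in> N. \<kappa> r = n \<otimes> x [^] r)" by blast
        have fI: "finite I" by (rule finite_subset[of I "{0..<d}"]) (auto simp: I_def)
        obtain T where T: "finite T" "card T \<le> B" "T \<subseteq> carrier G" "\<forall>k \<in> K \<inter> N. \<exists>h \<in> K' \<inter> N. \<exists>t \<in> T. k = h \<otimes> t"
          using B unfolding covered_def by blast
        let ?S = "(\<lambda>(t, r). t \<otimes> \<kappa> r) ` (T \<times> I)"
        have "covered G K' K (card ?S)"
        proof (rule coveredI[of ?S])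
          show "?S \<subseteq> carrier G" using T(3) \<kappa> subgroup.subset[OF K] by auto
          fix k assume k: "k \<in> K"
          then obtain n j where nj: "n \<in> N" "k = n \<otimes> x [^] (j::int)" using extend.hyps(7) KP by blast
          define q where "q = j div d"
          define r where "r = j mod d"
          have r: "r \<in> {0..<d}" "j = d * q + r" using d by (auto simp: r_def q_def)
          obtain n2 where n2: "n2 \<in> N" "y [^] (- q) = n2 \<otimes> x [^] (- (d * q))"
            using coset_int_pow[OF extend.hyps(2) xG extend.hyps(6) n1(1), of "\<bar>j0\<bar>" "- q"] by (auto simp: y_def d_def)
          obtain n3 where n3: "n3 \<in> N" "x [^] (- (d * q)) \<otimes> n = n3 \<otimes> x [^] (- (d * q))"
            using normalizes_move(1)[OF nxj N.subset xj nj(1), of "- (d * q)"] by blast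
          have c: "n \<in> carrier G" "n2 \<in> carrier G" "n3 \<in> carrier G" using nj n2 n3 by auto
          have "y [^] (- q) \<otimes> k = n2 \<otimes> (x [^] (- (d * q)) \<otimes> n) \<otimes> x [^] j" using nj n2 c xj by (simp add: m_assoc)
          also have "\<dots> = (n2 \<otimes> n3) \<otimes> x [^] (- (d * q) + j)"
            unfolding n3(2) using c xj int_pow_mult[OF xG] by (simp only: m_assoc m_closed)
          also have "- (d * q) + j = r" using r(2) by simp
          finally have yk: "y [^] (- q) \<otimes> k = (n2 \<otimes> n3) \<otimes> x [^] r" .
          have yq: "y [^] q \<in> K'" "y [^] (- q) \<in> K'" using subgroup_int_pow_closed[OF K' yK'] by auto
          have ykK: "y [^] (- q) \<otimes> k \<in> K" using yq(2) sub k subgroup.m_closed[OF K] by blast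
          have rI: "r \<in> I" unfolding I_def using r(1) ykK yk n2(1) n3(1) by auto
          from \<kappa>[OF rI] obtain n4 where n4: "\<kappa> r \<in> K" "n4 \<in> N" "\<kappa> r = n4 \<otimes> x [^] r" by blast
          define m where "m = (y [^] (- q) \<otimes> k) \<otimes> inv (\<kappa> r)"
          have "m = (n2 \<otimes> n3) \<otimes> inv n4"
            unfolding m_def yk n4(3) using c n4(2) xj by (simp add: inv_mult_group m_assoc cancel_left)
          then have "m \<in> N" using n2(1) n3(1) n4(2) by simp
          moreover have "m \<in> K" unfolding m_def using ykK n4(1) K by (simp add: subgroup.m_closed subgroup.m_inv_closed)
          ultimately obtain h t where ht: "h \<in> K' \<inter> N" "t \<in> T" "m = h \<otimes> t" using T(4) by blast
          have cy: "y \<in> carrier G" "k \<in> carrier G" "\<kappa> r \<in> carrier G" "h \<in> carrier G" "t \<in> carrier G"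
            using yK' k n4(1) ht K K' T(3) subgroup.mem_carrier by auto
          have "k = y [^] q \<otimes> (y [^] (- q) \<otimes> k)" using cy by (simp add: int_pow_neg cancel_left)
          also have "y [^] (- q) \<otimes> k = m \<otimes> \<kappa> r" unfolding m_def using cy by (simp add: m_assoc)
          also have "y [^] q \<otimes> (m \<otimes> \<kappa> r) = (y [^] q \<otimes> h) \<otimes> (t \<otimes> \<kappa> r)" unfolding ht(3) using cy by (simp add: m_assoc)
          finally have "k = (y [^] q \<otimes> h) \<otimes> (t \<otimes> \<kappa> r)" .
          moreover have "y [^] q \<otimes> h \<in> K'" using yq(1) ht(1) subgroup.m_closed[OF K'] by blast
          moreover have "t \<otimes> \<kappa> r \<in> ?S" using ht(2) rI by auto
          ultimately show "\<exists>h\<in>K'. \<exists>t\<in>?S. k = h \<otimes> t" by blast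
        qed (use T fI in auto)
        then show ?thesis by blast
      qed
    qed
    ultimately show "\<nu> K' \<le> \<nu> K \<and> (\<nu> K' = \<nu> K \<longrightarrow> (\<exists>B. covered G K' K B))" by blast
  qed
qed

lemma polycyclic_finitely_generated:
  assumes "polycyclic G K"
  shows "\<exists>S. finite S \<and> S \<subseteq> K \<and> (\<forall>H. subgroup H G \<longrightarrow> S \<subseteq> H \<longrightarrow> K \<subseteq> H)"
  using assms
proof induction
  case trivial
  then show ?case using subgroup.one_closed by (intro exI[of _ "{}"]) auto
next
  case (extend N K x)
  then obtain S where S: "finite S" "S \<subseteq> N" "\<And>H. subgroup H G \<Longrightarrow> S \<subseteq> H \<Longrightarrow> N \<subseteq> H" by blast
  have "K \<subseteq> H" if "subgroup H G" "insert x S \<subseteq> H" for H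
  proof
    fix k assume "k \<in> K"
    then obtain n j where "n \<in> N" "k = n \<otimes> x [^] (j::int)" using extend.hyps(7) by blast
    then show "k \<in> H" using S(3)[of H] that subgroup_int_pow_closed[OF that(1), of x j] subgroup.m_closed[OF that(1)] by auto
  qed
  then show ?case using S extend.hyps by (intro exI[of _ "insert x S"]) auto
qed

text \<open>Noetherian induction on subgroups: the union of an ascending chain is polycyclic, hence
  finitely generated, so a chain of counterexamples cannot ascend forever.\<close>

lemma polycyclic_induct_up:
  assumes pc: "polycyclic G (carrier G)" and L: "subgroup L G"
    and step: "\<And>L. subgroup L G \<Longrightarrow> (\<And>L'. subgroup L' G \<Longrightarrow> L \<subset> L' \<Longrightarrow> P L') \<Longrightarrow> P L"
  shows "P L"
proof (rule ccontr)
  assume nP: "\<not> P L"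
  define bad where "bad = {L. subgroup L G \<and> \<not> P L}"
  have ex: "\<exists>L'. L' \<in> bad \<and> L \<subset> L'" if "L \<in> bad" for L using step[of L] that unfolding bad_def by blast
  define nx where "nx L = (SOME L'. L' \<in> bad \<and> L \<subset> L')" for L
  have nx: "nx L \<in> bad" "L \<subset> nx L" if "L \<in> bad" for L
    using someI_ex[OF ex[OF that]] by (auto simp: nx_def)
  define f where "f n = (nx ^^ n) L" for n
  have fF: "f n \<in> bad" for n by (induction n) (use nP L in \<open>auto simp: f_def nx bad_def[symmetric]\<close>, simp add: bad_def)
  have "f (Suc n) = nx (f n)" for n by (simp add: f_def)
  then have inc: "f n \<subset> f (Suc n)" for n using nx[OF fF[of n]] by simp
  have fs: "subgroup (f n) G" for n using fF[of n] by (simp add: bad_def)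
  have fmono: "f n \<subseteq> f m" if "n \<le> m" for n m by (rule lift_Suc_mono_le[of f, OF _ that]) (use inc in blast)
  define U where "U = (\<Union>n. f n)"
  have sU: "subgroup U G"
  proof (rule subgroupI)
    show "U \<subseteq> carrier G" using subgroup.subset[OF fs] by (auto simp: U_def)
    show "U \<noteq> {}" using subgroup.one_closed[OF fs] by (auto simp: U_def)
    fix a assume "a \<in> U"
    then obtain n where n: "a \<in> f n" by (auto simp: U_def)
    show "inv a \<in> U" using subgroup.m_inv_closed[OF fs n] by (auto simp: U_def)
    fix b assume "b \<in> U"
    then obtain m where m: "b \<in> f m" by (auto simp: U_def)
    have "a \<in> f (max n m)" "b \<in> f (max n m)" using n m fmono[of n "max n m"] fmono[of m "max n m"] by auto
    then show "a \<otimes> b \<in> U" using subgroup.m_closed[OF fs] by (auto simp: U_def)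
  qed
  have "polycyclic G U" by (rule polycyclic_subgroup[OF pc sU subgroup.subset[OF sU]])
  from polycyclic_finitely_generated[OF this]
  obtain S where S: "finite S" "S \<subseteq> U" "\<And>H. subgroup H G \<Longrightarrow> S \<subseteq> H \<Longrightarrow> U \<subseteq> H" by blast
  have "\<exists>n. S \<subseteq> f n" using S(1,2)
  proof (induction S)
    case (insert s S)
    then obtain n m where nm: "S \<subseteq> f n" "s \<in> f m" by (auto simp: U_def)
    then have "insert s S \<subseteq> f (max n m)" using fmono[of n "max n m"] fmono[of m "max n m"] by auto
    then show ?case by blast
  qed simp
  then obtain n where "S \<subseteq> f n" by blast
  then have "U \<subseteq> f n" by (rule S(3)[OF fs])
  then have "f (Suc n) \<subseteq> f n" unfolding U_def by blast
  then show False using inc[of n] by blast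
qed

end

section \<open>Nilpotent groups\<close>

lemma (in group) conj_eq_inv_commutator:
  assumes "k \<in> carrier G" "y \<in> carrier G"
  shows "inv (k \<otimes> y \<otimes> inv k \<otimes> inv y) \<otimes> k = y \<otimes> k \<otimes> inv y"
  using assms by (simp add: inv_mult_group m_assoc)

declare lower_central.simps(2) [simp del]

lemma (in group) lower_central_normal:
  "subgroup (lower_central G n) G \<and> (\<forall>k \<in> lower_central G n. \<forall>y \<in> carrier G. y \<otimes> k \<otimes> inv y \<in> lower_central G n) \<and>
   lower_central G (Suc n) \<subseteq> lower_central G n"
proof (induction n)
  case 0
  have "(\<Union>x \<in> carrier G. \<Union>y \<in> carrier G. {x \<otimes> y \<otimes> inv x \<otimes> inv y}) \<subseteq> carrier G" by auto
  then have "generate G (\<Union>x \<in> carrier G. \<Union>y \<in> carrier G. {x \<otimes> y \<otimes> inv x \<otimes> inv y}) \<subseteq> carrier G"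
    by (rule generate_incl)
  then show ?case using subgroup_self by (simp add: lower_central.simps(2))
next
  case (Suc n)
  let ?A = "lower_central G n" and ?B = "lower_central G (Suc n)" and ?C = "lower_central G (Suc (Suc n))"
  interpret A: subgroup ?A G using Suc by blast
  have BA: "?B \<subseteq> ?A" using Suc by blast
  have gens: "(\<Union>x \<in> ?A. \<Union>y \<in> carrier G. {x \<otimes> y \<otimes> inv x \<otimes> inv y}) \<subseteq> carrier G" using A.mem_carrier by auto
  have sB: "subgroup ?B G" using generate_is_subgroup[OF gens] unfolding lower_central.simps(2) .
  interpret B: subgroup ?B G by fact
  have comm: "x \<otimes> y \<otimes> inv x \<otimes> inv y \<in> ?B" if "x \<in> ?A" "y \<in> carrier G" for x y
    unfolding lower_central.simps(2) by (rule generate.incl) (use that in blast)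
  have nB: "y \<otimes> k \<otimes> inv y \<in> ?B" if k: "k \<in> ?B" and y: "y \<in> carrier G" for k y
  proof -
    have kc: "k \<in> carrier G" using k B.mem_carrier by blast
    have 1: "inv (k \<otimes> y \<otimes> inv k \<otimes> inv y) \<otimes> k \<in> ?B"
      by (rule B.m_closed[OF B.m_inv_closed[OF comm[OF subsetD[OF BA k] y]] k])
    then show ?thesis unfolding conj_eq_inv_commutator[OF kc y] .
  qed
  have "x \<otimes> y \<otimes> inv x \<otimes> inv y \<in> ?B" if "x \<in> ?B" "y \<in> carrier G" for x y
    using comm[of x y] that BA by blast
  then have "(\<Union>x \<in> ?B. \<Union>y \<in> carrier G. {x \<otimes> y \<otimes> inv x \<otimes> inv y}) \<subseteq> ?B" by blast
  from generate_subgroup_incl[OF this sB] have "?C \<subseteq> ?B" unfolding lower_central.simps(2)[of G "Suc n"] .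
  then show ?case using sB nB by blast
qed

context group
begin

lemma lower_central_subgroup: "subgroup (lower_central G n) G"
  and lower_central_mono: "lower_central G (Suc n) \<subseteq> lower_central G n"
  by (use lower_central_normal[of n] in simp_all)

lemma commutator_lower_central:
  assumes "x \<in> lower_central G n" "y \<in> carrier G"
  shows "commutator x y \<in> lower_central G (Suc n)"
  unfolding lower_central.simps(2) commutator_def by (rule generate.incl) (use assms in blast)

text \<open>Modulo the following term the commutator map is bilinear, so commutators of generators
  of one term with generators of \<open>G\<close> generate the next term.\<close>

lemma lower_central_finitely_generated:
  assumes S0: "finite S0" "S0 \<subseteq> carrier G" "generate G S0 = carrier G"
  shows "\<exists>S. finite S \<and> S \<subseteq> lower_central G n \<and>
    (\<forall>H. subgroup H G \<longrightarrow> S \<subseteq> H \<longrightarrow> lower_central G (Suc n) \<subseteq> H \<longrightarrow> lower_central G n \<subseteq> H)"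
proof (induction n)
  case 0
  have "carrier G \<subseteq> H" if "subgroup H G" "S0 \<subseteq> H" for H
    using generate_subgroup_incl[OF that(2,1)] S0(3) by simp
  then show ?case using S0 by (intro exI[of _ S0]) auto
next
  case (Suc n)
  let ?A = "lower_central G n" and ?B = "lower_central G (Suc n)" and ?C = "lower_central G (Suc (Suc n))"
  obtain S where S: "finite S" "S \<subseteq> ?A" "\<And>H. subgroup H G \<Longrightarrow> S \<subseteq> H \<Longrightarrow> ?B \<subseteq> H \<Longrightarrow> ?A \<subseteq> H"
    using Suc.IH by blast
  interpret A: subgroup ?A G by (rule lower_central_subgroup)
  interpret B: subgroup ?B G by (rule lower_central_subgroup)
  let ?S = "(\<lambda>(s, g). commutator s g) ` (S \<times> S0)"
  show ?case
  proof (intro exI[of _ ?S] conjI allI impI)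
    show "finite ?S" using S S0 by simp
    show SB: "?S \<subseteq> ?B"
    proof
      fix z assume "z \<in> ?S"
      then obtain s g where sg: "s \<in> S" "g \<in> S0" "z = commutator s g" by auto
      show "z \<in> ?B"
        unfolding sg(3) by (rule commutator_lower_central[OF subsetD[OF S(2) sg(1)] subsetD[OF S0(2) sg(2)]])
    qed
    fix H assume H: "subgroup H G" "?S \<subseteq> H" "?C \<subseteq> H"
    \<comment> \<open>Containing \<open>?C\<close> makes \<open>K\<close> normal in
      \<open>G\<close>, so that the elements with commutators in \<open>K\<close> form
      subgroups.\<close>
    define K where "K = H \<inter> ?B"
    have sK: "subgroup K G" unfolding K_def by (rule subgroups_Inter_pair[OF H(1) lower_central_subgroup])
    interpret K: subgroup K G by fact
    have CK: "?C \<subseteq> K" using H(3) lower_central_mono[of "Suc n"] by (auto simp: K_def)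
    have nK: "y \<otimes> k \<otimes> inv y \<in> K" if y: "y \<in> carrier G" and k: "k \<in> K" for y k
    proof -
      have "k \<in> ?B" using k by (simp add: K_def)
      have "commutator k y \<in> K" by (rule subsetD[OF CK commutator_lower_central[OF \<open>k \<in> ?B\<close> y]])
      then have 1: "inv (commutator k y) \<otimes> k \<in> K" using k by simp
      then show ?thesis unfolding commutator_def conj_eq_inv_commutator[OF K.mem_carrier[OF k] y] .
    qed
    have sy: "commutator s y \<in> K" if s: "s \<in> S" and y: "y \<in> carrier G" for s y
    proof -
      have sc: "s \<in> carrier G" using s S(2) A.mem_carrier by blast
      have "generate G S0 \<subseteq> {y \<in> carrier G. commutator s y \<in> K}"
      proof (rule generate_subgroup_incl)
        show "S0 \<subseteq> {y \<in> carrier G. commutator s y \<in> K}" using H(2) SB s S0(2) by (auto simp: K_def)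
        show "subgroup {y \<in> carrier G. commutator s y \<in> K} G" by (rule subgroup_commutator_right[OF sK nK sc])
      qed
      then show ?thesis using y S0(3) by blast
    qed
    have xy: "commutator x y \<in> H" if x: "x \<in> ?A" and y: "y \<in> carrier G" for x y
    proof -
      have "?A \<subseteq> {x \<in> carrier G. commutator x y \<in> K}"
      proof (rule S(3))
        show "subgroup {x \<in> carrier G. commutator x y \<in> K} G" by (rule subgroup_commutator_left[OF sK nK y])
        show "S \<subseteq> {x \<in> carrier G. commutator x y \<in> K}" using sy[OF _ y] S(2) A.mem_carrier by blast
        show "?B \<subseteq> {x \<in> carrier G. commutator x y \<in> K}"
          using subsetD[OF CK commutator_lower_central[OF _ y]] B.subset by blast
      qed
      then show ?thesis using x by (auto simp: K_def)
    qed
    have "(\<Union>x \<in> ?A. \<Union>y \<in> carrier G. {x \<otimes> y \<otimes> inv x \<otimes> inv y}) \<subseteq> H"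
      using xy unfolding commutator_def by blast
    from generate_subgroup_incl[OF this H(1)] show "?B \<subseteq> H" unfolding lower_central.simps(2) .
  qed
qed

text \<open>An element of one term normalizes every subgroup that contains the next term, because
  its commutators lie there; so the generators can be adjoined one after another.\<close>

lemma polycyclic_lower_central_step:
  assumes pc: "polycyclic G (lower_central G (Suc n))" and S: "finite S" "S \<subseteq> lower_central G n"
  shows "\<exists>H. polycyclic G H \<and> subgroup H G \<and> lower_central G (Suc n) \<subseteq> H \<and> H \<subseteq> lower_central G n \<and> S \<subseteq> H"
  using S
proof (induction S)
  case empty
  then show ?case using pc lower_central_subgroup lower_central_mono by blast
next
  case (insert s S)
  then obtain H where H: "polycyclic G H" "subgroup H G" "lower_central G (Suc n) \<subseteq> H" "H \<subseteq> lower_central G n" "S \<subseteq> H"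
    by blast
  interpret A: subgroup "lower_central G n" G by (rule lower_central_subgroup)
  have s: "s \<in> lower_central G n" "inv s \<in> lower_central G n" "s \<in> carrier G" using insert.prems A.mem_carrier by auto
  have Hc: "H \<subseteq> carrier G" using subgroup.subset[OF H(2)] .
  have ns: "normalizes G s H"
  proof (rule normalizes_commutator[OF H(2) s(3)])
    fix n assume "n \<in> H"
    then have n: "n \<in> carrier G" using Hc by blast
    show "commutator s n \<in> H" "commutator (inv s) n \<in> H"
      using commutator_lower_central[OF s(1) n] commutator_lower_central[OF s(2) n] H(3) by auto
  qed
  note ad = adjoin[OF H(2) s(3) ns]
  have "adjoin H s \<subseteq> lower_central G n" by (rule adjoin_least[OF lower_central_subgroup H(4) s(1)])
  then show ?case using polycyclic_adjoin[OF H(1,2) s(3) ns] ad H(3,5)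
    by (intro exI[of _ "adjoin H s"]) auto
qed

lemma nilpotent_polycyclic:
  assumes "fin_gen_group G" "nilpotent_group G"
  shows "polycyclic G (carrier G)"
proof -
  obtain S0 where S0: "finite S0" "S0 \<subseteq> carrier G" "generate G S0 = carrier G"
    using assms(1) by (auto simp: fin_gen_group_def)
  obtain c where c: "lower_central G c = {\<one>}" using assms(2) by (auto simp: nilpotent_group_def)
  have "polycyclic G (lower_central G (c - n))" for n
  proof (induction n)
    case 0 then show ?case using c polycyclic.trivial by simp
  next
    case (Suc n)
    show ?case
    proof (cases "n < c")
      case True
      then have e: "c - n = Suc (c - Suc n)" by simp
      obtain S where S: "finite S" "S \<subseteq> lower_central G (c - Suc n)"
        "\<And>H. subgroup H G \<Longrightarrow> S \<subseteq> H \<Longrightarrow> lower_central G (c - n) \<subseteq> H \<Longrightarrow> lower_central G (c - Suc n) \<subseteq> H"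
        using lower_central_finitely_generated[OF S0, of "c - Suc n"] unfolding e by blast
      obtain H where H: "polycyclic G H" "subgroup H G" "lower_central G (c - n) \<subseteq> H"
        "H \<subseteq> lower_central G (c - Suc n)" "S \<subseteq> H"
        using polycyclic_lower_central_step[OF _ S(1,2)] Suc unfolding e by blast
      have "H = lower_central G (c - Suc n)" using H(4) S(3)[OF H(2,5,3)] by blast
      then show ?thesis using H(1) by simp
    qed (use Suc in simp)
  qed
  from this[of c] show ?thesis by simp
qed

end

text \<open>The terms are mere sets, and the commutator condition is restricted to the carrier. In
  this form the same \<open>Z\<close> serves for every subgroup, whereas the lower central series of
  a subgroup is a different one.\<close>

definition central_series :: "('g, 'b) monoid_scheme \<Rightarrow> nat \<Rightarrow> (nat \<Rightarrow> 'g set) \<Rightarrow> bool" where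
  "central_series G n Z \<longleftrightarrow> carrier G \<subseteq> Z 0 \<and> Z n \<subseteq> {\<one>\<^bsub>G\<^esub>} \<and>
     (\<forall>i. \<forall>x \<in> Z i. x \<in> carrier G \<longrightarrow> (\<forall>y \<in> carrier G. x \<otimes>\<^bsub>G\<^esub> y \<otimes>\<^bsub>G\<^esub> inv\<^bsub>G\<^esub> x \<otimes>\<^bsub>G\<^esub> inv\<^bsub>G\<^esub> y \<in> Z (Suc i)))"

context group
begin

lemma nilpotent_central_series:
  assumes "nilpotent_group G" shows "\<exists>n Z. central_series G n Z"
proof -
  obtain c where c: "lower_central G c = {\<one>}" using assms(1) by (auto simp: nilpotent_group_def)
  have "central_series G c (lower_central G)"
    unfolding central_series_def using c commutator_lower_central unfolding commutator_def by auto
  then show ?thesis by blast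
qed

lemma restrict_central_series:
  assumes "central_series G n Z" "subgroup H G" shows "central_series (G\<lparr>carrier := H\<rparr>) n Z"
proof -
  interpret H: subgroup H G by fact
  have "x \<otimes> y \<otimes> inv\<^bsub>G\<lparr>carrier := H\<rparr>\<^esub> x \<otimes> inv\<^bsub>G\<lparr>carrier := H\<rparr>\<^esub> y \<in> Z (Suc i)"
    if "x \<in> Z i" "x \<in> H" "y \<in> H" for x y i
    using that assms m_inv_consistent[OF assms(2)] H.mem_carrier by (simp add: central_series_def)
  then show ?thesis using assms(1) H.subset by (auto simp: central_series_def)
qed

lemma restrict_normalizes:
  assumes "subgroup H G" "x \<in> H" "normalizes G x N" shows "normalizes (G\<lparr>carrier := H\<rparr>) x N"
  using assms m_inv_consistent[OF assms(1,2)] by (simp add: normalizes_def)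

lemma restrict_polycyclic:
  assumes "polycyclic G K" "subgroup H G" "K \<subseteq> H" shows "polycyclic (G\<lparr>carrier := H\<rparr>) K"
  using assms(1,3)
proof induction
  case trivial
  then show ?case using polycyclic.trivial[of "G\<lparr>carrier := H\<rparr>"] by simp
next
  case (extend N K x)
  have xH: "x \<in> H" using extend by blast
  show ?case
  proof (rule polycyclic.extend[OF _ _ _ extend.hyps(4,5)])
    show "polycyclic (G\<lparr>carrier := H\<rparr>) N" using extend by blast
    show "subgroup N (G\<lparr>carrier := H\<rparr>)" "subgroup K (G\<lparr>carrier := H\<rparr>)"
      using subgroup_incl[OF _ assms(2)] extend by auto
    show "normalizes (G\<lparr>carrier := H\<rparr>) x N" by (rule restrict_normalizes[OF assms(2) xH extend.hyps(6)])
    fix k assume "k \<in> K"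
    then obtain n j where "n \<in> N" "k = n \<otimes> x [^] (j::int)" using extend.hyps(7) by blast
    then show "\<exists>n\<in>N. \<exists>j::int. k = n \<otimes>\<^bsub>G\<lparr>carrier := H\<rparr>\<^esub> x [^]\<^bsub>G\<lparr>carrier := H\<rparr>\<^esub> j"
      using int_pow_consistent[OF assms(2) xH] by auto
  qed
qed

end

section \<open>Free abelian quotients\<close>

definition zpow :: "('g, 'b) monoid_scheme \<Rightarrow> nat \<Rightarrow> (nat \<Rightarrow> 'g) \<Rightarrow> (nat \<Rightarrow> int) \<Rightarrow> 'g" where
  "zpow G k q a = finprod G (\<lambda>i. q i [^]\<^bsub>G\<^esub> a i) {..<k}"

context comm_group
begin

lemma zpow_closed: "(\<And>i. i < k \<Longrightarrow> q i \<in> carrier G) \<Longrightarrow> zpow G k q a \<in> carrier G"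
  unfolding zpow_def by (rule finprod_closed) auto

lemma zpow_add:
  assumes "\<And>i. i < k \<Longrightarrow> q i \<in> carrier G"
  shows "zpow G k q (a + b) = zpow G k q a \<otimes> zpow G k q b"
proof -
  have "zpow G k q (a + b) = finprod G (\<lambda>i. q i [^] a i \<otimes> q i [^] b i) {..<k}"
    unfolding zpow_def by (rule finprod_cong) (use assms in \<open>auto simp: int_pow_mult simp_implies_def\<close>)
  also have "\<dots> = zpow G k q a \<otimes> zpow G k q b"
    unfolding zpow_def by (rule finprod_multf) (use assms in auto)
  finally show ?thesis .
qed

lemma zpow_zero: "zpow G k q 0 = \<one>"
  unfolding zpow_def by (rule finprod_one_eqI) simp

lemma zpow_uminus:
  assumes "\<And>i. i < k \<Longrightarrow> q i \<in> carrier G"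
  shows "zpow G k q (- a) = inv (zpow G k q a)"
proof -
  have "zpow G k q (- a) \<otimes> zpow G k q a = \<one>" using zpow_add[where k = k and q = q and a = "- a" and b = a, OF assms] zpow_zero[of k q] by simp
  then show ?thesis using inv_equality[OF _ zpow_closed[where k = k and q = q, OF assms] zpow_closed[where k = k and q = q, OF assms]] by simp
qed

lemma zpow_single:
  assumes "\<And>i. i < k \<Longrightarrow> q i \<in> carrier G" "i < k" "\<And>j. j \<noteq> i \<Longrightarrow> j < k \<Longrightarrow> a j = 0"
  shows "zpow G k q a = q i [^] a i"
proof -
  have "zpow G k q a = finprod G (\<lambda>j. if i = j then q j [^] a j else \<one>) {..<k}"
    unfolding zpow_def by (rule finprod_cong) (use assms in \<open>auto simp: simp_implies_def\<close>)
  also have "\<dots> = q i [^] a i" by (rule finprod_singleton) (use assms in auto)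
  finally show ?thesis .
qed

lemma zpow_surj:
  assumes q: "\<And>i. i < k \<Longrightarrow> q i \<in> carrier G"
    and gen: "\<And>H. subgroup H G \<Longrightarrow> q ` {..<k} \<subseteq> H \<Longrightarrow> carrier G \<subseteq> H" and x: "x \<in> carrier G"
  shows "\<exists>a \<in> zvec k. x = zpow G k q a"
proof -
  let ?H = "zpow G k q ` zvec k"
  have "subgroup ?H G"
  proof (rule subgroupI)
    show "?H \<subseteq> carrier G" using zpow_closed[where k = k and q = q, OF q] by blast
    have "0 \<in> zvec k" by (simp add: zvec_def)
    then show "?H \<noteq> {}" by blast
    fix y assume "y \<in> ?H"
    then obtain a where a: "a \<in> zvec k" "y = zpow G k q a" by blast
    have "- a \<in> zvec k" using a by (simp add: zvec_def)
    then show "inv y \<in> ?H" using zpow_uminus[where k = k and q = q and a = a, OF q] a(2) by (metis image_eqI)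
    fix z assume "z \<in> ?H"
    then obtain b where b: "b \<in> zvec k" "z = zpow G k q b" by blast
    have "a + b \<in> zvec k" using a b by (simp add: zvec_def)
    then show "y \<otimes> z \<in> ?H" using zpow_add[where k = k and q = q and a = a and b = b, OF q] a(2) b(2) by (metis image_eqI)
  qed
  moreover have "q ` {..<k} \<subseteq> ?H"
  proof
    fix y assume "y \<in> q ` {..<k}"
    then obtain i where i: "i < k" "y = q i" by auto
    have "zpow G k q (unit_vec i) = q i [^] unit_vec i i"
      by (rule zpow_single[where k = k and q = q, OF q i(1)]) (auto simp: unit_vec_def)
    then have "zpow G k q (unit_vec i) = y" using i q by (simp add: unit_vec_def)
    moreover have "unit_vec i \<in> zvec k" using i by (auto simp: zvec_def unit_vec_def)
    ultimately show "y \<in> ?H" by (metis image_eqI)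
  qed
  ultimately have "carrier G \<subseteq> ?H" by (rule gen)
  then show ?thesis using x by blast
qed

text \<open>An elementary operation on the generators is matched by one on the exponents; this is
  one step of the Euclidean algorithm in \<open>torsion_free_basis\<close>.\<close>

lemma zpow_upd:
  assumes q: "\<And>i. i < k \<Longrightarrow> q i \<in> carrier G" and ij: "i < k" "j < k" "i \<noteq> j"
  shows "zpow G k (q(j := q j \<otimes> q i [^] (s::int))) a = zpow G k q (a(i := a i + s * a j))"
proof -
  let ?q = "q(j := q j \<otimes> q i [^] s)" and ?a = "a(i := a i + s * a j)"
  have q': "?q l \<in> carrier G" if "l < k" for l using q[OF that] q[OF ij(1)] q[OF ij(2)] by simp
  have split: "zpow G k p b = p i [^] b i \<otimes> (p j [^] b j \<otimes> finprod G (\<lambda>l. p l [^] b l) ({..<k} - {i} - {j}))"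
    if p: "\<And>l. l < k \<Longrightarrow> p l \<in> carrier G" for p b
  proof -
    have "{..<k} = insert i (insert j ({..<k} - {i} - {j}))" using ij by auto
    then have "zpow G k p b = finprod G (\<lambda>l. p l [^] b l) (insert i (insert j ({..<k} - {i} - {j})))"
      unfolding zpow_def by simp
    also have "\<dots> = p i [^] b i \<otimes> finprod G (\<lambda>l. p l [^] b l) (insert j ({..<k} - {i} - {j}))"
      by (rule finprod_insert) (use p ij in auto)
    also have "finprod G (\<lambda>l. p l [^] b l) (insert j ({..<k} - {i} - {j})) =
      p j [^] b j \<otimes> finprod G (\<lambda>l. p l [^] b l) ({..<k} - {i} - {j})"
      by (rule finprod_insert) (use p ij in auto)
    finally show ?thesis .
  qed
  let ?r = "finprod G (\<lambda>l. q l [^] a l) ({..<k} - {i} - {j})"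
  have r1: "finprod G (\<lambda>l. ?q l [^] a l) ({..<k} - {i} - {j}) = ?r"
    by (rule finprod_cong) (use q in \<open>auto simp: simp_implies_def\<close>)
  have r2: "finprod G (\<lambda>l. q l [^] ?a l) ({..<k} - {i} - {j}) = ?r"
    by (rule finprod_cong) (use q in \<open>auto simp: simp_implies_def\<close>)
  have rc: "?r \<in> carrier G" by (rule finprod_closed) (use q in auto)
  note qi = q[OF ij(1)] and qj = q[OF ij(2)]
  have "zpow G k ?q a = q i [^] a i \<otimes> ((q j \<otimes> q i [^] s) [^] a j \<otimes> ?r)"
    using split[of ?q a, OF q'] ij(3) unfolding r1 by simp
  also have "(q j \<otimes> q i [^] s) [^] a j = q j [^] a j \<otimes> q i [^] (s * a j)"
    using qi qj by (simp add: int_pow_distrib int_pow_pow)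
  also have "q i [^] a i \<otimes> (q j [^] a j \<otimes> q i [^] (s * a j) \<otimes> ?r) = (q i [^] a i \<otimes> q i [^] (s * a j)) \<otimes> (q j [^] a j \<otimes> ?r)"
    using qi qj rc by (simp add: m_ac)
  also have "q i [^] a i \<otimes> q i [^] (s * a j) = q i [^] (a i + s * a j)" using qi by (simp add: int_pow_mult)
  also have "q i [^] (a i + s * a j) \<otimes> (q j [^] a j \<otimes> ?r) = zpow G k q ?a"
    using split[of q ?a, OF q] ij(3) unfolding r2 by simp
  finally show ?thesis .
qed

text \<open>Generation is expressed through the subgroups containing the tuple, so that a change of
  generators is checked without words in them.\<close>

definition generates :: "nat \<Rightarrow> (nat \<Rightarrow> 'a) \<Rightarrow> bool" where
  "generates k q \<longleftrightarrow> (\<forall>i<k. q i \<in> carrier G) \<and> (\<forall>H. subgroup H G \<longrightarrow> q ` {..<k} \<subseteq> H \<longrightarrow> carrier G \<subseteq> H)"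

lemma generates_upd:
  assumes g: "generates k q" and ij: "i < k" "j < k" "i \<noteq> j"
  shows "generates k (q(j := q j \<otimes> q i [^] (s::int)))"
proof -
  let ?q = "q(j := q j \<otimes> q i [^] s)"
  have q: "\<And>l. l < k \<Longrightarrow> q l \<in> carrier G" and gen: "\<And>H. subgroup H G \<Longrightarrow> q ` {..<k} \<subseteq> H \<Longrightarrow> carrier G \<subseteq> H"
    using g unfolding generates_def by blast+
  have "carrier G \<subseteq> H" if H: "subgroup H G" "?q ` {..<k} \<subseteq> H" for H
  proof (rule gen[OF H(1)], rule image_subsetI)
    interpret H: subgroup H G by (rule H(1))
    have qH: "?q l \<in> H" if "l < k" for l using H(2) that by blast
    fix l assume "l \<in> {..<k}"
    then have l: "l < k" by simp
    show "q l \<in> H"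
    proof (cases "l = j")
      case False then show ?thesis using qH[OF l] by simp
    next
      case True
      have "q i \<in> H" using qH[OF ij(1)] ij(3) by simp
      then have "inv (q i [^] s) \<in> H" using subgroup_int_pow_closed[OF H(1)] by blast
      moreover have "q j \<otimes> q i [^] s \<in> H" using qH[OF ij(2)] by simp
      ultimately have "(q j \<otimes> q i [^] s) \<otimes> inv (q i [^] s) \<in> H" by (rule H.m_closed[rotated])
      then show ?thesis using True q[OF ij(1)] q[OF ij(2)] by (simp add: m_assoc)
    qed
  qed
  moreover have "?q l \<in> carrier G" if "l < k" for l using q[OF that] q[OF ij(1)] q[OF ij(2)] by simp
  ultimately show ?thesis unfolding generates_def by blast
qed

text \<open>The last generator moves into the slot of the trivial one.\<close>

lemma generates_drop:
  assumes g: "generates (Suc k) q" and i: "i < Suc k" "q i = \<one>"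
  shows "generates k (q(i := q k))"
proof -
  have q: "\<And>l. l < Suc k \<Longrightarrow> q l \<in> carrier G" and gen: "\<And>H. subgroup H G \<Longrightarrow> q ` {..<Suc k} \<subseteq> H \<Longrightarrow> carrier G \<subseteq> H"
    using g unfolding generates_def by blast+
  have "carrier G \<subseteq> H" if H: "subgroup H G" "(q(i := q k)) ` {..<k} \<subseteq> H" for H
  proof (rule gen[OF H(1)], rule image_subsetI)
    have qH: "(q(i := q k)) l \<in> H" if "l < k" for l using H(2) that by blast
    fix l assume "l \<in> {..<Suc k}"
    then have l: "l < Suc k" by simp
    show "q l \<in> H"
    proof (cases "l = i")
      case True then show ?thesis using i(2) subgroup.one_closed[OF H(1)] by simp
    next
      case False
      show ?thesis
      proof (cases "l = k")
        case True
        then have "i < k" using False i(1) by simp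
        from qH[OF this] show ?thesis using True by simp
      next
        case F: False
        then have "l < k" using l by simp
        from qH[OF this] show ?thesis using False by simp
      qed
    qed
  qed
  moreover have "(q(i := q k)) l \<in> carrier G" if "l < k" for l using q[of l] q[of k] that by simp
  ultimately show ?thesis unfolding generates_def by blast
qed

text \<open>Among the generating tuples of minimal length take a relation of minimal height; the Euclidean
  algorithm on its exponents leaves only one of them nonzero.\<close>

lemma torsion_free_basis:
  assumes S: "finite S" "S \<subseteq> carrier G" "\<And>H. subgroup H G \<Longrightarrow> S \<subseteq> H \<Longrightarrow> carrier G \<subseteq> H"
    and tf: "\<And>x n. x \<in> carrier G \<Longrightarrow> 0 < (n::nat) \<Longrightarrow> x [^] n = \<one> \<Longrightarrow> x = \<one>"
  shows "\<exists>k q. (\<forall>i<k. q i \<in> carrier G) \<and> (\<forall>x \<in> carrier G. \<exists>a \<in> zvec k. x = zpow G k q a) \<and>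
    (\<forall>a \<in> zvec k. zpow G k q a = \<one> \<longrightarrow> a = 0)"
proof -
  obtain n f where nf: "S = f ` {i::nat. i < n}" using finite_imp_nat_seg_image_inj_on[OF S(1)] by blast
  have "generates n f"
    unfolding generates_def
  proof (intro conjI allI impI)
    show "f i \<in> carrier G" if "i < n" for i using S(2) that unfolding nf by blast
    fix H assume "subgroup H G" "f ` {..<n} \<subseteq> H"
    then show "carrier G \<subseteq> H" using S(3)[of H] unfolding nf lessThan_def by blast
  qed
  then have ex: "\<exists>q. generates n q" by blast
  define k where "k = (LEAST k. \<exists>q. generates k q)"
  have kmin: "\<not> generates k' q" if "k' < k" for k' q using not_less_Least[OF that[unfolded k_def]] by blast
  have kex: "\<exists>q. generates k q" unfolding k_def by (rule LeastI[of "\<lambda>k. \<exists>q. generates k q", OF ex])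
  have key: "a = 0" if "generates k q" "a \<in> zvec k" "zpow G k q a = \<one>" for q a
    using that
  proof (induction "\<Sum>i<k. nat \<bar>a i\<bar>" arbitrary: q a rule: less_induct)
    case less
    have q: "q l \<in> carrier G" if "l < k" for l using less.prems(1) that unfolding generates_def by blast
    have az: "a l = 0" if "\<not> l < k" for l using less.prems(2) that by (simp add: zvec_def)
    show ?case
    proof (rule ccontr)
      assume "a \<noteq> 0"
      then obtain l0 where "a l0 \<noteq> 0" by (auto simp: fun_eq_iff)
      show False
      proof (cases "\<exists>i j. i \<noteq> j \<and> a i \<noteq> 0 \<and> a j \<noteq> 0")
        case False
        then have oth: "a j = 0" if "j \<noteq> l0" for j using that \<open>a l0 \<noteq> 0\<close> by blast
        have l0: "l0 < k" using az[of l0] \<open>a l0 \<noteq> 0\<close> by blast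
        have "zpow G k q a = q l0 [^] a l0" by (rule zpow_single[where k = k and q = q, OF q l0]) (use oth in auto)
        then have p: "q l0 [^] a l0 = \<one>" using less.prems(3) by simp
        have "q l0 [^] \<bar>a l0\<bar> = \<one>"
        proof (cases "0 \<le> a l0")
          case False
          then have "q l0 [^] \<bar>a l0\<bar> = inv (q l0 [^] a l0)" using int_pow_neg[OF q[OF l0], of "a l0"] by simp
          then show ?thesis using p by simp
        qed (use p in simp)
        then have "q l0 [^] nat \<bar>a l0\<bar> = \<one>" using pow_nat[where i = "\<bar>a l0\<bar>" and x = "q l0" and G = G] by simp
        then have "q l0 = \<one>" by (rule tf[OF q[OF l0], rotated]) (use \<open>a l0 \<noteq> 0\<close> in simp)
        moreover obtain k' where k': "k = Suc k'" using l0 by (cases k) auto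
        ultimately have "generates k' (q(l0 := q k'))" using generates_drop[of k' q l0] less.prems(1) l0 by simp
        then show False using kmin[of k'] k' by simp
      next
        case True
        then obtain i j where ij: "i \<noteq> j" "a i \<noteq> 0" "a j \<noteq> 0" "\<bar>a j\<bar> \<le> \<bar>a i\<bar>"
          by (metis linear)
        have ijk: "i < k" "j < k" using az ij by blast+
        \<comment> \<open>With this sign, subtracting \<open>s * a j\<close> lowers the absolute
          value of \<open>a i\<close> by that of \<open>a j\<close>.\<close>
        define s where "s = sgn (a i) * sgn (a j)"
        define a' where "a' = a(i := a i - s * a j)"
        define q' where "q' = q(j := q j \<otimes> q i [^] s)"
        have less': "nat \<bar>a' i\<bar> < nat \<bar>a i\<bar>"
        proof -
          have "\<bar>a i - s * a j\<bar> < \<bar>a i\<bar>"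
            using ij by (cases "0 < a i"; cases "0 < a j") (auto simp: s_def sgn_if)
          then show ?thesis using ij(2) by (simp add: a'_def)
        qed
        have "(\<Sum>l<k. nat \<bar>a' l\<bar>) < (\<Sum>l<k. nat \<bar>a l\<bar>)"
          by (rule sum_strict_mono_ex1) (use less' ijk in \<open>auto simp: a'_def\<close>)
        moreover have "generates k q'" unfolding q'_def by (rule generates_upd[OF less.prems(1) ijk ij(1)])
        moreover have "a' \<in> zvec k" using less.prems(2) ijk by (auto simp: zvec_def a'_def)
        moreover have "zpow G k q' a' = \<one>"
        proof -
          have "zpow G k q' a' = zpow G k q (a'(i := a' i + s * a' j))"
            unfolding q'_def by (rule zpow_upd[where k = k and q = q, OF q ijk ij(1)])
          also have "a'(i := a' i + s * a' j) = a" using ij(1) by (auto simp: a'_def)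
          finally show ?thesis using less.prems(3) by simp
        qed
        ultimately have "a' = 0" by (rule less.hyps)
        then have "a' j = 0" by simp
        then show False using ij(1,3) by (simp add: a'_def)
      qed
    qed
  qed
  obtain q where q: "generates k q" using kex by blast
  have qc: "\<And>l. l < k \<Longrightarrow> q l \<in> carrier G" and gen: "\<And>H. subgroup H G \<Longrightarrow> q ` {..<k} \<subseteq> H \<Longrightarrow> carrier G \<subseteq> H"
    using q unfolding generates_def by blast+
  have "\<exists>a\<in>zvec k. x = zpow G k q a" if "x \<in> carrier G" for x by (rule zpow_surj[where k = k and q = q, OF qc gen that])
  then show ?thesis using qc key[OF q] by (intro exI[of _ k] exI[of _ q]) simp
qed

end

text \<open>The basis of \<open>G/L\<close> is lifted to representatives in \<open>G\<close>, so
  that the later arguments stay inside \<open>G\<close>. The map \<open>\<rho>\<close> is defined on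
  all integer sequences and is a homomorphism up to a left factor from \<open>L\<close>; injectivity
  holds on \<open>zvec k\<close>.\<close>

lemma (in group) quotient_basis:
  assumes pc: "polycyclic G (carrier G)" and L: "subgroup L G"
    and comm: "\<And>x y. x \<in> carrier G \<Longrightarrow> y \<in> carrier G \<Longrightarrow> commutator x y \<in> L"
    and tf: "\<And>u e. u \<in> carrier G \<Longrightarrow> 0 < (e::nat) \<Longrightarrow> u [^] e \<in> L \<Longrightarrow> u \<in> L"
  shows "\<exists>k (\<rho> :: (nat \<Rightarrow> int) \<Rightarrow> 'a). (\<forall>a. \<rho> a \<in> carrier G) \<and>
    (\<forall>a b. \<exists>l \<in> L. \<rho> (a + b) = l \<otimes> (\<rho> a \<otimes> \<rho> b)) \<and>
    (\<forall>g \<in> carrier G. \<exists>a \<in> zvec k. \<exists>l \<in> L. g = l \<otimes> \<rho> a) \<and> (\<forall>a \<in> zvec k. \<rho> a \<in> L \<longrightarrow> a = 0)"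
proof -
  interpret L: subgroup L G by fact
  have "x \<otimes> h \<otimes> inv x \<in> L" if "x \<in> carrier G" "h \<in> L" for x h
    using conj_commutator[OF that(1) L.mem_carrier[OF that(2)]] comm[OF that(1) L.mem_carrier[OF that(2)]] that(2) by simp
  then have nL: "L \<lhd> G" using normal_inv_iff L by blast
  interpret N: normal L G by (rule nL)
  define Q where "Q = G Mod L"
  have Qg: "group Q" unfolding Q_def by (rule N.factorgroup_is_group)
  have Qc: "carrier Q = (\<lambda>x. L #> x) ` carrier G" by (simp add: Q_def carrier_FactGroup)
  have Qm: "(L #> x) \<otimes>\<^bsub>Q\<^esub> (L #> y) = L #> (x \<otimes> y)" if "x \<in> carrier G" "y \<in> carrier G" for x y
    using N.rcos_sum[OF that] by (simp add: Q_def)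
  have Q1: "\<one>\<^bsub>Q\<^esub> = L #> \<one>" using L.subset by (simp add: Q_def coset_mult_one)
  have eqI: "L #> (l \<otimes> y) = L #> y" if "l \<in> L" "y \<in> carrier G" for l y
    using repr_independence[of "l \<otimes> y" L y] that L by (auto simp: r_coset_def)
  have eqD: "\<exists>l \<in> L. x = l \<otimes> y" if "L #> x = L #> y" "x \<in> carrier G" for x y
  proof -
    have "x \<in> L #> y" using rcos_self[OF that(2) L] that(1) by simp
    then show ?thesis by (auto simp: r_coset_def)
  qed
  have memL: "x \<in> L" if "L #> x = L #> \<one>" "x \<in> carrier G" for x using eqD[OF that] L.mem_carrier by auto
  have inL: "L #> x = L #> \<one>" if "x \<in> L" for x using eqI[OF that one_closed] L.mem_carrier[OF that] by simp
  have Qcomm: "x \<otimes>\<^bsub>Q\<^esub> y = y \<otimes>\<^bsub>Q\<^esub> x" if "x \<in> carrier Q" "y \<in> carrier Q" for x y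
  proof -
    obtain g h where gh: "g \<in> carrier G" "h \<in> carrier G" "x = L #> g" "y = L #> h" using \<open>x \<in> carrier Q\<close> \<open>y \<in> carrier Q\<close> unfolding Qc by auto
    have "g \<otimes> h = commutator g h \<otimes> (h \<otimes> g)" using gh(1,2) by (simp add: commutator_def m_assoc cancel_left)
    then have "L #> (g \<otimes> h) = L #> (h \<otimes> g)" using eqI[OF comm[OF gh(1,2)], of "h \<otimes> g"] gh(1,2) by simp
    then show ?thesis using Qm gh by simp
  qed
  interpret Q: comm_group Q by (rule group.group_comm_groupI[OF Qg Qcomm])
  have Qpow: "(L #> x) [^]\<^bsub>Q\<^esub> (n::nat) = L #> (x [^] n)" if "x \<in> carrier G" for x n
    by (induction n) (use that Qm Q1 in auto)
  have tfQ: "x = \<one>\<^bsub>Q\<^esub>" if "x \<in> carrier Q" "0 < (n::nat)" "x [^]\<^bsub>Q\<^esub> n = \<one>\<^bsub>Q\<^esub>" for x n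
  proof -
    obtain g where g: "g \<in> carrier G" "x = L #> g" using \<open>x \<in> carrier Q\<close> unfolding Qc by auto
    have "g [^] n \<in> L"
    proof (rule memL)
      show "L #> (g [^] n) = L #> \<one>" using that(3) unfolding g(2) Qpow[OF g(1)] Q1 .
    qed (use g(1) in simp)
    then have gL: "g \<in> L" by (rule tf[OF g(1) that(2)])
    show ?thesis unfolding g(2) Q1 by (rule inL[OF gL])
  qed
  obtain S where S: "finite S" "S \<subseteq> carrier G" "\<And>H. subgroup H G \<Longrightarrow> S \<subseteq> H \<Longrightarrow> carrier G \<subseteq> H"
    using polycyclic_finitely_generated[OF pc] by blast
  have gen: "carrier Q \<subseteq> H" if H: "subgroup H Q" "(\<lambda>x. L #> x) ` S \<subseteq> H" for H
  proof -
    interpret H: subgroup H Q by (rule H(1))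
    have "subgroup {x \<in> carrier G. L #> x \<in> H} G"
    proof (rule subgroupI)
      show "{x \<in> carrier G. L #> x \<in> H} \<noteq> {}" using H.one_closed Q1 by auto
      fix x assume "x \<in> {x \<in> carrier G. L #> x \<in> H}"
      then have x: "x \<in> carrier G" "L #> x \<in> H" by auto
      have "(L #> inv x) \<otimes>\<^bsub>Q\<^esub> (L #> x) = \<one>\<^bsub>Q\<^esub>" using Qm[of "inv x" x] x(1) Q1 by simp
      then have "inv\<^bsub>Q\<^esub> (L #> x) = L #> inv x" by (rule Q.inv_equality) (use x(1) Qc in auto)
      then show "inv x \<in> {x \<in> carrier G. L #> x \<in> H}" using x H.m_inv_closed[OF x(2)] by simp
      fix y assume "y \<in> {x \<in> carrier G. L #> x \<in> H}"
      then have y: "y \<in> carrier G" "L #> y \<in> H" by auto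
      show "x \<otimes> y \<in> {x \<in> carrier G. L #> x \<in> H}" using H.m_closed[OF x(2) y(2)] Qm[OF x(1) y(1)] x(1) y(1) by simp
    qed auto
    moreover have "S \<subseteq> {x \<in> carrier G. L #> x \<in> H}" using H(2) S(2) by auto
    ultimately have "carrier G \<subseteq> {x \<in> carrier G. L #> x \<in> H}" by (rule S(3))
    then show ?thesis unfolding Qc by blast
  qed
  have "\<exists>k q. (\<forall>i<k. q i \<in> carrier Q) \<and> (\<forall>x \<in> carrier Q. \<exists>a \<in> zvec k. x = zpow Q k q a) \<and>
    (\<forall>a \<in> zvec k. zpow Q k q a = \<one>\<^bsub>Q\<^esub> \<longrightarrow> a = 0)"
  proof (rule Q.torsion_free_basis[of "(\<lambda>x. L #> x) ` S"])
    show "finite ((#>) L ` S)" using S(1) by simp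
    show "(#>) L ` S \<subseteq> carrier Q" unfolding Qc using S(2) by blast
    show "carrier Q \<subseteq> H" if "subgroup H Q" "(#>) L ` S \<subseteq> H" for H by (rule gen[OF that])
    show "x = \<one>\<^bsub>Q\<^esub>" if "x \<in> carrier Q" "0 < n" "x [^]\<^bsub>Q\<^esub> n = \<one>\<^bsub>Q\<^esub>" for x and n :: nat by (rule tfQ[OF that])
  qed
  then obtain k q where kq: "\<forall>i<k. q i \<in> carrier Q" "\<forall>x \<in> carrier Q. \<exists>a \<in> zvec k. x = zpow Q k q a"
    "\<forall>a \<in> zvec k. zpow Q k q a = \<one>\<^bsub>Q\<^esub> \<longrightarrow> a = 0" by (elim exE conjE)
  have q: "q i \<in> carrier Q" if "i < k" for i using kq(1) that by simp
  have surj: "\<exists>a \<in> zvec k. x = zpow Q k q a" if "x \<in> carrier Q" for x by (rule bspec[OF kq(2) that])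
  have inj: "a = 0" if "a \<in> zvec k" "zpow Q k q a = \<one>\<^bsub>Q\<^esub>" for a using kq(3) that by simp
  have zc: "zpow Q k q a \<in> carrier Q" for a by (rule Q.zpow_closed[where k = k and q = q, OF q])
  have "\<forall>a. \<exists>x. x \<in> carrier G \<and> L #> x = zpow Q k q a"
  proof
    fix a show "\<exists>x. x \<in> carrier G \<and> L #> x = zpow Q k q a" using zc[of a] unfolding Qc by auto
  qed
  from choice[OF this] obtain \<rho> where \<rho>': "\<forall>a. \<rho> a \<in> carrier G \<and> L #> \<rho> a = zpow Q k q a" by (elim exE)
  have \<rho>: "\<rho> a \<in> carrier G" "L #> \<rho> a = zpow Q k q a" for a using \<rho>' by auto
  have "\<exists>l \<in> L. \<rho> (a + b) = l \<otimes> (\<rho> a \<otimes> \<rho> b)" for a b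
  proof (rule eqD[OF _ \<rho>(1)])
    show "L #> \<rho> (a + b) = L #> (\<rho> a \<otimes> \<rho> b)"
      using Qm[OF \<rho>(1) \<rho>(1), of a b] Q.zpow_add[where k = k and q = q and a = a and b = b, OF q] \<rho>(2) by simp
  qed
  moreover have "\<exists>a \<in> zvec k. \<exists>l \<in> L. g = l \<otimes> \<rho> a" if g: "g \<in> carrier G" for g
  proof -
    obtain a where a: "a \<in> zvec k" "L #> g = zpow Q k q a" using surj[of "L #> g"] g unfolding Qc by blast
    have "\<exists>l \<in> L. g = l \<otimes> \<rho> a" by (rule eqD[OF _ g]) (simp add: a(2) \<rho>(2))
    then show ?thesis using a(1) by blast
  qed
  moreover have "a = 0" if "a \<in> zvec k" "\<rho> a \<in> L" for a
  proof (rule inj[OF that(1)])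
    show "zpow Q k q a = \<one>\<^bsub>Q\<^esub>" unfolding \<rho>(2)[symmetric] Q1 by (rule inL[OF that(2)])
  qed
  ultimately show ?thesis using \<rho>(1) by (intro exI[of _ k] exI[of _ \<rho>]) simp
qed

section \<open>Induced modules\<close>

text \<open>This is \<open>M = U \<otimes>\<^bsub>FH\<^esub> FG\<close>, stated without choosing a transversal: \<open>C\<close> and \<open>C'\<close> range over the pairs of
  sets that meet no common right coset of \<open>H\<close>.\<close>

definition good :: "('g, 'b) monoid_scheme \<Rightarrow> ('m, 'c) ring_scheme \<Rightarrow> ('m \<Rightarrow> 'g \<Rightarrow> 'm) \<Rightarrow> ('m \<Rightarrow> 'm) set \<Rightarrow>
    'g set \<Rightarrow> 'm set \<Rightarrow> bool" where
  "good G M act Om H U \<longleftrightarrow> subgroup H G \<and> opsub M act Om H U \<and> msum M (tr act U ` carrier G) = carrier M \<and>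
    (\<forall>C C'. C \<subseteq> carrier G \<longrightarrow> C' \<subseteq> carrier G \<longrightarrow> (\<forall>c \<in> C. \<forall>c' \<in> C'. \<forall>h \<in> H. h \<otimes>\<^bsub>G\<^esub> c' \<noteq> c) \<longrightarrow>
      msum M (tr act U ` C) \<inter> msum M (tr act U ` C') = {\<zero>\<^bsub>M\<^esub>})"

lemma msum_restrict: "msum (M\<lparr>carrier := U\<rparr>) S = msum M S"
proof (intro equalityI subsetI)
  fix x assume "x \<in> msum (M\<lparr>carrier := U\<rparr>) S"
  then show "x \<in> msum M S" by induction (auto intro: msum.intros)
next
  fix x assume "x \<in> msum M S"
  then show "x \<in> msum (M\<lparr>carrier := U\<rparr>) S"
  proof induction
    case zero
    then show ?case using msum.zero[of "M\<lparr>carrier := U\<rparr>" S] by simp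
  next
    case (step Z x y)
    then show ?case using msum.step[of Z S x y "M\<lparr>carrier := U\<rparr>"] by simp
  qed
qed

lemma opsub_restrict: "W \<subseteq> U \<Longrightarrow> U \<subseteq> carrier M \<Longrightarrow> opsub (M\<lparr>carrier := U\<rparr>) act Om L W \<longleftrightarrow> opsub M act Om L W"
  unfolding opsub_def by auto

context opmod
begin

abbreviation "gd \<equiv> good G M act Om"

lemma goodD:
  assumes "gd H U"
  shows "subgroup H G" "sub H U" "sumof (tra U ` carrier G) = carrier M"
  using assms unfolding good_def by auto

lemma goodD_indep:
  assumes "gd H U" "C \<subseteq> carrier G" "C' \<subseteq> carrier G" "\<And>c c' h. c \<in> C \<Longrightarrow> c' \<in> C' \<Longrightarrow> h \<in> H \<Longrightarrow> h \<otimes> c' \<noteq> c"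
    and "x \<in> sumof (tra U ` C)" "x \<in> sumof (tra U ` C')"
  shows "x = \<zero>\<^bsub>M\<^esub>"
proof -
  have "sumof (tra U ` C) \<inter> sumof (tra U ` C') = {\<zero>\<^bsub>M\<^esub>}"
    using assms(1) unfolding good_def
    by (elim conjE allE[of _ C] allE[of _ C'] impE) (simp_all add: assms(2-4))
  then show ?thesis using assms(5,6) by blast
qed

lemma sub_add: "\<lbrakk>sub L W; g \<in> carrier G\<rbrakk> \<Longrightarrow> sub {} (tra W g)"
  by (rule sub_tr) (auto intro: sub_mono simp: normalizes_def)

lemma sub_sums:
  assumes "sub L W" "C \<subseteq> carrier G" shows "sub {} (sumof (tra W ` C))"
proof (rule sumof_sub)
  fix Z assume "Z \<in> tra W ` C"
  then obtain g where "g \<in> C" "Z = tra W g" by blast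
  then show "sub {} Z" using sub_add[OF assms(1)] assms(2) by blast
qed simp

lemma tr_sums:
  assumes "W \<subseteq> carrier M" "C \<subseteq> carrier G" "g \<in> carrier G"
  shows "tra (sumof (tra W ` C)) g = sumof (tra W ` ((\<lambda>c. c \<otimes> g) ` C))"
proof -
  have "tra (sumof (tra W ` C)) g = sumof ((\<lambda>Z. tra Z g) ` (tra W ` C))"
    by (rule tr_sumof) (use tr_carrier[OF assms(1)] assms(2,3) in auto)
  also have "(\<lambda>Z. tra Z g) ` (tra W ` C) = tra W ` ((\<lambda>c. c \<otimes> g) ` C)"
    unfolding image_image by (rule image_cong) (use tr_tr[OF assms(1)] assms(2,3) in auto)
  finally show ?thesis .
qed

lemma tr_in_sums: "\<lbrakk>W \<subseteq> carrier M; C \<subseteq> carrier G; c \<in> C\<rbrakk> \<Longrightarrow> tra W c \<subseteq> sumof (tra W ` C)"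
  by (rule sumof_incl[OF imageI]) (auto intro: subsetD[OF tr_carrier])

lemma sumsI_sub:
  assumes "sub L W" "C \<subseteq> carrier G" "\<And>Z. Z \<in> S \<Longrightarrow> Z \<subseteq> sumof (tra W ` C)"
  shows "sumof S \<subseteq> sumof (tra W ` C)"
  by (rule sumof_least[OF sub_sums[OF assms(1,2)] assms(3)])

lemma sums_Un:
  assumes "W \<subseteq> carrier M" "C \<union> C' \<subseteq> carrier G" "z \<in> sumof (tra W ` (C \<union> C'))"
  shows "\<exists>x \<in> sumof (tra W ` C). \<exists>y \<in> sumof (tra W ` C'). z = x \<oplus>\<^bsub>M\<^esub> y"
proof (rule sumof_Un)
  show "z \<in> sumof (tra W ` C \<union> tra W ` C')" using assms(3) by (simp add: image_Un)
  show "Z \<subseteq> carrier M" if "Z \<in> tra W ` C \<union> tra W ` C'" for Z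
    using that tr_carrier[OF assms(1)] assms(2) by auto
qed

lemma sums_carrier: "\<lbrakk>W \<subseteq> carrier M; C \<subseteq> carrier G\<rbrakk> \<Longrightarrow> sumof (tra W ` C) \<subseteq> carrier M"
  using sumof_carrier[of "tra W ` C"] tr_carrier[of W] by blast

lemma add_cancel_diff:
  assumes "x \<in> carrier M" "y \<in> carrier M" "z \<in> carrier M" "z = x \<oplus>\<^bsub>M\<^esub> y"
  shows "x = z \<ominus>\<^bsub>M\<^esub> y" "y = z \<ominus>\<^bsub>M\<^esub> x"
proof -
  show "x = z \<ominus>\<^bsub>M\<^esub> y" using assms by (simp add: M.minus_eq M.a_assoc M.r_neg)
  have "z = y \<oplus>\<^bsub>M\<^esub> x" using assms by (simp add: M.a_comm)
  then show "y = z \<ominus>\<^bsub>M\<^esub> x" using assms(1,2) by (simp add: M.minus_eq M.a_assoc M.r_neg)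
qed

text \<open>Separation of two families reduces to one coset against a family: an element common to
  both sums is written with finitely many translates and stripped of its components one coset at a
  time.\<close>

lemma goodI:
  assumes H: "subgroup H G" and U: "sub H U" and full: "carrier M \<subseteq> sumof (tra U ` carrier G)"
    and ind: "\<And>t C x. t \<in> carrier G \<Longrightarrow> C \<subseteq> carrier G \<Longrightarrow> (\<And>c h. c \<in> C \<Longrightarrow> h \<in> H \<Longrightarrow> h \<otimes> c \<noteq> t) \<Longrightarrow>
      x \<in> tra U t \<Longrightarrow> x \<in> sumof (tra U ` C) \<Longrightarrow> x = \<zero>\<^bsub>M\<^esub>"
  shows "gd H U"
proof -
  interpret H: subgroup H G by fact
  have Uc: "U \<subseteq> carrier M" by (rule subD(1)[OF U])
  have key: "x = \<zero>\<^bsub>M\<^esub>" if "finite C" "C \<subseteq> carrier G" "C' \<subseteq> carrier G"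
    "\<And>c c' h. c \<in> C \<Longrightarrow> c' \<in> C' \<Longrightarrow> h \<in> H \<Longrightarrow> h \<otimes> c' \<noteq> c"
    "x \<in> sumof (tra U ` C)" "x \<in> sumof (tra U ` C')" for C C' x
    using that
  proof (induction C)
    case empty
    then show ?case by (simp add: sumof_empty)
  next
    case (insert t C)
    have tc: "t \<in> carrier G" and C: "C \<subseteq> carrier G" using insert.prems(1) by auto
    have IH: "x \<in> sumof (tra U ` C) \<Longrightarrow> x = \<zero>\<^bsub>M\<^esub>"
      by (rule insert.IH[OF C insert.prems(2) _ _ insert.prems(5)]) (use insert.prems(3) in auto)
    show ?case
    proof (cases "\<exists>c \<in> C. \<exists>h \<in> H. h \<otimes> c = t")
      case True
      then obtain c h where ch: "c \<in> C" "h \<in> H" "h \<otimes> c = t" by blast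
      have "tra U t = tra U c" using tr_coset[OF U ch(2) H, of c] ch C by blast
      then have "tra U ` insert t C = tra U ` C" using ch(1) by auto
      then show ?thesis using IH insert.prems(4) by simp
    next
      case False
      have "insert t C = {t} \<union> C" by simp
      then obtain u y where uy: "u \<in> sumof (tra U ` {t})" "y \<in> sumof (tra U ` C)" "x = u \<oplus>\<^bsub>M\<^esub> y"
        using sums_Un[OF Uc, of "{t}" C x] insert.prems(1,4) by auto
      have ut: "u \<in> tra U t" using uy(1) sumof_single[OF sub_add[OF U tc]] by simp
      have CC: "C \<union> C' \<subseteq> carrier G" using C insert.prems(2) by simp
      have cc: "u \<in> carrier M" "y \<in> carrier M" "x \<in> carrier M"
        using ut tr_carrier[OF Uc tc] uy(2) sums_carrier[OF Uc C] insert.prems(5) sums_carrier[OF Uc insert.prems(2)] by auto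
      have "sumof (tra U ` C) \<subseteq> sumof (tra U ` (C \<union> C'))" "sumof (tra U ` C') \<subseteq> sumof (tra U ` (C \<union> C'))"
        by (intro sumof_mono image_mono, simp)+
      then have "x \<ominus>\<^bsub>M\<^esub> y \<in> sumof (tra U ` (C \<union> C'))"
        using sub_minus[OF sub_sums[OF U CC]] uy(2) insert.prems(5) by blast
      then have us: "u \<in> sumof (tra U ` (C \<union> C'))" using add_cancel_diff(1)[OF cc uy(3)] by simp
      have "u = \<zero>\<^bsub>M\<^esub>"
      proof (rule ind[OF tc CC _ ut us])
        fix c h assume "c \<in> C \<union> C'" "h \<in> H"
        then show "h \<otimes> c \<noteq> t" using False insert.prems(3)[of t c h] by auto
      qed
      then have "x \<in> sumof (tra U ` C)" using uy(2,3) cc by simp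
      then show ?thesis by (rule IH)
    qed
  qed
  have "sumof (tra U ` C) \<inter> sumof (tra U ` C') = {\<zero>\<^bsub>M\<^esub>}"
    if C: "C \<subseteq> carrier G" "C' \<subseteq> carrier G" and CC: "\<forall>c \<in> C. \<forall>c' \<in> C'. \<forall>h \<in> H. h \<otimes> c' \<noteq> c" for C C'
  proof -
    have "x = \<zero>\<^bsub>M\<^esub>" if x: "x \<in> sumof (tra U ` C)" "x \<in> sumof (tra U ` C')" for x
    proof -
      obtain S where S: "finite S" "S \<subseteq> tra U ` C" "x \<in> sumof S" using sumof_finite[OF x(1)] by (elim exE conjE)
      obtain D where D: "D \<subseteq> C" "finite D" "S = tra U ` D" using finite_subset_image[OF S(1,2)] by (elim exE conjE)
      show ?thesis
      proof (rule key[OF D(2) _ C(2) _ _ x(2)])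
        show "D \<subseteq> carrier G" using D(1) C(1) by blast
        show "x \<in> sumof (tra U ` D)" using S(3) D(3) by simp
        show "h \<otimes> c' \<noteq> c" if "c \<in> D" "c' \<in> C'" "h \<in> H" for c c' h using CC D(1) that by blast
      qed
    qed
    then show ?thesis using msum.zero[of M] by blast
  qed
  moreover have "sumof (tra U ` carrier G) = carrier M" using full sums_carrier[OF Uc, of "carrier G"] by blast
  ultimately show ?thesis unfolding good_def using H U by blast
qed

text \<open>The translates of the larger module regroup those of \<open>U\<close>: each coset of
  \<open>H'\<close> is a union of cosets of \<open>H\<close>, and distinct cosets of
  \<open>H'\<close> share none of them.\<close>

lemma good_coarsen:
  assumes g: "gd H U" and H': "subgroup H' G" "H \<subseteq> H'"
  shows "gd H' (sumof (tra U ` H'))"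
proof -
  interpret H: subgroup H G by (rule goodD(1)[OF g])
  interpret H': subgroup H' G by fact
  let ?U = "sumof (tra U ` H')"
  have Uc: "U \<subseteq> carrier M" by (rule subD(1)[OF goodD(2)[OF g]])
  note U = goodD(2)[OF g]
  have sU: "sub {} ?U" by (rule sub_sums[OF U H'.subset])
  have act: "act x l \<in> ?U" if x: "x \<in> ?U" and l: "l \<in> H'" for x l
  proof -
    have lc: "l \<in> carrier G" using l H'.subset by blast
    have "act x l \<in> tra ?U l" using x by (auto simp: tr_def)
    also have "tra ?U l = sumof (tra U ` ((\<lambda>c. c \<otimes> l) ` H'))" by (rule tr_sums[OF Uc H'.subset lc])
    also have "\<dots> \<subseteq> ?U" by (intro sumof_mono image_mono) (use l in auto)
    finally show ?thesis .
  qed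
  have subU: "sub H' ?U" unfolding opsub_def using subD(1-4)[OF sU] act by simp
  have Uc': "?U \<subseteq> carrier M" by (rule subD(1)[OF subU])
  have UU: "U \<subseteq> ?U" using tr_in_sums[OF Uc H'.subset H'.one_closed] tr_one[OF Uc] by simp
  have trU: "tra ?U t \<subseteq> sumof (tra U ` D)" if "t \<in> carrier G" "\<And>h. h \<in> H' \<Longrightarrow> h \<otimes> t \<in> D" for t D
    unfolding tr_sums[OF Uc H'.subset that(1)] by (intro sumof_mono image_mono) (use that(2) in auto)
  show ?thesis
  proof (rule goodI[OF H'(1) subU])
    have "sumof (tra U ` carrier G) \<subseteq> sumof (tra ?U ` carrier G)"
    proof (rule sumsI_sub[OF subU order.refl])
      fix Z assume "Z \<in> tra U ` carrier G"
      then obtain t where t: "t \<in> carrier G" "Z = tra U t" by blast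
      have "tra U t \<subseteq> tra ?U t" using UU by (auto simp: tr_def)
      then show "Z \<subseteq> sumof (tra ?U ` carrier G)" using tr_in_sums[OF Uc' order.refl t(1)] t(2) by blast
    qed
    then show "carrier M \<subseteq> sumof (tra ?U ` carrier G)" using goodD(3)[OF g] by simp
    fix t C x assume t: "t \<in> carrier G" and C: "C \<subseteq> carrier G"
      and tC: "\<And>c h. c \<in> C \<Longrightarrow> h \<in> H' \<Longrightarrow> h \<otimes> c \<noteq> t" and x: "x \<in> tra ?U t" "x \<in> sumof (tra ?U ` C)"
    let ?A = "(\<lambda>h. h \<otimes> t) ` H'" and ?B = "(\<lambda>(h, c). h \<otimes> c) ` (H' \<times> C)"
    have AB: "?A \<subseteq> carrier G" "?B \<subseteq> carrier G" using t C H'.mem_carrier by auto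
    have xA: "x \<in> sumof (tra U ` ?A)" using trU[OF t, of ?A] x(1) by auto
    have "sumof (tra ?U ` C) \<subseteq> sumof (tra U ` ?B)"
    proof (rule sumsI_sub[OF U AB(2)])
      fix Z assume "Z \<in> tra ?U ` C"
      then obtain c where c: "c \<in> C" "Z = tra ?U c" by blast
      show "Z \<subseteq> sumof (tra U ` ?B)" unfolding c(2) by (rule trU) (use c(1) C in auto)
    qed
    then have xB: "x \<in> sumof (tra U ` ?B)" using x(2) by blast
    show "x = \<zero>\<^bsub>M\<^esub>"
    proof (rule goodD_indep[OF g AB _ xA xB])
      fix a b h assume "a \<in> ?A" "b \<in> ?B" "h \<in> H"
      then obtain h1 h2 c where hc: "h1 \<in> H'" "a = h1 \<otimes> t" "h2 \<in> H'" "c \<in> C" "b = h2 \<otimes> c" "h \<in> H'"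
        using H'(2) by auto
      show "h \<otimes> b \<noteq> a"
      proof
        assume eq: "h \<otimes> b = a"
        have cG: "h1 \<in> carrier G" "h2 \<in> carrier G" "c \<in> carrier G" "h \<in> carrier G" using hc C H'.mem_carrier by auto
        have "t = inv h1 \<otimes> (h1 \<otimes> t)" using cG t by (simp add: G.m_assoc[symmetric])
        also have "\<dots> = inv h1 \<otimes> (h \<otimes> (h2 \<otimes> c))" using eq hc by simp
        also have "\<dots> = (inv h1 \<otimes> (h \<otimes> h2)) \<otimes> c" using cG by (simp add: G.m_assoc)
        finally have "(inv h1 \<otimes> (h \<otimes> h2)) \<otimes> c = t" by simp
        moreover have "inv h1 \<otimes> (h \<otimes> h2) \<in> H'" using hc by simp
        ultimately show False using tC[OF hc(4)] by blast
      qed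
    qed
  qed
qed

text \<open>If the translates of \<open>W\<close> generate \<open>M\<close>, each \<open>u\<close>
  in \<open>U\<close> splits into a part from \<open>H\<close>, which lies in \<open>W\<close>, and
  a part from the other cosets. The latter lies in \<open>U\<close> as well as in the sum of its
  other translates, so it is zero.\<close>

lemma good_irreducible:
  assumes g: "gd H U" and irr: "\<And>W. sub (carrier G) W \<Longrightarrow> W = {\<zero>\<^bsub>M\<^esub>} \<or> W = carrier M"
    and W: "sub H W" "W \<subseteq> U"
  shows "W = {\<zero>\<^bsub>M\<^esub>} \<or> W = U"
proof -
  interpret H: subgroup H G by (rule goodD(1)[OF g])
  have Uc: "U \<subseteq> carrier M" by (rule subD(1)[OF goodD(2)[OF g]])
  have Wc: "W \<subseteq> carrier M" by (rule subD(1)[OF W(1)])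
  let ?W = "sumof (tra W ` carrier G)"
  have sW: "sub {} ?W" by (rule sub_sums[OF W(1) order.refl])
  have act: "act x l \<in> ?W" if x: "x \<in> ?W" and l: "l \<in> carrier G" for x l
  proof -
    have "act x l \<in> tra ?W l" using x by (auto simp: tr_def)
    also have "tra ?W l = sumof (tra W ` ((\<lambda>c. c \<otimes> l) ` carrier G))" by (rule tr_sums[OF Wc order.refl l])
    also have "\<dots> \<subseteq> ?W" by (intro sumof_mono image_mono) (use l in auto)
    finally show ?thesis .
  qed
  have WW: "W \<subseteq> ?W" using tr_in_sums[OF Wc order.refl G.one_closed] tr_one[OF Wc] by simp
  have "sub (carrier G) ?W" unfolding opsub_def using subD(1-4)[OF sW] act by simp
  from irr[OF this] show ?thesis
  proof
    assume "?W = {\<zero>\<^bsub>M\<^esub>}"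
    then show ?thesis using WW subD(2)[OF W(1)] by blast
  next
    assume full: "?W = carrier M"
    have HG: "H \<union> (carrier G - H) = carrier G" using H.subset by blast
    have "u \<in> W" if u: "u \<in> U" for u
    proof -
      have "u \<in> sumof (tra W ` (H \<union> (carrier G - H)))" using full u Uc HG by auto
      from sums_Un[OF Wc _ this] obtain y z where yz: "y \<in> sumof (tra W ` H)" "z \<in> sumof (tra W ` (carrier G - H))"
        "u = y \<oplus>\<^bsub>M\<^esub> z" using HG by auto
      have "tra W h \<subseteq> W" if "h \<in> H" for h using subD(5)[OF W(1) _ that] by (auto simp: tr_def)
      then have "sumof (tra W ` H) \<subseteq> W" by (intro sumof_least[OF W(1)]) auto
      then have yW: "y \<in> W" using yz(1) by blast
      have cc: "y \<in> carrier M" "z \<in> carrier M" "u \<in> carrier M"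
        using yW Wc yz(2) sums_carrier[OF Wc, of "carrier G - H"] u Uc by auto
      have zU: "z \<in> U" using add_cancel_diff(2)[OF cc yz(3)] sub_minus[OF goodD(2)[OF g] u] yW W(2) by auto
      have z1: "z \<in> sumof (tra U ` {\<one>})"
        using zU tr_one[OF Uc] sumof_single[OF goodD(2)[OF g]] by simp
      have "sumof (tra W ` (carrier G - H)) \<subseteq> sumof (tra U ` (carrier G - H))"
      proof (rule sumsI_sub[OF goodD(2)[OF g]])
        fix Z assume "Z \<in> tra W ` (carrier G - H)"
        then obtain c where c: "c \<in> carrier G - H" "Z = tra W c" by blast
        have "tra W c \<subseteq> tra U c" using W(2) by (auto simp: tr_def)
        then show "Z \<subseteq> sumof (tra U ` (carrier G - H))" using tr_in_sums[OF Uc _ c(1)] c(2) by blast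
      qed simp
      then have z2: "z \<in> sumof (tra U ` (carrier G - H))" using yz(2) by blast
      have "z = \<zero>\<^bsub>M\<^esub>"
      proof (rule goodD_indep[OF g _ _ _ z1 z2])
        fix c c' h assume a: "c \<in> {\<one>}" "c' \<in> carrier G - H" "h \<in> H"
        show "h \<otimes> c' \<noteq> c"
        proof
          assume "h \<otimes> c' = c"
          then have "c' = inv h" using a H.mem_carrier[OF a(3)] by (metis DiffD1 G.inv_equality G.inv_inv singletonD)
          then show False using a by simp
        qed
      qed auto
      then show ?thesis using yz(3) yW cc by simp
    qed
    then show ?thesis using W(2) by blast
  qed
qed

text \<open>After translation by \<open>inv t\<close> the coset in question is \<open>H'\<close>
  itself. Cosets outside \<open>H\<close> are separated from it by the outer induction, and the
  remaining cosets inside \<open>H\<close> by the inner one.\<close>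

lemma good_trans:
  assumes g: "gd H U" and g': "good (G\<lparr>carrier := H\<rparr>) (M\<lparr>carrier := U\<rparr>) act Om H' U'"
  shows "gd H' U'"
proof -
  interpret H: subgroup H G by (rule goodD(1)[OF g])
  note U = goodD(2)[OF g]
  have Uc: "U \<subseteq> carrier M" by (rule subD(1)[OF U])
  have sH': "subgroup H' (G\<lparr>carrier := H\<rparr>)" and oU': "opsub (M\<lparr>carrier := U\<rparr>) act Om H' U'"
    and full': "sumof (tra U' ` H) = U"
    using g' unfolding good_def by (auto simp: msum_restrict)
  have ind': "x = \<zero>\<^bsub>M\<^esub>" if "C \<subseteq> H" "C' \<subseteq> H" "\<forall>c \<in> C. \<forall>c' \<in> C'. \<forall>h \<in> H'. h \<otimes> c' \<noteq> c"
    "x \<in> sumof (tra U' ` C)" "x \<in> sumof (tra U' ` C')" for C C' x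
  proof -
    have "sumof (tra U' ` C) \<inter> sumof (tra U' ` C') = {\<zero>\<^bsub>M\<^esub>}"
      using g' that(1-3) unfolding good_def by (simp add: msum_restrict)
    then show ?thesis using that(4,5) by blast
  qed
  have H': "subgroup H' G" by (rule G.incl_subgroup[OF goodD(1)[OF g] sH'])
  interpret H': subgroup H' G by fact
  have HH: "H' \<subseteq> H" using subgroup.subset[OF sH'] by simp
  have U'U: "U' \<subseteq> U" using oU' by (simp add: opsub_def)
  have U': "sub H' U'" using oU' opsub_restrict[OF U'U Uc] by blast
  have U'c: "U' \<subseteq> carrier M" using U'U Uc by blast
  show ?thesis
  proof (rule goodI[OF H' U'])
    have "sumof (tra U ` carrier G) \<subseteq> sumof (tra U' ` carrier G)"
    proof (rule sumsI_sub[OF U' order.refl])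
      fix Z assume "Z \<in> tra U ` carrier G"
      then obtain t where t: "t \<in> carrier G" "Z = tra U t" by blast
      have "Z = sumof (tra U' ` ((\<lambda>c. c \<otimes> t) ` H))"
        using tr_sums[OF U'c H.subset t(1)] full' t(2) by simp
      also have "\<dots> \<subseteq> sumof (tra U' ` carrier G)"
        by (intro sumof_mono image_mono) (use t H.mem_carrier in auto)
      finally show "Z \<subseteq> sumof (tra U' ` carrier G)" .
    qed
    then show "carrier M \<subseteq> sumof (tra U' ` carrier G)" using goodD(3)[OF g] by simp
    fix t C x assume t: "t \<in> carrier G" and C: "C \<subseteq> carrier G"
      and tC: "\<And>c h. c \<in> C \<Longrightarrow> h \<in> H' \<Longrightarrow> h \<otimes> c \<noteq> t" and x: "x \<in> tra U' t" "x \<in> sumof (tra U' ` C)"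
    define D where "D = (\<lambda>c. c \<otimes> inv t) ` C"
    have Dc: "D \<subseteq> carrier G" using C t by (auto simp: D_def)
    have D': "h \<otimes> d \<noteq> \<one>" if d: "d \<in> D" and h: "h \<in> H'" for d h
    proof
      assume eq: "h \<otimes> d = \<one>"
      obtain c where c: "c \<in> C" "d = c \<otimes> inv t" using d by (auto simp: D_def)
      have cc: "c \<in> carrier G" "h \<in> carrier G" using c C H'.mem_carrier[OF h] by auto
      have "h \<otimes> c = (h \<otimes> d) \<otimes> t" using c(2) cc t by (simp add: G.m_assoc)
      then show False using tC[OF c(1) h] eq t by simp
    qed
    define y where "y = act x (inv t)"
    have ti: "inv t \<in> carrier G" using t by simp
    have xc: "x \<in> carrier M" using x(1) tr_carrier[OF U'c t] by blast
    have yU': "y \<in> U'" using x(1) mem_tr_iff[OF U'c t xc] by (simp add: y_def)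
    have "y \<in> tra (sumof (tra U' ` C)) (inv t)" using x(2) by (auto simp: y_def tr_def)
    then have yD: "y \<in> sumof (tra U' ` D)" unfolding tr_sums[OF U'c C ti] D_def .
    have Dsplit: "D = (D \<inter> H) \<union> (D - H)" by blast
    then have "y \<in> sumof (tra U' ` ((D \<inter> H) \<union> (D - H)))" using yD by simp
    from sums_Un[OF U'c _ this] obtain a b where ab: "a \<in> sumof (tra U' ` (D \<inter> H))" "b \<in> sumof (tra U' ` (D - H))"
      "y = a \<oplus>\<^bsub>M\<^esub> b" using Dc by auto
    have "sumof (tra U' ` (D \<inter> H)) \<subseteq> sumof (tra U' ` H)" by (intro sumof_mono image_mono) simp
    then have aU: "a \<in> U" using ab(1) full' by blast
    have bc: "b \<in> carrier M" using ab(2) sums_carrier[OF U'c, of "D - H"] Dc by blast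
    have cc: "a \<in> carrier M" "b \<in> carrier M" "y \<in> carrier M" using aU Uc bc yU' U'c by auto
    have yU: "y \<in> U" using yU' U'U by blast
    have bU: "b \<in> U" using add_cancel_diff(2)[OF cc ab(3)] sub_minus[OF U yU aU] by simp
    have b1: "b \<in> sumof (tra U ` {\<one>})" using bU tr_one[OF Uc] sumof_single[OF U] by simp
    have DH: "D - H \<subseteq> carrier G" using Dc by blast
    have "sumof (tra U' ` (D - H)) \<subseteq> sumof (tra U ` (D - H))"
    proof (rule sumsI_sub[OF U DH])
      fix Z assume "Z \<in> tra U' ` (D - H)"
      then obtain c where c: "c \<in> D - H" "Z = tra U' c" by blast
      have "tra U' c \<subseteq> tra U c" using U'U by (auto simp: tr_def)
      then show "Z \<subseteq> sumof (tra U ` (D - H))" using tr_in_sums[OF Uc DH c(1)] c(2) by blast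
    qed
    then have b2: "b \<in> sumof (tra U ` (D - H))" using ab(2) by blast
    have "b = \<zero>\<^bsub>M\<^esub>"
    proof (rule goodD_indep[OF g _ DH _ b1 b2])
      fix c c' h assume a: "c \<in> {\<one>}" "c' \<in> D - H" "h \<in> H"
      show "h \<otimes> c' \<noteq> c"
      proof
        assume eq: "h \<otimes> c' = c"
        have "c' \<in> carrier G" using a(2) Dc by blast
        then have "c' = inv h" using eq a(1) H.mem_carrier[OF a(3)] by (metis G.inv_equality G.inv_inv singletonD)
        then show False using a by simp
      qed
    qed simp
    then have ya: "y \<in> sumof (tra U' ` (D \<inter> H))" using ab(1,3) cc by simp
    have y1: "y \<in> sumof (tra U' ` {\<one>})" using yU' tr_one[OF U'c] sumof_single[OF U'] by simp
    have "y = \<zero>\<^bsub>M\<^esub>"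
    proof (rule ind'[OF _ _ _ y1 ya])
      show "\<forall>c\<in>{\<one>}. \<forall>c'\<in>D \<inter> H. \<forall>h\<in>H'. h \<otimes> c' \<noteq> c" using D' by blast
    qed (use H.one_closed in auto)
    then show "x = \<zero>\<^bsub>M\<^esub>" using act_eq_zero[OF xc ti] by (simp add: y_def)
  qed
qed

lemma good_self: "gd (carrier G) (carrier M)"
proof (rule goodI[OF G.subgroup_self sub_full[OF order.refl]])
  show "carrier M \<subseteq> sumof (tra (carrier M) ` carrier G)"
    using tr_in_sums[OF order.refl order.refl G.one_closed] tr_one[OF order.refl] by simp
  fix t C x assume t: "t \<in> carrier G" and C: "C \<subseteq> carrier G"
    and tC: "\<And>c h. c \<in> C \<Longrightarrow> h \<in> carrier G \<Longrightarrow> h \<otimes> c \<noteq> t" and x: "x \<in> sumof (tra (carrier M) ` C)"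
  have "C = {}"
  proof (rule ccontr)
    assume "C \<noteq> {}"
    then obtain c where c: "c \<in> C" by blast
    then have "c \<in> carrier G" using C by blast
    then have "(t \<otimes> inv c) \<otimes> c = t" using t by (simp add: G.m_assoc)
    then show False using tC[OF c] t \<open>c \<in> carrier G\<close> by (metis G.inv_closed G.m_closed)
  qed
  then show "x = \<zero>\<^bsub>M\<^esub>" using x sumof_empty by simp
qed

lemma good_nonzero:
  assumes "gd H U" "carrier M \<noteq> {\<zero>\<^bsub>M\<^esub>}" shows "U \<noteq> {\<zero>\<^bsub>M\<^esub>}"
proof
  assume U: "U = {\<zero>\<^bsub>M\<^esub>}"
  have "tra U g = {\<zero>\<^bsub>M\<^esub>}" if "g \<in> carrier G" for g using act_zero[OF that] by (simp add: U tr_def)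
  then have "sumof (tra U ` carrier G) \<subseteq> {\<zero>\<^bsub>M\<^esub>}"
    by (intro sumof_least[OF sub_zero[OF order.refl]]) auto
  then show False using goodD(3)[OF assms(1)] assms(2) by auto
qed

end

section \<open>Induction from subgroups with free abelian quotient\<close>

text \<open>An identification of \<open>G/L\<close> with the integer vectors of length
  \<open>k\<close> through representatives \<open>\<rho> a\<close>. The left factor from
  \<open>L\<close> in \<open>\<rho>_add\<close> is invisible to translates of
  \<open>L\<close>-submodules.\<close>

locale coset_grading = opmod G M act Om
  for G :: "('g, 'b) monoid_scheme" (structure) and M :: "('m, 'c) ring_scheme" (structure) and act Om +
  fixes L :: "'g set" and k :: nat and \<rho> :: "(nat \<Rightarrow> int) \<Rightarrow> 'g"
  assumes L: "subgroup L G" and nL: "g \<in> carrier G \<Longrightarrow> normalizes G g L"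
    and \<rho>_closed: "\<rho> a \<in> carrier G"
    and \<rho>_add: "\<exists>l \<in> L. \<rho> (a + b) = l \<otimes> (\<rho> a \<otimes> \<rho> b)"
    and \<rho>_surj: "g \<in> carrier G \<Longrightarrow> \<exists>a \<in> zvec k. \<exists>l \<in> L. g = l \<otimes> \<rho> a"
    and \<rho>_inj: "\<lbrakk>a \<in> zvec k; \<rho> a \<in> L\<rbrakk> \<Longrightarrow> a = 0"
begin

lemma Lc: "L \<subseteq> carrier G" by (rule subgroup.subset[OF L])

lemma \<rho>_zero: "\<rho> 0 \<in> L"
proof -
  obtain l where l: "l \<in> L" "\<rho> (0 + 0) = l \<otimes> (\<rho> 0 \<otimes> \<rho> 0)" using \<rho>_add[of 0 0] by blast
  have c: "l \<in> carrier G" "\<rho> 0 \<in> carrier G" using l(1) Lc \<rho>_closed by auto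
  have "(l \<otimes> \<rho> 0) \<otimes> \<rho> 0 = \<one> \<otimes> \<rho> 0" using l(2) c by (simp add: G.m_assoc)
  then have "l \<otimes> \<rho> 0 = \<one>" using c by (metis G.m_closed G.one_closed G.r_cancel)
  then have "\<rho> 0 = inv l" using c by (metis G.inv_equality G.inv_inv G.inv_closed)
  then show ?thesis using l(1) subgroup.m_inv_closed[OF L] by simp
qed

definition shift :: "'m set \<Rightarrow> (nat \<Rightarrow> int) \<Rightarrow> 'm set" where
  "shift K a = tra K (\<rho> a)"

definition meets :: "'m set \<Rightarrow> 'm set set \<Rightarrow> bool" where
  "meets K S \<longleftrightarrow> K \<inter> sumof S \<noteq> {\<zero>\<^bsub>M\<^esub>}"

lemma shift_coset: "sub L K \<Longrightarrow> l \<in> L \<Longrightarrow> tra K (l \<otimes> \<rho> a) = shift K a"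
  unfolding shift_def by (rule tr_coset[OF _ _ L \<rho>_closed])

lemma shift_add:
  assumes "sub L K" shows "shift (shift K a) b = shift K (a + b)"
proof -
  obtain l where l: "l \<in> L" "\<rho> (a + b) = l \<otimes> (\<rho> a \<otimes> \<rho> b)" using \<rho>_add by blast
  have ab: "\<rho> a \<otimes> \<rho> b \<in> carrier G" using \<rho>_closed by simp
  have "shift K (a + b) = tra K (\<rho> a \<otimes> \<rho> b)"
    unfolding shift_def l(2) by (rule tr_coset[OF assms l(1) L ab])
  then show ?thesis unfolding shift_def tr_tr[OF subD(1)[OF assms] \<rho>_closed \<rho>_closed] by simp
qed

lemma shift_zero: assumes "sub L K" shows "shift K 0 = K"
proof -
  have "tra K (\<rho> 0 \<otimes> \<one>) = tra K \<one>" by (rule tr_coset[OF assms \<rho>_zero L]) simp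
  then show ?thesis unfolding shift_def using \<rho>_closed tr_one[OF subD(1)[OF assms]] by simp
qed

lemma crit_sums: "S \<subseteq> {K. crit L K} \<Longrightarrow> sub L (sumof S)"
  by (rule sumof_sub[OF _ Lc]) (auto dest: critD(1))

text \<open>Exchange merely rearranges \<open>z = x \<oplus> w\<close>; transitivity is where
  criticality acts, through \<open>crit_meets_trans\<close>.\<close>

sublocale td: translated_dependence "{K. crit L K}" meets shift
proof
  fix K K' :: "'m set" and S S' :: "'m set set" and a b :: "nat \<Rightarrow> int"
  show "\<not> meets K {}" if "K \<in> {K. crit L K}"
    using that subD(2)[OF critD(1), of L K] by (auto simp: meets_def sumof_empty)
  show "meets K S" if "K \<in> S" "S \<subseteq> {K. crit L K}"
  proof -
    have K: "crit L K" using that by blast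
    have "K \<subseteq> sumof S" by (rule sumof_incl[OF that(1) subD(1)[OF critD(1)[OF K]]])
    then show ?thesis using critD(2)[OF K] by (simp add: meets_def Int_absorb2)
  qed
  show "meets K S'" if "meets K S" "S \<subseteq> S'" "S' \<subseteq> {K. crit L K}"
    using that(1) sumof_mono[OF that(2)] msum.zero[of M S] unfolding meets_def by blast
  show "meets K' S" if K': "K' \<in> {K. crit L K}" and K: "K \<in> {K. crit L K}" and S: "S \<subseteq> {K. crit L K}"
    and m: "meets K S" "meets K' (insert K S)"
  proof -
    have cK: "crit L K" and sK': "sub L K'" and sS: "sub L (sumof S)"
      using K K' critD(1) crit_sums[OF S] by auto
    obtain v where v: "v \<in> K" "v \<in> sumof S" "v \<noteq> \<zero>\<^bsub>M\<^esub>"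
      using m(1) subD(2)[OF critD(1)[OF cK]] subD(2)[OF sS] unfolding meets_def by blast
    have "\<zero>\<^bsub>M\<^esub> \<in> K'" "\<zero>\<^bsub>M\<^esub> \<in> sumof (insert K S)" by (rule subD(2)[OF sK'], rule msum.zero)
    then obtain z where z: "z \<in> K'" "z \<in> sumof (insert K S)" "z \<noteq> \<zero>\<^bsub>M\<^esub>" using m(2) unfolding meets_def by blast
    have Sc: "Y \<subseteq> carrier M" if "Y \<in> S" for Y using S that critD(1) subD(1) by blast
    from sumof_insert[OF critD(1)[OF cK] Sc z(2)] obtain x w where xw: "x \<in> K" "w \<in> sumof S" "z = x \<oplus>\<^bsub>M\<^esub> w" by blast
    show ?thesis unfolding meets_def
      by (rule crit_meets_trans[OF cK sK' sS Lc v xw(1,2)]) (use z xw(3) in auto)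
  qed
  show "meets K (insert K' S)" if K': "K' \<in> {K. crit L K}" and K: "K \<in> {K. crit L K}" and S: "S \<subseteq> {K. crit L K}"
    and m: "meets K' (insert K S)" "\<not> meets K' S"
  proof -
    have cK: "crit L K" and sK': "sub L K'" and sS: "sub L (sumof S)"
      using K K' critD(1) crit_sums[OF S] by auto
    have "\<zero>\<^bsub>M\<^esub> \<in> K'" "\<zero>\<^bsub>M\<^esub> \<in> sumof (insert K S)" by (rule subD(2)[OF sK'], rule msum.zero)
    then obtain z where z: "z \<in> K'" "z \<in> sumof (insert K S)" "z \<noteq> \<zero>\<^bsub>M\<^esub>" using m(1) unfolding meets_def by blast
    have Sc: "Y \<subseteq> carrier M" if "Y \<in> S" for Y using S that critD(1) subD(1) by blast
    from sumof_insert[OF critD(1)[OF cK] Sc z(2)] obtain x w where xw: "x \<in> K" "w \<in> sumof S" "z = x \<oplus>\<^bsub>M\<^esub> w" by blast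
    have cc: "x \<in> carrier M" "w \<in> carrier M" "z \<in> carrier M"
      using sub_carrier[OF critD(1)[OF cK] xw(1)] sub_carrier[OF sS xw(2)] sub_carrier[OF sK' z(1)] .
    have "x \<noteq> \<zero>\<^bsub>M\<^esub>"
    proof
      assume "x = \<zero>\<^bsub>M\<^esub>"
      then have "z = w" using xw(3) cc by simp
      then have "z \<in> K' \<inter> sumof S" using z(1) xw(2) by simp
      then show False using m(2) z(3) unfolding meets_def by blast
    qed
    moreover have "x \<in> sumof (insert K' S)"
    proof -
      have sI: "sub L (sumof (insert K' S))" by (rule crit_sums) (use K' S in auto)
      have "z \<in> sumof (insert K' S)" using sumof_incl[of K' "insert K' S"] subD(1)[OF sK'] z(1) by blast
      moreover have "w \<in> sumof (insert K' S)" using sumof_mono[of S "insert K' S"] xw(2) by blast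
      ultimately have "z \<ominus>\<^bsub>M\<^esub> w \<in> sumof (insert K' S)" by (rule sub_minus[OF sI])
      then show ?thesis using add_cancel_diff(1)[OF cc xw(3)] by simp
    qed
    ultimately show ?thesis using xw(1) unfolding meets_def by blast
  qed
  show "shift K a \<in> {K. crit L K}" if "K \<in> {K. crit L K}"
    using crit_tr[of L K "\<rho> a"] that \<rho>_closed nL[OF \<rho>_closed] Lc by (simp add: shift_def)
  show "shift (shift K a) b = shift K (a + b)" if "K \<in> {K. crit L K}"
    by (rule shift_add) (use that critD(1) in blast)
  show "shift K 0 = K" if "K \<in> {K. crit L K}"
    by (rule shift_zero) (use that critD(1) in blast)
  show "meets (shift K a) ((\<lambda>K. shift K a) ` S)" if K: "K \<in> {K. crit L K}" and S: "S \<subseteq> {K. crit L K}" and m: "meets K S"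
  proof -
    have sK: "sub L K" and sS: "sub L (sumof S)" using K critD(1) crit_sums[OF S] by auto
    have "sumof ((\<lambda>K. tra K (\<rho> a)) ` S) = tra (sumof S) (\<rho> a)"
      by (rule tr_sumof[symmetric, OF _ \<rho>_closed]) (use S critD(1) subD(1) in blast)
    then show ?thesis
      using m tr_Int_zero[OF subD(1)[OF sK] subD(1)[OF sS] subD(2)[OF sK] subD(2)[OF sS] \<rho>_closed, of a]
      unfolding meets_def shift_def by simp
  qed
qed

lemma \<rho>_pow: "\<exists>l \<in> L. \<rho> (\<lambda>i. int n * a i) = l \<otimes> \<rho> a [^] n"
proof (induction n)
  case 0
  have "(\<lambda>i. int 0 * a i) = 0" by auto
  then show ?case using \<rho>_zero Lc by (intro bexI[of _ "\<rho> 0"]) auto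
next
  case (Suc n)
  then obtain l where l: "l \<in> L" "\<rho> (\<lambda>i. int n * a i) = l \<otimes> \<rho> a [^] n" by blast
  have e: "(\<lambda>i. int (Suc n) * a i) = (\<lambda>i. int n * a i) + a" by (auto simp: algebra_simps)
  obtain m where m: "m \<in> L" "\<rho> ((\<lambda>i. int n * a i) + a) = m \<otimes> (\<rho> (\<lambda>i. int n * a i) \<otimes> \<rho> a)" using \<rho>_add by blast
  have c: "l \<in> carrier G" "m \<in> carrier G" "\<rho> a \<in> carrier G" using l(1) m(1) Lc \<rho>_closed by auto
  have "\<rho> (\<lambda>i. int (Suc n) * a i) = (m \<otimes> l) \<otimes> \<rho> a [^] Suc n"
    unfolding e m(2) l(2) using c by (simp add: G.m_assoc)
  then show ?case using subgroup.m_closed[OF L m(1) l(1)] by blast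
qed

text \<open>Any finite set of translates of \<open>V\<close> can be moved into the nonnegative orthant, so independence
  there is enough.\<close>

lemma good_if_free:
  assumes V: "crit L V" and free: "td.free k unit_vec V {..<k}" and full: "sumof (tra V ` carrier G) = carrier M"
  shows "gd L V"
proof (rule goodI[OF L critD(1)[OF V]])
  note sV = critD(1)[OF V]
  show "carrier M \<subseteq> sumof (tra V ` carrier G)" using full by simp
  fix t C x assume t: "t \<in> carrier G" and C: "C \<subseteq> carrier G"
    and tC: "\<And>c h. c \<in> C \<Longrightarrow> h \<in> L \<Longrightarrow> h \<otimes> c \<noteq> t" and x: "x \<in> tra V t" "x \<in> sumof (tra V ` C)"
  obtain b l where b: "b \<in> zvec k" "l \<in> L" "t = l \<otimes> \<rho> b" using \<rho>_surj[OF t] by blast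
  have "\<forall>c \<in> C. \<exists>a. a \<in> zvec k \<and> (\<exists>l \<in> L. c = l \<otimes> \<rho> a)" using \<rho>_surj C by blast
  from bchoice[OF this] obtain \<beta> where \<beta>: "\<forall>c \<in> C. \<beta> c \<in> zvec k \<and> (\<exists>l \<in> L. c = l \<otimes> \<rho> (\<beta> c))" by (elim exE)
  have trt: "tra V t = shift V b" unfolding b(3) by (rule shift_coset[OF sV b(2)])
  have trc: "tra V c = shift V (\<beta> c)" if c: "c \<in> C" for c
  proof -
    obtain l' where l': "l' \<in> L" "c = l' \<otimes> \<rho> (\<beta> c)" using \<beta> c by blast
    have "tra V c = tra V (l' \<otimes> \<rho> (\<beta> c))" using l'(2) by simp
    then show ?thesis using shift_coset[OF sV l'(1)] by simp
  qed
  have ne: "\<beta> c \<noteq> b" if c: "c \<in> C" for c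
  proof
    assume eq: "\<beta> c = b"
    obtain l' where l': "l' \<in> L" "c = l' \<otimes> \<rho> b" using \<beta> c eq by blast
    have cc: "l \<in> carrier G" "l' \<in> carrier G" using b(2) l'(1) Lc by auto
    have "(l \<otimes> inv l') \<otimes> c = l \<otimes> (inv l' \<otimes> (l' \<otimes> \<rho> b))"
      unfolding l'(2) using cc \<rho>_closed by (simp add: G.m_assoc)
    also have "inv l' \<otimes> (l' \<otimes> \<rho> b) = \<rho> b" using cc \<rho>_closed by (simp add: G.m_assoc[symmetric])
    finally have "(l \<otimes> inv l') \<otimes> c = t" using b(3) by simp
    moreover have "l \<otimes> inv l' \<in> L" using b(2) l'(1) L by (simp add: subgroup.m_closed subgroup.m_inv_closed)
    ultimately show False using tC[OF c] by blast
  qed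
  obtain S where S: "finite S" "S \<subseteq> tra V ` C" "x \<in> sumof S" using sumof_finite[OF x(2)] by (elim exE conjE)
  obtain D where D: "D \<subseteq> C" "finite D" "S = tra V ` D" using finite_subset_image[OF S(1,2)] by (elim exE conjE)
  define B where "B = \<beta> ` D"
  have Bf: "finite B" "b \<notin> B" "B \<subseteq> zvec k" using D ne \<beta> by (auto simp: B_def)
  have SB: "S = shift V ` B" unfolding D(3) B_def image_image by (rule image_cong) (use trc D(1) in auto)
  \<comment> \<open>In each coordinate, the sum of all absolute values involved is a shift that
    makes every exponent nonnegative.\<close>
  define s where "s = (\<lambda>i. if i < k then \<Sum>a \<in> insert b B. \<bar>a i\<bar> else 0)"
  have nonneg: "0 \<le> (a + s) i" if "a \<in> insert b B" "i < k" for a i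
  proof -
    have "\<bar>a i\<bar> \<le> (\<Sum>a \<in> insert b B. \<bar>a i\<bar>)" by (rule member_le_sum[OF that(1)]) (use Bf(1) in auto)
    then show ?thesis using that(2) by (simp add: s_def)
  qed
  define nu where "nu a = (\<lambda>i. nat ((a + s) i))" for a :: "nat \<Rightarrow> int"
  have outs: "(a + s) i = 0" if "a \<in> insert b B" "\<not> i < k" for a i
    using that Bf(3) b(1) by (auto simp: zvec_def s_def)
  have cnu: "comb k unit_vec (nu a) = a + s" if a: "a \<in> insert b B" for a
  proof
    fix i show "comb k unit_vec (nu a) i = (a + s) i"
      using nonneg[OF a, of i] outs[OF a, of i] by (simp add: comb_unit nu_def)
  qed
  have inj: "a = a'" if "a \<in> insert b B" "a' \<in> insert b B" "nu a = nu a'" for a a'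
  proof -
    have "a + s = comb k unit_vec (nu a)" by (rule cnu[OF that(1), symmetric])
    also have "\<dots> = a' + s" unfolding that(3) by (rule cnu[OF that(2)])
    finally show ?thesis by (rule add_right_imp_eq)
  qed
  let ?Y = "nu ` insert b B"
  have Yv: "?Y \<subseteq> vsupp {..<k}" using outs by (auto simp: vsupp_def nu_def)
  have nm: "\<not> meets (shift V (comb k unit_vec (nu b))) ((\<lambda>n. shift V (comb k unit_vec n)) ` (?Y - {nu b}))"
    by (rule free[unfolded td.free_def, rule_format, OF _ Yv]) (use Bf(1) in auto)
  have "?Y - {nu b} = nu ` B" using inj Bf(2) by auto
  then have "(\<lambda>n. shift V (comb k unit_vec n)) ` (?Y - {nu b}) = (\<lambda>a. shift V (a + s)) ` B"
    unfolding image_image by (simp only: image_image) (rule image_cong, use cnu in auto)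
  also have "\<dots> = (\<lambda>Z. shift Z s) ` S" unfolding SB image_image using shift_add[OF sV] by simp
  finally have nm': "\<not> meets (shift (shift V b) s) ((\<lambda>Z. shift Z s) ` S)"
    using nm cnu[of b] shift_add[OF sV] by simp
  have "\<not> meets (shift V b) S"
  proof
    assume m: "meets (shift V b) S"
    have "shift V a \<in> {K. crit L K}" for a by (rule td.T_closed) (use V in simp)
    then have "meets (shift (shift V b) s) ((\<lambda>Z. shift Z s) ` S)"
      by (intro td.dep_T[OF _ _ m]) (auto simp: SB)
    then show False using nm' by simp
  qed
  then show "x = \<zero>\<^bsub>M\<^esub>" using x(1) S(3) unfolding trt meets_def by blast
qed

text \<open>For \<open>\<rho> y\<close> in \<open>H\<close>, the translate of \<open>K\<close> by
  \<open>y + a\<close> lies in the summand of \<open>M\<close> belonging to the coset of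
  \<open>\<rho> a\<close>. Incongruent \<open>a\<close> give distinct summands, so a dependence
  takes place within a single \<open>a\<close>.\<close>

lemma coset_split_good:
  assumes g: "gd H U" and LH: "L \<subseteq> H" and K: "crit L K" and KU: "K \<subseteq> U"
  shows "td.coset_split k K {a \<in> zvec k. \<rho> a \<in> H}"
  unfolding td.coset_split_def
proof (intro allI impI)
  interpret H: subgroup H G by (rule goodD(1)[OF g])
  note U = goodD(2)[OF g] and sK = critD(1)[OF K]
  have Uc: "U \<subseteq> carrier M" by (rule subD(1)[OF U])
  have Kc: "K \<subseteq> carrier M" by (rule subD(1)[OF sK])
  have KC: "K \<in> {K. crit L K}" using K by simp
  have sC: "shift K a \<in> {K. crit L K}" for a by (rule td.T_closed[OF KC])
  fix A Y assume A: "finite A" "A \<subseteq> zvec k" and incong: "\<forall>a\<in>A. \<forall>b\<in>A. a \<noteq> b \<longrightarrow> a - b \<notin> {a \<in> zvec k. \<rho> a \<in> H}"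
    and Y: "finite Y" "Y \<subseteq> {a \<in> zvec k. \<rho> a \<in> H}" and fd: "td.findep K Y"
  have inU: "shift K (y + a) \<subseteq> tra U (\<rho> a)" if y: "y \<in> Y" for y a
  proof -
    obtain l where l: "l \<in> L" "\<rho> (y + a) = l \<otimes> (\<rho> y \<otimes> \<rho> a)" using \<rho>_add by blast
    have lH: "l \<otimes> \<rho> y \<in> H" using l(1) LH Y(2) y by blast
    have lc: "l \<in> carrier G" using l(1) Lc by blast
    have "\<rho> (y + a) = (l \<otimes> \<rho> y) \<otimes> \<rho> a" using l(2) lc \<rho>_closed by (simp add: G.m_assoc)
    then have "tra U (\<rho> (y + a)) = tra U (\<rho> a)" using tr_coset[OF U lH goodD(1)[OF g] \<rho>_closed] by simp
    moreover have "shift K (y + a) \<subseteq> tra U (\<rho> (y + a))" using KU by (auto simp: shift_def tr_def)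
    ultimately show ?thesis by simp
  qed
  have \<rho>_diff: "\<rho> (a - b) \<in> H" if "h \<in> H" "h \<otimes> \<rho> b = \<rho> a" for a b h
  proof -
    obtain l where l: "l \<in> L" "\<rho> ((a - b) + b) = l \<otimes> (\<rho> (a - b) \<otimes> \<rho> b)" using \<rho>_add by blast
    have lc: "l \<in> carrier G" "h \<in> carrier G" "l \<in> H" using l(1) Lc that(1) LH by auto
    have "h \<otimes> \<rho> b = (l \<otimes> \<rho> (a - b)) \<otimes> \<rho> b" using l(2) that(2) lc \<rho>_closed by (simp add: G.m_assoc)
    then have "h = l \<otimes> \<rho> (a - b)" using lc \<rho>_closed by (metis G.m_closed G.r_cancel)
    then have "inv l \<otimes> h = \<rho> (a - b)" using lc \<rho>_closed by (simp add: G.m_assoc[symmetric])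
    then show ?thesis using lc(3) that(1) H.m_closed[OF H.m_inv_closed[OF lc(3)] that(1)] by simp
  qed
  let ?P = "(\<lambda>(y, a). y + a) ` (Y \<times> A)"
  show "td.findep K ?P"
    unfolding td.findep_def
  proof
    fix n assume "n \<in> ?P"
    then obtain y a where ya: "y \<in> Y" "a \<in> A" "n = y + a" by auto
    let ?S1 = "(\<lambda>y'. shift K (y' + a)) ` (Y - {y})"
    let ?S2 = "(\<lambda>(y', a'). shift K (y' + a')) ` (Y \<times> (A - {a}))"
    have S: "shift K ` (?P - {n}) \<subseteq> ?S1 \<union> ?S2"
    proof
      fix Z assume "Z \<in> shift K ` (?P - {n})"
      then obtain y' a' where Z: "y' \<in> Y" "a' \<in> A" "Z = shift K (y' + a')" "y' + a' \<noteq> n" by auto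
      show "Z \<in> ?S1 \<union> ?S2"
      proof (cases "a' = a")
        case True
        then have "y' \<noteq> y" using Z(4) ya(3) by auto
        then show ?thesis using Z(1,3) True by blast
      next
        case False
        then have "(y', a') \<in> Y \<times> (A - {a})" using Z(1,2) by blast
        then show ?thesis using Z(3) by force
      qed
    qed
    have S12: "Z \<subseteq> carrier M" if ZS: "Z \<in> ?S1 \<union> ?S2" for Z
    proof -
      obtain c where "Z = shift K c" using ZS by auto
      then show ?thesis using sC[of c] subD(1)[OF critD(1)] by simp
    qed
    show "\<not> meets (shift K n) (shift K ` (?P - {n}))"
    proof
      assume m: "meets (shift K n) (shift K ` (?P - {n}))"
      have "\<zero>\<^bsub>M\<^esub> \<in> shift K n" using sC[of n] subD(2)[OF critD(1)] by simp
      then obtain x where x: "x \<in> shift K n" "x \<in> sumof (shift K ` (?P - {n}))" "x \<noteq> \<zero>\<^bsub>M\<^esub>"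
        using m msum.zero[of M] unfolding meets_def by blast
      have "x \<in> sumof (?S1 \<union> ?S2)" using x(2) sumof_mono[OF S] by blast
      from sumof_Un[OF S12 this] obtain p r where pr: "p \<in> sumof ?S1" "r \<in> sumof ?S2" "x = p \<oplus>\<^bsub>M\<^esub> r" by blast
      let ?C' = "\<rho> ` (A - {a})"
      have C'c: "?C' \<subseteq> carrier G" using \<rho>_closed by auto
      have s1: "sub {} (tra U (\<rho> a))" by (rule sub_add[OF U \<rho>_closed])
      have "sumof ?S1 \<subseteq> tra U (\<rho> a)" by (rule sumof_least[OF s1]) (use inU in auto)
      then have pU: "p \<in> tra U (\<rho> a)" using pr(1) by blast
      have xU: "x \<in> tra U (\<rho> a)" using x(1) inU[OF ya(1)] ya(3) by auto
      have "sumof ?S2 \<subseteq> sumof (tra U ` ?C')"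
      proof (rule sumsI_sub[OF U C'c])
        fix Z assume "Z \<in> ?S2"
        then obtain y' a' where Z: "y' \<in> Y" "a' \<in> A - {a}" "Z = shift K (y' + a')" by auto
        have "tra U (\<rho> a') \<subseteq> sumof (tra U ` ?C')" by (rule tr_in_sums[OF Uc C'c]) (use Z(2) in blast)
        then show "Z \<subseteq> sumof (tra U ` ?C')" using inU[OF Z(1), of a'] Z(3) by blast
      qed
      then have rC: "r \<in> sumof (tra U ` ?C')" using pr(2) by blast
      have cc: "p \<in> carrier M" "r \<in> carrier M" "x \<in> carrier M"
        using pU xU tr_carrier[OF Uc \<rho>_closed] rC sums_carrier[OF Uc C'c] by auto
      have rU: "r \<in> tra U (\<rho> a)" using add_cancel_diff(2)[OF cc pr(3)] sub_minus[OF s1 xU pU] by simp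
      then have r1: "r \<in> sumof (tra U ` {\<rho> a})" using sumof_single[OF s1] by simp
      have "r = \<zero>\<^bsub>M\<^esub>"
      proof (rule goodD_indep[OF g _ C'c _ r1 rC])
        show "{\<rho> a} \<subseteq> carrier G" using \<rho>_closed by simp
        fix c c' h assume c: "c \<in> {\<rho> a}" "c' \<in> ?C'" "h \<in> H"
        then obtain a' where a': "a' \<in> A" "a' \<noteq> a" "c' = \<rho> a'" by auto
        show "h \<otimes> c' \<noteq> c"
        proof
          assume "h \<otimes> c' = c"
          then have "\<rho> (a - a') \<in> H" using \<rho>_diff[OF c(3)] c(1) a'(3) by simp
          moreover have "a - a' \<in> zvec k"
            using subsetD[OF A(2) ya(2)] subsetD[OF A(2) a'(1)] by (simp add: zvec_def)
          ultimately show False using incong[rule_format, OF ya(2) a'(1) a'(2)[symmetric]] by simp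
        qed
      qed
      then have "x = p" using pr(3) cc by simp
      then have m0: "meets (shift (shift K y) a) ((\<lambda>Z. shift Z a) ` (shift K ` (Y - {y})))"
        using x(1,3) pr(1) ya(3) shift_add[OF sK] unfolding meets_def image_image by auto
      \<comment> \<open>Translating by \<open>- a\<close> turns the dependence into one among the
        translates over \<open>Y\<close>, which are independent.\<close>
      have m1: "meets (shift (shift (shift K y) a) (- a)) ((\<lambda>Z. shift Z (- a)) ` ((\<lambda>Z. shift Z a) ` (shift K ` (Y - {y}))))"
      proof (rule td.dep_T[OF td.T_closed[OF sC] _ m0])
        show "(\<lambda>Z. shift Z a) ` (shift K ` (Y - {y})) \<subseteq> {K. crit L K}"
          unfolding image_image using td.T_closed[OF sC] by (intro image_subsetI)
      qed
      have shift_back: "shift (shift (shift K c) a) (- a) = shift K c" for c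
        using shift_add[OF sK] td.T_add[OF sC[of c]] td.T_zero[OF sC[of c]] by simp
      have "meets (shift K y) (shift K ` (Y - {y}))" using m1 unfolding image_image shift_back by simp
      then show False using fd ya(1) unfolding td.findep_def by blast
    qed
  qed
qed

text \<open>The set consists of representatives of the nonzero vectors of norm at most
  \<open>c\<close>; \<open>short_vector\<close> puts one of them into the lattice of exponents of
  \<open>H\<close>.\<close>

lemma small_element:
  assumes irr: "\<And>W. sub (carrier G) W \<Longrightarrow> W = {\<zero>\<^bsub>M\<^esub>} \<or> W = carrier M" and nz: "carrier M \<noteq> {\<zero>\<^bsub>M\<^esub>}"
    and fin: "\<And>H U. gd H U \<Longrightarrow> \<exists>n>0. \<forall>g \<in> carrier G. g [^] (n::nat) \<in> H"
    and ex: "\<exists>V. crit L V" and k: "0 < k"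
  shows "\<exists>\<Phi>. finite \<Phi> \<and> \<Phi> \<subseteq> carrier G - L \<and> (\<forall>H U. gd H U \<longrightarrow> L \<subseteq> H \<longrightarrow> \<Phi> \<inter> H \<noteq> {})"
proof -
  have full: "sumof (tra V ` carrier G) = carrier M" if V: "crit L V" for V
  proof -
    note sV = critD(1)[OF V]
    have Vc: "V \<subseteq> carrier M" by (rule subD(1)[OF sV])
    let ?W = "sumof (tra V ` carrier G)"
    have sW: "sub {} ?W" by (rule sub_sums[OF sV order.refl])
    have act: "act x l \<in> ?W" if x: "x \<in> ?W" and l: "l \<in> carrier G" for x l
    proof -
      have "act x l \<in> tra ?W l" using x by (auto simp: tr_def)
      also have "tra ?W l = sumof (tra V ` ((\<lambda>c. c \<otimes> l) ` carrier G))" by (rule tr_sums[OF Vc order.refl l])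
      also have "\<dots> \<subseteq> ?W" by (intro sumof_mono image_mono) (use l in auto)
      finally show ?thesis .
    qed
    have "sub (carrier G) ?W" unfolding opsub_def using subD(1-4)[OF sW] act by simp
    moreover have "V \<subseteq> ?W" using tr_in_sums[OF Vc order.refl G.one_closed] tr_one[OF Vc] by simp
    ultimately show ?thesis using irr critD(2)[OF V] subD(2)[OF sV] by blast
  qed
  obtain V where V: "crit L V" using ex by blast
  \<comment> \<open>Freeness would make \<open>M\<close> induced from \<open>L\<close>. By
    \<open>fin\<close> some positive power of a basis element would then lie in \<open>L\<close>,
    although basis elements have infinite order modulo \<open>L\<close>.\<close>
  have nfree: "\<not> td.free k unit_vec V {..<k}"
  proof
    assume "td.free k unit_vec V {..<k}"
    from fin[OF good_if_free[OF V this full[OF V]]] obtain n :: nat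
      where n: "0 < n" "\<forall>g \<in> carrier G. g [^] n \<in> L" by blast
    let ?e = "\<lambda>i. int n * unit_vec 0 i"
    obtain l where l: "l \<in> L" "\<rho> ?e = l \<otimes> \<rho> (unit_vec 0) [^] n" using \<rho>_pow by blast
    have "\<rho> (unit_vec 0) [^] n \<in> L" using n(2) \<rho>_closed by blast
    then have "\<rho> ?e \<in> L" using l subgroup.m_closed[OF L] by simp
    moreover have "?e \<in> zvec k" using k by (auto simp: zvec_def unit_vec_def)
    ultimately have "?e = 0" by (rule \<rho>_inj[rotated])
    then have "?e 0 = 0" by (rule fun_cong[THEN trans]) simp
    then show False using n(1) by (simp add: unit_vec_def)
  qed
  \<comment> \<open>By irreducibility the translates of \<open>K'\<close> generate \<open>M\<close>,
    so a nonzero element of \<open>K\<close> is a finite sum of elements of them.\<close>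
  have conn: "\<exists>F. finite F \<and> F \<subseteq> zvec k \<and> meets K (shift K' ` F)" if K: "K \<in> {K. crit L K}" and K': "K' \<in> {K. crit L K}" for K K'
  proof -
    have cK: "crit L K" and cK': "crit L K'" using K K' by auto
    obtain x where x: "x \<in> K" "x \<noteq> \<zero>\<^bsub>M\<^esub>" using critD(2)[OF cK] subD(2)[OF critD(1)[OF cK]] by blast
    have "tra K' g \<in> shift K' ` zvec k" if g: "g \<in> carrier G" for g
    proof -
      obtain a l where a: "a \<in> zvec k" "l \<in> L" "g = l \<otimes> \<rho> a" using \<rho>_surj[OF g] by blast
      have "tra K' g = shift K' a" unfolding a(3) by (rule shift_coset[OF critD(1)[OF cK'] a(2)])
      then show ?thesis using a(1) by blast
    qed
    then have "sumof (tra K' ` carrier G) \<subseteq> sumof (shift K' ` zvec k)" by (intro sumof_mono) blast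
    then have "x \<in> sumof (shift K' ` zvec k)" using full[OF cK'] sub_carrier[OF critD(1)[OF cK] x(1)] by blast
    from sumof_finite[OF this] obtain S where S: "finite S" "S \<subseteq> shift K' ` zvec k" "x \<in> sumof S" by (elim exE conjE)
    obtain F where F: "F \<subseteq> zvec k" "finite F" "S = shift K' ` F" using finite_subset_image[OF S(1,2)] by (elim exE conjE)
    have "meets K (shift K' ` F)" using x S(3) F(3) unfolding meets_def by blast
    then show ?thesis using F by blast
  qed
  have VC: "V \<in> {K. crit L K}" using V by simp
  have "\<exists>c::nat. \<forall>H K. full_lattice k H \<longrightarrow> K \<in> {K. crit L K} \<longrightarrow> td.coset_split k K H \<longrightarrow> (\<exists>x\<in>H. x \<noteq> 0 \<and> (\<forall>i. \<bar>x i\<bar> \<le> int c))"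
    by (rule td.short_vector[OF VC nfree]) (rule conn)
  then obtain c :: nat where
    c: "\<forall>H K. full_lattice k H \<longrightarrow> K \<in> {K. crit L K} \<longrightarrow> td.coset_split k K H \<longrightarrow> (\<exists>x\<in>H. x \<noteq> 0 \<and> (\<forall>i. \<bar>x i\<bar> \<le> int c))"
    by (elim exE)
  define D where "D = {a \<in> zvec k. a \<noteq> 0 \<and> (\<forall>i. \<bar>a i\<bar> \<le> int c)}"
  have "finite D"
  proof (rule finite_subset)
    show "D \<subseteq> {a. \<forall>i. (i \<in> {..<k} \<longrightarrow> a i \<in> {- int c..int c}) \<and> (i \<notin> {..<k} \<longrightarrow> a i = 0)}"
      by (auto simp: D_def zvec_def abs_le_iff minus_le_iff)
    show "finite {a :: nat \<Rightarrow> int. \<forall>i. (i \<in> {..<k} \<longrightarrow> a i \<in> {- int c..int c}) \<and> (i \<notin> {..<k} \<longrightarrow> a i = 0)}"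
      by (rule finite_set_of_finite_funs) auto
  qed
  moreover have "\<rho> ` D \<subseteq> carrier G - L" using \<rho>_closed \<rho>_inj by (auto simp: D_def)
  moreover have "\<rho> ` D \<inter> H \<noteq> {}" if g: "gd H U" and LH: "L \<subseteq> H" for H U
  proof -
    interpret H: subgroup H G by (rule goodD(1)[OF g])
    note U = goodD(2)[OF g]
    \<comment> \<open>The exponent from \<open>fin\<close> supplies the required multiple of each
      unit vector.\<close>
    have "full_lattice k {a \<in> zvec k. \<rho> a \<in> H}"
    proof
      show "0 \<in> {a \<in> zvec k. \<rho> a \<in> H}" using \<rho>_zero LH by (auto simp: zvec_def)
      show "a - b \<in> {a \<in> zvec k. \<rho> a \<in> H}" if "a \<in> {a \<in> zvec k. \<rho> a \<in> H}" "b \<in> {a \<in> zvec k. \<rho> a \<in> H}" for a b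
      proof -
        have ab: "a \<in> zvec k" "b \<in> zvec k" "\<rho> a \<in> H" "\<rho> b \<in> H" using that by auto
        obtain l where l: "l \<in> L" "\<rho> ((a - b) + b) = l \<otimes> (\<rho> (a - b) \<otimes> \<rho> b)" using \<rho>_add by blast
        have lc: "l \<in> carrier G" "l \<in> H" using l(1) Lc LH by auto
        have "\<rho> a = l \<otimes> (\<rho> (a - b) \<otimes> \<rho> b)" using l(2) by simp
        then have "inv l \<otimes> \<rho> a = \<rho> (a - b) \<otimes> \<rho> b" using lc(1) \<rho>_closed by (simp add: G.m_assoc[symmetric])
        then have "(inv l \<otimes> \<rho> a) \<otimes> inv (\<rho> b) = \<rho> (a - b)" using \<rho>_closed by (simp add: G.m_assoc)
        moreover have "(inv l \<otimes> \<rho> a) \<otimes> inv (\<rho> b) \<in> H" using lc(2) ab(3,4) by simp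
        moreover have "a - b \<in> zvec k" using ab(1,2) by (auto simp: zvec_def)
        ultimately show ?thesis by simp
      qed
      show "\<exists>N>0. (\<lambda>i. if i = l then N else 0) \<in> {a \<in> zvec k. \<rho> a \<in> H}" if lk: "l < k" for l
      proof -
        from fin[OF g] obtain n :: nat where n: "0 < n" "\<forall>g \<in> carrier G. g [^] n \<in> H" by blast
        let ?e = "\<lambda>i. int n * unit_vec l i"
        obtain m where m: "m \<in> L" "\<rho> ?e = m \<otimes> \<rho> (unit_vec l) [^] n" using \<rho>_pow by blast
        have "\<rho> (unit_vec l) [^] n \<in> H" using n(2) \<rho>_closed by blast
        then have "\<rho> ?e \<in> H" using m LH by auto
        moreover have "?e = (\<lambda>i. if i = l then int n else 0)" by (auto simp: unit_vec_def)
        ultimately show ?thesis using n(1) lk by (intro exI[of _ "int n"]) (auto simp: zvec_def)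
      qed
    qed simp
    moreover obtain K where K: "crit L K" "K \<subseteq> U"
    proof -
      have "\<exists>K. crit L K \<and> K \<subseteq> U"
      proof (rule crit_below[OF V Lc])
        show "sub L U" by (rule sub_mono[OF U LH])
        show "U \<noteq> {\<zero>\<^bsub>M\<^esub>}" by (rule good_nonzero[OF g nz])
        show "U \<subseteq> sumof (tra V ` carrier G)" using full[OF V] subD(1)[OF U] by simp
      qed (rule nL)
      then show ?thesis using that by blast
    qed
    moreover have "td.coset_split k K {a \<in> zvec k. \<rho> a \<in> H}" by (rule coset_split_good[OF g LH K])
    ultimately obtain x where "x \<in> {a \<in> zvec k. \<rho> a \<in> H}" "x \<noteq> 0" "\<forall>i. \<bar>x i\<bar> \<le> int c"
      using c[rule_format, of "{a \<in> zvec k. \<rho> a \<in> H}" K] by auto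
    then have "\<rho> x \<in> \<rho> ` D \<inter> H" by (auto simp: D_def)
    then show ?thesis by blast
  qed
  ultimately show ?thesis by (intro exI[of _ "\<rho> ` D"]) blast
qed

end

section \<open>Bounding the index\<close>

context group
begin

lemma mem_adjoin: "n \<in> N \<Longrightarrow> n \<otimes> x [^] (j::nat) \<in> adjoin N x"
  unfolding adjoin_def int_pow_int[symmetric] by blast

text \<open>The elements commuting with \<open>g\<close> modulo the normal subgroup \<open>L\<close>
  form a subgroup that contains both \<open>L\<close> and \<open>u\<close>.\<close>

lemma central_mod_subgroup:
  assumes L: "subgroup L G" "\<And>g. g \<in> carrier G \<Longrightarrow> normalizes G g L"
    and g: "g \<in> carrier G" and u: "u \<in> carrier G" "commutator g u \<in> L"
    and x: "x \<in> adjoin L u"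
  shows "commutator g x \<in> L"
proof -
  interpret L: subgroup L G by (rule L(1))
  have nL: "y \<otimes> k \<otimes> inv y \<in> L" if "y \<in> carrier G" "k \<in> L" for y k
    using L(2)[OF that(1)] that(2) unfolding normalizes_def by simp
  have "subgroup {y \<in> carrier G. commutator g y \<in> L} G" by (rule subgroup_commutator_right[OF L(1) nL g])
  moreover have "L \<subseteq> {y \<in> carrier G. commutator g y \<in> L}"
  proof
    fix n assume n: "n \<in> L"
    have "commutator g n = (g \<otimes> n \<otimes> inv g) \<otimes> inv n" by (simp add: commutator_def)
    also have "\<dots> \<in> L" using nL[OF g n] n by simp
    finally show "n \<in> {y \<in> carrier G. commutator g y \<in> L}" using L.mem_carrier[OF n] by simp
  qed
  ultimately have "adjoin L u \<subseteq> {y \<in> carrier G. commutator g y \<in> L}" by (rule adjoin_least) (use u in simp)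
  then show ?thesis using x by blast
qed

text \<open>Modulo \<open>L\<close> the element \<open>commutator x y\<close> is central, which
  makes commutators with \<open>y\<close> multiplicative on powers of \<open>x\<close>.\<close>

lemma commutator_pow_left:
  assumes L: "subgroup L G" "\<And>g. g \<in> carrier G \<Longrightarrow> normalizes G g L"
    and xy: "x \<in> carrier G" "y \<in> carrier G" and v: "\<And>g. g \<in> carrier G \<Longrightarrow> commutator g (commutator x y) \<in> L"
  shows "\<exists>l \<in> L. commutator (x [^] (n::nat)) y = l \<otimes> commutator x y [^] n"
proof (induction n)
  interpret L: subgroup L G by (rule L(1))
  case 0
  then show ?case using xy commutator_one(2) by (intro bexI[of _ \<one>]) auto
next
  interpret L: subgroup L G by (rule L(1))
  case (Suc n)
  define v where "v = commutator x y"
  have vc: "v \<in> carrier G" using xy by (simp add: v_def commutator_closed)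
  obtain l where l: "l \<in> L" "commutator (x [^] n) y = l \<otimes> v [^] n" using Suc v_def by auto
  have lc: "l \<in> carrier G" using l(1) by simp
  have ad: "l \<otimes> v [^] n \<in> adjoin L v" using l(1) by (rule mem_adjoin)
  have m: "commutator x (l \<otimes> v [^] n) \<in> L"
    by (rule central_mod_subgroup[OF L xy(1) vc v[OF xy(1), folded v_def] ad])
  have "commutator (x [^] Suc n) y = commutator (x \<otimes> x [^] n) y" using xy(1) nat_pow_comm[of x 1 n] by simp
  also have "\<dots> = x \<otimes> (l \<otimes> v [^] n) \<otimes> inv x \<otimes> v"
    using commutator_mult_left[OF xy(1,2), of "x [^] n"] xy(1) l(2) by (simp add: v_def)
  also have "x \<otimes> (l \<otimes> v [^] n) \<otimes> inv x = commutator x (l \<otimes> v [^] n) \<otimes> (l \<otimes> v [^] n)"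
    by (rule conj_commutator) (use xy lc vc in auto)
  also have "commutator x (l \<otimes> v [^] n) \<otimes> (l \<otimes> v [^] n) \<otimes> v = (commutator x (l \<otimes> v [^] n) \<otimes> l) \<otimes> v [^] Suc n"
    using L.mem_carrier[OF m] lc vc by (simp add: m_assoc)
  finally show ?case unfolding v_def[symmetric] using L.m_closed[OF m l(1)] by blast
qed

lemma commutator_pow_right:
  assumes L: "subgroup L G" "\<And>g. g \<in> carrier G \<Longrightarrow> normalizes G g L"
    and xy: "x \<in> carrier G" "y \<in> carrier G" and v: "\<And>g. g \<in> carrier G \<Longrightarrow> commutator g (commutator x y) \<in> L"
  shows "\<exists>l \<in> L. commutator x (y [^] (n::nat)) = l \<otimes> commutator x y [^] n"
proof -
  interpret L: subgroup L G by (rule L(1))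
  define v where "v = commutator x y"
  have vc: "v \<in> carrier G" using xy by (simp add: v_def commutator_closed)
  have vn: "v [^] n \<in> carrier G" using vc by simp
  have yn: "y [^] n \<in> carrier G" using xy(2) by simp
  have iv: "commutator y x = inv v" using commutator_swap[OF xy] by (simp add: v_def)
  have "commutator g (commutator y x) \<in> L" if g: "g \<in> carrier G" for g
    unfolding iv
  proof (rule central_mod_subgroup[OF L g vc v[OF g, folded v_def]])
    have "\<one> \<otimes> v [^] (-1::int) \<in> adjoin L v" unfolding adjoin_def using L.one_closed by blast
    then show "inv v \<in> adjoin L v" using vc by (simp add: int_pow_neg)
  qed
  from commutator_pow_left[OF L xy(2,1) this] obtain l where
    l: "l \<in> L" "commutator (y [^] n) x = l \<otimes> inv v [^] n" unfolding iv by blast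
  have lc: "l \<in> carrier G" using l(1) by simp
  have "commutator x (y [^] n) = inv (l \<otimes> inv v [^] n)" using commutator_swap[OF yn xy(1)] l(2) by simp
  also have "\<dots> = v [^] n \<otimes> inv l" using lc vc by (simp add: inv_mult_group nat_pow_inv)
  also have "\<dots> = (v [^] n \<otimes> inv l \<otimes> inv (v [^] n)) \<otimes> v [^] n" using lc vn by (simp add: m_assoc)
  finally have e: "commutator x (y [^] n) = (v [^] n \<otimes> inv l \<otimes> inv (v [^] n)) \<otimes> v [^] n" .
  have "v [^] n \<otimes> inv l \<otimes> inv (v [^] n) \<in> L"
    using L(2)[OF vn] L.m_inv_closed[OF l(1)] unfolding normalizes_def by simp
  then show ?thesis using e unfolding v_def by blast
qed

text \<open>Each argument contributes one factor \<open>n\<close>. The commutator of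
  \<open>x [^] n\<close> and \<open>y\<close> is again central modulo \<open>L\<close>, so the rule
  for the right argument applies to it.\<close>

lemma commutator_pow_pow:
  assumes L: "subgroup L G" "\<And>g. g \<in> carrier G \<Longrightarrow> normalizes G g L"
    and xy: "x \<in> carrier G" "y \<in> carrier G" and v: "\<And>g. g \<in> carrier G \<Longrightarrow> commutator g (commutator x y) \<in> L"
  shows "\<exists>l \<in> L. commutator (x [^] (n::nat)) (y [^] n) = l \<otimes> commutator x y [^] (n * n)"
proof -
  interpret L: subgroup L G by (rule L(1))
  define v where "v = commutator x y"
  have vc: "v \<in> carrier G" using xy by (simp add: v_def commutator_closed)
  have xn: "x [^] n \<in> carrier G" using xy by simp
  obtain l where l: "l \<in> L" "commutator (x [^] n) y = l \<otimes> v [^] n"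
    using commutator_pow_left[OF L xy v] v_def by auto
  have ad: "l \<otimes> v [^] n \<in> adjoin L v" using l(1) by (rule mem_adjoin)
  have "commutator g (commutator (x [^] n) y) \<in> L" if g: "g \<in> carrier G" for g
    unfolding l(2) by (rule central_mod_subgroup[OF L g vc v[OF g, folded v_def] ad])
  from commutator_pow_right[OF L xn xy(2) this, of n] obtain m where
    m: "m \<in> L" "commutator (x [^] n) (y [^] n) = m \<otimes> (l \<otimes> v [^] n) [^] n" unfolding l(2) by blast
  obtain p where p: "p \<in> L" "(l \<otimes> v [^] int n) [^] int n = p \<otimes> v [^] (int n * int n)"
    using coset_int_pow[OF L(1) vc L(2)[OF vc] l(1), of "int n" "int n"] by blast
  have "(l \<otimes> v [^] n) [^] n = p \<otimes> v [^] (n * n)"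
    using p(2) unfolding int_pow_int of_nat_mult[symmetric] .
  then have "commutator (x [^] n) (y [^] n) = (m \<otimes> p) \<otimes> v [^] (n * n)"
    using m p(1) vc by (simp add: m_assoc)
  then show ?thesis using L.m_closed[OF m(1) p(1)] unfolding v_def by blast
qed

text \<open>The quotient of \<open>adjoin H u\<close> by \<open>H\<close> is cyclic, hence
  abelian.\<close>

lemma commutator_adjoin:
  assumes H: "subgroup H G" and u: "u \<in> carrier G" "normalizes G u H" and pq: "p \<in> adjoin H u" "q \<in> adjoin H u"
  shows "commutator p q \<in> H"
proof -
  interpret H: subgroup H G by fact
  obtain h i where p: "h \<in> H" "p = h \<otimes> u [^] (i::int)" using pq(1) by (auto simp: adjoin_def)
  obtain k j where q: "k \<in> H" "q = k \<otimes> u [^] (j::int)" using pq(2) by (auto simp: adjoin_def)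
  have nu: "normalizes G (u [^] e) H" for e :: int by (rule normalizes_int_pow[OF u(2) H.subset u(1)])
  have uc: "u [^] e \<in> carrier G" for e :: int using u(1) by simp
  obtain k' where k': "k' \<in> H" "u [^] i \<otimes> k = k' \<otimes> u [^] i" using normalizes_move(1)[OF nu H.subset uc q(1), of i] by blast
  obtain h' where h': "h' \<in> H" "u [^] j \<otimes> h = h' \<otimes> u [^] j" using normalizes_move(1)[OF nu H.subset uc p(1), of j] by blast
  have c: "h \<in> carrier G" "k \<in> carrier G" "h' \<in> carrier G" "k' \<in> carrier G" using p q h' k' by auto
  have "p \<otimes> q = h \<otimes> (u [^] i \<otimes> k) \<otimes> u [^] j" using p q c uc by (simp add: m_assoc)
  also have "\<dots> = (h \<otimes> k') \<otimes> u [^] (i + j)" unfolding k'(2) using c uc u(1) by (simp add: m_assoc int_pow_mult)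
  finally have a: "p \<otimes> q = (h \<otimes> k') \<otimes> u [^] (i + j)" .
  have "q \<otimes> p = k \<otimes> (u [^] j \<otimes> h) \<otimes> u [^] i" using p q c uc by (simp add: m_assoc)
  also have "\<dots> = (k \<otimes> h') \<otimes> u [^] (j + i)" unfolding h'(2) using c uc u(1) by (simp add: m_assoc int_pow_mult)
  finally have b: "q \<otimes> p = (k \<otimes> h') \<otimes> u [^] (i + j)" by (simp add: add.commute)
  have pqc: "p \<in> carrier G" "q \<in> carrier G" using p q c uc by auto
  have "commutator p q = (p \<otimes> q) \<otimes> inv (q \<otimes> p)" using pqc by (simp add: commutator_def inv_mult_group m_assoc)
  also have "\<dots> = (h \<otimes> k') \<otimes> inv (k \<otimes> h')" unfolding a b using c uc[of "i + j"] by (simp add: inv_mult_group m_assoc cancel_left)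
  also have "\<dots> \<in> H" using p(1) q(1) h'(1) k'(1) by simp
  finally show ?thesis .
qed

end

context opmod
begin

text \<open>Induction over the normal subgroups \<open>L\<close> contained in \<open>H\<close>. An element \<open>u\<close> central modulo \<open>L\<close> may
  be adjoined to \<open>H\<close>; if \<open>G/L\<close> is not free abelian, \<open>u\<close> has a bounded power in \<open>H\<close>, and otherwise \<open>H\<close>
  contains one of finitely many \<open>u\<close>.\<close>

lemma bounded_index:
  assumes irr: "\<And>W. sub (carrier G) W \<Longrightarrow> W = {\<zero>\<^bsub>M\<^esub>} \<or> W = carrier M" and nz: "carrier M \<noteq> {\<zero>\<^bsub>M\<^esub>}"
    and fin: "\<And>H U. gd H U \<Longrightarrow> \<exists>B. covered G H (carrier G) B"
    and pc: "polycyclic G (carrier G)" and cs: "central_series G c Z"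
  shows "\<exists>B. \<forall>H U. gd H U \<longrightarrow> covered G H (carrier G) B"
proof -
  \<comment> \<open>Normality is placed inside \<open>P\<close>, so that the induction principle,
    which runs over all subgroups, can be applied. The case \<open>L = {\<one>}\<close> covers every
    good \<open>H\<close>.\<close>
  define P where "P L \<longleftrightarrow> ((\<forall>g \<in> carrier G. normalizes G g L) \<longrightarrow>
    (\<exists>B. \<forall>H U. gd H U \<longrightarrow> L \<subseteq> H \<longrightarrow> covered G H (carrier G) B))" for L
  have "P {\<one>}"
  proof (rule G.polycyclic_induct_up[OF pc G.triv_subgroup])
    fix L assume L: "subgroup L G" and IH: "\<And>L'. subgroup L' G \<Longrightarrow> L \<subset> L' \<Longrightarrow> P L'"
    interpret L: subgroup L G by (rule L)
    show "P L"
      unfolding P_def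
    proof (rule impI)
      assume "\<forall>g\<in>carrier G. normalizes G g L"
      then have nL: "normalizes G g L" if "g \<in> carrier G" for g using that by blast
      have com_sym: "G.commutator g u \<in> L" if "g \<in> carrier G" "u \<in> carrier G" "G.commutator u g \<in> L" for g u
        using G.commutator_swap[OF that(2,1)] that(3) by simp
      have adj: "normalizes G u H"
        if u: "u \<in> carrier G" "\<And>g. g \<in> carrier G \<Longrightarrow> G.commutator u g \<in> L" and H: "subgroup H G" "L \<subseteq> H" for u H
      proof (rule G.normalizes_commutator[OF H(1) u(1)])
        fix n assume "n \<in> H"
        then have n: "n \<in> carrier G" using subgroup.mem_carrier[OF H(1)] by blast
        show "G.commutator u n \<in> H" using u(2)[OF n] H(2) by blast
        have "inv (G.commutator u n) \<in> L" using u(2)[OF n] by simp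
        then have "inv u \<otimes> inv (G.commutator u n) \<otimes> inv (inv u) \<in> L"
          using nL[of "inv u"] u(1) unfolding normalizes_def by simp
        then show "G.commutator (inv u) n \<in> H" using G.commutator_inv_left[OF u(1) n] H(2) by auto
      qed
      \<comment> \<open>With this bound, what remains in each case is the index of \<open>H\<close>
        in \<open>adjoin H u\<close>.\<close>
      have ext: "\<exists>B. \<forall>H U. gd H U \<longrightarrow> L \<subseteq> H \<longrightarrow> covered G (G.adjoin H u) (carrier G) B"
        if u: "u \<in> carrier G" "u \<notin> L" "\<And>g. g \<in> carrier G \<Longrightarrow> G.commutator u g \<in> L" for u
      proof -
        have nuL: "normalizes G u L" by (rule nL[OF u(1)])
        note ad = G.adjoin[OF L u(1) nuL]
        have "P (G.adjoin L u)" by (rule IH[OF ad(1)]) (use ad(2,3) u(2) in blast)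
        moreover have "normalizes G g (G.adjoin L u)" if g: "g \<in> carrier G" for g
        proof (rule G.normalizes_commutator[OF ad(1) g])
          fix n assume n: "n \<in> G.adjoin L u"
          have "G.commutator g n \<in> L" "G.commutator (inv g) n \<in> L"
            using G.central_mod_subgroup[OF L nL g u(1) com_sym[OF g u(1) u(3)[OF g]] n]
              G.central_mod_subgroup[OF L nL _ u(1) com_sym[OF _ u(1) u(3)] n, of "inv g"] g by auto
          then show "G.commutator g n \<in> G.adjoin L u" "G.commutator (inv g) n \<in> G.adjoin L u" using ad(2) by auto
        qed
        ultimately obtain B where B: "\<forall>H U. gd H U \<longrightarrow> G.adjoin L u \<subseteq> H \<longrightarrow> covered G H (carrier G) B"
          unfolding P_def by blast
        have "covered G (G.adjoin H u) (carrier G) B" if g: "gd H U" and LH: "L \<subseteq> H" for H U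
        proof -
          note sH = goodD(1)[OF g]
          note adH = G.adjoin[OF sH u(1) adj[OF u(1,3) sH LH]]
          have "gd (G.adjoin H u) (sumof (tra U ` G.adjoin H u))" by (rule good_coarsen[OF g adH(1,2)])
          moreover have "G.adjoin L u \<subseteq> G.adjoin H u"
            by (rule G.adjoin_least[OF adH(1) order.trans[OF LH adH(2)] adH(3)])
          ultimately show ?thesis using B by blast
        qed
        then show ?thesis by blast
      qed
      show "\<exists>B. \<forall>H U. gd H U \<longrightarrow> L \<subseteq> H \<longrightarrow> covered G H (carrier G) B"
      proof (cases "\<forall>x \<in> carrier G. \<forall>y \<in> carrier G. G.commutator x y \<in> L")
        case False
        let ?p = "\<lambda>m. \<forall>x \<in> Z m. x \<in> carrier G \<longrightarrow> (\<forall>y \<in> carrier G. G.commutator x y \<in> L)"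
        have "?p c" using cs G.commutator_one(2) unfolding central_series_def by auto
        \<comment> \<open>At the least such index, which is positive here, the series is central
          modulo \<open>L\<close>. The term before it contains some \<open>x\<close> with a
          commutator \<open>u\<close> outside \<open>L\<close>, and \<open>u\<close>, lying in the
          central term, is central modulo \<open>L\<close>.\<close>
        then have pm: "?p (LEAST m. ?p m)" by (rule LeastI[where P = ?p])
        have "\<not> ?p 0" using cs False unfolding central_series_def by blast
        then obtain m where m: "(LEAST m. ?p m) = Suc m" using pm by (metis (no_types, lifting) not0_implies_Suc)
        have "\<not> ?p m" by (rule not_less_Least) (simp add: m)
        then obtain x y where xy: "x \<in> Z m" "x \<in> carrier G" "y \<in> carrier G" "G.commutator x y \<notin> L" by blast
        define u where "u = G.commutator x y"
        have uc: "u \<in> carrier G" "u \<notin> L" using xy G.commutator_closed by (auto simp: u_def)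
        have "u \<in> Z (Suc m)" using cs xy(1-3) unfolding central_series_def u_def G.commutator_def by blast
        then have ug: "G.commutator u g \<in> L" if "g \<in> carrier G" for g using pm uc(1) that unfolding m by blast
        have gu: "G.commutator g (G.commutator x y) \<in> L" if "g \<in> carrier G" for g
          using com_sym[OF that uc(1) ug[OF that]] unfolding u_def .
        obtain B where B: "\<forall>H U. gd H U \<longrightarrow> L \<subseteq> H \<longrightarrow> covered G (G.adjoin H u) (carrier G) B"
          using ext[OF uc ug] by blast
        \<comment> \<open>By \<open>covered_pow\<close> the powers of \<open>x\<close> and
          \<open>y\<close> with exponent \<open>b\<close> lie in \<open>adjoin H u\<close>, so their
          commutator lies in \<open>H\<close>; modulo \<open>L\<close> it is the power of
          \<open>u\<close> with exponent \<open>b * b\<close>.\<close>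
        define b :: nat where "b = fact B"
        have "covered G H (carrier G) (B * (b * b))" if g: "gd H U" and LH: "L \<subseteq> H" for H U
        proof -
          note sH = goodD(1)[OF g]
          interpret H: subgroup H G by (rule sH)
          have nu: "normalizes G u H" by (rule adj[OF uc(1) ug sH LH])
          note adH = G.adjoin[OF sH uc(1) nu]
          have cB: "covered G (G.adjoin H u) (carrier G) B" using B g LH by blast
          have pb: "z [^] b \<in> G.adjoin H u" if "z \<in> carrier G" for z
            unfolding b_def by (rule G.covered_pow[OF cB adH(1) G.subgroup_self that])
          have cH: "G.commutator (x [^] b) (y [^] b) \<in> H"
            by (rule G.commutator_adjoin[OF sH uc(1) nu pb[OF xy(2)] pb[OF xy(3)]])
          obtain l where l: "l \<in> L" "G.commutator (x [^] b) (y [^] b) = l \<otimes> u [^] (b * b)"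
            using G.commutator_pow_pow[OF L nL xy(2,3) gu, of b] unfolding u_def by blast
          have lH: "l \<in> H" using l(1) LH by blast
          have "u [^] (b * b) = inv l \<otimes> (l \<otimes> u [^] (b * b))"
            using H.mem_carrier[OF lH] uc(1) by (simp add: G.cancel_left)
          also have "\<dots> \<in> H" using cH lH unfolding l(2) by simp
          finally have ub: "u [^] (b * b) \<in> H" .
          have "covered G H (G.adjoin H u) (b * b)" by (rule G.covered_adjoin[OF sH uc(1) nu _ ub]) (simp add: b_def)
          from G.covered_trans[OF cB this H.subset] show ?thesis .
        qed
        then show ?thesis by blast
      next
        case True
        then have ab: "G.commutator x y \<in> L" if "x \<in> carrier G" "y \<in> carrier G" for x y using that by blast
        show ?thesis
        proof (cases "\<exists>u \<in> carrier G - L. \<exists>e>0. u [^] (e::nat) \<in> L")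
          case True
          then obtain u and e :: nat where u: "u \<in> carrier G" "u \<notin> L" and e: "0 < e" "u [^] e \<in> L" by blast
          obtain B where B: "\<forall>H U. gd H U \<longrightarrow> L \<subseteq> H \<longrightarrow> covered G (G.adjoin H u) (carrier G) B"
            using ext[OF u ab[OF u(1)]] by blast
          have "covered G H (carrier G) (B * e)" if g: "gd H U" and LH: "L \<subseteq> H" for H U
          proof -
            note sH = goodD(1)[OF g]
            have nu: "normalizes G u H" by (rule adj[OF u(1) ab[OF u(1)] sH LH])
            have cB: "covered G (G.adjoin H u) (carrier G) B" using B g LH by blast
            have "covered G H (G.adjoin H u) e" by (rule G.covered_adjoin[OF sH u(1) nu e(1) subsetD[OF LH e(2)]])
            from G.covered_trans[OF cB this subgroup.subset[OF sH]] show ?thesis .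
          qed
          then show ?thesis by blast
        next
          case False
          then have tf: "u \<in> L" if "u \<in> carrier G" "0 < (e::nat)" "u [^] e \<in> L" for u e using that by blast
          show ?thesis
          proof (cases "L = carrier G")
            case True
            have "covered G H (carrier G) 1" if g: "gd H U" and LH: "L \<subseteq> H" for H U
              using G.covered_mono[OF G.covered_self[OF order.refl]] LH True by simp
            then show ?thesis by blast
          next
            case False
            have "\<exists>k (\<rho> :: (nat \<Rightarrow> int) \<Rightarrow> 'g). (\<forall>a. \<rho> a \<in> carrier G) \<and>
              (\<forall>a b. \<exists>l \<in> L. \<rho> (a + b) = l \<otimes> (\<rho> a \<otimes> \<rho> b)) \<and>
              (\<forall>g \<in> carrier G. \<exists>a \<in> zvec k. \<exists>l \<in> L. g = l \<otimes> \<rho> a) \<and> (\<forall>a \<in> zvec k. \<rho> a \<in> L \<longrightarrow> a = 0)"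
            proof (rule G.quotient_basis[OF pc L])
              show "G.commutator x y \<in> L" if "x \<in> carrier G" "y \<in> carrier G" for x y by (rule ab[OF that])
              show "u \<in> L" if "u \<in> carrier G" "0 < e" "u [^] e \<in> L" for u and e :: nat by (rule tf[OF that])
            qed
            then obtain k and \<rho> :: "(nat \<Rightarrow> int) \<Rightarrow> 'g" where
              \<rho>: "\<forall>a. \<rho> a \<in> carrier G" "\<forall>a b. \<exists>l \<in> L. \<rho> (a + b) = l \<otimes> (\<rho> a \<otimes> \<rho> b)"
              "\<forall>g \<in> carrier G. \<exists>a \<in> zvec k. \<exists>l \<in> L. g = l \<otimes> \<rho> a" "\<forall>a \<in> zvec k. \<rho> a \<in> L \<longrightarrow> a = 0"
              by (elim exE conjE)
            interpret cg: coset_grading G M act Om L k \<rho>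
            proof
              fix g :: 'g and a b :: "nat \<Rightarrow> int"
              show "normalizes G g L" if "g \<in> carrier G" by (rule nL[OF that])
              show "\<rho> a \<in> carrier G" using \<rho>(1) by blast
              show "\<exists>l\<in>L. \<rho> (a + b) = l \<otimes> (\<rho> a \<otimes> \<rho> b)" using \<rho>(2) by blast
              show "\<exists>a\<in>zvec k. \<exists>l\<in>L. g = l \<otimes> \<rho> a" if "g \<in> carrier G" by (rule bspec[OF \<rho>(3) that])
              show "a = 0" if "a \<in> zvec k" "\<rho> a \<in> L" using \<rho>(4) that by blast
            qed
            have k: "0 < k"
            proof (rule ccontr)
              assume "\<not> 0 < k"
              then have z: "zvec k = {0}" by (auto simp: zvec_def)
              have "g \<in> L" if g: "g \<in> carrier G" for g
              proof -
                obtain l where "l \<in> L" "g = l \<otimes> \<rho> 0" using cg.\<rho>_surj[OF g] unfolding z by blast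
                then show ?thesis using cg.\<rho>_zero by simp
              qed
              then show False using False L.subset by blast
            qed
            have fin': "\<exists>n>0. \<forall>g \<in> carrier G. g [^] (n::nat) \<in> H" if g: "gd H U" for H U
            proof -
              obtain B where B: "covered G H (carrier G) B" using fin[OF g] by blast
              have "\<forall>g \<in> carrier G. g [^] (fact B :: nat) \<in> H"
                using G.covered_pow[OF B goodD(1)[OF g] G.subgroup_self] by blast
              then show ?thesis by (intro exI[of _ "fact B"]) simp
            qed
            have exV: "\<exists>V. crit L V"
            proof -
              have "\<zero>\<^bsub>M\<^esub> \<in> carrier M" by simp
              then obtain a where a: "a \<in> carrier M" "a \<noteq> \<zero>\<^bsub>M\<^esub>" using nz by blast
              have "polycyclic G L" by (rule G.polycyclic_subgroup[OF pc L L.subset])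
              from noeth_polycyclic[OF this a(1)] obtain V where V: "sub L V" "a \<in> V" "noeth L V" by blast
              have "V \<noteq> {\<zero>\<^bsub>M\<^esub>}" using V(2) a(2) by blast
              from crit_exists[OF V(1,3) this L.subset] show ?thesis .
            qed
            have "\<exists>\<Phi>. finite \<Phi> \<and> \<Phi> \<subseteq> carrier G - L \<and> (\<forall>H U. gd H U \<longrightarrow> L \<subseteq> H \<longrightarrow> \<Phi> \<inter> H \<noteq> {})"
            proof (rule cg.small_element[OF _ nz _ exV k])
              show "W = {\<zero>\<^bsub>M\<^esub>} \<or> W = carrier M" if "sub (carrier G) W" for W by (rule irr[OF that])
              show "\<exists>n>0. \<forall>g \<in> carrier G. g [^] (n::nat) \<in> H" if "gd H U" for H U by (rule fin'[OF that])
            qed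
            then obtain \<Phi> where
              \<Phi>: "finite \<Phi>" "\<Phi> \<subseteq> carrier G - L" "\<forall>H U. gd H U \<longrightarrow> L \<subseteq> H \<longrightarrow> \<Phi> \<inter> H \<noteq> {}"
              by (elim exE conjE)
            have "\<forall>u \<in> \<Phi>. \<exists>B. \<forall>H U. gd H U \<longrightarrow> L \<subseteq> H \<longrightarrow> covered G (G.adjoin H u) (carrier G) B"
            proof
              fix u assume "u \<in> \<Phi>"
              then have u: "u \<in> carrier G" "u \<notin> L" using \<Phi>(2) by auto
              show "\<exists>B. \<forall>H U. gd H U \<longrightarrow> L \<subseteq> H \<longrightarrow> covered G (G.adjoin H u) (carrier G) B"
                by (rule ext[OF u ab[OF u(1)]])
            qed
            from bchoice[OF this] obtain B where
              B: "\<forall>u \<in> \<Phi>. \<forall>H U. gd H U \<longrightarrow> L \<subseteq> H \<longrightarrow> covered G (G.adjoin H u) (carrier G) (B u)" by (elim exE)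
            \<comment> \<open>A subgroup \<open>H\<close> containing \<open>u\<close> equals
              \<open>adjoin H u\<close>; the sum bounds all the cases at once.\<close>
            have "covered G H (carrier G) (\<Sum>u \<in> \<Phi>. B u)" if g: "gd H U" and LH: "L \<subseteq> H" for H U
            proof -
              obtain u where u: "u \<in> \<Phi>" "u \<in> H" using \<Phi>(3) g LH by blast
              have "covered G (G.adjoin H u) (carrier G) (B u)" using B u(1) g LH by blast
              then have "covered G H (carrier G) (B u)"
                by (rule G.covered_mono) (rule G.adjoin_least[OF goodD(1)[OF g] order.refl u(2)])
              then show ?thesis by (rule G.covered_le) (rule member_le_sum, use u(1) \<Phi>(1) in auto)
            qed
            then show ?thesis by blast
          qed
        qed
      qed
    qed
  qed
  moreover have "\<forall>g \<in> carrier G. normalizes G g {\<one>}" by (simp add: normalizes_def)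
  ultimately obtain B where B: "\<forall>H U. gd H U \<longrightarrow> {\<one>} \<subseteq> H \<longrightarrow> covered G H (carrier G) B"
    unfolding P_def by blast
  have "covered G H (carrier G) B" if g: "gd H U" for H U
    using B g subgroup.one_closed[OF goodD(1)[OF g]] by blast
  then show ?thesis by blast
qed

section \<open>Restriction to a good pair and the extremal choices\<close>

lemma opmod_restrict:
  assumes H: "subgroup H G" and U: "sub H U"
  shows "opmod (G\<lparr>carrier := H\<rparr>) (M\<lparr>carrier := U\<rparr>) act Om"
proof -
  interpret H: subgroup H G by fact
  note u = subD[OF U]
  have Uc: "x \<in> carrier M" if "x \<in> U" for x using u(1) that by blast
  have ag: "abelian_group (M\<lparr>carrier := U\<rparr>)"
  proof (rule abelian_groupI)
    fix x assume "x \<in> carrier (M\<lparr>carrier := U\<rparr>)"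
    then have x: "x \<in> U" by simp
    show "\<exists>y\<in>carrier (M\<lparr>carrier := U\<rparr>). y \<oplus>\<^bsub>M\<lparr>carrier := U\<rparr>\<^esub> x = \<zero>\<^bsub>M\<lparr>carrier := U\<rparr>\<^esub>"
      using sub_neg[OF U x] Uc[OF x] by (intro bexI[of _ "\<ominus>\<^bsub>M\<^esub> x"]) (auto simp: M.l_neg)
  qed (use u(2,3) Uc in \<open>auto simp: M.add.m_ac\<close>)
  have neg: "\<ominus>\<^bsub>M\<lparr>carrier := U\<rparr>\<^esub> x = \<ominus>\<^bsub>M\<^esub> x" if x: "x \<in> U" for x
  proof -
    interpret U: abelian_group "M\<lparr>carrier := U\<rparr>" by (rule ag)
    have "\<ominus>\<^bsub>M\<^esub> x \<in> U" by (rule sub_neg[OF U x])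
    then show ?thesis using U.minus_equality[of "\<ominus>\<^bsub>M\<^esub> x" x] x Uc[OF x] by (simp add: M.l_neg)
  qed
  have line': "\<exists>V. opsub (M\<lparr>carrier := U\<rparr>) act Om {\<one>} V \<and> a \<in> V \<and>
      (\<forall>W. opsub (M\<lparr>carrier := U\<rparr>) act Om {\<one>} W \<longrightarrow> W \<subseteq> V \<longrightarrow> W = {\<zero>\<^bsub>M\<^esub>} \<or> W = V)" if a: "a \<in> U" for a
  proof -
    have one: "{\<one>} \<subseteq> carrier G" "{\<one>} \<subseteq> H" by auto
    have "\<exists>V. sub {\<one>} V \<and> V \<subseteq> U \<and> a \<in> V \<and> (\<forall>W. sub {\<one>} W \<longrightarrow> W \<subseteq> V \<longrightarrow> W = {\<zero>\<^bsub>M\<^esub>} \<or> W = V)"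
    proof (cases "a = \<zero>\<^bsub>M\<^esub>")
      case True
      show ?thesis
      proof (intro exI[of _ "{\<zero>\<^bsub>M\<^esub>}"] conjI allI impI)
        show "sub {\<one>} {\<zero>\<^bsub>M\<^esub>}" by (rule sub_zero[OF one(1)])
        show "W = {\<zero>\<^bsub>M\<^esub>} \<or> W = {\<zero>\<^bsub>M\<^esub>}" if "sub {\<one>} W" "W \<subseteq> {\<zero>\<^bsub>M\<^esub>}" for W
          using subD(2)[OF that(1)] that(2) by blast
      qed (use True u(2) in auto)
    next
      case False
      obtain V where V: "sub {\<one>} V" "a \<in> V" "\<forall>W. sub {\<one>} W \<longrightarrow> W \<subseteq> V \<longrightarrow> W = {\<zero>\<^bsub>M\<^esub>} \<or> W = V"
        using line[OF Uc[OF a]] by (elim exE conjE)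
      \<comment> \<open>The module \<open>V\<close> meets \<open>U\<close> in the nonzero element
        \<open>a\<close>; having no proper nonzero submodules, it lies in \<open>U\<close>.\<close>
      have "sub {\<one>} (V \<inter> U)" by (rule sub_Int[OF V(1) sub_mono[OF U one(2)]])
      then have "V \<inter> U = {\<zero>\<^bsub>M\<^esub>} \<or> V \<inter> U = V" using V(3) by simp
      then have "V \<subseteq> U" using V(2) a False by blast
      then show ?thesis using V by (intro exI[of _ V]) simp
    qed
    then obtain V where V: "sub {\<one>} V" "V \<subseteq> U" "a \<in> V" "\<forall>W. sub {\<one>} W \<longrightarrow> W \<subseteq> V \<longrightarrow> W = {\<zero>\<^bsub>M\<^esub>} \<or> W = V"
      by (elim exE conjE)
    have "W = {\<zero>\<^bsub>M\<^esub>} \<or> W = V" if "opsub (M\<lparr>carrier := U\<rparr>) act Om {\<one>} W" "W \<subseteq> V" for W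
      using V(4) that opsub_restrict[OF order.trans[OF that(2) V(2)] u(1)] by blast
    then show ?thesis using V(1,3) opsub_restrict[OF V(2) u(1)] by (intro exI[of _ V]) blast
  qed
  show ?thesis
  proof (rule opmod.intro)
    show "group (G\<lparr>carrier := H\<rparr>)" by (rule H.subgroup_is_group) (rule G.group_axioms)
    show "abelian_group (M\<lparr>carrier := U\<rparr>)" by (rule ag)
    show "opmod_axioms (G\<lparr>carrier := H\<rparr>) (M\<lparr>carrier := U\<rparr>) act Om"
    proof (rule opmod_axioms.intro, goal_cases)
      case 8
      obtain \<omega> where w: "\<omega> \<in> Om" "\<forall>m \<in> carrier M. \<omega> m = \<ominus>\<^bsub>M\<^esub> m" using om_neg by blast
      have "\<forall>m \<in> U. \<omega> m = \<ominus>\<^bsub>M\<lparr>carrier := U\<rparr>\<^esub> m" using w(2) neg Uc by simp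
      then show ?case using w(1) by auto
    next
      case (9 a)
      then show ?case using line'[of a] by simp
    qed (use u(4,5) Uc H.mem_carrier in \<open>auto simp: act_add act_act act_one om_add om_act\<close>)
  qed
qed

theorem exists_primitive:
  assumes irr: "\<And>W. sub (carrier G) W \<Longrightarrow> W = {\<zero>\<^bsub>M\<^esub>} \<or> W = carrier M" and nz: "carrier M \<noteq> {\<zero>\<^bsub>M\<^esub>}"
    and pc: "polycyclic G (carrier G)" and cs: "central_series G c Z"
  shows "\<exists>H U. gd H U \<and> (\<forall>H' U'. good (G\<lparr>carrier := H\<rparr>) (M\<lparr>carrier := U\<rparr>) act Om H' U' \<longrightarrow> H' = H)"
proof -
  obtain \<mu> :: "'g set \<Rightarrow> nat" where \<mu>: "\<forall>K K'. subgroup K G \<longrightarrow> subgroup K' G \<longrightarrow> K' \<subseteq> K \<longrightarrow> K \<subseteq> carrier G \<longrightarrow>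
    \<mu> K' \<le> \<mu> K \<and> (\<mu> K' = \<mu> K \<longrightarrow> (\<exists>B. covered G K' K B))"
    using G.polycyclic_measure[OF pc] by (elim exE)
  have "\<exists>p. (\<lambda>(H, U). gd H U) p \<and> (\<forall>q. (\<lambda>(H, U). gd H U) q \<longrightarrow> \<mu> (fst p) \<le> \<mu> (fst q))"
    by (rule ex_has_least_nat[of _ "(carrier G, carrier M)"]) (simp add: good_self)
  then obtain H0 U0 where g0: "gd H0 U0" and min: "\<And>H U. gd H U \<Longrightarrow> \<mu> H0 \<le> \<mu> H" by fastforce
  note sH0 = goodD(1)[OF g0] and sU0 = goodD(2)[OF g0]
  have U0c: "U0 \<subseteq> carrier M" by (rule subD(1)[OF sU0])
  interpret H0: subgroup H0 G by (rule sH0)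
  let ?G = "G\<lparr>carrier := H0\<rparr>" and ?M = "M\<lparr>carrier := U0\<rparr>"
  interpret N: opmod ?G ?M act Om by (rule opmod_restrict[OF sH0 sU0])
  \<comment> \<open>Goodness inside the pair passes to \<open>G\<close> by transitivity, so
    minimality of the pair forces equal measures and thereby finite index.\<close>
  have cov: "\<exists>B. covered ?G H (carrier ?G) B" if g: "N.gd H U" for H U
  proof -
    have gG: "gd H U" by (rule good_trans[OF g0 g])
    have HH: "H \<subseteq> H0" using subgroup.subset[OF N.goodD(1)[OF g]] by simp
    have "\<mu> H \<le> \<mu> H0 \<and> (\<mu> H = \<mu> H0 \<longrightarrow> (\<exists>B. covered G H H0 B))"
      using \<mu> sH0 goodD(1)[OF gG] HH H0.subset by blast
    then obtain B where "covered G H H0 B" using min[OF gG] by force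
    then obtain T where T: "finite T" "card T \<le> B" "T \<subseteq> carrier G" "\<forall>k \<in> H0. \<exists>h \<in> H. \<exists>t \<in> T. k = h \<otimes> t"
      unfolding covered_def by (elim exE conjE)
    have "covered ?G H (carrier ?G) B"
    \<comment> \<open>A representative \<open>t\<close> of an element of \<open>H0\<close> lies in
      \<open>H0\<close> itself, since the other factor comes from \<open>H\<close>, a subset of
      \<open>H0\<close>.\<close>
    proof (rule N.G.coveredI[of "T \<inter> H0"])
      show "finite (T \<inter> H0)" "T \<inter> H0 \<subseteq> carrier ?G" using T(1) by auto
      show "card (T \<inter> H0) \<le> B" using T(1,2) card_mono[of T "T \<inter> H0"] by simp
      fix k assume "k \<in> carrier ?G"
      then have k: "k \<in> H0" by simp
      obtain h t where ht: "h \<in> H" "t \<in> T" "k = h \<otimes> t" using T(4) k by blast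
      have "h \<in> H0" using ht(1) HH by blast
      have "t = inv h \<otimes> k" unfolding ht(3) using H0.mem_carrier[OF \<open>h \<in> H0\<close>] ht(2) T(3) by (simp add: G.cancel_left subset_iff)
      then have "t \<in> H0" using \<open>h \<in> H0\<close> k by simp
      then show "\<exists>h\<in>H. \<exists>t\<in>T \<inter> H0. k = h \<otimes>\<^bsub>?G\<^esub> t" using ht by auto
    qed
    then show ?thesis by blast
  qed
  have "\<exists>B. \<forall>H U. N.gd H U \<longrightarrow> covered ?G H (carrier ?G) B"
  proof (rule N.bounded_index)
    show "W = {\<zero>\<^bsub>?M\<^esub>} \<or> W = carrier ?M" if W: "N.sub (carrier ?G) W" for W
    proof -
      have WU: "W \<subseteq> U0" using N.subD(1)[OF W] by simp
      have "sub (carrier ?G) W" by (rule iffD1[OF opsub_restrict[OF WU U0c] W])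
      then have "sub H0 W" by simp
      from good_irreducible[OF g0 irr this WU] show ?thesis by simp
    qed
    show "carrier ?M \<noteq> {\<zero>\<^bsub>?M\<^esub>}" using good_nonzero[OF g0 nz] by simp
    show "\<exists>B. covered ?G H (carrier ?G) B" if "N.gd H U" for H U by (rule cov[OF that])
    have "polycyclic G H0" by (rule G.polycyclic_subgroup[OF pc sH0 H0.subset])
    from G.restrict_polycyclic[OF this sH0 order.refl] show "polycyclic ?G (carrier ?G)" by simp
    show "central_series ?G c Z" by (rule G.restrict_central_series[OF cs sH0])
  qed
  then obtain B where B: "\<forall>H U. N.gd H U \<longrightarrow> covered ?G H (carrier ?G) B" by (elim exE)
  define ix where "ix H = (LEAST B. covered ?G H (carrier ?G) B)" for H
  have ix: "covered ?G H (carrier ?G) (ix H)" if g: "N.gd H U" for H U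
  proof -
    obtain B' where "covered ?G H (carrier ?G) B'" using cov[OF g] by (elim exE)
    then show ?thesis unfolding ix_def by (rule LeastI)
  qed
  have ixB: "ix H \<le> B" if "N.gd H U" for H U
    unfolding ix_def by (rule Least_le) (use B that in blast)
  have "\<exists>p. (\<lambda>(H, U). N.gd H U) p \<and> (\<forall>q. (\<lambda>(H, U). N.gd H U) q \<longrightarrow> ix (fst q) \<le> ix (fst p))"
  proof (rule ex_has_greatest_nat)
    show "(\<lambda>(H, U). N.gd H U) (carrier ?G, carrier ?M)" using N.good_self by simp
    show "\<forall>q. (\<lambda>(H, U). N.gd H U) q \<longrightarrow> ix (fst q) < Suc B"
    proof (intro allI impI)
      fix q assume "(\<lambda>(H, U). N.gd H U) q"
      then have "N.gd (fst q) (snd q)" by (simp add: case_prod_beta)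
      from ixB[OF this] show "ix (fst q) < Suc B" by simp
    qed
  qed
  then obtain p where p: "(\<lambda>(H, U). N.gd H U) p" "\<forall>q. (\<lambda>(H, U). N.gd H U) q \<longrightarrow> ix (fst q) \<le> ix (fst p)" by (elim exE conjE)
  define H1 where "H1 = fst p"
  define U1 where "U1 = snd p"
  have g1: "N.gd H1 U1" using p(1) by (simp add: H1_def U1_def case_prod_beta)
  have max: "ix H \<le> ix H1" if "N.gd H U" for H U
    using p(2)[rule_format, of "(H, U)"] that by (simp add: H1_def)
  have "H' = H1" if g: "good (G\<lparr>carrier := H1\<rparr>) (M\<lparr>carrier := U1\<rparr>) act Om H' U'" for H' U'
  proof (rule ccontr)
    assume ne: "H' \<noteq> H1"
    have g': "N.gd H' U'" by (rule N.good_trans[OF g1]) (use g in simp)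
    have "subgroup H' (G\<lparr>carrier := H1\<rparr>)" using g unfolding good_def by (elim conjE)
    then have HH: "H' \<subseteq> H1" using subgroup.subset by fastforce
    have "0 < ix H'" "covered ?G H1 (carrier ?G) (ix H' - 1)"
      using N.G.covered_index_increases[OF N.goodD(1)[OF g1] N.goodD(1)[OF g'] HH ne ix[OF g']] .
    then have "ix H1 < ix H'" unfolding ix_def[of H1] using Least_le[of "\<lambda>B. covered ?G H1 (carrier ?G) B" "ix H' - 1"] by linarith
    then show False using max[OF g'] by simp
  qed
  moreover have "gd H1 U1" by (rule good_trans[OF g0 g1])
  ultimately show ?thesis by blast
qed

end

section \<open>Separated translates and internal direct sums\<close>

lemma (in abelian_group) finsum_supp:
  assumes "finite S" "{i. v i \<noteq> \<zero>} \<subseteq> S" "\<And>i. i \<in> S \<Longrightarrow> v i \<in> carrier G"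
  shows "finsum G v {i. v i \<noteq> \<zero>} = finsum G v S"
  by (rule add.finprod_mono_neutral_cong_left) (use assms in auto)

context opmod
begin

lemma finsum_in_sumof:
  assumes "finite S" "\<And>i. i \<in> S \<Longrightarrow> v i \<in> V i" "\<And>i. i \<in> S \<Longrightarrow> V i \<subseteq> carrier M"
  shows "finsum M v S \<in> sumof (V ` S)"
  using assms
proof (induction S)
  case empty
  then show ?case by (simp add: msum.zero)
next
  case (insert i S)
  have IH: "finsum M v S \<in> sumof (V ` S)" by (rule insert.IH) (use insert.prems in auto)
  have "sumof (V ` S) \<subseteq> sumof (V ` insert i S)" by (rule sumof_mono) auto
  then have y: "finsum M v S \<in> sumof (V ` insert i S)" using IH by blast
  have "finsum M v (insert i S) = v i \<oplus>\<^bsub>M\<^esub> finsum M v S"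
    by (rule M.finsum_insert) (use insert in auto)
  then show ?case using msum.step[OF _ insert.prems(1) y, of i] by simp
qed

text \<open>Summands belonging to the same index are collected, which turns an inductively built sum
  into a family with one entry per index.\<close>

lemma sumof_finsum:
  assumes "x \<in> sumof (V ` D)" "\<And>i. i \<in> D \<Longrightarrow> sub {} (V i)"
  shows "\<exists>v. (\<forall>i \<in> D. v i \<in> V i) \<and> (\<forall>i. i \<notin> D \<longrightarrow> v i = \<zero>\<^bsub>M\<^esub>) \<and> finite {i. v i \<noteq> \<zero>\<^bsub>M\<^esub>} \<and>
    x = finsum M v {i. v i \<noteq> \<zero>\<^bsub>M\<^esub>}"
  using assms(1)
proof induction
  case zero
  show ?case by (intro exI[of _ "\<lambda>_. \<zero>\<^bsub>M\<^esub>"]) (use subD(2)[OF assms(2)] in auto)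
next
  case (step Z x y)
  then obtain t where t: "t \<in> D" "Z = V t" by blast
  from step.IH obtain v where v: "\<forall>i \<in> D. v i \<in> V i" "\<forall>i. i \<notin> D \<longrightarrow> v i = \<zero>\<^bsub>M\<^esub>" "finite {i. v i \<noteq> \<zero>\<^bsub>M\<^esub>}"
    "y = finsum M v {i. v i \<noteq> \<zero>\<^bsub>M\<^esub>}" by (elim exE conjE)
  have vc: "v i \<in> carrier M" for i
    using v(1,2) subD(1)[OF assms(2)] by (cases "i \<in> D") auto
  have xc: "x \<in> carrier M" using step.hyps(2) t subD(1)[OF assms(2)[OF t(1)]] by blast
  define w where "w = v(t := x \<oplus>\<^bsub>M\<^esub> v t)"
  have wc: "w i \<in> carrier M" for i using vc xc by (simp add: w_def)
  define S where "S = {i. v i \<noteq> \<zero>\<^bsub>M\<^esub>} - {t}"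
  have S: "finite S" "t \<notin> S" using v(3) by (auto simp: S_def)
  have sv: "y = v t \<oplus>\<^bsub>M\<^esub> finsum M v S"
  proof -
    have "y = finsum M v (insert t S)"
      unfolding v(4) by (rule M.finsum_supp) (use S vc in \<open>auto simp: S_def\<close>)
    also have "\<dots> = v t \<oplus>\<^bsub>M\<^esub> finsum M v S" by (rule M.finsum_insert) (use S vc in auto)
    finally show ?thesis .
  qed
  have supp: "{i. w i \<noteq> \<zero>\<^bsub>M\<^esub>} \<subseteq> insert t S" by (auto simp: w_def S_def)
  have "finsum M w {i. w i \<noteq> \<zero>\<^bsub>M\<^esub>} = finsum M w (insert t S)"
    by (rule M.finsum_supp) (use S supp wc in auto)
  also have "\<dots> = w t \<oplus>\<^bsub>M\<^esub> finsum M w S" by (rule M.finsum_insert) (use S wc in auto)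
  also have "finsum M w S = finsum M v S" by (rule M.finsum_cong') (use S vc in \<open>auto simp: w_def\<close>)
  also have "w t \<oplus>\<^bsub>M\<^esub> finsum M v S = x \<oplus>\<^bsub>M\<^esub> y"
    unfolding sv using xc vc M.finsum_closed[of v S] by (simp add: w_def M.a_assoc)
  finally have e: "x \<oplus>\<^bsub>M\<^esub> y = finsum M w {i. w i \<noteq> \<zero>\<^bsub>M\<^esub>}" by simp
  have "x \<oplus>\<^bsub>M\<^esub> v t \<in> V t" using subD(3)[OF assms(2)[OF t(1)]] step.hyps(2) t v(1) by blast
  then have "\<forall>i \<in> D. w i \<in> V i" using v(1) by (simp add: w_def)
  moreover have "\<forall>i. i \<notin> D \<longrightarrow> w i = \<zero>\<^bsub>M\<^esub>" using v(2) t(1) by (auto simp: w_def)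
  moreover have "finite {i. w i \<noteq> \<zero>\<^bsub>M\<^esub>}" by (rule finite_subset[OF supp]) (use S in simp)
  ultimately show ?case using e by blast
qed

lemma sub_additive_subgroup: "sub L W \<Longrightarrow> additive_subgroup W M"
  using subD[of L W] sub_neg[of L W]
  by (intro additive_subgroup.intro M.add.subgroupI) (auto simp: a_inv_def)

lemma transversal_cover:
  assumes T: "right_transversal T H G" and H: "subgroup H G" and g: "g \<in> carrier G"
  shows "\<exists>t \<in> T. \<exists>h \<in> H. g = h \<otimes> t"
proof -
  interpret H: subgroup H G by fact
  have "H #> g \<in> rcosets H" using g by (auto simp: RCOSETS_def)
  then obtain t where t: "t \<in> T" "t \<in> H #> g" using T unfolding right_transversal_def by blast
  then obtain h where h: "h \<in> H" "t = h \<otimes> g" by (auto simp: r_coset_def)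
  have "g = inv h \<otimes> t" unfolding h(2) using H.mem_carrier[OF h(1)] g by (simp add: G.m_assoc[symmetric])
  then show ?thesis using t(1) h(1) H.m_inv_closed by blast
qed

lemma transversal_unique:
  assumes T: "right_transversal T H G" and H: "subgroup H G" and t: "t \<in> T" "t' \<in> T" "h \<in> H" "h \<otimes> t' = t"
  shows "t = t'"
proof -
  interpret H: subgroup H G by fact
  have tc: "t' \<in> carrier G" using T t(2) unfolding right_transversal_def by blast
  have "H #> t' \<in> rcosets H" using tc by (auto simp: RCOSETS_def)
  moreover have "t \<in> H #> t'" "t' \<in> H #> t'" using t(3,4) G.rcos_self[OF tc H] by (auto simp: r_coset_def)
  ultimately show ?thesis using T t(1,2) unfolding right_transversal_def by blast
qed

lemma transversal_exists:
  assumes H: "subgroup H G" shows "\<exists>T. right_transversal T H G"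
proof -
  interpret H: subgroup H G by fact
  have ne: "\<exists>t. t \<in> C" if "C \<in> rcosets H" for C
    using that G.rcos_self[OF _ H] by (auto simp: RCOSETS_def)
  define T where "T = (\<lambda>C. SOME t. t \<in> C) ` (rcosets H)"
  have s: "(SOME t. t \<in> C) \<in> C" if "C \<in> rcosets H" for C using someI_ex[OF ne[OF that]] .
  have Cc: "C \<subseteq> carrier G" if "C \<in> rcosets H" for C using that G.rcosets_part_G[OF H] by blast
  have "\<exists>!t. t \<in> T \<and> t \<in> C" if C: "C \<in> rcosets H" for C
  proof (rule ex1I[of _ "SOME t. t \<in> C"])
    show "(SOME t. t \<in> C) \<in> T \<and> (SOME t. t \<in> C) \<in> C" using s[OF C] C unfolding T_def by blast
    fix t assume t: "t \<in> T \<and> t \<in> C"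
    then obtain D where D: "D \<in> rcosets H" "t = (SOME t. t \<in> D)" unfolding T_def by blast
    have "t \<in> D" unfolding D(2) by (rule s[OF D(1)])
    then have "C = D" using G.rcos_disjoint[OF H] C D(1) t by (auto simp: pairwise_def disjnt_def)
    then show "t = (SOME t. t \<in> C)" using D(2) by simp
  qed
  moreover have "T \<subseteq> carrier G" using s Cc unfolding T_def by blast
  ultimately have "right_transversal T H G" unfolding right_transversal_def by (intro conjI ballI)
  then show ?thesis by (rule exI)
qed

lemma add_eq_diff:
  assumes "a \<in> carrier M" "b \<in> carrier M" "p \<in> carrier M" "q \<in> carrier M" "a \<oplus>\<^bsub>M\<^esub> p = b \<oplus>\<^bsub>M\<^esub> q"
  shows "a \<ominus>\<^bsub>M\<^esub> b = q \<ominus>\<^bsub>M\<^esub> p"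
proof -
  have "a = (b \<oplus>\<^bsub>M\<^esub> q) \<oplus>\<^bsub>M\<^esub> \<ominus>\<^bsub>M\<^esub> p" using assms(1,3) by (simp add: assms(5)[symmetric] M.a_assoc M.r_neg)
  then have "a \<ominus>\<^bsub>M\<^esub> b = ((b \<oplus>\<^bsub>M\<^esub> q) \<oplus>\<^bsub>M\<^esub> \<ominus>\<^bsub>M\<^esub> p) \<oplus>\<^bsub>M\<^esub> \<ominus>\<^bsub>M\<^esub> b" by (simp add: M.minus_eq)
  also have "\<dots> = b \<oplus>\<^bsub>M\<^esub> (\<ominus>\<^bsub>M\<^esub> b \<oplus>\<^bsub>M\<^esub> (q \<oplus>\<^bsub>M\<^esub> \<ominus>\<^bsub>M\<^esub> p))" using assms(1-4) by (simp add: M.add.m_ac)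
  also have "\<dots> = q \<ominus>\<^bsub>M\<^esub> p" using assms(2-4) by (simp add: M.r_neg2 M.minus_eq)
  finally show ?thesis .
qed

text \<open>Two decompositions of an element differ at \<open>t\<close> by an element of the
  translate at \<open>t\<close> that also lies in the sum of the others, which separation makes
  zero. Conversely, every translate equals one indexed by the transversal, and a nonzero element of
  one that is a sum from the others would have two decompositions.\<close>

lemma good_iff_direct_sum:
  assumes H: "subgroup H G" and U: "sub H U"
  shows "gd H U \<longleftrightarrow> (\<exists>T. right_transversal T H G \<and> internal_direct_sum M T (tra U))"
proof
  have Uc: "U \<subseteq> carrier M" by (rule subD(1)[OF U])
  assume g: "gd H U"
  obtain T where T: "right_transversal T H G" using transversal_exists[OF H] by blast
  have Tc: "T \<subseteq> carrier G" using T unfolding right_transversal_def by blast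
  have sT: "sub {} (tra U t)" if "t \<in> T" for t by (rule sub_add[OF U]) (use that Tc in blast)
  have trc: "tra U t \<subseteq> carrier M" if "t \<in> T" for t by (rule subD(1)[OF sT[OF that]])
  have "internal_direct_sum M T (tra U)"
    unfolding internal_direct_sum_def
  proof (intro conjI ballI)
    fix t assume "t \<in> T"
    then show "additive_subgroup (tra U t) M" by (rule sub_additive_subgroup[OF sT])
  next
    fix m assume m: "m \<in> carrier M"
    have "sumof (tra U ` carrier G) \<subseteq> sumof (tra U ` T)"
    proof (rule sumof_mono, rule image_subsetI)
      fix g assume "g \<in> carrier G"
      then obtain t h where "t \<in> T" "h \<in> H" "g = h \<otimes> t" using transversal_cover[OF T H] by blast
      then have "tra U g = tra U t" using tr_coset[OF U _ H] Tc by blast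
      then show "tra U g \<in> tra U ` T" using \<open>t \<in> T\<close> by blast
    qed
    then have "m \<in> sumof (tra U ` T)" using m goodD(3)[OF g] by blast
    then have "\<exists>v. (\<forall>i \<in> T. v i \<in> tra U i) \<and> (\<forall>i. i \<notin> T \<longrightarrow> v i = \<zero>\<^bsub>M\<^esub>) \<and> finite {i. v i \<noteq> \<zero>\<^bsub>M\<^esub>} \<and>
      m = finsum M v {i. v i \<noteq> \<zero>\<^bsub>M\<^esub>}" by (rule sumof_finsum) (rule sT)
    then obtain v where v: "\<forall>i \<in> T. v i \<in> tra U i" "\<forall>i. i \<notin> T \<longrightarrow> v i = \<zero>\<^bsub>M\<^esub>"
      "finite {i. v i \<noteq> \<zero>\<^bsub>M\<^esub>}" "m = finsum M v {i. v i \<noteq> \<zero>\<^bsub>M\<^esub>}" by (elim exE conjE)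
    show "\<exists>!v. (\<forall>i\<in>T. v i \<in> tra U i) \<and> (\<forall>i. i \<notin> T \<longrightarrow> v i = \<zero>\<^bsub>M\<^esub>) \<and> finite {i. v i \<noteq> \<zero>\<^bsub>M\<^esub>} \<and>
      m = (\<Oplus>\<^bsub>M\<^esub>i\<in>{i. v i \<noteq> \<zero>\<^bsub>M\<^esub>}. v i)"
    proof (rule ex1I[of _ v])
      show "(\<forall>i\<in>T. v i \<in> tra U i) \<and> (\<forall>i. i \<notin> T \<longrightarrow> v i = \<zero>\<^bsub>M\<^esub>) \<and> finite {i. v i \<noteq> \<zero>\<^bsub>M\<^esub>} \<and>
        m = (\<Oplus>\<^bsub>M\<^esub>i\<in>{i. v i \<noteq> \<zero>\<^bsub>M\<^esub>}. v i)" by (intro conjI v)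
      fix w assume W: "(\<forall>i\<in>T. w i \<in> tra U i) \<and> (\<forall>i. i \<notin> T \<longrightarrow> w i = \<zero>\<^bsub>M\<^esub>) \<and> finite {i. w i \<noteq> \<zero>\<^bsub>M\<^esub>} \<and>
        m = (\<Oplus>\<^bsub>M\<^esub>i\<in>{i. w i \<noteq> \<zero>\<^bsub>M\<^esub>}. w i)"
      note w = conjunct1[OF W] conjunct1[OF conjunct2[OF W]] conjunct1[OF conjunct2[OF conjunct2[OF W]]]
        conjunct2[OF conjunct2[OF conjunct2[OF W]]]
      have vc1: "u i \<in> carrier M" if "\<forall>i\<in>T. u i \<in> tra U i" "\<forall>i. i \<notin> T \<longrightarrow> u i = \<zero>\<^bsub>M\<^esub>" for u i
      proof (cases "i \<in> T")
        case True
        then show ?thesis using that(1) trc[OF True] by blast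
      qed (use that(2) in simp)
      note vc = vc1[OF v(1,2)] vc1[OF w(1,2)]
      show "w = v"
      proof
        fix t show "w t = v t"
        proof (cases "t \<in> T")
          case False then show ?thesis using v(2) w(2) by simp
        next
          case t: True
          define S where "S = {i. v i \<noteq> \<zero>\<^bsub>M\<^esub>} \<union> {i. w i \<noteq> \<zero>\<^bsub>M\<^esub>} - {t}"
          have S: "finite S" "t \<notin> S" using v(3) w(3) by (auto simp: S_def)
          have ST: "S \<subseteq> T" using v(2) w(2) by (auto simp: S_def)
          have Sc: "S \<subseteq> carrier G" using ST Tc by blast
          have a: "m = u t \<oplus>\<^bsub>M\<^esub> finsum M u S"
            if u: "u = v \<or> u = w" for u
          proof -
            have uc: "u i \<in> carrier M" for i using vc u by auto
            have "m = finsum M u {i. u i \<noteq> \<zero>\<^bsub>M\<^esub>}" using v(4) w(4) u by auto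
            also have "\<dots> = finsum M u (insert t S)"
              by (rule M.finsum_supp) (use S uc u in \<open>auto simp: S_def\<close>)
            also have "\<dots> = u t \<oplus>\<^bsub>M\<^esub> finsum M u S" by (rule M.finsum_insert) (use S uc in auto)
            finally show ?thesis .
          qed
          have b: "finsum M u S \<in> sumof (tra U ` S)" if u: "u = v \<or> u = w" for u
          proof (rule finsum_in_sumof[OF S(1)])
            fix i assume "i \<in> S"
            then have i: "i \<in> T" using ST by blast
            show "tra U i \<subseteq> carrier M" by (rule trc[OF i])
            show "u i \<in> tra U i" using u v(1) w(1) i by auto
          qed
          define p where "p = finsum M v S"
          define q where "q = finsum M w S"
          have pq: "p \<in> sumof (tra U ` S)" "q \<in> sumof (tra U ` S)" using b by (auto simp: p_def q_def)
          have pqc: "p \<in> carrier M" "q \<in> carrier M" using pq sums_carrier[OF Uc Sc] by auto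
          have eq: "v t \<oplus>\<^bsub>M\<^esub> p = w t \<oplus>\<^bsub>M\<^esub> q" using a[of v] a[of w] by (simp add: p_def q_def)
          define d where "d = v t \<ominus>\<^bsub>M\<^esub> w t"
          have dt: "d \<in> tra U t" unfolding d_def using sub_minus[OF sT[OF t]] v(1) w(1) t by blast
          have dq: "d = q \<ominus>\<^bsub>M\<^esub> p"
            unfolding d_def by (rule add_eq_diff[OF vc pqc eq])
          have "d \<in> sumof (tra U ` S)" unfolding dq by (rule sub_minus[OF sub_sums[OF U Sc] pq(2,1)])
          moreover have "d \<in> sumof (tra U ` {t})" using dt sumof_single[OF sT[OF t]] by simp
          ultimately have "d = \<zero>\<^bsub>M\<^esub>"
          proof (intro goodD_indep[OF g _ Sc, of "{t}" d])
            show "{t} \<subseteq> carrier G" using t Tc by blast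
            show "h \<otimes> c' \<noteq> c" if "c \<in> {t}" "c' \<in> S" "h \<in> H" for c c' h
              using transversal_unique[OF T H t _ that(3), of c'] that(1,2) ST S(2) by auto
          qed
          then have "v t \<ominus>\<^bsub>M\<^esub> w t = \<zero>\<^bsub>M\<^esub>" by (simp add: d_def)
          then have "\<zero>\<^bsub>M\<^esub> \<oplus>\<^bsub>M\<^esub> w t = v t" using add_minus_cancel(2)[OF vc[of t]] unfolding M.minus_eq by simp
          then show ?thesis using vc by simp
        qed
      qed
    qed
  qed
  then show "\<exists>T. right_transversal T H G \<and> internal_direct_sum M T (tra U)" using T by blast
next
  have Uc: "U \<subseteq> carrier M" by (rule subD(1)[OF U])
  assume "\<exists>T. right_transversal T H G \<and> internal_direct_sum M T (tra U)"
  then obtain T where T: "right_transversal T H G" and ds: "internal_direct_sum M T (tra U)" by blast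
  have Tc: "T \<subseteq> carrier G" using T unfolding right_transversal_def by blast
  have sT: "sub {} (tra U t)" if "t \<in> T" for t by (rule sub_add[OF U]) (use that Tc in blast)
  have trc: "tra U t \<subseteq> carrier M" if "t \<in> T" for t by (rule subD(1)[OF sT[OF that]])
  define dec where "dec m v \<longleftrightarrow> (\<forall>i\<in>T. v i \<in> tra U i) \<and> (\<forall>i. i \<notin> T \<longrightarrow> v i = \<zero>\<^bsub>M\<^esub>) \<and> finite {i. v i \<noteq> \<zero>\<^bsub>M\<^esub>} \<and>
      m = (\<Oplus>\<^bsub>M\<^esub>i\<in>{i. v i \<noteq> \<zero>\<^bsub>M\<^esub>}. v i)" for m v
  have ex1: "\<exists>!v. dec m v" if "m \<in> carrier M" for m using ds that unfolding internal_direct_sum_def dec_def by blast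
  show "gd H U"
  proof (rule goodI[OF H U])
    show "carrier M \<subseteq> sumof (tra U ` carrier G)"
    proof
      fix m assume "m \<in> carrier M"
      then obtain v where v: "dec m v" using ex1 by blast
      define S where "S = {i. v i \<noteq> \<zero>\<^bsub>M\<^esub>}"
      have ST: "S \<subseteq> T" using v unfolding dec_def S_def by blast
      have "finsum M v S \<in> sumof (tra U ` S)"
      proof (rule finsum_in_sumof)
        show "finite S" using v by (simp add: dec_def S_def)
        fix i assume "i \<in> S"
        then have i: "i \<in> T" using ST by blast
        show "tra U i \<subseteq> carrier M" by (rule trc[OF i])
        show "v i \<in> tra U i" using v i by (simp add: dec_def)
      qed
      moreover have "m = finsum M v S" using v unfolding dec_def S_def by simp
      moreover have "sumof (tra U ` S) \<subseteq> sumof (tra U ` carrier G)"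
        by (intro sumof_mono image_mono) (use ST Tc in blast)
      ultimately show "m \<in> sumof (tra U ` carrier G)" by blast
    qed
    fix t C x assume t: "t \<in> carrier G" and C: "C \<subseteq> carrier G"
      and tC: "\<And>c h. c \<in> C \<Longrightarrow> h \<in> H \<Longrightarrow> h \<otimes> c \<noteq> t" and x: "x \<in> tra U t" "x \<in> sumof (tra U ` C)"
    interpret H: subgroup H G by (rule H)
    obtain t0 h0 where t0: "t0 \<in> T" "h0 \<in> H" "t = h0 \<otimes> t0" using transversal_cover[OF T H t] by blast
    have t0c: "t0 \<in> carrier G" using t0(1) Tc by blast
    have xt0: "x \<in> tra U t0" using x(1) tr_coset[OF U t0(2) H t0c] t0(3) by simp
    have xc: "x \<in> carrier M" using xt0 trc[OF t0(1)] by blast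
    define v1 where "v1 = (\<lambda>i. if i = t0 then x else \<zero>\<^bsub>M\<^esub>)"
    have d1: "dec x v1"
    proof -
      have "finsum M v1 {i. v1 i \<noteq> \<zero>\<^bsub>M\<^esub>} = finsum M v1 {t0}"
        by (rule M.finsum_supp) (use xc in \<open>auto simp: v1_def\<close>)
      also have "\<dots> = x" using xc by (simp add: v1_def)
      finally have "x = finsum M v1 {i. v1 i \<noteq> \<zero>\<^bsub>M\<^esub>}" by simp
      moreover have "finite {i. v1 i \<noteq> \<zero>\<^bsub>M\<^esub>}" by (rule finite_subset[of _ "{t0}"]) (auto simp: v1_def)
      moreover have "\<forall>i\<in>T. v1 i \<in> tra U i" using xt0 subD(2)[OF sT] by (simp add: v1_def)
      ultimately show ?thesis unfolding dec_def using t0(1) by (auto simp: v1_def)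
    qed
    define D where "D = T - {t0}"
    have "sumof (tra U ` C) \<subseteq> sumof (tra U ` D)"
    proof (rule sumof_mono, rule image_subsetI)
      fix c assume c: "c \<in> C"
      then have cc: "c \<in> carrier G" using C by blast
      obtain s h where s: "s \<in> T" "h \<in> H" "c = h \<otimes> s" using transversal_cover[OF T H cc] by blast
      have sc: "s \<in> carrier G" using s(1) Tc by blast
      have "s \<noteq> t0"
      proof
        assume st: "s = t0"
        have hc: "h \<in> carrier G" "h0 \<in> carrier G" using s(2) t0(2) by auto
        have "(h0 \<otimes> inv h) \<otimes> c = t"
          unfolding s(3) t0(3) st using hc t0c by (simp add: G.m_assoc G.cancel_left)
        moreover have "h0 \<otimes> inv h \<in> H" using s(2) t0(2) by simp
        ultimately show False using tC[OF c] by blast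
      qed
      then have "s \<in> D" using s(1) by (simp add: D_def)
      moreover have "tra U c = tra U s" unfolding s(3) by (rule tr_coset[OF U s(2) H sc])
      ultimately show "tra U c \<in> tra U ` D" by blast
    qed
    then have "x \<in> sumof (tra U ` D)" using x(2) by blast
    then have "\<exists>v. (\<forall>i \<in> D. v i \<in> tra U i) \<and> (\<forall>i. i \<notin> D \<longrightarrow> v i = \<zero>\<^bsub>M\<^esub>) \<and> finite {i. v i \<noteq> \<zero>\<^bsub>M\<^esub>} \<and>
      x = finsum M v {i. v i \<noteq> \<zero>\<^bsub>M\<^esub>}"
      by (rule sumof_finsum) (use sT in \<open>simp add: D_def\<close>)
    then obtain v2 where v2: "\<forall>i \<in> D. v2 i \<in> tra U i" "\<forall>i. i \<notin> D \<longrightarrow> v2 i = \<zero>\<^bsub>M\<^esub>"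
      "finite {i. v2 i \<noteq> \<zero>\<^bsub>M\<^esub>}" "x = finsum M v2 {i. v2 i \<noteq> \<zero>\<^bsub>M\<^esub>}" by (elim exE conjE)
    have "\<forall>i\<in>T. v2 i \<in> tra U i"
    proof
      fix i assume i: "i \<in> T"
      show "v2 i \<in> tra U i" using v2(1,2) subD(2)[OF sT[OF i]] by (cases "i \<in> D") auto
    qed
    moreover have "\<forall>i. i \<notin> T \<longrightarrow> v2 i = \<zero>\<^bsub>M\<^esub>" using v2(2) by (simp add: D_def)
    ultimately have d2: "dec x v2" unfolding dec_def using v2(3,4) by simp
    have "v1 = v2" using ex1[OF xc] d1 d2 by blast
    moreover have "v2 t0 = \<zero>\<^bsub>M\<^esub>" using v2(2) by (simp add: D_def)
    ultimately show "x = \<zero>\<^bsub>M\<^esub>" by (auto simp: v1_def dest: fun_cong[of _ _ t0])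
  qed
qed

end

section \<open>Modules over the group algebra\<close>

text \<open>Elements with at most one term, from which the group algebra is built by addition; at
  the identity of the group they represent the scalars.\<close>

definition single :: "('f, 'b) ring_scheme \<Rightarrow> 'g \<Rightarrow> 'f \<Rightarrow> 'g \<Rightarrow> 'f" where
  "single F g c = (\<lambda>h. if h = g then c else \<zero>\<^bsub>F\<^esub>)"

lemma group_basis_single: "group_basis F g = single F g \<one>\<^bsub>F\<^esub>"
  by (simp add: group_basis_def single_def)

context group_algebra_loc
begin

lemma single_closed: "g \<in> carrier G \<Longrightarrow> c \<in> carrier F \<Longrightarrow> single F g c \<in> carrier A"
  by (rule carrierI[of _ "{g}"]) (auto simp: single_def)

lemma single_mult:
  assumes g: "g \<in> carrier G" and h: "h \<in> carrier G" and c: "c \<in> carrier F" and d: "d \<in> carrier F"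
  shows "single F g c \<otimes>\<^bsub>A\<^esub> single F h d = single F (g \<otimes>\<^bsub>G\<^esub> h) (c \<otimes>\<^bsub>F\<^esub> d)"
proof
  fix k
  show "(single F g c \<otimes>\<^bsub>A\<^esub> single F h d) k = single F (g \<otimes>\<^bsub>G\<^esub> h) (c \<otimes>\<^bsub>F\<^esub> d) k"
  proof (cases "k \<in> carrier G")
    case True
    have "(single F g c \<otimes>\<^bsub>A\<^esub> single F h d) k =
      (\<Oplus>\<^bsub>F\<^esub>i \<in> {g}. single F g c i \<otimes>\<^bsub>F\<^esub> single F h d (inv\<^bsub>G\<^esub> i \<otimes>\<^bsub>G\<^esub> k))"
      by (rule mult_eq[OF single_closed[OF g c] single_closed[OF h d]]) (use g True in \<open>auto simp: single_def\<close>)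
    also have "\<dots> = c \<otimes>\<^bsub>F\<^esub> single F h d (inv\<^bsub>G\<^esub> g \<otimes>\<^bsub>G\<^esub> k)"
      using c d by (simp add: single_def)
    also have "\<dots> = single F (g \<otimes>\<^bsub>G\<^esub> h) (c \<otimes>\<^bsub>F\<^esub> d) k"
    proof -
      have "inv\<^bsub>G\<^esub> g \<otimes>\<^bsub>G\<^esub> k = h \<longleftrightarrow> k = g \<otimes>\<^bsub>G\<^esub> h"
        using g h True by (metis G.inv_solve_left)
      then show ?thesis using c by (simp add: single_def)
    qed
    finally show ?thesis .
  next
    case False
    then have "k \<noteq> g \<otimes>\<^bsub>G\<^esub> h" using g h by auto
    then show ?thesis using mult_outside[OF False] by (simp add: single_def)
  qed
qed

lemma single_add:
  "\<lbrakk>c \<in> carrier F; d \<in> carrier F\<rbrakk> \<Longrightarrow> single F g c \<oplus>\<^bsub>A\<^esub> single F g d = single F g (c \<oplus>\<^bsub>F\<^esub> d)"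
  by (rule ext) (simp add: add_eq single_def)

lemma single_zero: "single F g \<zero>\<^bsub>F\<^esub> = \<zero>\<^bsub>A\<^esub>"
  by (simp add: single_def zero_eq)

lemma single_one: "single F \<one>\<^bsub>G\<^esub> \<one>\<^bsub>F\<^esub> = \<one>\<^bsub>A\<^esub>"
  by (simp add: single_def one_eq)

text \<open>Terms are split off from the finite support one at a time.\<close>

lemma group_algebra_induct:
  assumes x: "x \<in> carrier A" and zero: "P \<zero>\<^bsub>A\<^esub>"
    and step: "\<And>g c y. g \<in> carrier G \<Longrightarrow> c \<in> carrier F \<Longrightarrow> y \<in> carrier A \<Longrightarrow> P y \<Longrightarrow> P (single F g c \<oplus>\<^bsub>A\<^esub> y)"
  shows "P x"
proof -
  have "P x" if "finite S" "x \<in> carrier A" "supp x \<subseteq> S" for S x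
    using that
  proof (induction S arbitrary: x)
    case empty
    then have "x = \<zero>\<^bsub>A\<^esub>" by (auto simp: zero_eq)
    then show ?case using zero by simp
  next
    case (insert g S)
    note x = carrierD[OF insert.prems(1)]
    define y where "y = x(g := \<zero>\<^bsub>F\<^esub>)"
    have y: "y \<in> carrier A" by (rule carrierI[of _ "supp x"]) (use x in \<open>auto simp: y_def\<close>)
    have Py: "P y" by (rule insert.IH[OF y]) (use insert.prems(2) in \<open>auto simp: y_def\<close>)
    show ?case
    proof (cases "g \<in> carrier G")
      case True
      have e: "x = single F g (x g) \<oplus>\<^bsub>A\<^esub> y" by (rule ext) (use x(1) in \<open>simp add: add_eq single_def y_def\<close>)
      show ?thesis by (rule ssubst[where P = P, OF e]) (rule step[OF True x(1) y Py])
    next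
      case False
      then have "y = x" using x(2) by (auto simp: y_def)
      then show ?thesis using Py by simp
    qed
  qed
  from this[OF carrierD(3)[OF x] x order.refl] show ?thesis .
qed

text \<open>For factors supported in \<open>H\<close> the convolution sum involves elements of
  \<open>H\<close> only, and by \<open>supp_mult\<close> the product taken in the large algebra
  vanishes outside \<open>H\<close>.\<close>

lemma subalgebra:
  assumes H: "subgroup H G"
  shows "carrier (group_algebra F (G\<lparr>carrier := H\<rparr>)) \<subseteq> carrier A"
    "\<zero>\<^bsub>group_algebra F (G\<lparr>carrier := H\<rparr>)\<^esub> = \<zero>\<^bsub>A\<^esub>" "\<one>\<^bsub>group_algebra F (G\<lparr>carrier := H\<rparr>)\<^esub> = \<one>\<^bsub>A\<^esub>"
    "x \<oplus>\<^bsub>group_algebra F (G\<lparr>carrier := H\<rparr>)\<^esub> y = x \<oplus>\<^bsub>A\<^esub> y"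
    "\<lbrakk>x \<in> carrier (group_algebra F (G\<lparr>carrier := H\<rparr>)); y \<in> carrier (group_algebra F (G\<lparr>carrier := H\<rparr>))\<rbrakk> \<Longrightarrow>
      x \<otimes>\<^bsub>group_algebra F (G\<lparr>carrier := H\<rparr>)\<^esub> y = x \<otimes>\<^bsub>A\<^esub> y"
proof -
  interpret H: subgroup H G by fact
  have HG: "group (G\<lparr>carrier := H\<rparr>)" by (rule H.subgroup_is_group) (rule G.group_axioms)
  interpret B: group_algebra_loc F "G\<lparr>carrier := H\<rparr>"
    by (intro group_algebra_loc.intro F.cring_axioms HG)
  show sub: "carrier (group_algebra F (G\<lparr>carrier := H\<rparr>)) \<subseteq> carrier A"
  proof
    fix x assume "x \<in> carrier (group_algebra F (G\<lparr>carrier := H\<rparr>))"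
    note x = B.carrierD[OF this]
    show "x \<in> carrier A"
      by (rule carrierI[of _ "supp x"]) (use x H.subset in auto)
  qed
  show "\<zero>\<^bsub>group_algebra F (G\<lparr>carrier := H\<rparr>)\<^esub> = \<zero>\<^bsub>A\<^esub>" "\<one>\<^bsub>group_algebra F (G\<lparr>carrier := H\<rparr>)\<^esub> = \<one>\<^bsub>A\<^esub>"
    "x \<oplus>\<^bsub>group_algebra F (G\<lparr>carrier := H\<rparr>)\<^esub> y = x \<oplus>\<^bsub>A\<^esub> y"
    by (simp_all add: group_algebra_def)
  assume xy: "x \<in> carrier (group_algebra F (G\<lparr>carrier := H\<rparr>))" "y \<in> carrier (group_algebra F (G\<lparr>carrier := H\<rparr>))"
  note x = B.carrierD[OF xy(1)] and y = B.carrierD[OF xy(2)]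
  have xA: "x \<in> carrier A" and yA: "y \<in> carrier A" using xy sub by auto
  show "x \<otimes>\<^bsub>group_algebra F (G\<lparr>carrier := H\<rparr>)\<^esub> y = x \<otimes>\<^bsub>A\<^esub> y"
  proof
    fix g
    show "(x \<otimes>\<^bsub>group_algebra F (G\<lparr>carrier := H\<rparr>)\<^esub> y) g = (x \<otimes>\<^bsub>A\<^esub> y) g"
    proof (cases "g \<in> H")
      case True
      have "(x \<otimes>\<^bsub>group_algebra F (G\<lparr>carrier := H\<rparr>)\<^esub> y) g =
        (\<Oplus>\<^bsub>F\<^esub>h \<in> supp x. x h \<otimes>\<^bsub>F\<^esub> y (inv\<^bsub>G\<lparr>carrier := H\<rparr>\<^esub> h \<otimes>\<^bsub>G\<lparr>carrier := H\<rparr>\<^esub> g))"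
        by (rule B.mult_eq[OF xy x(3) order.refl x(4)]) (use True in simp)
      also have "\<dots> = (\<Oplus>\<^bsub>F\<^esub>h \<in> supp x. x h \<otimes>\<^bsub>F\<^esub> y (inv\<^bsub>G\<^esub> h \<otimes>\<^bsub>G\<^esub> g))"
      proof (rule F.finsum_cong')
        fix h assume "h \<in> supp x"
        then have "h \<in> H" using x(4) by auto
        then show "x h \<otimes>\<^bsub>F\<^esub> y (inv\<^bsub>G\<lparr>carrier := H\<rparr>\<^esub> h \<otimes>\<^bsub>G\<lparr>carrier := H\<rparr>\<^esub> g) = x h \<otimes>\<^bsub>F\<^esub> y (inv\<^bsub>G\<^esub> h \<otimes>\<^bsub>G\<^esub> g)"
          using G.m_inv_consistent[OF H] by simp
      qed (use x(1) y(1) in auto)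
      also have "\<dots> = (x \<otimes>\<^bsub>A\<^esub> y) g"
        by (rule mult_eq[OF xA yA x(3) order.refl, symmetric]) (use x(4) True H.subset in auto)
      finally show ?thesis .
    next
      case False
      have "(x \<otimes>\<^bsub>A\<^esub> y) g = \<zero>\<^bsub>F\<^esub>"
      proof (rule ccontr)
        assume "(x \<otimes>\<^bsub>A\<^esub> y) g \<noteq> \<zero>\<^bsub>F\<^esub>"
        then have "g \<in> supp (x \<otimes>\<^bsub>A\<^esub> y)" by simp
        then obtain h k where "h \<in> supp x" "k \<in> supp y" "g = h \<otimes>\<^bsub>G\<^esub> k" using supp_mult[OF xA yA] by auto
        then show False using False x(4) y(4) H.m_closed[of h k] by auto
      qed
      then show ?thesis using B.mult_outside[of g] False by simp
    qed
  qed
qed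

end

section \<open>Modules over the group algebra as modules with operators\<close>

lemma (in right_module) rsmult_zero:
  assumes "m \<in> carrier M" shows "m \<bullet>\<^bsub>M\<^esub> \<zero>\<^bsub>R\<^esub> = \<zero>\<^bsub>M\<^esub>"
proof -
  have "m \<bullet>\<^bsub>M\<^esub> \<zero>\<^bsub>R\<^esub> \<oplus>\<^bsub>M\<^esub> m \<bullet>\<^bsub>M\<^esub> \<zero>\<^bsub>R\<^esub> = m \<bullet>\<^bsub>M\<^esub> \<zero>\<^bsub>R\<^esub>"
    using rsmult_add_right[OF assms R.zero_closed R.zero_closed] by simp
  then show ?thesis using rsmult_closed[OF assms R.zero_closed] by (simp add: M.add.l_cancel_one)
qed

lemma (in right_module) cyclic_right_submodule:
  assumes a: "a \<in> carrier M" shows "right_submodule (cyclic_submodule R M a) R M"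
  unfolding right_submodule_def
proof (intro conjI ballI)
  show "additive_subgroup (cyclic_submodule R M a) M"
  proof (intro additive_subgroup.intro M.add.subgroupI)
    show "cyclic_submodule R M a \<subseteq> carrier M" using a by (auto simp: cyclic_submodule_def rsmult_closed)
    show "cyclic_submodule R M a \<noteq> {}" unfolding cyclic_submodule_def using R.zero_closed by blast
    fix x assume "x \<in> cyclic_submodule R M a"
    then obtain r where r: "r \<in> carrier R" "x = a \<bullet>\<^bsub>M\<^esub> r" by (auto simp: cyclic_submodule_def)
    have "a \<bullet>\<^bsub>M\<^esub> (\<ominus>\<^bsub>R\<^esub> r) \<oplus>\<^bsub>M\<^esub> x = \<zero>\<^bsub>M\<^esub>"
      unfolding r(2) using rsmult_add_right[OF a, of "\<ominus>\<^bsub>R\<^esub> r" r] r(1) rsmult_zero[OF a] by (simp add: R.l_neg)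
    then have "\<ominus>\<^bsub>M\<^esub> x = a \<bullet>\<^bsub>M\<^esub> (\<ominus>\<^bsub>R\<^esub> r)"
      by (rule M.minus_equality) (use r a rsmult_closed in auto)
    then show "\<ominus>\<^bsub>M\<^esub> x \<in> cyclic_submodule R M a"
      unfolding cyclic_submodule_def using r(1) by blast
    fix y assume "y \<in> cyclic_submodule R M a"
    then obtain s where s: "s \<in> carrier R" "y = a \<bullet>\<^bsub>M\<^esub> s" by (auto simp: cyclic_submodule_def)
    have "x \<oplus>\<^bsub>M\<^esub> y = a \<bullet>\<^bsub>M\<^esub> (r \<oplus>\<^bsub>R\<^esub> s)" using rsmult_add_right[OF a r(1) s(1)] r(2) s(2) by simp
    then show "x \<oplus>\<^bsub>M\<^esub> y \<in> cyclic_submodule R M a"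
      unfolding cyclic_submodule_def using r(1) s(1) by auto
  qed
  fix x r assume "x \<in> cyclic_submodule R M a" and r: "r \<in> carrier R"
  then obtain s where s: "s \<in> carrier R" "x = a \<bullet>\<^bsub>M\<^esub> s" by (auto simp: cyclic_submodule_def)
  have "x \<bullet>\<^bsub>M\<^esub> r = a \<bullet>\<^bsub>M\<^esub> (s \<otimes>\<^bsub>R\<^esub> r)" using rsmult_assoc[OF a s(1) r] s(2) by simp
  then show "x \<bullet>\<^bsub>M\<^esub> r \<in> cyclic_submodule R M a" unfolding cyclic_submodule_def using s(1) r by auto
qed

lemma (in right_module) cyclic_self:
  assumes "a \<in> carrier M" shows "a \<in> cyclic_submodule R M a"
  unfolding cyclic_submodule_def using rsmult_one[OF assms] R.one_closed by (metis image_eqI)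

definition gact :: "('f, 'b) ring_scheme \<Rightarrow> ('g \<Rightarrow> 'f, 'm, 'd) right_module_scheme \<Rightarrow> 'm \<Rightarrow> 'g \<Rightarrow> 'm" where
  "gact F M m g = m \<bullet>\<^bsub>M\<^esub> group_basis F g"

text \<open>Field elements act through multiples of the identity of the group; as operators they
  commute with the action of \<open>G\<close>.\<close>

definition scalars :: "('f, 'b) ring_scheme \<Rightarrow> ('g, 'c) monoid_scheme \<Rightarrow> ('g \<Rightarrow> 'f, 'm, 'd) right_module_scheme \<Rightarrow>
    ('m \<Rightarrow> 'm) set" where
  "scalars F G M = (\<lambda>c m. m \<bullet>\<^bsub>M\<^esub> single F \<one>\<^bsub>G\<^esub> c) ` carrier F"

lemma translate_tr: "translate F M U = tr (gact F M) U"
  by (simp add: translate_def tr_def gact_def fun_eq_iff)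

lemma gact_restrict: "gact F (M\<lparr>carrier := U\<rparr>) = gact F M" "scalars F (G\<lparr>carrier := H\<rparr>) (M\<lparr>carrier := U\<rparr>) = scalars F G M"
  by (simp_all add: gact_def scalars_def fun_eq_iff)

locale group_module = F?: field F + G?: group G + RM: right_module "group_algebra F G" M
  for F :: "('f, 'b) ring_scheme" and G :: "('g, 'c) monoid_scheme" and M :: "('g \<Rightarrow> 'f, 'm, 'd) right_module_scheme"
begin

sublocale GA: group_algebra_loc F G
  by (intro group_algebra_loc.intro F.cring_axioms G.group_axioms)

lemma gact_scalar:
  assumes "m \<in> carrier M" "g \<in> carrier G" "c \<in> carrier F"
  shows "m \<bullet>\<^bsub>M\<^esub> single F g c = gact F M (m \<bullet>\<^bsub>M\<^esub> single F \<one>\<^bsub>G\<^esub> c) g"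
    "m \<bullet>\<^bsub>M\<^esub> single F g c = gact F M m g \<bullet>\<^bsub>M\<^esub> single F \<one>\<^bsub>G\<^esub> c"
  unfolding gact_def group_basis_single
  using assms RM.rsmult_assoc[OF assms(1) GA.single_closed GA.single_closed, symmetric] GA.single_mult by simp_all

sublocale OM: opmod G M "gact F M" "scalars F G M"
proof (intro opmod.intro opmod_axioms.intro)
  show "group G" by (rule G.group_axioms)
  show "abelian_group M" by (rule RM.M.abelian_group_axioms)
  note sc = GA.single_closed[OF _ F.one_closed] and s1 = GA.single_closed[OF G.one_closed]
  show "gact F M m g \<in> carrier M" if "m \<in> carrier M" "g \<in> carrier G" for m g
    unfolding gact_def group_basis_single by (rule RM.rsmult_closed[OF that(1) sc[OF that(2)]])
  show "gact F M (m \<oplus>\<^bsub>M\<^esub> n) g = gact F M m g \<oplus>\<^bsub>M\<^esub> gact F M n g"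
    if "m \<in> carrier M" "n \<in> carrier M" "g \<in> carrier G" for m n g
    unfolding gact_def group_basis_single by (rule RM.rsmult_add_left[OF that(1,2) sc[OF that(3)]])
  show "gact F M (gact F M m g) h = gact F M m (g \<otimes>\<^bsub>G\<^esub> h)"
    if "m \<in> carrier M" "g \<in> carrier G" "h \<in> carrier G" for m g h
    unfolding gact_def group_basis_single RM.rsmult_assoc[OF that(1) sc[OF that(2)] sc[OF that(3)], symmetric]
    using GA.single_mult[OF that(2,3)] by simp
  show "gact F M m \<one>\<^bsub>G\<^esub> = m" if "m \<in> carrier M" for m
    unfolding gact_def group_basis_single GA.single_one by (rule RM.rsmult_one[OF that])
  show "\<omega> m \<in> carrier M" if "\<omega> \<in> scalars F G M" "m \<in> carrier M" for \<omega> m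
    using that RM.rsmult_closed[OF that(2) s1] by (auto simp: scalars_def)
  show "\<omega> (m \<oplus>\<^bsub>M\<^esub> n) = \<omega> m \<oplus>\<^bsub>M\<^esub> \<omega> n" if "\<omega> \<in> scalars F G M" "m \<in> carrier M" "n \<in> carrier M" for \<omega> m n
    using that RM.rsmult_add_left[OF that(2,3) s1] by (auto simp: scalars_def)
  show "\<omega> (gact F M m g) = gact F M (\<omega> m) g" if "\<omega> \<in> scalars F G M" "m \<in> carrier M" "g \<in> carrier G" for \<omega> m g
    using that gact_scalar[OF that(2,3)] by (auto simp: scalars_def)
  have mone: "\<ominus>\<^bsub>F\<^esub> \<one>\<^bsub>F\<^esub> \<in> carrier F" by simp
  show "\<exists>\<omega> \<in> scalars F G M. \<forall>m \<in> carrier M. \<omega> m = \<ominus>\<^bsub>M\<^esub> m"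
  proof (rule bexI[of _ "\<lambda>m. m \<bullet>\<^bsub>M\<^esub> single F \<one>\<^bsub>G\<^esub> (\<ominus>\<^bsub>F\<^esub> \<one>\<^bsub>F\<^esub>)"], rule ballI)
    fix m assume m: "m \<in> carrier M"
    have "m \<bullet>\<^bsub>M\<^esub> single F \<one>\<^bsub>G\<^esub> (\<ominus>\<^bsub>F\<^esub> \<one>\<^bsub>F\<^esub>) \<oplus>\<^bsub>M\<^esub> m \<bullet>\<^bsub>M\<^esub> single F \<one>\<^bsub>G\<^esub> \<one>\<^bsub>F\<^esub> = \<zero>\<^bsub>M\<^esub>"
      unfolding RM.rsmult_add_right[OF m s1[OF mone] s1[OF F.one_closed], symmetric] GA.single_add[OF mone F.one_closed]
      using RM.rsmult_zero[OF m] by (simp add: F.l_neg GA.single_zero)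
    then have "m \<bullet>\<^bsub>M\<^esub> single F \<one>\<^bsub>G\<^esub> (\<ominus>\<^bsub>F\<^esub> \<one>\<^bsub>F\<^esub>) \<oplus>\<^bsub>M\<^esub> m = \<zero>\<^bsub>M\<^esub>"
      unfolding GA.single_one RM.rsmult_one[OF m] .
    then show "m \<bullet>\<^bsub>M\<^esub> single F \<one>\<^bsub>G\<^esub> (\<ominus>\<^bsub>F\<^esub> \<one>\<^bsub>F\<^esub>) = \<ominus>\<^bsub>M\<^esub> m"
      using RM.M.minus_equality[OF _ m RM.rsmult_closed[OF m s1[OF mone]]] by simp
  qed (use mone in \<open>auto simp: scalars_def\<close>)
  fix a assume a: "a \<in> carrier M"
  \<comment> \<open>The line spanned by \<open>a\<close>. A nonzero submodule of it contains the
    multiple of \<open>a\<close> by some nonzero \<open>c\<close>, and the inverse of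
    \<open>c\<close> recovers the whole line.\<close>
  define V where "V = (\<lambda>c. a \<bullet>\<^bsub>M\<^esub> single F \<one>\<^bsub>G\<^esub> c) ` carrier F"
  have s1m: "(a \<bullet>\<^bsub>M\<^esub> single F \<one>\<^bsub>G\<^esub> c) \<bullet>\<^bsub>M\<^esub> single F \<one>\<^bsub>G\<^esub> d = a \<bullet>\<^bsub>M\<^esub> single F \<one>\<^bsub>G\<^esub> (c \<otimes>\<^bsub>F\<^esub> d)"
    if "c \<in> carrier F" "d \<in> carrier F" for c d
    unfolding RM.rsmult_assoc[OF a s1[OF that(1)] s1[OF that(2)], symmetric]
    using GA.single_mult[OF G.one_closed G.one_closed that] by simp
  have aV: "a \<in> V" unfolding V_def using RM.rsmult_one[OF a] GA.single_one F.one_closed by (metis image_eqI)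
  have "opsub M (gact F M) (scalars F G M) {\<one>\<^bsub>G\<^esub>} V"
    unfolding opsub_def
  proof (intro conjI ballI)
    show "V \<subseteq> carrier M" unfolding V_def using RM.rsmult_closed[OF a s1] by blast
    show "\<zero>\<^bsub>M\<^esub> \<in> V" unfolding V_def using RM.rsmult_zero[OF a] GA.single_zero F.zero_closed by (metis image_eqI)
    fix x assume "x \<in> V"
    then obtain c where c: "c \<in> carrier F" "x = a \<bullet>\<^bsub>M\<^esub> single F \<one>\<^bsub>G\<^esub> c" by (auto simp: V_def)
    have xc: "x \<in> carrier M" using c RM.rsmult_closed[OF a s1] by simp
    show "\<omega> x \<in> V" if "\<omega> \<in> scalars F G M" for \<omega>
    proof -
      obtain d where d: "d \<in> carrier F" "\<omega> = (\<lambda>m. m \<bullet>\<^bsub>M\<^esub> single F \<one>\<^bsub>G\<^esub> d)" using \<open>\<omega> \<in> scalars F G M\<close> by (auto simp: scalars_def)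
      have "\<omega> x = a \<bullet>\<^bsub>M\<^esub> single F \<one>\<^bsub>G\<^esub> (c \<otimes>\<^bsub>F\<^esub> d)" using s1m[OF c(1) d(1)] c(2) d(2) by simp
      then show ?thesis unfolding V_def using c(1) d(1) by blast
    qed
    show "gact F M x l \<in> V" if "l \<in> {\<one>\<^bsub>G\<^esub>}" for l
    proof -
      have "gact F M x l = x"
        using that RM.rsmult_one[OF xc] by (simp add: gact_def group_basis_single GA.single_one)
      then show ?thesis using \<open>x \<in> V\<close> by simp
    qed
    fix y assume "y \<in> V"
    then obtain d where d: "d \<in> carrier F" "y = a \<bullet>\<^bsub>M\<^esub> single F \<one>\<^bsub>G\<^esub> d" by (auto simp: V_def)
    have "x \<oplus>\<^bsub>M\<^esub> y = a \<bullet>\<^bsub>M\<^esub> single F \<one>\<^bsub>G\<^esub> (c \<oplus>\<^bsub>F\<^esub> d)"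
      unfolding c(2) d(2) RM.rsmult_add_right[OF a s1[OF c(1)] s1[OF d(1)], symmetric] GA.single_add[OF c(1) d(1)] ..
    then show "x \<oplus>\<^bsub>M\<^esub> y \<in> V" unfolding V_def using c(1) d(1) by blast
  qed
  moreover have "W = {\<zero>\<^bsub>M\<^esub>} \<or> W = V"
    if W: "opsub M (gact F M) (scalars F G M) {\<one>\<^bsub>G\<^esub>} W" "W \<subseteq> V" for W
  proof (cases "W = {\<zero>\<^bsub>M\<^esub>}")
    case False
    have "\<zero>\<^bsub>M\<^esub> \<in> W" using W(1) by (simp add: opsub_def)
    then obtain x where x: "x \<in> W" "x \<noteq> \<zero>\<^bsub>M\<^esub>" using False by blast
    then obtain c where c: "c \<in> carrier F" "x = a \<bullet>\<^bsub>M\<^esub> single F \<one>\<^bsub>G\<^esub> c" using W(2) by (auto simp: V_def)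
    have "c \<noteq> \<zero>\<^bsub>F\<^esub>" using c(2) x(2) GA.single_zero RM.rsmult_zero[OF a] by auto
    then have cU: "c \<in> Units F" using c(1) F.field_Units by simp
    have "V \<subseteq> W"
    proof
      fix y assume "y \<in> V"
      then obtain d where d: "d \<in> carrier F" "y = a \<bullet>\<^bsub>M\<^esub> single F \<one>\<^bsub>G\<^esub> d" by (auto simp: V_def)
      let ?e = "inv\<^bsub>F\<^esub> c \<otimes>\<^bsub>F\<^esub> d"
      have e: "?e \<in> carrier F" using cU d(1) by simp
      have "c \<otimes>\<^bsub>F\<^esub> ?e = d" using cU d(1) c(1) by (simp add: F.m_assoc[symmetric])
      then have ye: "y = x \<bullet>\<^bsub>M\<^esub> single F \<one>\<^bsub>G\<^esub> ?e" using s1m[OF c(1) e] c(2) d(2) by simp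
      have om: "(\<lambda>m. m \<bullet>\<^bsub>M\<^esub> single F \<one>\<^bsub>G\<^esub> ?e) \<in> scalars F G M" unfolding scalars_def using e by blast
      have "\<forall>x \<in> W. \<forall>\<omega> \<in> scalars F G M. \<omega> x \<in> W" using W(1) unfolding opsub_def by (elim conjE)
      from bspec[OF bspec[OF this x(1)] om] show "y \<in> W" using ye by simp
    qed
    then show ?thesis using W(2) by blast
  qed simp
  ultimately show "\<exists>V. opsub M (gact F M) (scalars F G M) {\<one>\<^bsub>G\<^esub>} V \<and> a \<in> V \<and>
      (\<forall>W. opsub M (gact F M) (scalars F G M) {\<one>\<^bsub>G\<^esub>} W \<longrightarrow> W \<subseteq> V \<longrightarrow> W = {\<zero>\<^bsub>M\<^esub>} \<or> W = V)"
    using aV by blast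
qed

text \<open>A one-term element acts as a scalar followed by a group element, and every element of
  the group algebra is a sum of such elements.\<close>

lemma right_submodule_iff:
  assumes H: "subgroup H G"
  shows "right_submodule U (group_algebra F (G\<lparr>carrier := H\<rparr>)) M \<longleftrightarrow> OM.sub H U"
proof
  interpret H: subgroup H G by fact
  have HG: "group (G\<lparr>carrier := H\<rparr>)" by (rule H.subgroup_is_group) (rule G.group_axioms)
  interpret B: group_algebra_loc F "G\<lparr>carrier := H\<rparr>"
    by (intro group_algebra_loc.intro F.cring_axioms HG)
  have sH: "single F h c \<in> carrier B.A" if "h \<in> H" "c \<in> carrier F" for h c
    by (rule B.single_closed) (use that in simp_all)
  {
    assume rs: "right_submodule U B.A M"
    interpret U: additive_subgroup U M using rs by (simp add: right_submodule_def)
    have cl: "u \<bullet>\<^bsub>M\<^esub> r \<in> U" if "u \<in> U" "r \<in> carrier B.A" for u r using rs that by (simp add: right_submodule_def)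
    have "\<omega> u \<in> U" if "u \<in> U" "\<omega> \<in> scalars F G M" for u \<omega>
      using that cl[OF that(1) sH[OF H.one_closed]] by (auto simp: scalars_def)
    moreover have "gact F M u h \<in> U" if "u \<in> U" "h \<in> H" for u h
      unfolding gact_def group_basis_single by (rule cl[OF that(1) sH[OF that(2) F.one_closed]])
    ultimately show "OM.sub H U" unfolding opsub_def using U.a_subset U.zero_closed U.a_closed by blast
  }
  {
    assume U: "OM.sub H U"
    note u = OM.subD[OF U]
    have "x \<bullet>\<^bsub>M\<^esub> r \<in> U" if x: "x \<in> U" and r: "r \<in> carrier B.A" for x r
    proof -
      have xc: "x \<in> carrier M" using u(1) x by blast
      show ?thesis
        using r
      proof (rule B.group_algebra_induct)
        show "x \<bullet>\<^bsub>M\<^esub> \<zero>\<^bsub>B.A\<^esub> \<in> U" using RM.rsmult_zero[OF xc] u(2) GA.subalgebra(2)[OF H] by simp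
        fix g c y assume a: "g \<in> carrier (G\<lparr>carrier := H\<rparr>)" "c \<in> carrier F" "y \<in> carrier B.A" "x \<bullet>\<^bsub>M\<^esub> y \<in> U"
        have g: "g \<in> H" "g \<in> carrier G" using a(1) H.subset by auto
        have yA: "y \<in> carrier (group_algebra F G)" using a(3) GA.subalgebra(1)[OF H] by blast
        have "(\<lambda>m. m \<bullet>\<^bsub>M\<^esub> single F \<one>\<^bsub>G\<^esub> c) \<in> scalars F G M" unfolding scalars_def using a(2) by blast
        from u(5)[OF u(4)[OF x this] g(1)] have "x \<bullet>\<^bsub>M\<^esub> single F g c \<in> U"
          using gact_scalar(1)[OF xc g(2) a(2)] by simp
        from u(3)[OF this a(4)] show "x \<bullet>\<^bsub>M\<^esub> (single F g c \<oplus>\<^bsub>B.A\<^esub> y) \<in> U"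
          unfolding GA.subalgebra(4)[OF H] RM.rsmult_add_right[OF xc GA.single_closed[OF g(2) a(2)] yA] .
      qed
    qed
    then show "right_submodule U B.A M"
      unfolding right_submodule_def using OM.sub_additive_subgroup[OF U] by blast
  }
qed

lemma right_module_subgroup:
  assumes H: "subgroup H G" and U: "OM.sub H U"
  shows "right_module (group_algebra F (G\<lparr>carrier := H\<rparr>)) (M\<lparr>carrier := U\<rparr>)"
proof -
  interpret H: subgroup H G by fact
  have HG: "group (G\<lparr>carrier := H\<rparr>)" by (rule H.subgroup_is_group) (rule G.group_axioms)
  interpret B: group_algebra_loc F "G\<lparr>carrier := H\<rparr>"
    by (intro group_algebra_loc.intro F.cring_axioms HG)
  interpret N: opmod "G\<lparr>carrier := H\<rparr>" "M\<lparr>carrier := U\<rparr>" "gact F M" "scalars F G M"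
    by (rule OM.opmod_restrict[OF H U])
  have rs: "right_submodule U B.A M" using right_submodule_iff[OF H] U by simp
  have Uc: "u \<in> carrier M" if "u \<in> U" for u using OM.subD(1)[OF U] that by blast
  have A: "r \<in> carrier (group_algebra F G)" if "r \<in> carrier B.A" for r using GA.subalgebra(1)[OF H] that by blast
  show ?thesis
  proof (intro right_module.intro right_module_axioms.intro)
    show "ring B.A" by (rule B.ring_group_algebra)
    show "abelian_group (M\<lparr>carrier := U\<rparr>)" by (rule N.M.abelian_group_axioms)
    fix m r assume m: "m \<in> carrier (M\<lparr>carrier := U\<rparr>)"
    then have mU: "m \<in> U" and mc: "m \<in> carrier M" using Uc by auto
    show "m \<bullet>\<^bsub>M\<lparr>carrier := U\<rparr>\<^esub> \<one>\<^bsub>B.A\<^esub> = m" using RM.rsmult_one[OF mc] GA.subalgebra(3)[OF H] by simp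
    assume r: "r \<in> carrier B.A"
    show "m \<bullet>\<^bsub>M\<lparr>carrier := U\<rparr>\<^esub> r \<in> carrier (M\<lparr>carrier := U\<rparr>)" using rs mU r by (simp add: right_submodule_def)
    show "(m \<oplus>\<^bsub>M\<lparr>carrier := U\<rparr>\<^esub> n) \<bullet>\<^bsub>M\<lparr>carrier := U\<rparr>\<^esub> r =
        m \<bullet>\<^bsub>M\<lparr>carrier := U\<rparr>\<^esub> r \<oplus>\<^bsub>M\<lparr>carrier := U\<rparr>\<^esub> n \<bullet>\<^bsub>M\<lparr>carrier := U\<rparr>\<^esub> r"
      if "n \<in> carrier (M\<lparr>carrier := U\<rparr>)" for n
      using RM.rsmult_add_left[OF mc Uc A[OF r], of n] that by simp
    fix s assume s: "s \<in> carrier B.A"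
    show "m \<bullet>\<^bsub>M\<lparr>carrier := U\<rparr>\<^esub> (r \<oplus>\<^bsub>B.A\<^esub> s) =
        m \<bullet>\<^bsub>M\<lparr>carrier := U\<rparr>\<^esub> r \<oplus>\<^bsub>M\<lparr>carrier := U\<rparr>\<^esub> m \<bullet>\<^bsub>M\<lparr>carrier := U\<rparr>\<^esub> s"
      using RM.rsmult_add_right[OF mc A[OF r] A[OF s]] GA.subalgebra(4)[OF H] by simp
    show "m \<bullet>\<^bsub>M\<lparr>carrier := U\<rparr>\<^esub> (r \<otimes>\<^bsub>B.A\<^esub> s) = m \<bullet>\<^bsub>M\<lparr>carrier := U\<rparr>\<^esub> r \<bullet>\<^bsub>M\<lparr>carrier := U\<rparr>\<^esub> s"
      using RM.rsmult_assoc[OF mc A[OF r] A[OF s]] GA.subalgebra(5)[OF H r s] by simp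
  qed
qed

text \<open>The bridge between the given definition, with its transversal, and the formulation used
  in the argument.\<close>

lemma induced_from_iff_good: "induced_from F G M H U \<longleftrightarrow> OM.gd H U"
proof
  assume i: "induced_from F G M H U"
  then have H: "subgroup H G" and rs: "right_submodule U (group_algebra F (G\<lparr>carrier := H\<rparr>)) M"
    and T: "\<exists>T. right_transversal T H G \<and> internal_direct_sum M T (translate F M U)"
    unfolding induced_from_def by auto
  have U: "OM.sub H U" using right_submodule_iff[OF H] rs by simp
  show "OM.gd H U" using OM.good_iff_direct_sum[OF H U] T unfolding translate_tr by simp
next
  assume g: "OM.gd H U"
  note H = OM.goodD(1)[OF g] and U = OM.goodD(2)[OF g]
  have rs: "right_submodule U (group_algebra F (G\<lparr>carrier := H\<rparr>)) M" using right_submodule_iff[OF H] U by simp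
  show "induced_from F G M H U"
    unfolding induced_from_def translate_tr
    using OM.good_iff_direct_sum[OF H U] g H rs RM.right_module_axioms by simp
qed

lemma primitive_if_no_good:
  assumes H: "subgroup H G" and U: "OM.sub H U"
    and no: "\<And>H' U'. good (G\<lparr>carrier := H\<rparr>) (M\<lparr>carrier := U\<rparr>) (gact F M) (scalars F G M) H' U' \<Longrightarrow> H' = H"
  shows "primitive_module F (G\<lparr>carrier := H\<rparr>) (M\<lparr>carrier := U\<rparr>)"
proof -
  interpret H: subgroup H G by fact
  have HG: "group (G\<lparr>carrier := H\<rparr>)" by (rule H.subgroup_is_group) (rule G.group_axioms)
  note rm = right_module_subgroup[OF H U]
  interpret N: group_module F "G\<lparr>carrier := H\<rparr>" "M\<lparr>carrier := U\<rparr>"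
    by (intro group_module.intro F.field_axioms HG rm)
  have "H' = H" if "induced_from F (G\<lparr>carrier := H\<rparr>) (M\<lparr>carrier := U\<rparr>) H' U'" for H' U'
  proof (rule no)
    show "good (G\<lparr>carrier := H\<rparr>) (M\<lparr>carrier := U\<rparr>) (gact F M) (scalars F G M) H' U'"
      using that unfolding N.induced_from_iff_good gact_restrict .
  qed
  then show ?thesis unfolding primitive_module_def using rm by auto
qed

end

text \<open>Any nonzero element of the inducing module \<open>U\<close> can serve as
  \<open>a\<close>: irreducibility of \<open>M\<close> and of \<open>U\<close> makes the two cyclic
  submodules all of \<open>M\<close> and all of \<open>U\<close>.\<close>

theorem theorem1:
  fixes F :: "('f, 'b) ring_scheme" and G :: "('g, 'c) monoid_scheme"
    and M :: "('g \<Rightarrow> 'f, 'm, 'd) right_module_scheme"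
  assumes "fin_gen_field F" and "char_zero F"
    and "fin_gen_group G" and "nilpotent_group G"
    and "irreducible_module (group_algebra F G) M"
  shows "\<exists>a L. a \<in> carrier M \<and> a \<noteq> \<zero>\<^bsub>M\<^esub> \<and> subgroup L G \<and>
    (let FG = group_algebra F G; FL = group_algebra F (G\<lparr>carrier := L\<rparr>);
         aFG = cyclic_submodule FG M a; aFL = cyclic_submodule FL M a
     in induced_from F G (M\<lparr>carrier := aFG\<rparr>) L aFL \<and>
        primitive_module F (G\<lparr>carrier := L\<rparr>) (M\<lparr>carrier := aFL\<rparr>))"
proof -
  have F: "field F" using assms(1) by (simp add: fin_gen_field_def)
  have G: "group G" using assms(3) by (simp add: fin_gen_group_def)
  have rm: "right_module (group_algebra F G) M" and nz: "carrier M \<noteq> {\<zero>\<^bsub>M\<^esub>}"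
    and irr: "\<And>U. right_submodule U (group_algebra F G) M \<Longrightarrow> U = {\<zero>\<^bsub>M\<^esub>} \<or> U = carrier M"
    using assms(5) unfolding irreducible_module_def by blast+
  interpret group_module F G M by (intro group_module.intro F G rm)
  obtain c Z where cs: "central_series G c Z" using G.nilpotent_central_series[OF assms(4)] by (elim exE)
  have irr': "W = {\<zero>\<^bsub>M\<^esub>} \<or> W = carrier M" if "OM.sub (carrier G) W" for W
    by (rule irr) (use right_submodule_iff[OF G.subgroup_self] that in simp)
  have "\<exists>H U. OM.gd H U \<and> (\<forall>H' U'. good (G\<lparr>carrier := H\<rparr>) (M\<lparr>carrier := U\<rparr>) (gact F M) (scalars F G M) H' U' \<longrightarrow> H' = H)"
    by (rule OM.exists_primitive[OF irr' nz G.nilpotent_polycyclic[OF assms(3,4)] cs])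
  then obtain L U where g: "OM.gd L U"
    and max: "\<forall>H' U'. good (G\<lparr>carrier := L\<rparr>) (M\<lparr>carrier := U\<rparr>) (gact F M) (scalars F G M) H' U' \<longrightarrow> H' = L"
    by (elim exE conjE)
  note L = OM.goodD(1)[OF g] and U = OM.goodD(2)[OF g]
  interpret L: subgroup L G by (rule L)
  obtain a where a: "a \<in> U" "a \<noteq> \<zero>\<^bsub>M\<^esub>" using OM.good_nonzero[OF g nz] OM.subD(2)[OF U] by blast
  have ac: "a \<in> carrier M" using OM.subD(1)[OF U] a(1) by blast
  let ?FG = "group_algebra F G" and ?FL = "group_algebra F (G\<lparr>carrier := L\<rparr>)"
  have aFG: "cyclic_submodule ?FG M a = carrier M"
    using irr[OF RM.cyclic_right_submodule[OF ac]] RM.cyclic_self[OF ac] a(2) by blast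
  have aFL: "cyclic_submodule ?FL M a = U"
  proof -
    have "OM.sub L (carrier M)" by (rule OM.sub_full[OF L.subset])
    from right_module_subgroup[OF L this] have "right_module ?FL M" by simp
    then interpret FL: right_module ?FL M .
    have s1: "OM.sub L (cyclic_submodule ?FL M a)"
      using FL.cyclic_right_submodule[OF ac] right_submodule_iff[OF L] by simp
    have s2: "cyclic_submodule ?FL M a \<subseteq> U"
      using right_submodule_iff[OF L, of U] U a(1) unfolding right_submodule_def cyclic_submodule_def by blast
    have "cyclic_submodule ?FL M a = {\<zero>\<^bsub>M\<^esub>} \<or> cyclic_submodule ?FL M a = U"
      by (rule OM.good_irreducible[OF g _ s1 s2]) (rule irr')
    then show ?thesis using FL.cyclic_self[OF ac] a(2) by blast
  qed
  have "induced_from F G M L U" using induced_from_iff_good g by simp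
  moreover have "primitive_module F (G\<lparr>carrier := L\<rparr>) (M\<lparr>carrier := U\<rparr>)"
    by (rule primitive_if_no_good[OF L U]) (use max in blast)
  ultimately show ?thesis
    unfolding Let_def using a(2) ac L aFG aFL by (intro exI[of _ a] exI[of _ L]) simp
qed

end
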